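(* Consider a graphon game $\mathcal G(\mathcal A_{ad}^\infty,U,\theta,W)$ in which the players have homogeneous action sets, i.e. $\mathcal A^x=\mathcal A^0$ for all $x\in[0,1]$. Suppose that: (A1) For all $\tilde z,\tilde\theta\in\mathcal A$, $\tilde a\mapsto U(\tilde a,\tilde z,\tilde\theta)$ is continuously Gâteaux differentiable and $U(\tilde a,\tilde z,\tilde\theta)+\frac{\alpha_U}{2}\|\tilde a\|_{\mathcal A}^2$ is concave in $\tilde a$, with $\alpha_U>0$; and $\nabla_{\tilde a}U(\cdot,\tilde z,\tilde\theta)$ is Lipschitz in $\tilde z,\tilde\theta$ with constants $\ell_U,\ell_\theta$, i.e. $\|\nabla_{\tilde a}U(\tilde a,\tilde z_1,\tilde\theta_1)-\nabla_{\tilde a}U(\tilde a,\tilde z_2,\tilde\theta_2)\|_{\mathcal A}\le \ell_U\|\tilde z_1-\tilde z_2\|_{\mathcal A}+\ell_\theta\|\tilde\theta_1-\tilde\theta_2\|_{\mathcal A}$. (A2) $\mathcal A^0$ is nonempty, convex and closed, and there exist $\tilde z_0,\tilde\theta_0\in\mathcal A$ such that $(\arg\max_{\tilde a\in\mathcal A^x}U(\tilde a,\tilde z_0,\tilde\theta_0))_{x\in[0,1]}\in\mathcal A^\infty$. (A3) There is a constant $M$ such that $\|\tilde a\|_{\mathcal A}\le M$ for all $\tilde a\in\mathcal A^0$. (A4) There exist a constant $L$ and a finite partition $\{I_1,\dots,I_{K+1}\}$ of $[0,1]$ such that for all $1\le k,l\le K+1$ and $(x,y),(x',y')\in I_k\times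 I_l$, $|W(x,y)-W(x',y')|\le L(|x-x'|+|y-y'|)$. (A5) $\ell_U<\alpha_U$. (A6) $U(\tilde a,\tilde z,\tilde\theta)$ is jointly Lipschitz in $(\tilde a,\tilde z,\tilde\theta)$. (A7) There exists a solution $\bar\theta$ to the graphon intervention problem such that $\|\bar\theta^x\|_{\mathcal A}\le\bar\theta_{\max}$ for all $x\in[0,1]$ and a constant $\bar\theta_{\max}$, and there exist a constant $L_{\bar\theta}$ and a finite partition $\{I'_1,\dots,I'_{K_{\bar\theta}+1}\}$ of $[0,1]$ with $\|\bar\theta^x-\bar\theta^{x'}\|_{\mathcal A}\le L_{\bar\theta}|x-x'|$ whenever $x,x'$ lie in the same $I'_k$. Let $\theta^N\in\mathcal A^N$ satisfy $\|\theta-\theta^N_{\mathrm{step}}\|_{\mathcal A^\infty}\to0$ as $N\to\infty$, and let $\bar\theta^N_W$ be the approximate network intervention with respect to $\bar\theta$. Then: (i) (Weighted graphs, $G^N=G_w^N(W)$.) The network game $\mathcal G((\mathcal A^0)^N,U,\theta^N+\hat\theta^N,G_w^N(W))$ admits a unique Nash equilibrium for all $\hat\theta^N\in\mathcal A^N$ and all $N\in\mathbb N$. For every $0<\delta<e^{-1}$, with $\mathbb Q$-probability at least $1-\delta$, $$T^N_{\mathrm{opt}}-T^N(\bar\theta^N_W)=\mathcal O\Big(\Big(\frac{\log(N/\delta)}N\Big)^{1/4}\vee\|\theta-\theta^N_{\mathrm{step}}\|_{\mathcal A^\infty}\Big).$$ In particular, $T^N_{\mathrm{opt}}-T^N(\bar\theta^N_W)$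 converges $\mathbb Q$-almost surely to $0$ as $N\to\infty$. (ii) (Simple graphs, $G^N=G_s^N(W)$, density parameters $\kappa_N\equiv1$.) For any $0<\delta<e^{-1}$ there exists $N_\delta\in\mathbb N$ such that the network game $\mathcal G((\mathcal A^0)^N,U,\theta^N+\hat\theta^N,G_s^N(W))$ admits a unique Nash equilibrium with $\mathbb Q$-probability at least $1-2\delta$ for all $\hat\theta^N\in\mathcal A^N$ and all $N\ge N_\delta$. With $\mathbb Q$-probability at least $1-2\delta$, $$T^N_{\mathrm{opt}}-T^N(\bar\theta^N_W)=\mathcal O\Big(\Big(\frac{\log(N/\delta)}N\Big)^{1/4}\vee\|\theta-\theta^N_{\mathrm{step}}\|_{\mathcal A^\infty}\Big).$$ In particular, $T^N_{\mathrm{opt}}-T^N(\bar\theta^N_W)$ converges $\mathbb Q$-almost surely to $0$ as $N\to\infty$.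
   Context: Probabilistic setting. Fix a time horizon (also denoted $T>0$, not to be confused with the welfare functionals $T(\cdot),T^N(\cdot)$), a probability space $(\Omega,\mathcal F,\mathbb P)$, a probability space $([0,1],\mathcal I,\nu)$ extending the Lebesgue space on $[0,1]$, and a rich Fubini extension $([0,1]\times\Omega,\mathcal I\boxtimes\mathcal F,\nu\boxtimes\mathbb P)$ of the product space (an extension on which Fubini's theorem holds for all integrable functions and which supports essentially pairwise independent families of processes). Write $dx$ for $\nu(dx)$. $\mathbb F=(\mathcal F_t)_{0\le t\le T}$ is the augmentation of the filtration generated by $(\theta^x)_{x\in[0,1]}$; the augmented filtrations generated by the finite-player heterogeneity processes are assumed to be contained in $\mathbb F$. $\mathcal A$ is the Hilbert space of $\mathbb F$-progressively measurable $\tilde a:\Omega\times[0,T]\to\mathbb R$ with $\|\tilde a\|_{\mathcal A}^2=\int_0^T\mathbb E[\tilde a_t^2]dt<\infty$; $\mathcal A^N$ carries $\|a^N\|_{\mathcal A^N}^2=\sum_{i=1}^N\|a^{i,N}\|_{\mathcal A}^2$. An action profile is a family $a=(a^x)_{x\in[0,1]}$, $a^x\in\mathcal A$, with $(x,t,\omega)\mapsto a^x_t(\omega)$ being $\mathcal I\otimes\mathcal B([0,T])\otimes\mathcal F$-measurable; $\mathcal A^\infty$ is the Hilbert space of action profiles with $\|a\|_{\mathcal A^\infty}^2=\int_0^1\int_0^T\mathbb E[(a_t^x)^2]dtdx<\infty$. $U:\mathcal A^3\to\mathbb R$ is a given utility functional. Graphon game $\mathcal G(\mathcal A_{ad}^\infty,U,\theta,W)$: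 $\theta\in\mathcal A^\infty$; $W$ is a graphon (symmetric measurable $[0,1]^2\to[0,1]$); $(\boldsymbol Wa)(x)=\int_0^1W(x,y)a^ydy$; $\mathcal A_{ad}^\infty=\{a\in\mathcal A^\infty:a^x\in\mathcal A^x\ \forall x\}$. A Nash equilibrium is $\bar a\in\mathcal A_{ad}^\infty$ with $\bar a^x=\arg\max_{\tilde a\in\mathcal A^x}U(\tilde a,(\boldsymbol W\bar a)(x),\theta^x)$ for every $x\in[0,1]$. Network game $\mathcal G((\mathcal A^0)^N,U,\theta^N,G^N)$: a Nash equilibrium is $\bar a^N\in(\mathcal A^0)^N$ with $\bar a^{i,N}=\arg\max_{\tilde a\in\mathcal A^0}U(\tilde a,\frac1N\sum_jG^N_{ij}\bar a^{j,N},\theta^{i,N})$ for all $i$. Step profiles. $\mathcal P_i^N=[\frac{i-1}N,\frac iN)$ for $i<N$, $\mathcal P_N^N=[\frac{N-1}N,1]$; for $a^N\in\mathcal A^N$, $a^{x,N}_{\mathrm{step}}=a^{i,N}$ for $x\in\mathcal P_i^N$. Sampling. On a separate probability space $(\Omega',\mathcal F',\mathbb Q)$, independently of the randomness of $\mathbb P$, let $(x_1,\dots,x_N)$ be an ordered $N$-tuple of independent uniform random points of $[0,1]$. $G_w^N(W)$ has nodes $1,\dots,N$ and edge weights $W(x_i,x_j)$. $G_s^N(W)$ is obtained from $N$ isolated nodes by adding undirected edges between $i$ and $j$ at random with probability $W(x_i,x_j)$ (i.e. $\kappa_N W(x_i,x_j)$ with $\kappa_N\equiv1$) for $1\le i<j\le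 N$. Intervention problems with budget $C_B>0$. Graphon problem: maximize over $\hat\theta\in\mathcal A^\infty$ with $\|\hat\theta\|_{\mathcal A^\infty}^2\le C_B$ the value $T(\hat\theta)=\int_0^1U(\bar a^x_{\hat\theta},\bar z^x_{\hat\theta},\theta^x+\hat\theta^x)dx$, where $\bar a_{\hat\theta}$ is the Nash equilibrium of $\mathcal G(\mathcal A_{ad}^\infty,U,\theta+\hat\theta,W)$ and $\bar z_{\hat\theta}=\boldsymbol W\bar a_{\hat\theta}$. Network problem on $G^N$: maximize over $\hat\theta^N\in\mathcal A^N$ with $\frac1N\|\hat\theta^N\|_{\mathcal A^N}^2\le C_B$ the value $T^N(\hat\theta^N)=\frac1N\sum_{i=1}^NU(\bar a^{i,N},\bar z^{i,N},\theta^{i,N}+\hat\theta^{i,N})$, where $\bar a^N$ is the Nash equilibrium of $\mathcal G((\mathcal A^0)^N,U,\theta^N+\hat\theta^N,G^N)$ and $\bar z^N=\frac1NG^N\bar a^N$; $T^N_{\mathrm{opt}}$ is the supremum of $T^N$ over this set. Approximate intervention: $(\bar\theta^N_W)_i=\bar\theta(\frac iN)/\gamma^N$, where $\bar\theta(\frac iN)$ denotes $\bar\theta^x$ at $x=\frac iN$ and $\gamma^N$ is the normalizing constant ensuring $\frac1N\|\bar\theta^N_W\|_{\mathcal A^N}^2=\|\bar\theta\|_{\mathcal A^\infty}^2$ (with $\bar\theta^N_W=0$ if all $\bar\theta(\frac iN)=0$). "With $\mathbb Q$-probability at least $p$, $X_N=\mathcal O(r_N)$" means: there is a constant $C$ independent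 of $N$ such that, for all sufficiently large $N$, $X_N\le Cr_N$ with $\mathbb Q$-probability at least $p$.
   Formalization: The partitions in (A4) and (A7) are taken to be partitions into finitely many intervals (for arbitrary sets the claim fails), and the joint Lipschitz condition (A6) is required only for actions in A^0, since on all of A it contradicts the strong concavity in (A1). *)

theory Defs
  imports "HOL-Probability.Probability" "HOL-Library.Function_Algebras"
    "HOL-Library.Disjoint_Sets"
begin

definition extends_unit_lebesgue :: "real measure \<Rightarrow> bool" where
  "extends_unit_lebesgue \<nu> \<longleftrightarrow>
     prob_space \<nu> \<and> space \<nu> = {0..1} \<and>
     sets (lebesgue_on {0..1}) \<subseteq> sets \<nu> \<and>
     (\<forall>B\<in>sets (lebesgue_on {0..1}). emeasure \<nu> B = emeasure (lebesgue_on {0..1}) B)"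

definition fubini_extension ::
  "real measure \<Rightarrow> 'w measure \<Rightarrow> (real \<times> 'w) measure \<Rightarrow> bool" where
  "fubini_extension \<nu> P E \<longleftrightarrow>
     prob_space E \<and> space E = space (\<nu> \<Otimes>\<^sub>M P) \<and>
     sets (\<nu> \<Otimes>\<^sub>M P) \<subseteq> sets E \<and>
     (\<forall>B\<in>sets (\<nu> \<Otimes>\<^sub>M P). emeasure E B = emeasure (\<nu> \<Otimes>\<^sub>M P) B) \<and>
     (\<forall>f :: real \<times> 'w \<Rightarrow> real. integrable E f \<longrightarrow>
        (AE x in \<nu>. integrable P (\<lambda>w. f (x, w))) \<and>
        (AE w in P. integrable \<nu> (\<lambda>x. f (x, w))) \<and>
        integrable \<nu> (\<lambda>x. LINT w|P. f (x, w)) \<and>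
        integrable P (\<lambda>w. LINT x|\<nu>. f (x, w)) \<and>
        (LINT q|E. f q) = (LINT x|\<nu>. LINT w|P. f (x, w)) \<and>
        (LINT q|E. f q) = (LINT w|P. LINT x|\<nu>. f (x, w)))"

text \<open>Richness in the sense of Sun and Zhang: the extension carries a measurable family that is
  essentially pairwise independent with uniform marginals; families with other marginal laws are
  images of it.\<close>

definition rich_fubini_extension ::
  "real measure \<Rightarrow> 'w measure \<Rightarrow> (real \<times> 'w) measure \<Rightarrow> bool" where
  "rich_fubini_extension \<nu> P E \<longleftrightarrow>
     fubini_extension \<nu> P E \<and>
     (\<exists>g \<in> borel_measurable E.
        (AE x in \<nu>. distr P borel (\<lambda>w. g (x, w)) = uniform_measure lborel {0..1::real}) \<and>
        (AE x in \<nu>. AE y in \<nu>.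
           prob_space.indep_var P borel (\<lambda>w. g (x, w)) borel (\<lambda>w. g (y, w))))"

type_synonym 'w process = "'w \<times> real \<Rightarrow> real"

definition time_prod :: "'w measure \<Rightarrow> real \<Rightarrow> ('w \<times> real) measure" where
  "time_prod P T = P \<Otimes>\<^sub>M restrict_space lborel {0..T}"

definition augmented_filtration ::
  "'w measure \<Rightarrow> 'i set \<Rightarrow> ('i \<Rightarrow> 'w process) \<Rightarrow> real \<Rightarrow> 'w measure" where
  "augmented_filtration P J X t = sigma (space P)
     ({(\<lambda>w. X j (w, s)) -` B \<inter> space P | j s B. j \<in> J \<and> s \<in> {0..t} \<and> B \<in> sets borel}
        \<union> null_sets P)"

definition progressive :: "(real \<Rightarrow> 'w measure) \<Rightarrow> real \<Rightarrow> 'w process \<Rightarrow> bool" where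
  "progressive F T a \<longleftrightarrow>
     (\<forall>t\<in>{0..T}. a \<in> borel_measurable (F t \<Otimes>\<^sub>M restrict_space borel {0..t}))"

text \<open>Elements of the Hilbert space \<open>\<A>\<close> are represented by functions, and equality in \<open>\<A>\<close> is
  equality almost everywhere on \<open>\<Omega> \<times> [0,T]\<close>. The carrier contains all measurable representatives
  of the classes of progressively measurable processes: a pointwise average of progressive
  processes over players need only be almost everywhere equal to a progressive process.\<close>

definition proc_space :: "'w measure \<Rightarrow> real \<Rightarrow> (real \<Rightarrow> 'w measure) \<Rightarrow> 'w process set" where
  "proc_space P T F = {a \<in> borel_measurable (time_prod P T).
     integrable (time_prod P T) (\<lambda>p. (a p)\<^sup>2) \<and>
     (\<exists>b. progressive F T b \<and> (AE p in time_prod P T. a p = b p))}"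

definition proc_inner :: "'w measure \<Rightarrow> real \<Rightarrow> 'w process \<Rightarrow> 'w process \<Rightarrow> real" where
  "proc_inner P T a b = (LINT p|time_prod P T. a p * b p)"

definition proc_norm :: "'w measure \<Rightarrow> real \<Rightarrow> 'w process \<Rightarrow> real" where
  "proc_norm P T a = sqrt (LINT p|time_prod P T. (a p)\<^sup>2)"

definition proc_eq :: "'w measure \<Rightarrow> real \<Rightarrow> 'w process \<Rightarrow> 'w process \<Rightarrow> bool" where
  "proc_eq P T a b \<longleftrightarrow> (AE p in time_prod P T. a p = b p)"

definition net_space ::
  "'w measure \<Rightarrow> real \<Rightarrow> (real \<Rightarrow> 'w measure) \<Rightarrow> nat \<Rightarrow> (nat \<Rightarrow> 'w process) set" where
  "net_space P T F N = {a. \<forall>i\<in>{1..N}. a i \<in> proc_space P T F}"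

definition net_norm :: "'w measure \<Rightarrow> real \<Rightarrow> nat \<Rightarrow> (nat \<Rightarrow> 'w process) \<Rightarrow> real" where
  "net_norm P T N a = sqrt (\<Sum>i=1..N. (proc_norm P T (a i))\<^sup>2)"

definition profile_space ::
  "real measure \<Rightarrow> 'w measure \<Rightarrow> real \<Rightarrow> (real \<Rightarrow> 'w measure) \<Rightarrow> (real \<Rightarrow> 'w process) set" where
  "profile_space \<nu> P T F = {a. (\<forall>x\<in>{0..1}. a x \<in> proc_space P T F) \<and>
     (\<lambda>(x, p). a x p) \<in> borel_measurable (\<nu> \<Otimes>\<^sub>M time_prod P T) \<and>
     integrable (\<nu> \<Otimes>\<^sub>M time_prod P T) (\<lambda>(x, p). (a x p)\<^sup>2)}"

definition profile_norm ::
  "real measure \<Rightarrow> 'w measure \<Rightarrow> real \<Rightarrow> (real \<Rightarrow> 'w process) \<Rightarrow> real" where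
  "profile_norm \<nu> P T a = sqrt (LINT q|(\<nu> \<Otimes>\<^sub>M time_prod P T). (a (fst q) (snd q))\<^sup>2)"

definition unit_cell :: "nat \<Rightarrow> nat \<Rightarrow> real set" where
  "unit_cell N i = (if i < N then {(real i - 1) / real N ..< real i / real N}
                    else {(real N - 1) / real N .. 1})"

definition step_profile :: "nat \<Rightarrow> (nat \<Rightarrow> 'w process) \<Rightarrow> real \<Rightarrow> 'w process" where
  "step_profile N a x = a (THE i. i \<in> {1..N} \<and> x \<in> unit_cell N i)"

definition closed_convex_in ::
  "'w measure \<Rightarrow> real \<Rightarrow> (real \<Rightarrow> 'w measure) \<Rightarrow> 'w process set \<Rightarrow> bool" where
  "closed_convex_in P T F S \<longleftrightarrow>
     S \<subseteq> proc_space P T F \<and>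
     (\<forall>a\<in>S. \<forall>b\<in>S. \<forall>s\<in>{0..1}. (\<lambda>p. s * a p + (1 - s) * b p) \<in> S) \<and>
     (\<forall>\<sigma> a. (\<forall>n::nat. \<sigma> n \<in> S) \<and> a \<in> proc_space P T F \<and>
        (\<lambda>n. proc_norm P T (\<sigma> n - a)) \<longlonglongrightarrow> 0 \<longrightarrow> a \<in> S)"

type_synonym 'w utility = "'w process \<Rightarrow> 'w process \<Rightarrow> 'w process \<Rightarrow> real"

definition utility_respects_eq ::
  "'w measure \<Rightarrow> real \<Rightarrow> (real \<Rightarrow> 'w measure) \<Rightarrow> 'w utility \<Rightarrow> bool" where
  "utility_respects_eq P T F U \<longleftrightarrow>
     (\<forall>a\<in>proc_space P T F. \<forall>a'\<in>proc_space P T F. \<forall>z\<in>proc_space P T F. \<forall>z'\<in>proc_space P T F.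
      \<forall>h\<in>proc_space P T F. \<forall>h'\<in>proc_space P T F.
        proc_eq P T a a' \<and> proc_eq P T z z' \<and> proc_eq P T h h' \<longrightarrow> U a z h = U a' z' h')"

definition has_gateaux_gradient ::
  "'w measure \<Rightarrow> real \<Rightarrow> (real \<Rightarrow> 'w measure) \<Rightarrow> ('w process \<Rightarrow> real) \<Rightarrow> 'w process \<Rightarrow> 'w process \<Rightarrow> bool" where
  "has_gateaux_gradient P T F f a g \<longleftrightarrow>
     g \<in> proc_space P T F \<and>
     (\<forall>h\<in>proc_space P T F.
        ((\<lambda>e. (f (\<lambda>p. a p + e * h p) - f a) / e) \<longlongrightarrow> proc_inner P T g h) (at 0))"

definition continuous_gateaux_gradient ::
  "'w measure \<Rightarrow> real \<Rightarrow> (real \<Rightarrow> 'w measure) \<Rightarrow> ('w process \<Rightarrow> real) \<Rightarrow> ('w process \<Rightarrow> 'w process) \<Rightarrow> bool" where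
  "continuous_gateaux_gradient P T F f Df \<longleftrightarrow>
     (\<forall>a\<in>proc_space P T F. has_gateaux_gradient P T F f a (Df a)) \<and>
     (\<forall>a\<in>proc_space P T F. \<forall>\<sigma>. (\<forall>n::nat. \<sigma> n \<in> proc_space P T F) \<and>
        (\<lambda>n. proc_norm P T (\<sigma> n - a)) \<longlonglongrightarrow> 0 \<longrightarrow>
        (\<lambda>n. proc_norm P T (Df (\<sigma> n) - Df a)) \<longlonglongrightarrow> 0)"

definition concave_in ::
  "'w measure \<Rightarrow> real \<Rightarrow> (real \<Rightarrow> 'w measure) \<Rightarrow> ('w process \<Rightarrow> real) \<Rightarrow> bool" where
  "concave_in P T F f \<longleftrightarrow>
     (\<forall>a\<in>proc_space P T F. \<forall>b\<in>proc_space P T F. \<forall>s\<in>{0..1}.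
        s * f a + (1 - s) * f b \<le> f (\<lambda>p. s * a p + (1 - s) * b p))"

definition regular_utility ::
  "'w measure \<Rightarrow> real \<Rightarrow> (real \<Rightarrow> 'w measure) \<Rightarrow> 'w utility \<Rightarrow> real \<Rightarrow> real \<Rightarrow> real \<Rightarrow> bool" where
  "regular_utility P T F U \<alpha>\<^sub>U l\<^sub>U l\<^sub>\<theta> \<longleftrightarrow>
     \<alpha>\<^sub>U > 0 \<and>
     (\<forall>z\<in>proc_space P T F. \<forall>h\<in>proc_space P T F.
        concave_in P T F (\<lambda>a. U a z h + \<alpha>\<^sub>U / 2 * (proc_norm P T a)\<^sup>2)) \<and>
     (\<exists>DU. (\<forall>z\<in>proc_space P T F. \<forall>h\<in>proc_space P T F.
               continuous_gateaux_gradient P T F (\<lambda>a. U a z h) (\<lambda>a. DU a z h)) \<and>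
           (\<forall>a\<in>proc_space P T F. \<forall>z\<in>proc_space P T F. \<forall>z'\<in>proc_space P T F.
            \<forall>h\<in>proc_space P T F. \<forall>h'\<in>proc_space P T F.
               proc_norm P T (DU a z h - DU a z' h')
                 \<le> l\<^sub>U * proc_norm P T (z - z') + l\<^sub>\<theta> * proc_norm P T (h - h')))"

text \<open>The Lipschitz property is required for admissible actions only. A functional that is
  strongly concave in the action on the whole space cannot be Lipschitz in an unbounded action.\<close>

definition jointly_lipschitz_utility ::
  "'w measure \<Rightarrow> real \<Rightarrow> (real \<Rightarrow> 'w measure) \<Rightarrow> 'w process set \<Rightarrow> 'w utility \<Rightarrow> bool" where
  "jointly_lipschitz_utility P T F A\<^sub>0 U \<longleftrightarrow>
     (\<exists>L. \<forall>a\<in>A\<^sub>0. \<forall>a'\<in>A\<^sub>0. \<forall>z\<in>proc_space P T F. \<forall>z'\<in>proc_space P T F.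
          \<forall>h\<in>proc_space P T F. \<forall>h'\<in>proc_space P T F.
        \<bar>U a z h - U a' z' h'\<bar>
          \<le> L * (proc_norm P T (a - a') + proc_norm P T (z - z') + proc_norm P T (h - h')))"

definition graphon :: "(real \<Rightarrow> real \<Rightarrow> real) \<Rightarrow> bool" where
  "graphon W \<longleftrightarrow>
     (\<lambda>(x, y). W x y) \<in> borel_measurable (lebesgue_on ({0..1} \<times> {0..1})) \<and>
     (\<forall>x\<in>{0..1}. \<forall>y\<in>{0..1}. W x y \<in> {0..1} \<and> W x y = W y x)"

definition graphon_op ::
  "real measure \<Rightarrow> (real \<Rightarrow> real \<Rightarrow> real) \<Rightarrow> (real \<Rightarrow> 'w process) \<Rightarrow> real \<Rightarrow> 'w process" where
  "graphon_op \<nu> W a x = (\<lambda>p. LINT y|\<nu>. W x y * a y p)"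

definition finite_interval_partition :: "real set set \<Rightarrow> bool" where
  "finite_interval_partition \<I> \<longleftrightarrow>
     finite \<I> \<and> partition_on {0..1} \<I> \<and> (\<forall>I\<in>\<I>. is_interval I)"

definition piecewise_lipschitz_graphon :: "(real \<Rightarrow> real \<Rightarrow> real) \<Rightarrow> bool" where
  "piecewise_lipschitz_graphon W \<longleftrightarrow>
     (\<exists>L \<I>. finite_interval_partition \<I> \<and>
        (\<forall>I\<in>\<I>. \<forall>J\<in>\<I>. \<forall>x\<in>I. \<forall>x'\<in>I. \<forall>y\<in>J. \<forall>y'\<in>J.
           \<bar>W x y - W x' y'\<bar> \<le> L * (\<bar>x - x'\<bar> + \<bar>y - y'\<bar>)))"

definition piecewise_lipschitz_profile ::
  "'w measure \<Rightarrow> real \<Rightarrow> (real \<Rightarrow> 'w process) \<Rightarrow> bool" where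
  "piecewise_lipschitz_profile P T a \<longleftrightarrow>
     (\<exists>L \<I>. finite_interval_partition \<I> \<and>
        (\<forall>I\<in>\<I>. \<forall>x\<in>I. \<forall>x'\<in>I. proc_norm P T (a x - a x') \<le> L * \<bar>x - x'\<bar>))"

definition admissible_profiles ::
  "real measure \<Rightarrow> 'w measure \<Rightarrow> real \<Rightarrow> (real \<Rightarrow> 'w measure) \<Rightarrow> (real \<Rightarrow> 'w process set)
     \<Rightarrow> (real \<Rightarrow> 'w process) set" where
  "admissible_profiles \<nu> P T F A = {a \<in> profile_space \<nu> P T F. \<forall>x\<in>{0..1}. a x \<in> A x}"

definition graphon_nash ::
  "real measure \<Rightarrow> 'w measure \<Rightarrow> real \<Rightarrow> (real \<Rightarrow> 'w measure) \<Rightarrow> (real \<Rightarrow> 'w process set) \<Rightarrow>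
   'w utility \<Rightarrow> (real \<Rightarrow> 'w process) \<Rightarrow> (real \<Rightarrow> real \<Rightarrow> real) \<Rightarrow> (real \<Rightarrow> 'w process) \<Rightarrow> bool" where
  "graphon_nash \<nu> P T F A U \<theta> W a \<longleftrightarrow>
     a \<in> admissible_profiles \<nu> P T F A \<and>
     (\<forall>x\<in>{0..1}. is_arg_max (\<lambda>b. U b (graphon_op \<nu> W a x) (\<theta> x)) (\<lambda>b. b \<in> A x) (a x))"

definition graphon_welfare ::
  "real measure \<Rightarrow> 'w measure \<Rightarrow> real \<Rightarrow> (real \<Rightarrow> 'w measure) \<Rightarrow> (real \<Rightarrow> 'w process set) \<Rightarrow>
   'w utility \<Rightarrow> (real \<Rightarrow> 'w process) \<Rightarrow> (real \<Rightarrow> real \<Rightarrow> real) \<Rightarrow> (real \<Rightarrow> 'w process) \<Rightarrow> real" where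
  "graphon_welfare \<nu> P T F A U \<theta> W \<theta>h =
     (let a = (SOME a. graphon_nash \<nu> P T F A U (\<theta> + \<theta>h) W a)
      in LINT x|\<nu>. U (a x) (graphon_op \<nu> W a x) (\<theta> x + \<theta>h x))"

definition graphon_intervention_solution ::
  "real measure \<Rightarrow> 'w measure \<Rightarrow> real \<Rightarrow> (real \<Rightarrow> 'w measure) \<Rightarrow> (real \<Rightarrow> 'w process set) \<Rightarrow>
   'w utility \<Rightarrow> (real \<Rightarrow> 'w process) \<Rightarrow> (real \<Rightarrow> real \<Rightarrow> real) \<Rightarrow> real \<Rightarrow> (real \<Rightarrow> 'w process) \<Rightarrow> bool" where
  "graphon_intervention_solution \<nu> P T F A U \<theta> W C\<^sub>B \<theta>b \<longleftrightarrow>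
     is_arg_max (graphon_welfare \<nu> P T F A U \<theta> W)
       (\<lambda>\<theta>h. \<theta>h \<in> profile_space \<nu> P T F \<and> (profile_norm \<nu> P T \<theta>h)\<^sup>2 \<le> C\<^sub>B) \<theta>b"

definition network_agg ::
  "nat \<Rightarrow> (nat \<Rightarrow> nat \<Rightarrow> real) \<Rightarrow> (nat \<Rightarrow> 'w process) \<Rightarrow> nat \<Rightarrow> 'w process" where
  "network_agg N G a i = (\<lambda>p. 1 / real N * (\<Sum>j=1..N. G i j * a j p))"

definition network_nash ::
  "nat \<Rightarrow> 'w process set \<Rightarrow> 'w utility \<Rightarrow> (nat \<Rightarrow> 'w process) \<Rightarrow> (nat \<Rightarrow> nat \<Rightarrow> real) \<Rightarrow>
   (nat \<Rightarrow> 'w process) \<Rightarrow> bool" where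
  "network_nash N A\<^sub>0 U \<theta> G a \<longleftrightarrow>
     (\<forall>i\<in>{1..N}. is_arg_max (\<lambda>b. U b (network_agg N G a i) (\<theta> i)) (\<lambda>b. b \<in> A\<^sub>0) (a i))"

definition unique_network_nash ::
  "'w measure \<Rightarrow> real \<Rightarrow> nat \<Rightarrow> 'w process set \<Rightarrow> 'w utility \<Rightarrow> (nat \<Rightarrow> 'w process) \<Rightarrow>
   (nat \<Rightarrow> nat \<Rightarrow> real) \<Rightarrow> bool" where
  "unique_network_nash P T N A\<^sub>0 U \<theta> G \<longleftrightarrow>
     (\<exists>a. network_nash N A\<^sub>0 U \<theta> G a) \<and>
     (\<forall>a b. network_nash N A\<^sub>0 U \<theta> G a \<and> network_nash N A\<^sub>0 U \<theta> G b \<longrightarrow>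
        (\<forall>i\<in>{1..N}. proc_eq P T (a i) (b i)))"

definition network_welfare ::
  "nat \<Rightarrow> 'w process set \<Rightarrow> 'w utility \<Rightarrow> (nat \<Rightarrow> 'w process) \<Rightarrow> (nat \<Rightarrow> nat \<Rightarrow> real) \<Rightarrow>
   (nat \<Rightarrow> 'w process) \<Rightarrow> real" where
  "network_welfare N A\<^sub>0 U \<theta> G \<theta>h =
     (let a = (SOME a. network_nash N A\<^sub>0 U (\<theta> + \<theta>h) G a)
      in 1 / real N * (\<Sum>i=1..N. U (a i) (network_agg N G a i) (\<theta> i + \<theta>h i)))"

definition network_optimum ::
  "'w measure \<Rightarrow> real \<Rightarrow> (real \<Rightarrow> 'w measure) \<Rightarrow> nat \<Rightarrow> 'w process set \<Rightarrow> 'w utility \<Rightarrow>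
   (nat \<Rightarrow> 'w process) \<Rightarrow> (nat \<Rightarrow> nat \<Rightarrow> real) \<Rightarrow> real \<Rightarrow> real" where
  "network_optimum P T F N A\<^sub>0 U \<theta> G C\<^sub>B =
     (SUP \<theta>h \<in> {\<theta>h \<in> net_space P T F N. 1 / real N * (net_norm P T N \<theta>h)\<^sup>2 \<le> C\<^sub>B}.
        network_welfare N A\<^sub>0 U \<theta> G \<theta>h)"

text \<open>Since \<open>x / 0 = 0\<close>, the approximate intervention is zero when all sampled values vanish, and
  also when \<open>profile_norm \<nu> P T \<theta>b = 0\<close>, where the normalization forces it.\<close>

definition intervention_scale ::
  "real measure \<Rightarrow> 'w measure \<Rightarrow> real \<Rightarrow> (real \<Rightarrow> 'w process) \<Rightarrow> nat \<Rightarrow> real" where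
  "intervention_scale \<nu> P T \<theta>b N =
     sqrt (1 / real N * (net_norm P T N (\<lambda>i. \<theta>b (real i / real N)))\<^sup>2) / profile_norm \<nu> P T \<theta>b"

definition approx_intervention ::
  "real measure \<Rightarrow> 'w measure \<Rightarrow> real \<Rightarrow> (real \<Rightarrow> 'w process) \<Rightarrow> nat \<Rightarrow> nat \<Rightarrow> 'w process" where
  "approx_intervention \<nu> P T \<theta>b N i =
     (\<lambda>p. \<theta>b (real i / real N) p / intervention_scale \<nu> P T \<theta>b N)"

definition intervention_gap ::
  "real measure \<Rightarrow> 'w measure \<Rightarrow> real \<Rightarrow> (real \<Rightarrow> 'w measure) \<Rightarrow> nat \<Rightarrow> 'w process set \<Rightarrow> 'w utility \<Rightarrow>
   (nat \<Rightarrow> 'w process) \<Rightarrow> (nat \<Rightarrow> nat \<Rightarrow> real) \<Rightarrow> real \<Rightarrow> (real \<Rightarrow> 'w process) \<Rightarrow> real" where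
  "intervention_gap \<nu> P T F N A\<^sub>0 U \<theta> G C\<^sub>B \<theta>b =
     network_optimum P T F N A\<^sub>0 U \<theta> G C\<^sub>B
       - network_welfare N A\<^sub>0 U \<theta> G (approx_intervention \<nu> P T \<theta>b N)"

definition iid_uniform :: "'q measure \<Rightarrow> nat \<Rightarrow> (nat \<Rightarrow> 'q \<Rightarrow> real) \<Rightarrow> bool" where
  "iid_uniform Q N u \<longleftrightarrow>
     prob_space.indep_vars Q (\<lambda>_. borel) u {1..N} \<and>
     (\<forall>i\<in>{1..N}. u i \<in> space Q \<rightarrow> {0..1} \<and>
        distr Q borel (u i) = uniform_measure lborel {0..1})"

definition order_statistic :: "nat \<Rightarrow> (nat \<Rightarrow> 'q \<Rightarrow> real) \<Rightarrow> nat \<Rightarrow> 'q \<Rightarrow> real" where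
  "order_statistic N u i \<omega> = sort (map (\<lambda>k. u k \<omega>) [1..<Suc N]) ! (i - 1)"

definition weighted_graph :: "(real \<Rightarrow> real \<Rightarrow> real) \<Rightarrow> (nat \<Rightarrow> 'q \<Rightarrow> real) \<Rightarrow> 'q \<Rightarrow> nat \<Rightarrow> nat \<Rightarrow> real" where
  "weighted_graph W x \<omega> i j = W (x i \<omega>) (x j \<omega>)"

definition node_pairs :: "nat \<Rightarrow> (nat \<times> nat) set" where
  "node_pairs N = {(i, j). 1 \<le> i \<and> i < j \<and> j \<le> N}"

text \<open>The random edge set \<open>S\<close> is specified by its conditional law: given the node positions \<open>x\<close>,
  the pairs \<open>i < j\<close> are joined independently, with probabilities \<open>W x\<^sub>i x\<^sub>j\<close>.\<close>

definition sampled_edges ::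
  "'q measure \<Rightarrow> nat \<Rightarrow> (real \<Rightarrow> real \<Rightarrow> real) \<Rightarrow> (nat \<Rightarrow> 'q \<Rightarrow> real) \<Rightarrow> ('q \<Rightarrow> (nat \<times> nat) set) \<Rightarrow> bool" where
  "sampled_edges Q N W x S \<longleftrightarrow>
     S \<in> Q \<rightarrow>\<^sub>M count_space (Pow (node_pairs N)) \<and>
     (\<forall>B \<in> sets (PiM {1..N} (\<lambda>_. borel)). \<forall>e \<subseteq> node_pairs N.
        measure Q {\<omega> \<in> space Q. (\<lambda>i\<in>{1..N}. x i \<omega>) \<in> B \<and> S \<omega> = e} =
        (LINT \<omega>|Q. indicator B (\<lambda>i\<in>{1..N}. x i \<omega>) *
           (\<Prod>(i, j)\<in>node_pairs N.
              if (i, j) \<in> e then W (x i \<omega>) (x j \<omega>) else 1 - W (x i \<omega>) (x j \<omega>))))"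

definition adjacency :: "(nat \<times> nat) set \<Rightarrow> nat \<Rightarrow> nat \<Rightarrow> real" where
  "adjacency e i j = (if (i, j) \<in> e \<or> (j, i) \<in> e then 1 else 0)"

definition whp_bigo :: "'q measure \<Rightarrow> real \<Rightarrow> (nat \<Rightarrow> 'q \<Rightarrow> real) \<Rightarrow> (nat \<Rightarrow> real) \<Rightarrow> bool" where
  "whp_bigo Q q X r \<longleftrightarrow>
     (\<exists>C. \<forall>\<^sub>F N in sequentially. measure Q {\<omega> \<in> space Q. X N \<omega> \<le> C * r N} \<ge> q)"

end

theory Submission imports Defs "HOL-Real_Asymp.Real_Asymp" begin

text \<open>A network game is a graphon game for a step graphon, played by step profiles. Strong concavity
  makes the best response Lipschitz in the aggregate with constant \<open>l\<^sub>U / \<alpha>\<^sub>U < 1\<close>, so equilibria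
  exist, are unique, and depend in the mean over the players in a Lipschitz way on the heterogeneity
  and on the aggregation operator applied to bounded actions. Hence the welfare gap of the
  approximate intervention is at most a constant times the distance of the sampled graph to the graphon,
  tested on bounded actions, plus \<open>\<parallel>\<theta> - \<theta>\<^sup>N\<parallel>\<close> and the \<open>O(1 / sqrt N)\<close> error
  of sampling the solution at the points \<open>i / N\<close>. The optimal network intervention enters only through its
  step profile, which is feasible for the graphon problem. Hoeffding's inequality bounds the
  distance of the ordered sample to the grid and, for simple graphs, the entries of \<open>B\<^sup>T B\<close>, where
  \<open>B\<close> is the difference of the adjacency and the weight matrix; the latter yields the exponent
  \<open>1/4\<close>. Almost sure convergence is Borel-Cantelli with \<open>\<delta> = 1 / N\<^sup>2\<close>.\<close>

section \<open>Square integrable functions\<close>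

text \<open>Two obstacles shape the proof. The space of processes need not be separable and nothing
  is assumed about measurability of \<open>U\<close>, so best responses chosen player by player need
  not form a jointly measurable family. The remedy is that a jointly measurable family has a
  separable range: it is a limit of countably valued families, and Lipschitz dependence carries
  measurability over to best responses and to welfare integrands. Completeness enters through
  pointwise limits of geometrically convergent sequences, since these preserve joint and progressive
  measurability. An aggregation with weights in [0,1] does not increase mean distances. The
  contraction constant is therefore the same for the graphon and for all sampled graphs, and each
  realised network game has a unique equilibrium. The entries of \<open>B\<^sup>T B\<close> off the
  diagonal are of order sqrt(N log(N/\<delta>)). Divided by N they bound the mean square error of
  the aggregates, and the mean error takes one more root, whence 1/4.\<close>

definition square_integrable :: "'a measure \<Rightarrow> ('a \<Rightarrow> real) \<Rightarrow> bool" where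
  "square_integrable M f \<longleftrightarrow> f \<in> borel_measurable M \<and> integrable M (\<lambda>x. (f x)\<^sup>2)"

definition l2_norm :: "'a measure \<Rightarrow> ('a \<Rightarrow> real) \<Rightarrow> real" where
  "l2_norm M f = sqrt (LINT x|M. (f x)\<^sup>2)"

lemma square_integrable_measurable: "square_integrable M f \<Longrightarrow> f \<in> borel_measurable M"
  by (simp add: square_integrable_def)

lemma l2_norm_nonneg [simp]: "l2_norm M f \<ge> 0"
  by (simp add: l2_norm_def)

lemma l2_norm_sq: "(l2_norm M f)\<^sup>2 = (LINT x|M. (f x)\<^sup>2)"
  by (simp add: l2_norm_def)

lemma integrable_mult_square:
  assumes f: "square_integrable M f" and g: "square_integrable M g"
  shows "integrable M (\<lambda>x. f x * g x)"
proof (rule Bochner_Integration.integrable_bound)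
  show "integrable M (\<lambda>x. (f x)\<^sup>2 + (g x)\<^sup>2)"
    using f g by (simp add: square_integrable_def)
  show "(\<lambda>x. f x * g x) \<in> borel_measurable M"
    using f g by (auto simp: square_integrable_def)
  have "\<bar>a * b\<bar> \<le> a\<^sup>2 + b\<^sup>2" for a b :: real
  proof -
    have "2 * (\<bar>a\<bar> * \<bar>b\<bar>) \<le> a\<^sup>2 + b\<^sup>2"
      using sum_squares_bound[of "\<bar>a\<bar>" "\<bar>b\<bar>"] by simp
    then show ?thesis by (simp add: abs_mult)
        (smt (verit) mult_nonneg_nonneg abs_ge_zero)
  qed
  then show "AE x in M. norm (f x * g x) \<le> norm ((f x)\<^sup>2 + (g x)\<^sup>2)"
    by (auto simp: abs_mult intro!: order_trans[OF _ abs_ge_self])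
qed

lemma square_expand:
  fixes u v c d :: real
  shows "(c * u + d * v)\<^sup>2 = c\<^sup>2 * u\<^sup>2 + 2 * c * d * (u * v) + d\<^sup>2 * v\<^sup>2"
  by (simp add: power2_eq_square algebra_simps)

lemma square_integrable_lincomb:
  assumes f: "square_integrable M f" and g: "square_integrable M g"
  shows "square_integrable M (\<lambda>x. c * f x + d * g x)"
proof -
  have "integrable M (\<lambda>x. c\<^sup>2 * (f x)\<^sup>2 + 2 * c * d * (f x * g x) + d\<^sup>2 * (g x)\<^sup>2)"
    using f g integrable_mult_square[OF f g]
    by (intro Bochner_Integration.integrable_add integrable_mult_right)
      (auto simp: square_integrable_def)
  moreover have "(\<lambda>x. c * f x + d * g x) \<in> borel_measurable M"
    using f g by (auto simp: square_integrable_def)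
  ultimately show ?thesis
    by (simp add: square_integrable_def square_expand)
qed

lemma l2_norm_lincomb_sq:
  assumes f: "square_integrable M f" and g: "square_integrable M g"
  shows "(l2_norm M (\<lambda>x. c * f x + d * g x))\<^sup>2
    = c\<^sup>2 * (l2_norm M f)\<^sup>2 + 2 * c * d * (LINT x|M. f x * g x) + d\<^sup>2 * (l2_norm M g)\<^sup>2"
  using f g integrable_mult_square[OF f g]
  by (simp add: square_integrable_def l2_norm_sq square_expand)

lemma square_integrable_diff:
  "square_integrable M f \<Longrightarrow> square_integrable M g \<Longrightarrow> square_integrable M (f - g)"
  using square_integrable_lincomb[of M f g 1 "-1"] by (simp add: fun_diff_def)

lemma square_integrable_cmult:
  "square_integrable M f \<Longrightarrow> square_integrable M (\<lambda>x. c * f x)"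
  using square_integrable_lincomb[of M f f c 0] by simp

lemma square_integrable_zero: "square_integrable M (\<lambda>x. 0)"
  by (simp add: square_integrable_def)

lemma square_integrable_sum:
  "(\<And>i. i \<in> I \<Longrightarrow> square_integrable M (f i)) \<Longrightarrow> square_integrable M (\<lambda>x. \<Sum>i\<in>I. c i * f i x)"
proof (induction I rule: infinite_finite_induct)
  case (insert a I)
  then show ?case
    using square_integrable_lincomb[of M "f a" "\<lambda>x. \<Sum>i\<in>I. c i * f i x" "c a" 1] by simp
qed (auto simp: square_integrable_zero)

lemma square_integrable_bounded:
  assumes "finite_measure M" "f \<in> borel_measurable M" "\<And>x. x \<in> space M \<Longrightarrow> \<bar>f x\<bar> \<le> B"
  shows "square_integrable M f"
proof -
  interpret finite_measure M by fact
  have "integrable M (\<lambda>x. (f x)\<^sup>2)"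
    using assms(2) power_mono[OF assms(3) abs_ge_zero, of _ 2]
    by (intro integrable_const_bound[where B="B\<^sup>2"] AE_I2) auto
  then show ?thesis using assms by (simp add: square_integrable_def)
qed

text \<open>The squared norm of \<open>s * f + t * g\<close> is a nonnegative quadratic form in
  \<open>s\<close> and \<open>t\<close>, so its discriminant is not positive. The degenerate case
  \<open>c = 0\<close> is treated apart because \<open>c\<close> serves as a value of
  \<open>s\<close>.\<close>

lemma l2_Cauchy_Schwarz:
  assumes f: "square_integrable M f" and g: "square_integrable M g"
  shows "\<bar>LINT x|M. f x * g x\<bar> \<le> l2_norm M f * l2_norm M g"
proof -
  define a b c where "a = (l2_norm M f)\<^sup>2" and "b = (LINT x|M. f x * g x)" and "c = (l2_norm M g)\<^sup>2"
  have quad: "0 \<le> a * s\<^sup>2 + 2 * s * t * b + c * t\<^sup>2" for s t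
    using l2_norm_lincomb_sq[OF f g, of s t] zero_le_power2[of "l2_norm M (\<lambda>x. s * f x + t * g x)"]
    by (simp add: a_def b_def c_def algebra_simps)
  have "b\<^sup>2 \<le> a * c"
  proof (cases "c = 0")
    case True
    have "0 \<le> a + 2 * t * b" for t using quad[of 1 t] True by simp
    \<comment> \<open>If \<open>b\<close> were nonzero, this value of \<open>t\<close> would make
      the form equal to -1.\<close>
    from this[of "- (a + 1) / (2 * b)"] have "b = 0"
      by (cases "b = 0") (auto simp: field_simps)
    then show ?thesis using True by simp
  next
    case False
    then have "c > 0" by (simp add: c_def)
    have "0 \<le> a * c\<^sup>2 - b\<^sup>2 * c"
      using quad[of c "-b"] by (simp add: power2_eq_square algebra_simps)
    then have "b\<^sup>2 * c \<le> (a * c) * c" by (simp add: power2_eq_square algebra_simps)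
    then show ?thesis using \<open>c > 0\<close> by simp
  qed
  then have "b\<^sup>2 \<le> (l2_norm M f * l2_norm M g)\<^sup>2" by (simp add: a_def c_def power_mult_distrib)
  then show ?thesis unfolding b_def[symmetric] by (metis abs_le_square_iff abs_of_nonneg
        l2_norm_nonneg mult_nonneg_nonneg)
qed

lemma l2_norm_triangle:
  assumes f: "square_integrable M f" and g: "square_integrable M g"
  shows "l2_norm M (f + g) \<le> l2_norm M f + l2_norm M g"
proof (rule power2_le_imp_le)
  have "(l2_norm M (f + g))\<^sup>2 = (l2_norm M f)\<^sup>2 + 2 * (LINT x|M. f x * g x) + (l2_norm M g)\<^sup>2"
    using l2_norm_lincomb_sq[OF f g, of 1 1] by (simp add: plus_fun_def)
  also have "\<dots> \<le> (l2_norm M f)\<^sup>2 + 2 * (l2_norm M f * l2_norm M g) + (l2_norm M g)\<^sup>2"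
    using l2_Cauchy_Schwarz[OF f g] by simp
  finally show "(l2_norm M (f + g))\<^sup>2 \<le> (l2_norm M f + l2_norm M g)\<^sup>2"
    by (simp add: power2_sum algebra_simps)
qed simp

lemma l2_norm_cmult: "l2_norm M (\<lambda>x. c * f x) = \<bar>c\<bar> * l2_norm M f"
  by (simp add: l2_norm_def power_mult_distrib real_sqrt_mult)

lemma l2_norm_zero [simp]: "l2_norm M (\<lambda>x. 0) = 0" "l2_norm M 0 = 0"
  by (simp_all add: l2_norm_def)

lemma l2_norm_minus_commute: "l2_norm M (f - g) = l2_norm M (g - f)"
  by (simp add: l2_norm_def power2_commute)

lemma l2_norm_diff_triangle:
  assumes "square_integrable M f" "square_integrable M g" "square_integrable M h"
  shows "l2_norm M (f - h) \<le> l2_norm M (f - g) + l2_norm M (g - h)"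
  using l2_norm_triangle[of M "f - g" "g - h"] assms by (simp add: square_integrable_diff)

lemma l2_norm_le_add:
  assumes "square_integrable M f" "square_integrable M g"
  shows "l2_norm M f \<le> l2_norm M (f - g) + l2_norm M g"
  using l2_norm_triangle[of M "f - g" g] assms by (simp add: square_integrable_diff)

lemma l2_norm_diff_le:
  assumes "square_integrable M f" "square_integrable M g"
  shows "l2_norm M (f - g) \<le> l2_norm M f + l2_norm M g"
  using l2_norm_lincomb_sq[of M g g "-1" 0] l2_norm_triangle[of M f "- g"] assms
    square_integrable_lincomb[of M g g "-1" 0] l2_norm_cmult[of M "-1" g]
  by (simp add: fun_Compl_def plus_fun_def fun_diff_def)

lemma l2_norm_sum:
  "(\<And>i. i \<in> I \<Longrightarrow> square_integrable M (f i)) \<Longrightarrow>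
     l2_norm M (\<lambda>x. \<Sum>i\<in>I. c i * f i x) \<le> (\<Sum>i\<in>I. \<bar>c i\<bar> * l2_norm M (f i))"
proof (induction I rule: infinite_finite_induct)
  case (insert a I)
  have "l2_norm M ((\<lambda>x. c a * f a x) + (\<lambda>x. \<Sum>i\<in>I. c i * f i x))
      \<le> l2_norm M (\<lambda>x. c a * f a x) + l2_norm M (\<lambda>x. \<Sum>i\<in>I. c i * f i x)"
    using insert by (intro l2_norm_triangle square_integrable_sum square_integrable_cmult) auto
  then show ?case using insert by (simp add: plus_fun_def l2_norm_cmult)
qed (auto simp: square_integrable_zero)

lemma l2_norm_eq_0_iff:
  assumes "square_integrable M f"
  shows "l2_norm M f = 0 \<longleftrightarrow> (AE x in M. f x = 0)"
  using assms by (simp add: l2_norm_def square_integrable_def integral_nonneg_eq_0_iff_AE)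

lemma l2_norm_cong_AE:
  assumes "f \<in> borel_measurable M" "g \<in> borel_measurable M" "AE x in M. f x = g x"
  shows "l2_norm M f = l2_norm M g"
  unfolding l2_norm_def using assms by (intro arg_cong[where f=sqrt] integral_cong_AE) auto

lemma integral_abs_le_l2_norm:
  assumes "prob_space M" "square_integrable M f"
  shows "integrable M f" "(LINT x|M. \<bar>f x\<bar>) \<le> l2_norm M f"
proof -
  interpret prob_space M by fact
  have one: "square_integrable M (\<lambda>x. 1)" "l2_norm M (\<lambda>x. 1) = 1"
    by (auto simp: square_integrable_def l2_norm_def prob_space)
  show "integrable M f" using integrable_mult_square[OF assms(2) one(1)] by simp
  have abs: "square_integrable M (\<lambda>x. \<bar>f x\<bar>)" "l2_norm M (\<lambda>x. \<bar>f x\<bar>) = l2_norm M f"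
    using assms(2) by (auto simp: square_integrable_def l2_norm_def)
  show "(LINT x|M. \<bar>f x\<bar>) \<le> l2_norm M f"
    using l2_Cauchy_Schwarz[OF abs(1) one(1)] by (simp add: abs one)
qed

text \<open>The defect with factor \<open>s * (1 - s)\<close> is what turns concavity of the utility
  plus a multiple of the squared norm into strong concavity of the utility.\<close>

lemma l2_norm_convex_comb_sq:
  assumes f: "square_integrable M f" and g: "square_integrable M g"
  shows "(l2_norm M (\<lambda>x. s * f x + (1 - s) * g x))\<^sup>2
    = s * (l2_norm M f)\<^sup>2 + (1 - s) * (l2_norm M g)\<^sup>2 - s * (1 - s) * (l2_norm M (f - g))\<^sup>2"
proof -
  have "(l2_norm M (f - g))\<^sup>2 = (l2_norm M f)\<^sup>2 - 2 * (LINT x|M. f x * g x) + (l2_norm M g)\<^sup>2"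
    using l2_norm_lincomb_sq[OF f g, of 1 "-1"] by (simp add: fun_diff_def)
  moreover have "s\<^sup>2 * a + 2 * s * (1 - s) * b + (1 - s)\<^sup>2 * c
      = s * a + (1 - s) * c - s * (1 - s) * (a - 2 * b + c)" for a b c :: real
    by (simp add: power2_eq_square algebra_simps)
  ultimately show ?thesis
    unfolding l2_norm_lincomb_sq[OF f g] by (simp only:)
qed

section \<open>Completeness through geometrically convergent sequences\<close>

lemma geometric_telescope_bound:
  fixes d :: "nat \<Rightarrow> nat \<Rightarrow> real"
  assumes step: "\<And>n. d n (Suc n) \<le> C * q ^ n" and refl: "\<And>n. d n n = 0"
    and tri: "\<And>l m n. d l n \<le> d l m + d m n"
    and q: "0 \<le> q" "q < 1" and C: "0 \<le> C"
  shows "n \<le> m \<Longrightarrow> d n m \<le> C * q ^ n / (1 - q)"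
proof -
  assume "n \<le> m"
  have "d n (n + k) \<le> C * q ^ n * (\<Sum>j<k. q ^ j)" for k
  proof (induction k)
    case (Suc k)
    have "d n (n + Suc k) \<le> d n (n + k) + C * q ^ (n + k)"
      using tri[of n "n + Suc k" "n + k"] step[of "n + k"] by simp
    also have "\<dots> \<le> C * q ^ n * (\<Sum>j<k. q ^ j) + C * q ^ n * q ^ k"
      using Suc by (simp add: power_add)
    finally show ?case by (simp add: algebra_simps)
  qed (simp add: refl)
  moreover have "(\<Sum>j<k. q ^ j) \<le> 1 / (1 - q)" for k
    using q by (simp add: sum_gp_strict divide_right_mono)
  ultimately have "d n (n + k) \<le> C * q ^ n * (1 / (1 - q))" for k
    using C q by (meson order_trans mult_left_mono mult_nonneg_nonneg zero_le_power)
  then show ?thesis using \<open>n \<le> m\<close> by (metis le_add_diff_inverse times_divide_eq_right mult.right_neutral)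
qed

text \<open>The limit is taken pointwise, with whatever value \<open>lim\<close> has where the
  sequence diverges. This makes \<open>g\<close> measurable for every sigma-algebra that makes all
  \<open>f n\<close> measurable, which abstract completeness would not give.\<close>

lemma l2_geometric_limit:
  fixes f :: "nat \<Rightarrow> 'a \<Rightarrow> real"
  assumes fin: "finite_measure M" and f: "\<And>n. square_integrable M (f n)"
    and step: "\<And>n. l2_norm M (f n - f (Suc n)) \<le> C * q ^ n"
    and q: "0 \<le> q" "q < 1"
  defines "g \<equiv> \<lambda>x. lim (\<lambda>n. f n x)"
  shows "square_integrable M g" "\<And>n. l2_norm M (f n - g) \<le> C * q ^ n / (1 - q)"
    "AE x in M. (\<lambda>n. f n x) \<longlonglongrightarrow> g x"
proof -
  interpret finite_measure M by fact
  have [measurable]: "f n \<in> borel_measurable M" for n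
    using f by (rule square_integrable_measurable)
  have [measurable]: "g \<in> borel_measurable M" unfolding g_def by measurable
  have C: "0 \<le> C" using order_trans[OF l2_norm_nonneg step[of 0]] by simp
  have dist: "l2_norm M (f n - f m) \<le> C * q ^ n / (1 - q)" if "n \<le> m" for n m
    using that step q C l2_norm_diff_triangle[OF f f f]
    by (intro geometric_telescope_bound[where d="\<lambda>n m. l2_norm M (f n - f m)"]) auto
  have sqd: "square_integrable M (f n - f m)" for n m using f by (simp add: square_integrable_diff)
  have one: "square_integrable M (\<lambda>x. 1)" by (rule square_integrable_bounded[where B=1]) (auto simp: fin)
  define K where "K = l2_norm M (\<lambda>x. 1)"
  \<comment> \<open>On a finite measure space the L2 increments bound the L1 increments, which are
    therefore summable; Tonelli's theorem then makes the increments absolutely summable at almost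
    every point.\<close>
  have L1: "(LINT x|M. \<bar>f n x - f (Suc n) x\<bar>) \<le> K * C * q ^ n"
    and int1: "integrable M (\<lambda>x. \<bar>f n x - f (Suc n) x\<bar>)" for n
  proof -
    let ?h = "\<lambda>x. \<bar>f n x - f (Suc n) x\<bar>"
    have h: "square_integrable M ?h" and hn: "l2_norm M ?h = l2_norm M (f n - f (Suc n))"
      using sqd[of n "Suc n"] by (auto simp: square_integrable_def l2_norm_def)
    show "integrable M ?h" using integrable_mult_square[OF h one] by simp
    have "(LINT x|M. ?h x) \<le> l2_norm M ?h * K"
      using l2_Cauchy_Schwarz[OF h one] by (simp add: K_def)
    also have "\<dots> \<le> (C * q ^ n) * K" using step[of n] hn by (intro mult_right_mono) (auto simp: K_def)
    finally show "(LINT x|M. ?h x) \<le> K * C * q ^ n" by (simp add: algebra_simps)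
  qed
  have "(\<integral>\<^sup>+x. (\<Sum>n. ennreal \<bar>f n x - f (Suc n) x\<bar>) \<partial>M)
      = (\<Sum>n. \<integral>\<^sup>+x. ennreal \<bar>f n x - f (Suc n) x\<bar> \<partial>M)"
    by (rule nn_integral_suminf) simp
  also have "\<dots> = (\<Sum>n. ennreal (LINT x|M. \<bar>f n x - f (Suc n) x\<bar>))"
    using int1 by (simp add: nn_integral_eq_integral)
  also have "\<dots> \<le> (\<Sum>n. ennreal (K * C * q ^ n))"
    using L1 by (intro suminf_le) (auto intro!: ennreal_leI)
  also have "\<dots> < \<infinity>"
    using q C by (subst suminf_ennreal2) (auto simp: K_def intro!: summable_mult summable_geometric)
  finally have "AE x in M. (\<Sum>n. ennreal \<bar>f n x - f (Suc n) x\<bar>) \<noteq> \<infinity>"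
    by (intro nn_integral_PInf_AE) auto
  then show conv: "AE x in M. (\<lambda>n. f n x) \<longlonglongrightarrow> g x"
  proof eventually_elim
    case (elim x)
    then have "(\<Sum>n. ennreal \<bar>f n x - f (Suc n) x\<bar>) \<noteq> \<top>"
      unfolding infinity_ennreal_def .
    then have "summable (\<lambda>n. \<bar>f n x - f (Suc n) x\<bar>)"
      by (rule summable_suminf_not_top[rotated]) (rule abs_ge_zero)
    then have "summable (\<lambda>n. f (Suc n) x - f n x)"
      by (subst (asm) abs_minus_commute) (rule summable_rabs_cancel)
    then have "convergent (\<lambda>n. \<Sum>i<n. f (Suc i) x - f i x)"
      by (simp add: summable_iff_convergent)
    then have "convergent (\<lambda>n. f n x - f 0 x)" 
      using sum_lessThan_telescope[of "\<lambda>i. f i x"] by (simp cong del: sum.cong_simp)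
    then have "convergent (\<lambda>n. f 0 x + (f n x - f 0 x))"
      by (intro convergent_add convergent_const)
    then have "convergent (\<lambda>n. f n x)" by simp
    then show ?case by (simp add: g_def convergent_LIMSEQ_iff)
  qed
  \<comment> \<open>Fatou's lemma along the almost everywhere convergent sequence carries the Cauchy
    bound over to the limit.\<close>
  have nn: "(\<integral>\<^sup>+x. ennreal ((f n x - g x)\<^sup>2) \<partial>M) \<le> ennreal ((C * q ^ n / (1 - q))\<^sup>2)" for n
  proof -
    have "(\<integral>\<^sup>+x. ennreal ((f n x - g x)\<^sup>2) \<partial>M)
        = (\<integral>\<^sup>+x. liminf (\<lambda>m. ennreal ((f n x - f m x)\<^sup>2)) \<partial>M)"
    proof (intro nn_integral_cong_AE, use conv in eventually_elim)
      case (elim x)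
      have "(\<lambda>m. ennreal ((f n x - f m x)\<^sup>2)) \<longlonglongrightarrow> ennreal ((f n x - g x)\<^sup>2)"
        by (intro tendsto_intros elim)
      from lim_imp_Liminf[OF sequentially_bot this] show ?case by (rule sym)
    qed
    also have "\<dots> \<le> liminf (\<lambda>m. \<integral>\<^sup>+x. ennreal ((f n x - f m x)\<^sup>2) \<partial>M)"
      by (rule nn_integral_liminf) simp
    also have "\<dots> \<le> ennreal ((C * q ^ n / (1 - q))\<^sup>2)"
    proof (rule Liminf_le, simp, rule eventually_sequentiallyI[of n])
      fix m assume "n \<le> m"
      have "(\<integral>\<^sup>+x. ennreal ((f n x - f m x)\<^sup>2) \<partial>M) = ennreal ((l2_norm M (f n - f m))\<^sup>2)"
        using sqd[of n m] by (simp add: nn_integral_eq_integral square_integrable_def l2_norm_sq)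
      also have "\<dots> \<le> ennreal ((C * q ^ n / (1 - q))\<^sup>2)"
        using dist[OF \<open>n \<le> m\<close>] by (intro ennreal_leI power_mono) auto
      finally show "(\<integral>\<^sup>+x. ennreal ((f n x - f m x)\<^sup>2) \<partial>M) \<le> ennreal ((C * q ^ n / (1 - q))\<^sup>2)" .
    qed
    finally show ?thesis .
  qed
  have sq: "square_integrable M (f n - g)" for n
    using nn[of n] by (auto simp: square_integrable_def fun_diff_def intro!: integrableI_bounded
        dest: order.strict_trans1[OF _ ennreal_less_top])
  have "f 0 - (f 0 - g) = g" by (simp add: fun_eq_iff)
  then show "square_integrable M g" using square_integrable_diff[OF f sq, of 0 0] by simp
  show "l2_norm M (f n - g) \<le> C * q ^ n / (1 - q)" for n
  proof (rule power2_le_imp_le)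
    have "ennreal ((l2_norm M (f n - g))\<^sup>2) = (\<integral>\<^sup>+x. ennreal ((f n x - g x)\<^sup>2) \<partial>M)"
      using sq[of n] by (simp add: nn_integral_eq_integral square_integrable_def l2_norm_sq)
    then show "(l2_norm M (f n - g))\<^sup>2 \<le> (C * q ^ n / (1 - q))\<^sup>2"
      using nn[of n] by (metis ennreal_le_iff zero_le_power2)
    show "0 \<le> C * q ^ n / (1 - q)" using C q by simp
  qed
qed

section \<open>Families of square integrable functions\<close>

text \<open>Square integrability is required of every section, not of almost every one, because the
  equilibrium condition is imposed on every single player.\<close>

definition L2_profile :: "'i measure \<Rightarrow> 'a measure \<Rightarrow> ('i \<Rightarrow> 'a \<Rightarrow> real) \<Rightarrow> bool" where
  "L2_profile \<nu> M c \<longleftrightarrow> case_prod c \<in> borel_measurable (\<nu> \<Otimes>\<^sub>M M) \<and>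
     integrable (\<nu> \<Otimes>\<^sub>M M) (\<lambda>(x, p). (c x p)\<^sup>2) \<and> (\<forall>x\<in>space \<nu>. square_integrable M (c x))"

text \<open>The square integrable functions on an arbitrary probability space need not form a
  separable space; this asks only that the sections lie near one countable set, whose elements need
  not be sections themselves.\<close>

definition separable_profile :: "'i measure \<Rightarrow> 'a measure \<Rightarrow> ('i \<Rightarrow> 'a \<Rightarrow> real) \<Rightarrow> bool" where
  "separable_profile \<nu> M f \<longleftrightarrow> (\<exists>C. countable C \<and> (\<forall>c\<in>C. square_integrable M c) \<and>
     (\<forall>x\<in>space \<nu>. \<forall>\<epsilon>>0. \<exists>c\<in>C. l2_norm M (f x - c) < \<epsilon>))"

locale index_product = I: prob_space \<nu> + D: finite_measure M
  for \<nu> :: "'i measure" and M :: "'a measure"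
begin

sublocale pair_sigma_finite \<nu> M ..

sublocale PP: finite_measure "\<nu> \<Otimes>\<^sub>M M"
  by (rule finite_measure_pair_measure) unfold_locales

lemma l2_norm_section_measurable:
  assumes [measurable]: "case_prod c \<in> borel_measurable (\<nu> \<Otimes>\<^sub>M M)"
  shows "(\<lambda>x. l2_norm M (c x)) \<in> borel_measurable \<nu>"
  unfolding l2_norm_def by measurable

lemma section_measurable:
  assumes "case_prod c \<in> borel_measurable (\<nu> \<Otimes>\<^sub>M M)" "x \<in> space \<nu>"
  shows "c x \<in> borel_measurable M"
  using measurable_compose[OF measurable_Pair1'[OF assms(2)] assms(1)] by simp

lemma L2_profile_square_integrable:
  "L2_profile \<nu> M c \<Longrightarrow> square_integrable (\<nu> \<Otimes>\<^sub>M M) (case_prod c)"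
  by (simp add: L2_profile_def square_integrable_def case_prod_beta')

lemma L2_profile_lincomb:
  assumes "L2_profile \<nu> M a" "L2_profile \<nu> M b"
  shows "L2_profile \<nu> M (\<lambda>x p. c * a x p + d * b x p)"
proof -
  have "square_integrable (\<nu> \<Otimes>\<^sub>M M) (\<lambda>q. c * case_prod a q + d * case_prod b q)"
    by (intro square_integrable_lincomb L2_profile_square_integrable assms)
  moreover have "square_integrable M (\<lambda>p. c * a x p + d * b x p)" if "x \<in> space \<nu>" for x
    using assms that by (intro square_integrable_lincomb) (auto simp: L2_profile_def)
  ultimately show ?thesis
    by (auto simp: L2_profile_def square_integrable_def[of "\<nu> \<Otimes>\<^sub>M M"] case_prod_beta')
qed

lemma L2_profile_diff: "L2_profile \<nu> M a \<Longrightarrow> L2_profile \<nu> M b \<Longrightarrow> L2_profile \<nu> M (a - b)"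
  using L2_profile_lincomb[of a b 1 "-1"] by (simp add: fun_diff_def)

lemma L2_profile_add: "L2_profile \<nu> M a \<Longrightarrow> L2_profile \<nu> M b \<Longrightarrow> L2_profile \<nu> M (a + b)"
  using L2_profile_lincomb[of a b 1 1] by (simp add: plus_fun_def)

lemma L2_profile_norm:
  assumes c: "L2_profile \<nu> M c"
  shows "square_integrable \<nu> (\<lambda>x. l2_norm M (c x))"
    "l2_norm \<nu> (\<lambda>x. l2_norm M (c x)) = l2_norm (\<nu> \<Otimes>\<^sub>M M) (case_prod c)"
proof -
  have [measurable]: "case_prod c \<in> borel_measurable (\<nu> \<Otimes>\<^sub>M M)" using c by (simp add: L2_profile_def)
  have i: "integrable (\<nu> \<Otimes>\<^sub>M M) (\<lambda>(x, p). (c x p)\<^sup>2)" using c by (simp add: L2_profile_def)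
  show "square_integrable \<nu> (\<lambda>x. l2_norm M (c x))"
    using integrable_fst[OF i] by (simp add: square_integrable_def l2_norm_sq l2_norm_section_measurable)
  show "l2_norm \<nu> (\<lambda>x. l2_norm M (c x)) = l2_norm (\<nu> \<Otimes>\<^sub>M M) (case_prod c)"
    using integral_fst[OF i] by (simp add: l2_norm_def[of \<nu>] l2_norm_def[of "\<nu> \<Otimes>\<^sub>M M"] l2_norm_sq case_prod_beta')
qed

lemma L2_profile_mean_norm:
  assumes "L2_profile \<nu> M c"
  shows "integrable \<nu> (\<lambda>x. l2_norm M (c x))"
    "(LINT x|\<nu>. l2_norm M (c x)) \<le> l2_norm (\<nu> \<Otimes>\<^sub>M M) (case_prod c)"
  using integral_abs_le_l2_norm[OF I.prob_space_axioms L2_profile_norm(1)[OF assms]]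
    L2_profile_norm(2)[OF assms] by simp_all

lemma L2_profile_bounded:
  assumes c: "case_prod c \<in> borel_measurable (\<nu> \<Otimes>\<^sub>M M)"
    and sq: "\<And>x. x \<in> space \<nu> \<Longrightarrow> square_integrable M (c x)"
    and B: "\<And>x. x \<in> space \<nu> \<Longrightarrow> l2_norm M (c x) \<le> B"
  shows "L2_profile \<nu> M c"
proof -
  have [measurable]: "case_prod c \<in> borel_measurable (\<nu> \<Otimes>\<^sub>M M)" by (rule c)
  have "integrable (\<nu> \<Otimes>\<^sub>M M) (\<lambda>(x, p). (c x p)\<^sup>2)"
  proof (rule Fubini_integrable)
    have "integrable \<nu> (\<lambda>x. (l2_norm M (c x))\<^sup>2)"
      using l2_norm_section_measurable[OF c] B power_mono[OF B l2_norm_nonneg, of _ 2]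
      by (intro I.integrable_const_bound[where B="B\<^sup>2"] AE_I2) auto
    then show "integrable \<nu> (\<lambda>x. LINT y|M. norm (case (x, y) of (x, p) \<Rightarrow> (c x p)\<^sup>2))"
      by (simp add: l2_norm_sq)
    show "AE x in \<nu>. integrable M (\<lambda>y. case (x, y) of (x, p) \<Rightarrow> (c x p)\<^sup>2)"
      using sq by (auto simp: square_integrable_def)
  qed measurable
  then show ?thesis using c sq by (simp add: L2_profile_def)
qed

text \<open>Minkowski's integral inequality, by duality: the norm of the average \<open>z\<close> is tested against
  \<open>z\<close> itself.\<close>

lemma weighted_average:
  assumes c: "L2_profile \<nu> M c" and w[measurable]: "w \<in> borel_measurable \<nu>"
    and w1: "\<And>y. y \<in> space \<nu> \<Longrightarrow> \<bar>w y\<bar> \<le> 1"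
  defines "z \<equiv> \<lambda>p. LINT y|\<nu>. w y * c y p"
  shows "square_integrable M z" "l2_norm M z \<le> (LINT y|\<nu>. \<bar>w y\<bar> * l2_norm M (c y))"
proof -
  have cm[measurable]: "case_prod c \<in> borel_measurable (\<nu> \<Otimes>\<^sub>M M)" using c by (simp add: L2_profile_def)
  have i: "integrable (\<nu> \<Otimes>\<^sub>M M) (\<lambda>(x, p). (c x p)\<^sup>2)" using c by (simp add: L2_profile_def)
  have wc: "(w y * c y p)\<^sup>2 \<le> (c y p)\<^sup>2" if "y \<in> space \<nu>" for y p
    using mult_right_mono[OF power_mono[OF w1[OF that], of 2], of "(c y p)\<^sup>2"]
    by (simp add: power_mult_distrib)
  have iw: "integrable (\<nu> \<Otimes>\<^sub>M M) (\<lambda>(y, p). (w y * c y p)\<^sup>2)"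
    by (rule Bochner_Integration.integrable_bound[OF i])
      (auto intro!: AE_I2 wc simp: space_pair_measure)
  have sw: "square_integrable (\<nu> \<Otimes>\<^sub>M M) (\<lambda>(y, p). w y * c y p)"
    using iw by (simp add: square_integrable_def case_prod_beta')
  have zm[measurable]: "z \<in> borel_measurable M" unfolding z_def by measurable
  have zle: "AE p in M. (z p)\<^sup>2 \<le> (LINT y|\<nu>. (w y * c y p)\<^sup>2)"
    using AE_integrable_snd[OF iw] AE_space
  proof eventually_elim
    case (elim p)
    have "(\<lambda>y. w y * c y p) \<in> borel_measurable \<nu>" using elim by measurable
    then have sq: "square_integrable \<nu> (\<lambda>y. w y * c y p)"
      using elim by (simp add: square_integrable_def)
    have "\<bar>z p\<bar> \<le> l2_norm \<nu> (\<lambda>y. w y * c y p)"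
      unfolding z_def
      by (rule order_trans[OF integral_abs_bound integral_abs_le_l2_norm(2)[OF I.prob_space_axioms sq]])
    then have "\<bar>z p\<bar>\<^sup>2 \<le> (l2_norm \<nu> (\<lambda>y. w y * c y p))\<^sup>2" by (intro power_mono) auto
    then show ?case by (simp add: l2_norm_sq)
  qed
  have "integrable M (\<lambda>p. (z p)\<^sup>2)"
    by (rule Bochner_Integration.integrable_bound[OF integrable_snd[OF iw]]) (use zle in auto)
  then show z: "square_integrable M z" by (simp add: square_integrable_def)
  have "case_prod (\<lambda>y. z) \<in> borel_measurable (\<nu> \<Otimes>\<^sub>M M)" by measurable
  then have zz: "square_integrable (\<nu> \<Otimes>\<^sub>M M) (\<lambda>(y, p). z p)"
    using L2_profile_square_integrable[OF L2_profile_bounded[of "\<lambda>y. z" "l2_norm M z"]] z by simp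
  have int: "integrable (\<nu> \<Otimes>\<^sub>M M) (\<lambda>(y, p). z p * (w y * c y p))"
    using integrable_mult_square[OF zz sw] by (simp add: case_prod_beta')
  have "(l2_norm M z)\<^sup>2 = (LINT p|M. z p * z p)"
    unfolding l2_norm_sq by (simp only: power2_eq_square)
  also have "\<dots> = (LINT p|M. LINT y|\<nu>. z p * (w y * c y p))"
    unfolding integral_mult_right_zero by (simp only: z_def)
  also have "\<dots> = (LINT y|\<nu>. LINT p|M. z p * (w y * c y p))"
    by (rule Fubini_integral[OF int])
  also have "\<dots> = (LINT y|\<nu>. w y * (LINT p|M. z p * c y p))"
    by (intro Bochner_Integration.integral_cong refl) (simp add: mult.left_commute)
  also have "\<dots> \<le> (LINT y|\<nu>. l2_norm M z * (\<bar>w y\<bar> * l2_norm M (c y)))"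
  proof (rule integral_mono_AE)
    show "integrable \<nu> (\<lambda>y. w y * (LINT p|M. z p * c y p))"
      using integrable_fst[OF int] by (simp add: mult.left_commute)
    show "integrable \<nu> (\<lambda>y. l2_norm M z * (\<bar>w y\<bar> * l2_norm M (c y)))"
      by (intro integrable_mult_right Bochner_Integration.integrable_bound[OF L2_profile_mean_norm(1)[OF c]])
        (auto intro!: AE_I2 mult_left_le_one_le w1 l2_norm_section_measurable borel_measurable_times simp: abs_mult)
    show "AE y in \<nu>. w y * (LINT p|M. z p * c y p) \<le> l2_norm M z * (\<bar>w y\<bar> * l2_norm M (c y))"
    proof (rule AE_I2)
      fix y assume "y \<in> space \<nu>"
      then have "\<bar>LINT p|M. z p * c y p\<bar> \<le> l2_norm M z * l2_norm M (c y)"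
        using c by (intro l2_Cauchy_Schwarz z) (simp add: L2_profile_def)
      then have "\<bar>w y\<bar> * \<bar>LINT p|M. z p * c y p\<bar> \<le> \<bar>w y\<bar> * (l2_norm M z * l2_norm M (c y))"
        by (rule mult_left_mono) simp
      then show "w y * (LINT p|M. z p * c y p) \<le> l2_norm M z * (\<bar>w y\<bar> * l2_norm M (c y))"
        using abs_ge_self[of "w y * (LINT p|M. z p * c y p)"] unfolding abs_mult
        by (simp only: mult.left_commute[of "l2_norm M z"])
    qed
  qed
  finally have "l2_norm M z * l2_norm M z \<le> l2_norm M z * (LINT y|\<nu>. \<bar>w y\<bar> * l2_norm M (c y))"
    by (simp add: power2_eq_square)
  moreover have "0 \<le> (LINT y|\<nu>. \<bar>w y\<bar> * l2_norm M (c y))" by simp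
  ultimately show "l2_norm M z \<le> (LINT y|\<nu>. \<bar>w y\<bar> * l2_norm M (c y))"
    using l2_norm_nonneg[of M z] by (metis less_eq_real_def mult_le_cancel_left_pos)
qed

section \<open>Separability of the range of a measurable family\<close>

lemma separable_profile_lincomb:
  assumes f: "separable_profile \<nu> M f" and fs: "\<And>x. x \<in> space \<nu> \<Longrightarrow> square_integrable M (f x)"
    and g: "separable_profile \<nu> M g" and gs: "\<And>x. x \<in> space \<nu> \<Longrightarrow> square_integrable M (g x)"
  shows "separable_profile \<nu> M (\<lambda>x p. a * f x p + b * g x p)"
proof -
  obtain C where C: "countable C" "\<forall>c\<in>C. square_integrable M c"
    "\<forall>x\<in>space \<nu>. \<forall>\<epsilon>>0. \<exists>c\<in>C. l2_norm M (f x - c) < \<epsilon>"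
    using f unfolding separable_profile_def by auto
  obtain C' where C': "countable C'" "\<forall>c\<in>C'. square_integrable M c"
    "\<forall>x\<in>space \<nu>. \<forall>\<epsilon>>0. \<exists>c\<in>C'. l2_norm M (g x - c) < \<epsilon>"
    using g unfolding separable_profile_def by auto
  let ?C = "(\<lambda>(c, c') p. a * c p + b * c' p) ` (C \<times> C')"
  have "\<exists>d\<in>?C. l2_norm M ((\<lambda>p. a * f x p + b * g x p) - d) < \<epsilon>"
    if x: "x \<in> space \<nu>" and e: "\<epsilon> > 0" for x \<epsilon>
  proof -
    define \<delta> where "\<delta> = \<epsilon> / (\<bar>a\<bar> + \<bar>b\<bar> + 1)"
    have \<delta>: "\<delta> > 0" using e by (simp add: \<delta>_def)
    obtain c c' where c: "c \<in> C" "l2_norm M (f x - c) < \<delta>" and c': "c' \<in> C'" "l2_norm M (g x - c') < \<delta>"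
      using C(3) C'(3) x \<delta> by meson
    have s: "square_integrable M (f x - c)" "square_integrable M (g x - c')"
      using c c' C C' fs[OF x] gs[OF x] by (auto intro: square_integrable_diff)
    have eq: "(\<lambda>p. a * f x p + b * g x p) - (\<lambda>p. a * c p + b * c' p)
        = (\<lambda>p. a * (f x - c) p) + (\<lambda>p. b * (g x - c') p)"
      by (auto simp: fun_eq_iff algebra_simps)
    have "l2_norm M ((\<lambda>p. a * f x p + b * g x p) - (\<lambda>p. a * c p + b * c' p))
        \<le> \<bar>a\<bar> * l2_norm M (f x - c) + \<bar>b\<bar> * l2_norm M (g x - c')"
      unfolding eq using l2_norm_triangle[OF square_integrable_cmult[OF s(1)] square_integrable_cmult[OF s(2)], of a b]
      by (simp only: l2_norm_cmult)
    also have "\<dots> \<le> \<bar>a\<bar> * \<delta> + \<bar>b\<bar> * \<delta>"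
      using c c' by (intro add_mono mult_left_mono) auto
    also have "\<dots> < (\<bar>a\<bar> + \<bar>b\<bar> + 1) * \<delta>" using \<delta> by (simp add: algebra_simps)
    also have "\<dots> = \<epsilon>"
    proof -
      have "\<bar>a\<bar> + \<bar>b\<bar> + 1 \<noteq> 0" using abs_ge_zero[of a] abs_ge_zero[of b] by linarith
      then show ?thesis by (simp add: \<delta>_def)
    qed
    finally show ?thesis using c c' by auto
  qed
  moreover have "countable ?C" using C C' by auto
  moreover have "\<forall>d\<in>?C. square_integrable M d" using C C' by (auto intro: square_integrable_lincomb)
  ultimately show ?thesis unfolding separable_profile_def by blast
qed

lemma separable_profile_limit:
  assumes f: "\<And>n::nat. separable_profile \<nu> M (f n)"
    and fs: "\<And>n x. x \<in> space \<nu> \<Longrightarrow> square_integrable M (f n x)"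
    and gs: "\<And>x. x \<in> space \<nu> \<Longrightarrow> square_integrable M (g x)"
    and lim: "\<And>x. x \<in> space \<nu> \<Longrightarrow> (\<lambda>n. l2_norm M (g x - f n x)) \<longlonglongrightarrow> 0"
  shows "separable_profile \<nu> M g"
proof -
  obtain C where C: "\<And>n. countable (C n)" "\<And>n. \<forall>c\<in>C n. square_integrable M c"
    "\<And>n. \<forall>x\<in>space \<nu>. \<forall>\<epsilon>>0. \<exists>c\<in>C n. l2_norm M (f n x - c) < \<epsilon>"
    using f unfolding separable_profile_def by metis
  have "\<exists>c\<in>(\<Union>n. C n). l2_norm M (g x - c) < \<epsilon>" if x: "x \<in> space \<nu>" and e: "\<epsilon> > 0" for x \<epsilon>
  proof -
    have "\<forall>\<^sub>F n in sequentially. l2_norm M (g x - f n x) < \<epsilon> / 2"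
      using lim[OF x] e by (intro order_tendstoD(2)) auto
    then obtain n where n: "l2_norm M (g x - f n x) < \<epsilon> / 2" by (auto simp: eventually_sequentially)
    obtain c where c: "c \<in> C n" "l2_norm M (f n x - c) < \<epsilon> / 2" using C(3) x e half_gt_zero by blast
    have "l2_norm M (g x - c) \<le> l2_norm M (g x - f n x) + l2_norm M (f n x - c)"
      using C(2) c fs[OF x] gs[OF x] by (intro l2_norm_diff_triangle) auto
    then show ?thesis using n c by (intro bexI[of _ c]) auto
  qed
  moreover have "countable (\<Union>n. C n)" using C by auto
  ultimately show ?thesis unfolding separable_profile_def using C(2) by blast
qed

lemma indicator_section_square_integrable:
  assumes "X \<in> sets (\<nu> \<Otimes>\<^sub>M M)" "x \<in> space \<nu>"
  shows "square_integrable M (\<lambda>p. indicator X (x, p))"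
  using assms D.finite_measure_axioms
  by (intro square_integrable_bounded[where B=1] section_measurable[of "\<lambda>x p. indicator X (x, p)"])
    (auto simp: indicator_def)

text \<open>Dynkin's argument over measurable rectangles, whose sections take only two values.
  Complements are differences with the whole space, and a disjoint countable union is the limit of
  its finite partial unions in the norm of every section.\<close>

lemma separable_profile_indicator:
  assumes "X \<in> sets (\<nu> \<Otimes>\<^sub>M M)"
  shows "separable_profile \<nu> M (\<lambda>x p. indicator X (x, p))"
proof -
  let ?S = "\<lambda>X. separable_profile \<nu> M (\<lambda>x p. indicator X (x, p))"
  have "X \<in> sigma_sets (space \<nu> \<times> space M) {a \<times> b |a b. a \<in> sets \<nu> \<and> b \<in> sets M}"
    using assms by (simp add: sets_pair_measure)
  with Int_stable_pair_measure_generator pair_measure_closed show ?thesis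
  proof (induction rule: sigma_sets_induct_disjoint)
    case (basic A)
    then obtain a b where ab: "A = a \<times> b" "a \<in> sets \<nu>" "b \<in> sets M" by auto
    show ?case unfolding separable_profile_def
    proof (intro exI[of _ "{indicator b, \<lambda>p. 0}"] conjI ballI allI impI)
      fix c assume "c \<in> {indicator b, \<lambda>p. 0::real}"
      then show "square_integrable M c" using ab D.finite_measure_axioms
        by (intro square_integrable_bounded[where B=1]) (auto simp: indicator_def)
    next
      fix x and \<epsilon> :: real assume "\<epsilon> > 0"
      have "(\<lambda>p. indicator A (x, p)) = (if x \<in> a then indicator b else (\<lambda>p. 0::real))"
        by (auto simp: ab indicator_def fun_eq_iff)
      then show "\<exists>c\<in>{indicator b, \<lambda>p. 0}. l2_norm M ((\<lambda>p. indicator A (x, p)) - c) < \<epsilon>"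
        using \<open>\<epsilon> > 0\<close> by (cases "x \<in> a") auto
    qed auto
  next
    case empty
    show ?case unfolding separable_profile_def
      by (intro exI[of _ "{\<lambda>p. 0}"]) (auto simp: square_integrable_zero fun_diff_def)
  next
    case (compl A)
    then have A: "A \<in> sets (\<nu> \<Otimes>\<^sub>M M)" by (simp add: sets_pair_measure)
    have one: "separable_profile \<nu> M (\<lambda>x p. indicator (space M) p)"
      unfolding separable_profile_def
      by (intro exI[of _ "{indicator (space M)}"])
        (auto intro!: square_integrable_bounded[where B=1] D.finite_measure_axioms simp: fun_diff_def)
    have sq1: "square_integrable M (\<lambda>p. indicator (space M) p)"
      by (auto intro!: square_integrable_bounded[where B=1] D.finite_measure_axioms)
    have "separable_profile \<nu> M (\<lambda>x p. 1 * indicator (space M) p + (-1) * indicator A (x, p))"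
      using compl A
      by (intro separable_profile_lincomb one sq1) (auto intro: indicator_section_square_integrable)
    moreover have "(1 * indicator (space M) p + (-1) * indicator A (x, p) :: real)
        = indicator (space \<nu> \<times> space M - A) (x, p)" if "x \<in> space \<nu>" for x p
      using that sets.sets_into_space[OF A] by (auto simp: indicator_def space_pair_measure)
    ultimately show ?case unfolding separable_profile_def by (simp add: fun_diff_def cong: ball_cong)
  next
    case (union A)
    have A: "A i \<in> sets (\<nu> \<Otimes>\<^sub>M M)" for i using union(2) by (auto simp: sets_pair_measure)
    let ?f = "\<lambda>n x p. indicator (\<Union>i<n. A i) (x, p) :: real"
    have fin: "(\<Union>i<n. A i) \<in> sets (\<nu> \<Otimes>\<^sub>M M)" for n using A by auto
    have UN: "(\<Union>i. A i) \<in> sets (\<nu> \<Otimes>\<^sub>M M)" using A by auto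
    have "separable_profile \<nu> M (?f n)" for n
    proof (induction n)
      case 0
      show ?case unfolding separable_profile_def
        by (intro exI[of _ "{\<lambda>p. 0}"]) (auto simp: square_integrable_zero fun_diff_def)
    next
      case (Suc n)
      have "separable_profile \<nu> M (\<lambda>x p. 1 * ?f n x p + 1 * indicator (A n) (x, p))"
        using Suc union fin A
        by (intro separable_profile_lincomb indicator_section_square_integrable) auto
      moreover have "1 * ?f n x p + 1 * indicator (A n) (x, p) = ?f (Suc n) x p" for x p
      proof -
        have "(\<Union>i<n. A i) \<inter> A n = {}" using union(1) by (auto simp: disjoint_family_on_def)
          (metis disjoint_iff nat_less_le)
        then show ?thesis by (auto simp: indicator_def lessThan_Suc)
      qed
      ultimately show ?case by simp
    qed
    then show ?case
    proof (rule separable_profile_limit)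
      fix x assume x: "x \<in> space \<nu>"
      show "square_integrable M (?f n x)" for n
        using fin x by (rule indicator_section_square_integrable)
      show "square_integrable M (\<lambda>p. indicator (\<Union>i. A i) (x, p))"
        using A x by (intro indicator_section_square_integrable) auto
      have "(\<lambda>n. LINT p|M. (indicator (\<Union>i. A i) (x, p) - ?f n x p)\<^sup>2) \<longlonglongrightarrow> (LINT p|M. 0)"
      proof (rule integral_dominated_convergence[where w="\<lambda>p. 1"])
        show "(\<lambda>p. (indicator (\<Union>i. A i) (x, p) - ?f n x p)\<^sup>2) \<in> borel_measurable M" for n
          using indicator_section_square_integrable[OF UN x, THEN square_integrable_measurable]
            indicator_section_square_integrable[OF fin x, THEN square_integrable_measurable]
          by measurable
        show "AE p in M. (\<lambda>n. (indicator (\<Union>i. A i) (x, p) - ?f n x p)\<^sup>2) \<longlonglongrightarrow> 0"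
        proof (rule AE_I2)
          fix p
          have "(\<lambda>n. ?f n x p) \<longlonglongrightarrow> indicator (\<Union>i. A i) (x, p)"
            by (rule LIMSEQ_indicator_UN)
          then have "(\<lambda>n. (indicator (\<Union>i. A i) (x, p) - ?f n x p)\<^sup>2)
              \<longlonglongrightarrow> (indicator (\<Union>i. A i) (x, p) - indicator (\<Union>i. A i) (x, p))\<^sup>2"
            by (intro tendsto_intros)
          then show "(\<lambda>n. (indicator (\<Union>i. A i) (x, p) - ?f n x p)\<^sup>2) \<longlonglongrightarrow> 0" by simp
        qed
      qed (auto simp: indicator_def)
      from tendsto_real_sqrt[OF this]
      show "(\<lambda>n. l2_norm M ((\<lambda>p. indicator (\<Union>i. A i) (x, p)) - ?f n x)) \<longlonglongrightarrow> 0"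
        by (simp add: l2_norm_def)
    qed
  qed
qed

text \<open>Simple functions are finite combinations of indicators. Approximants dominated by a
  multiple of the function converge in the norm of each section, and separability passes to such
  limits.\<close>

lemma separable_profile_measurable:
  assumes f: "case_prod f \<in> borel_measurable (\<nu> \<Otimes>\<^sub>M M)"
    and sq: "\<And>x. x \<in> space \<nu> \<Longrightarrow> square_integrable M (f x)"
  shows "separable_profile \<nu> M f"
proof -
  let ?P = "\<nu> \<Otimes>\<^sub>M M"
  from borel_measurable_implies_sequence_metric[OF f, of 0] obtain s where
    s: "\<And>i. simple_function ?P (s i)" "\<And>q. q \<in> space ?P \<Longrightarrow> (\<lambda>i. s i q) \<longlonglongrightarrow> case_prod f q"
      "\<And>i q. q \<in> space ?P \<Longrightarrow> dist (s i q) 0 \<le> 2 * dist (case_prod f q) 0"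
    by metis
  have sm: "s i \<in> borel_measurable ?P" for i using s(1) by (rule borel_measurable_simple_function)
  have sfin: "finite (s i ` space ?P)" for i using s(1) by (auto simp: simple_function_def)
  let ?g = "\<lambda>i Y x p. \<Sum>y\<in>Y. y * indicator (s i -` {y} \<inter> space ?P) (x, p) :: real"
  have sets: "s i -` {y} \<inter> space ?P \<in> sets ?P" for i y using sm[of i] by measurable
  have gsq: "square_integrable M (?g i Y x)" if "x \<in> space \<nu>" for i Y x
    using that sets by (intro square_integrable_sum indicator_section_square_integrable) auto
  have gsep: "separable_profile \<nu> M (?g i Y)" if "finite Y" for i Y
    using that
  proof induction
    case empty
    show ?case unfolding separable_profile_def
      by (intro exI[of _ "{\<lambda>p. 0}"]) (auto simp: square_integrable_zero fun_diff_def)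
  next
    case (insert y Y)
    have "separable_profile \<nu> M (\<lambda>x p. y * indicator (s i -` {y} \<inter> space ?P) (x, p) + 1 * ?g i Y x p)"
      using separable_profile_indicator[OF sets] indicator_section_square_integrable[OF sets]
        insert.IH gsq
      by (rule separable_profile_lincomb[where a=y and b=1 and g="?g i Y"
            and f="\<lambda>x p. indicator (s i -` {y} \<inter> space ?P) (x, p)"])
    then show ?case unfolding sum.insert[OF insert.hyps] by (simp only: mult_1)
  qed
  define g where "g i = ?g i (s i ` space ?P)" for i
  have seq: "s i (x, p) = g i x p" if "x \<in> space \<nu>" "p \<in> space M" for i x p
  proof -
    have q: "(x, p) \<in> space ?P" using that by (simp add: space_pair_measure)
    show ?thesis unfolding g_def
      by (subst simple_function_indicator_representation_banach[OF s(1)[of i] q],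
          rule sum.cong[OF refl], simp only: real_scaleR_def mult.commute)
  qed
  show ?thesis
  proof (rule separable_profile_limit[where f=g])
    show "separable_profile \<nu> M (g i)" for i unfolding g_def by (rule gsep[OF sfin])
    fix x assume x: "x \<in> space \<nu>"
    show gs: "square_integrable M (g i x)" for i unfolding g_def by (rule gsq[OF x])
    show "square_integrable M (f x)" by (rule sq[OF x])
    have fm: "f x \<in> borel_measurable M" using sq[OF x] by (rule square_integrable_measurable)
    have "(\<lambda>i. LINT p|M. (f x p - g i x p)\<^sup>2) \<longlonglongrightarrow> (LINT p|M. 0)"
    proof (rule integral_dominated_convergence[where w="\<lambda>p. 9 * (f x p)\<^sup>2"])
      show "(\<lambda>p. (f x p - g i x p)\<^sup>2) \<in> borel_measurable M" for i
        by (intro borel_measurable_power borel_measurable_diff fm square_integrable_measurable[OF gs])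
      show "integrable M (\<lambda>p. 9 * (f x p)\<^sup>2)" using sq[OF x] by (simp add: square_integrable_def)
      show "AE p in M. (\<lambda>i. (f x p - g i x p)\<^sup>2) \<longlonglongrightarrow> 0"
      proof (rule AE_I2)
        fix p assume p: "p \<in> space M"
        have "(\<lambda>i. (f x p - s i (x, p))\<^sup>2) \<longlonglongrightarrow> (f x p - f x p)\<^sup>2"
          using s(2)[of "(x, p)"] x p by (intro tendsto_intros) (auto simp: space_pair_measure)
        then show "(\<lambda>i. (f x p - g i x p)\<^sup>2) \<longlonglongrightarrow> 0"
          unfolding seq[OF x p] by simp
      qed
      \<comment> \<open>The approximants satisfy
        \<open>\<bar>s i\<bar> \<le> 2 * \<bar>f\<bar>\<close>, so the error is at most
        \<open>3 * \<bar>f\<bar>\<close>; squaring gives the factor 9.\<close>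
      show "AE p in M. norm ((f x p - g i x p)\<^sup>2) \<le> 9 * (f x p)\<^sup>2" for i
      proof (rule AE_I2)
        fix p assume p: "p \<in> space M"
        have "\<bar>s i (x, p)\<bar> \<le> 2 * \<bar>f x p\<bar>"
          using s(3)[of "(x, p)" i] x p by (auto simp: space_pair_measure)
        then have "\<bar>f x p - s i (x, p)\<bar> \<le> 3 * \<bar>f x p\<bar>" by linarith
        then have "\<bar>f x p - s i (x, p)\<bar>\<^sup>2 \<le> (3 * \<bar>f x p\<bar>)\<^sup>2" by (rule power_mono) simp
        then show "norm ((f x p - g i x p)\<^sup>2) \<le> 9 * (f x p)\<^sup>2"
          unfolding seq[OF x p] by (simp add: power_mult_distrib)
      qed
    qed auto
    from tendsto_real_sqrt[OF this]
    show "(\<lambda>i. l2_norm M (f x - g i x)) \<longlonglongrightarrow> 0" by (simp add: l2_norm_def)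
  qed
qed

end

section \<open>Countably valued approximation of measurable families\<close>

context index_product
begin

text \<open>The countable sets supplied by separability do not consist of sections, so for every
  pair of their elements and every precision one index with sections nearby is picked, if there is
  one. Treating two families at once yields indices that serve both.\<close>

lemma dense_index_points:
  assumes f: "case_prod f \<in> borel_measurable (\<nu> \<Otimes>\<^sub>M M)" and fs: "\<And>x. x \<in> space \<nu> \<Longrightarrow> square_integrable M (f x)"
    and g: "case_prod g \<in> borel_measurable (\<nu> \<Otimes>\<^sub>M M)" and gs: "\<And>x. x \<in> space \<nu> \<Longrightarrow> square_integrable M (g x)"
  shows "\<exists>d :: nat \<Rightarrow> 'i. (\<forall>n. d n \<in> space \<nu>) \<and>
    (\<forall>x\<in>space \<nu>. \<forall>\<epsilon>>0. \<exists>n. l2_norm M (f x - f (d n)) + l2_norm M (g x - g (d n)) < \<epsilon>)"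
proof -
  obtain C where C: "countable C" "\<forall>c\<in>C. square_integrable M c"
    "\<forall>x\<in>space \<nu>. \<forall>\<epsilon>>0. \<exists>c\<in>C. l2_norm M (f x - c) < \<epsilon>"
    using separable_profile_measurable[OF f fs] unfolding separable_profile_def by auto
  obtain C' where C': "countable C'" "\<forall>c\<in>C'. square_integrable M c"
    "\<forall>x\<in>space \<nu>. \<forall>\<epsilon>>0. \<exists>c\<in>C'. l2_norm M (g x - c) < \<epsilon>"
    using separable_profile_measurable[OF g gs] unfolding separable_profile_def by auto
  obtain x0 where x0: "x0 \<in> space \<nu>" using I.not_empty by auto
  define Q where "Q c c' m x \<longleftrightarrow> x \<in> space \<nu> \<and> l2_norm M (f x - c) < inverse (real (Suc m)) \<and>
    l2_norm M (g x - c') < inverse (real (Suc m))" for c c' m x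
  define pick where "pick c c' m = (if \<exists>x. Q c c' m x then SOME x. Q c c' m x else x0)" for c c' m
  have pick: "Q c c' m (pick c c' m)" if "Q c c' m x" for c c' m x
    using that someI[of "Q c c' m" x] by (auto simp: pick_def)
  have pick_space: "pick c c' m \<in> space \<nu>" for c c' m
    using x0 someI_ex[of "Q c c' m"] by (auto simp: pick_def Q_def[of c c' m "SOME x. Q c c' m x"])
  define D where "D = insert x0 ((\<lambda>(c, c', m). pick c c' m) ` (C \<times> C' \<times> UNIV))"
  have D: "countable D" "D \<noteq> {}" "D \<subseteq> space \<nu>"
    using C C' x0 pick_space by (auto simp: D_def)
  show ?thesis
  proof (intro exI[of _ "from_nat_into D"] conjI allI ballI impI)
    show "from_nat_into D n \<in> space \<nu>" for n using D from_nat_into[of D] by auto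
    fix x and \<epsilon> :: real assume x: "x \<in> space \<nu>" and "\<epsilon> > 0"
    \<comment> \<open>Four distances enter below: one from \<open>x\<close> and one from the picked
      index, for each of the two families.\<close>
    then obtain m where m: "inverse (real (Suc m)) < \<epsilon> / 4" using reals_Archimedean[of "\<epsilon> / 4"] by auto
    define h where "h = inverse (real (Suc m))"
    have "h > 0" by (simp add: h_def)
    obtain c c' where c: "c \<in> C" "l2_norm M (f x - c) < h" and c': "c' \<in> C'" "l2_norm M (g x - c') < h"
      using C(3) C'(3) x \<open>h > 0\<close> by meson
    define e where "e = pick c c' m"
    have "Q c c' m x" using c c' x by (simp add: Q_def h_def)
    then have e: "e \<in> space \<nu>" "l2_norm M (f e - c) < h" "l2_norm M (g e - c') < h"
      using pick[of c c' m x] by (simp_all add: Q_def e_def h_def)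
    have "l2_norm M (f x - f e) \<le> l2_norm M (f x - c) + l2_norm M (c - f e)"
      using c C fs x e by (intro l2_norm_diff_triangle) auto
    moreover have "l2_norm M (g x - g e) \<le> l2_norm M (g x - c') + l2_norm M (c' - g e)"
      using c' C' gs x e by (intro l2_norm_diff_triangle) auto
    ultimately have "l2_norm M (f x - f e) + l2_norm M (g x - g e) < \<epsilon>"
      using c c' e m l2_norm_minus_commute[of M c "f e"] l2_norm_minus_commute[of M c' "g e"]
      by (simp add: h_def)
    moreover have "e \<in> D" unfolding D_def e_def using c c'
      by (intro insertI2 image_eqI[of _ _ "(c, c', m)"]) auto
    then obtain n where "from_nat_into D n = e" using D(1) from_nat_into_surj by metis
    ultimately show "\<exists>n. l2_norm M (f x - f (from_nat_into D n)) + l2_norm M (g x - g (from_nat_into D n)) < \<epsilon>"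
      by auto
  qed
qed

text \<open>The measurable choice \<open>\<kappa> m\<close> of a nearby index has values in a
  countable set. Substituting \<open>d (\<kappa> m x)\<close> for the index therefore turns any
  family of measurable functions into a jointly measurable one, however that family depends on its
  index.\<close>

lemma countable_index_approximation:
  assumes f: "case_prod f \<in> borel_measurable (\<nu> \<Otimes>\<^sub>M M)" and fs: "\<And>x. x \<in> space \<nu> \<Longrightarrow> square_integrable M (f x)"
    and g: "case_prod g \<in> borel_measurable (\<nu> \<Otimes>\<^sub>M M)" and gs: "\<And>x. x \<in> space \<nu> \<Longrightarrow> square_integrable M (g x)"
  obtains d :: "nat \<Rightarrow> 'i" and \<kappa> :: "nat \<Rightarrow> 'i \<Rightarrow> nat"
  where "\<And>n. d n \<in> space \<nu>" "\<And>m. \<kappa> m \<in> \<nu> \<rightarrow>\<^sub>M count_space UNIV"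
    "\<And>m x. x \<in> space \<nu> \<Longrightarrow>
      l2_norm M (f x - f (d (\<kappa> m x))) + l2_norm M (g x - g (d (\<kappa> m x))) < (1 / 2) ^ m"
proof -
  obtain d :: "nat \<Rightarrow> 'i" where d: "\<And>n. d n \<in> space \<nu>"
    "\<And>x \<epsilon>. x \<in> space \<nu> \<Longrightarrow> \<epsilon> > 0 \<Longrightarrow> \<exists>n. l2_norm M (f x - f (d n)) + l2_norm M (g x - g (d n)) < \<epsilon>"
    using dense_index_points[OF assms] by blast
  define P where "P m n x \<longleftrightarrow> l2_norm M (f x - f (d n)) + l2_norm M (g x - g (d n)) < (1 / 2) ^ m" for m n x
  have [measurable]: "case_prod f \<in> borel_measurable (\<nu> \<Otimes>\<^sub>M M)" "case_prod g \<in> borel_measurable (\<nu> \<Otimes>\<^sub>M M)"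
    by fact+
  have [measurable]: "f (d n) \<in> borel_measurable M" "g (d n) \<in> borel_measurable M" for n
    using d(1) fs gs square_integrable_measurable by blast+
  have [measurable]: "(\<lambda>x. l2_norm M (f x - f (d n))) \<in> borel_measurable \<nu>"
      "(\<lambda>x. l2_norm M (g x - g (d n))) \<in> borel_measurable \<nu>" for n
    by (intro l2_norm_section_measurable; simp add: fun_diff_def; measurable)+
  have [measurable]: "Measurable.pred \<nu> (P m n)" for m n unfolding P_def by measurable
  show ?thesis
  proof (rule that[of d "\<lambda>m x. LEAST n. P m n x"])
    show "(\<lambda>x. LEAST n. P m n x) \<in> \<nu> \<rightarrow>\<^sub>M count_space UNIV" for m by measurable
    fix m x assume x: "x \<in> space \<nu>"
    then have "\<exists>n. P m n x" using d(2)[of x "(1 / 2) ^ m"] by (auto simp: P_def)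
    then have "P m (LEAST n. P m n x) x" by (rule LeastI_ex)
    then show "l2_norm M (f x - f (d (LEAST n. P m n x))) + l2_norm M (g x - g (d (LEAST n. P m n x))) < (1 / 2) ^ m"
      by (simp add: P_def)
  qed (rule d)
qed

text \<open>Applied to welfare integrands: the utility is only known to be Lipschitz, and a
  Lipschitz function of two measurable families is a pointwise limit of countably valued measurable
  functions.\<close>

lemma Lipschitz_functional_measurable:
  fixes \<phi> :: "'i \<Rightarrow> real"
  assumes f: "case_prod f \<in> borel_measurable (\<nu> \<Otimes>\<^sub>M M)" "\<And>x. x \<in> space \<nu> \<Longrightarrow> square_integrable M (f x)"
    and g: "case_prod g \<in> borel_measurable (\<nu> \<Otimes>\<^sub>M M)" "\<And>x. x \<in> space \<nu> \<Longrightarrow> square_integrable M (g x)"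
    and lip: "\<And>x y. x \<in> space \<nu> \<Longrightarrow> y \<in> space \<nu> \<Longrightarrow>
      \<bar>\<phi> x - \<phi> y\<bar> \<le> c * (l2_norm M (f x - f y) + l2_norm M (g x - g y))" and c: "0 \<le> c"
  shows "\<phi> \<in> borel_measurable \<nu>"
proof -
  obtain d :: "nat \<Rightarrow> 'i" and \<kappa> where d: "\<And>n. d n \<in> space \<nu>" and \<kappa>: "\<And>m. \<kappa> m \<in> \<nu> \<rightarrow>\<^sub>M count_space UNIV"
    and app: "\<And>m x. x \<in> space \<nu> \<Longrightarrow>
      l2_norm M (f x - f (d (\<kappa> m x))) + l2_norm M (g x - g (d (\<kappa> m x))) < (1 / 2) ^ m"
    using countable_index_approximation[OF f g] by blast
  show ?thesis
  proof (rule borel_measurable_LIMSEQ_real)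
    show "(\<lambda>x. \<phi> (d (\<kappa> m x))) \<in> borel_measurable \<nu>" for m
      by (rule measurable_compose[OF \<kappa>]) simp
    fix x assume x: "x \<in> space \<nu>"
    have "(\<lambda>m. \<phi> (d (\<kappa> m x)) - \<phi> x) \<longlonglongrightarrow> 0"
    proof (rule tendsto_rabs_zero_cancel,
        rule tendsto_sandwich[where f="\<lambda>_. 0" and h="\<lambda>m. c * (1 / 2) ^ m"])
      show "(\<lambda>m. c * (1 / 2) ^ m) \<longlonglongrightarrow> 0"
        by (intro tendsto_mult_right_zero LIMSEQ_power_zero) simp
      have "\<bar>\<phi> (d (\<kappa> m x)) - \<phi> x\<bar> \<le> c * (1 / 2) ^ m" for m
        using order_trans[OF lip[OF x d] mult_left_mono[OF less_imp_le[OF app[OF x]] c]]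
        by (simp add: abs_minus_commute)
      then show "\<forall>\<^sub>F m in sequentially. \<bar>\<phi> (d (\<kappa> m x)) - \<phi> x\<bar> \<le> c * (1 / 2) ^ m" by simp
    qed auto
    then show "(\<lambda>m. \<phi> (d (\<kappa> m x))) \<longlonglongrightarrow> \<phi> x" by (simp add: LIM_zero_iff)
  qed
qed

text \<open>The choice of \<open>r x\<close> within its equivalence class may depend on \<open>x\<close> in a non-measurable way;
  a jointly measurable version arises as the limit of the countably valued families
  \<open>x \<mapsto> r (d (\<kappa> m x))\<close>.\<close>

lemma Lipschitz_selection:
  fixes r :: "'i \<Rightarrow> 'a \<Rightarrow> real"
  assumes f: "case_prod f \<in> borel_measurable (\<nu> \<Otimes>\<^sub>M M)" "\<And>x. x \<in> space \<nu> \<Longrightarrow> square_integrable M (f x)"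
    and g: "case_prod g \<in> borel_measurable (\<nu> \<Otimes>\<^sub>M M)" "\<And>x. x \<in> space \<nu> \<Longrightarrow> square_integrable M (g x)"
    and r: "\<And>x. x \<in> space \<nu> \<Longrightarrow> square_integrable M (r x)"
    and lip: "\<And>x y. x \<in> space \<nu> \<Longrightarrow> y \<in> space \<nu> \<Longrightarrow>
      l2_norm M (r x - r y) \<le> c * (l2_norm M (f x - f y) + l2_norm M (g x - g y))" and c: "0 \<le> c"
  obtains r' where "case_prod r' \<in> borel_measurable (\<nu> \<Otimes>\<^sub>M M)"
    "\<And>x. x \<in> space \<nu> \<Longrightarrow> square_integrable M (r' x) \<and> l2_norm M (r x - r' x) = 0"
proof -
  obtain d :: "nat \<Rightarrow> 'i" and \<kappa> where d: "\<And>n. d n \<in> space \<nu>" and \<kappa>: "\<And>m. \<kappa> m \<in> \<nu> \<rightarrow>\<^sub>M count_space UNIV"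
    and app: "\<And>m x. x \<in> space \<nu> \<Longrightarrow>
      l2_norm M (f x - f (d (\<kappa> m x))) + l2_norm M (g x - g (d (\<kappa> m x))) < (1 / 2) ^ m"
    using countable_index_approximation[OF f g] by blast
  define s where "s m x = r (d (\<kappa> m x))" for m x
  define r' where "r' x p = lim (\<lambda>m. s m x p)" for x p
  have near: "l2_norm M (r x - s m x) \<le> c * (1 / 2) ^ m" if "x \<in> space \<nu>" for x m
    unfolding s_def using order_trans[OF lip[OF that d] mult_left_mono[OF less_imp_le[OF app[OF that]] c]] .
  have s: "square_integrable M (s m x)" for m x unfolding s_def using r d by blast
  have "l2_norm M (s m x - s (Suc m) x) \<le> (2 * c) * (1 / 2) ^ m" if x: "x \<in> space \<nu>" for x m
  proof -
    have "l2_norm M (s m x - s (Suc m) x) \<le> l2_norm M (s m x - r x) + l2_norm M (r x - s (Suc m) x)"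
      using s r x by (intro l2_norm_diff_triangle) auto
    also have "\<dots> \<le> c * (1 / 2) ^ m + c * (1 / 2) ^ Suc m"
      using near[OF x, of m] near[OF x, of "Suc m"] by (simp only: l2_norm_minus_commute[of M "s m x"])
    also have "\<dots> \<le> (2 * c) * (1 / 2) ^ m" using c by simp
    finally show ?thesis .
  qed
  then have lim: "square_integrable M (r' x)" "l2_norm M (s m x - r' x) \<le> 2 * c * (1 / 2) ^ m / (1 - 1 / 2)"
    if "x \<in> space \<nu>" for x m
    using that l2_geometric_limit[where f="\<lambda>m. s m x" and C="2 * c" and q="1 / 2",
        OF D.finite_measure_axioms s] unfolding r'_def[abs_def] by auto
  show ?thesis
  proof (rule that)
    have "(\<lambda>q. s m (fst q) (snd q)) \<in> borel_measurable (\<nu> \<Otimes>\<^sub>M M)" for m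
      unfolding s_def
    proof (rule measurable_compose_countable[where g="\<lambda>q. \<kappa> m (fst q)" and f="\<lambda>n q. r (d n) (snd q)"])
      show "(\<lambda>q. r (d n) (snd q)) \<in> borel_measurable (\<nu> \<Otimes>\<^sub>M M)" for n
        by (rule measurable_compose[OF measurable_snd square_integrable_measurable[OF r[OF d]]])
      show "(\<lambda>q. \<kappa> m (fst q)) \<in> \<nu> \<Otimes>\<^sub>M M \<rightarrow>\<^sub>M count_space UNIV"
        by (rule measurable_compose[OF measurable_fst \<kappa>])
    qed
    then show "case_prod r' \<in> borel_measurable (\<nu> \<Otimes>\<^sub>M M)"
      unfolding r'_def case_prod_beta' by (rule borel_measurable_lim_metric)
    fix x assume x: "x \<in> space \<nu>"
    have "l2_norm M (r x - r' x) \<le> (5 * c) * (1 / 2) ^ m" for m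
      using l2_norm_diff_triangle[OF r[OF x] s lim(1)[OF x], of m x] near[OF x, of m] lim(2)[OF x, of m]
      by simp
    moreover have "(\<lambda>m. (5 * c) * (1 / 2) ^ m) \<longlonglongrightarrow> 0"
      by (intro tendsto_mult_right_zero LIMSEQ_power_zero) simp
    ultimately have "l2_norm M (r x - r' x) \<le> 0" by (intro LIMSEQ_le_const[of _ 0]) auto
    then show "square_integrable M (r' x) \<and> l2_norm M (r x - r' x) = 0"
      using lim(1)[OF x] l2_norm_nonneg[of M "r x - r' x"] by simp
  qed
qed

end

lemma nonpos_if_le_geometric:
  fixes x c q :: real
  assumes "\<And>n::nat. x \<le> c * q ^ n" "0 \<le> q" "q < 1"
  shows "x \<le> 0"
proof (rule LIMSEQ_le_const)
  show "(\<lambda>n. c * q ^ n) \<longlonglongrightarrow> 0"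
    using assms by (intro tendsto_mult_right_zero LIMSEQ_power_zero) simp
  show "\<exists>N. \<forall>n\<ge>N. x \<le> c * q ^ n" using assms(1) by blast
qed

section \<open>The space of processes\<close>

lemma finite_measure_time_prod:
  assumes "prob_space P"
  shows "finite_measure (time_prod P T)"
  unfolding time_prod_def
proof (rule finite_measure_pair_measure)
  show "finite_measure P" using assms by (rule prob_space.finite_measure)
  show "finite_measure (restrict_space lborel {0..T})"
    by (rule finite_measureI) (simp add: emeasure_restrict_space space_restrict_space emeasure_lborel_Icc_eq)
qed

lemma proc_norm_eq: "proc_norm P T a = l2_norm (time_prod P T) a"
  by (simp add: proc_norm_def l2_norm_def)

lemma proc_space_square_integrable: "a \<in> proc_space P T F \<Longrightarrow> square_integrable (time_prod P T) a"
  by (simp add: proc_space_def square_integrable_def)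

lemma proc_space_iff:
  "a \<in> proc_space P T F \<longleftrightarrow> square_integrable (time_prod P T) a \<and>
     (\<exists>b. progressive F T b \<and> (AE p in time_prod P T. a p = b p))"
  by (auto simp: proc_space_def square_integrable_def)

lemma proc_space_zero: "(\<lambda>p. 0) \<in> proc_space P T F"
  by (auto simp: proc_space_iff square_integrable_zero progressive_def intro!: exI[of _ "\<lambda>p. 0"])

lemma proc_space_lincomb:
  assumes "a \<in> proc_space P T F" "b \<in> proc_space P T F"
  shows "(\<lambda>p. c * a p + d * b p) \<in> proc_space P T F"
proof -
  obtain a' where a': "progressive F T a'" "AE p in time_prod P T. a p = a' p"
    using assms(1) by (auto simp: proc_space_iff)
  obtain b' where b': "progressive F T b'" "AE p in time_prod P T. b p = b' p"
    using assms(2) by (auto simp: proc_space_iff)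
  have "progressive F T (\<lambda>p. c * a' p + d * b' p)"
    using a' b' by (auto simp: progressive_def intro!: borel_measurable_add borel_measurable_times)
  moreover have "AE p in time_prod P T. c * a p + d * b p = c * a' p + d * b' p"
    using a'(2) b'(2) by eventually_elim simp
  ultimately show ?thesis
    using assms by (auto simp: proc_space_iff intro: square_integrable_lincomb)
qed

lemma proc_space_add: "a \<in> proc_space P T F \<Longrightarrow> b \<in> proc_space P T F \<Longrightarrow> a + b \<in> proc_space P T F"
  using proc_space_lincomb[of a P T F b 1 1] by (simp add: plus_fun_def)

lemma proc_space_diff: "a \<in> proc_space P T F \<Longrightarrow> b \<in> proc_space P T F \<Longrightarrow> a - b \<in> proc_space P T F"
  using proc_space_lincomb[of a P T F b 1 "-1"] by (simp add: fun_diff_def)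

lemma proc_space_cmult: "a \<in> proc_space P T F \<Longrightarrow> (\<lambda>p. c * a p) \<in> proc_space P T F"
  using proc_space_lincomb[of a P T F a c 0] by simp

lemma proc_space_sum:
  "(\<And>i. i \<in> I \<Longrightarrow> a i \<in> proc_space P T F) \<Longrightarrow> (\<lambda>p. \<Sum>i\<in>I. c i * a i p) \<in> proc_space P T F"
proof (induction I rule: infinite_finite_induct)
  case (insert x I)
  then show ?case
    using proc_space_lincomb[of "a x" P T F "\<lambda>p. \<Sum>i\<in>I. c i * a i p" "c x" 1] by simp
qed (auto simp: proc_space_zero)

text \<open>A subsequence converges almost everywhere, and so do the progressive versions of its
  members, outside one common null set. Their pointwise \<open>lim\<close> is progressive, whatever
  its values on that null set.\<close>

lemma proc_space_closed:
  assumes P: "prob_space P" and a: "\<And>n::nat. a n \<in> proc_space P T F"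
    and g: "square_integrable (time_prod P T) g"
    and lim: "(\<lambda>n. l2_norm (time_prod P T) (a n - g)) \<longlonglongrightarrow> 0"
  shows "g \<in> proc_space P T F"
proof -
  let ?M = "time_prod P T"
  have sq: "square_integrable ?M (a n)" for n using a by (rule proc_space_square_integrable)
  have "\<exists>n. l2_norm ?M (a n - g) < (1 / 2) ^ k" for k :: nat
    using order_tendstoD(2)[OF lim, of "(1 / 2) ^ k"] by (auto simp: eventually_sequentially)
  then obtain n where n: "\<And>k. l2_norm ?M (a (n k) - g) < (1 / 2) ^ k" by metis
  have "l2_norm ?M (a (n k) - a (n (Suc k))) \<le> 2 * (1 / 2) ^ k" for k
  proof -
    have "l2_norm ?M (a (n k) - a (n (Suc k))) \<le> l2_norm ?M (a (n k) - g) + l2_norm ?M (g - a (n (Suc k)))"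
      using sq g by (intro l2_norm_diff_triangle)
    also have "\<dots> \<le> (1 / 2) ^ k + (1 / 2) ^ Suc k"
      using n[of k] n[of "Suc k"] l2_norm_minus_commute[of ?M g] by (intro add_mono) auto
    also have "\<dots> \<le> 2 * (1 / 2) ^ k" by simp
    finally show ?thesis .
  qed
  note L = l2_geometric_limit[where f="\<lambda>k. a (n k)" and C=2 and q="1 / 2",
      OF finite_measure_time_prod[OF P] sq this]
  define h where "h p = lim (\<lambda>k. a (n k) p)" for p
  have h: "square_integrable ?M h" "AE p in ?M. (\<lambda>k. a (n k) p) \<longlonglongrightarrow> h p"
    "l2_norm ?M (a (n k) - h) \<le> 4 * (1 / 2) ^ k" for k
    using L by (simp_all add: h_def[abs_def])
  have "l2_norm ?M (g - h) \<le> 5 * (1 / 2) ^ k" for k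
    using l2_norm_diff_triangle[OF g sq h(1), of "n k"] n[of k] h(3)[of k]
      l2_norm_minus_commute[of ?M g "a (n k)"] by simp
  then have "l2_norm ?M (g - h) \<le> 0" by (rule nonpos_if_le_geometric) simp_all
  then have "AE p in ?M. (g - h) p = 0"
    using l2_norm_eq_0_iff[OF square_integrable_diff[OF g h(1)]] by (simp add: antisym)
  then have gh: "AE p in ?M. g p = h p" by simp
  have "\<forall>k. \<exists>b. progressive F T b \<and> (AE p in ?M. a (n k) p = b p)"
    using a by (auto simp: proc_space_iff)
  then obtain b where b: "\<And>k. progressive F T (b k)" "\<And>k. AE p in ?M. a (n k) p = b k p" by metis
  have "AE p in ?M. \<forall>k. a (n k) p = b k p" using b(2) by (simp add: AE_all_countable)
  with h(2) gh have "AE p in ?M. g p = lim (\<lambda>k. b k p)"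
    by eventually_elim (simp add: limI)
  moreover have "progressive F T (\<lambda>p. lim (\<lambda>k. b k p))"
    using b(1) by (auto simp: progressive_def intro: borel_measurable_lim_metric)
  ultimately show ?thesis using g by (auto simp: proc_space_iff)
qed

section \<open>Best responses\<close>

text \<open>The constants of the gradient bound carry no sign condition; this allows them to be
  replaced by their positive parts, as the locale below requires.\<close>

lemma regular_utility_mono:
  assumes "regular_utility P T F U \<alpha> l l'" "l \<le> k" "l' \<le> k'"
  shows "regular_utility P T F U \<alpha> k k'"
proof -
  have le: "l * proc_norm P T z + l' * proc_norm P T h \<le> k * proc_norm P T z + k' * proc_norm P T h" for z h
    using assms(2,3) by (intro add_mono mult_right_mono) (auto simp: proc_norm_eq)
  from assms(1) obtain DU where
    "\<alpha> > 0 \<and> (\<forall>z\<in>proc_space P T F. \<forall>h\<in>proc_space P T F.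
        concave_in P T F (\<lambda>a. U a z h + \<alpha> / 2 * (proc_norm P T a)\<^sup>2))"
    "\<forall>z\<in>proc_space P T F. \<forall>h\<in>proc_space P T F.
        continuous_gateaux_gradient P T F (\<lambda>a. U a z h) (\<lambda>a. DU a z h)"
    and "\<forall>a\<in>proc_space P T F. \<forall>z\<in>proc_space P T F. \<forall>z'\<in>proc_space P T F.
      \<forall>h\<in>proc_space P T F. \<forall>h'\<in>proc_space P T F. proc_norm P T (DU a z h - DU a z' h')
        \<le> l * proc_norm P T (z - z') + l' * proc_norm P T (h - h')"
    unfolding regular_utility_def by (elim conjE exE) (rule that, auto)
  then show ?thesis unfolding regular_utility_def by (auto intro!: exI[of _ DU] intro: order_trans[OF _ le])
qed

locale concave_game = prob_space P for P :: "'w measure" +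
  fixes T :: real and F :: "real \<Rightarrow> 'w measure" and U :: "'w utility" and A0 :: "'w process set"
    and \<alpha> l l\<^sub>\<theta> L M :: real
  assumes U_eq: "utility_respects_eq P T F U"
    and regular: "regular_utility P T F U \<alpha> l l\<^sub>\<theta>"
    and l_nonneg: "0 \<le> l" and l\<^sub>\<theta>_nonneg: "0 \<le> l\<^sub>\<theta>" and l_less: "l < \<alpha>"
    and A0_nonempty: "A0 \<noteq> {}" and A0_closed: "closed_convex_in P T F A0"
    and A0_bounded: "\<And>a. a \<in> A0 \<Longrightarrow> proc_norm P T a \<le> M"
    and L_nonneg: "0 \<le> L"
    and U_Lipschitz: "\<And>a a' z z' h h'. a \<in> A0 \<Longrightarrow> a' \<in> A0 \<Longrightarrow> z \<in> proc_space P T F \<Longrightarrow> z' \<in> proc_space P T F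
        \<Longrightarrow> h \<in> proc_space P T F \<Longrightarrow> h' \<in> proc_space P T F \<Longrightarrow> \<bar>U a z h - U a' z' h'\<bar>
          \<le> L * (proc_norm P T (a - a') + proc_norm P T (z - z') + proc_norm P T (h - h'))"
begin

abbreviation \<mu> :: "('w \<times> real) measure" where "\<mu> \<equiv> time_prod P T"
abbreviation K :: "'w process set" where "K \<equiv> proc_space P T F"
abbreviation nrm :: "'w process \<Rightarrow> real" where "nrm \<equiv> l2_norm \<mu>"

definition best :: "'w process \<Rightarrow> 'w process \<Rightarrow> 'w process \<Rightarrow> bool" where
  "best z h a \<longleftrightarrow> is_arg_max (\<lambda>b. U b z h) (\<lambda>b. b \<in> A0) a"

lemma best_iff: "best z h a \<longleftrightarrow> a \<in> A0 \<and> (\<forall>b\<in>A0. U b z h \<le> U a z h)"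
  by (auto simp: best_def is_arg_max_def not_less)

lemma \<alpha>_pos: "0 < \<alpha>" using l_nonneg l_less by simp

lemma A0_K: "a \<in> A0 \<Longrightarrow> a \<in> K"
  using A0_closed by (auto simp: closed_convex_in_def)

lemma K_sq: "a \<in> K \<Longrightarrow> square_integrable \<mu> a" by (rule proc_space_square_integrable)

lemma A0_sq: "a \<in> A0 \<Longrightarrow> square_integrable \<mu> a" using A0_K K_sq by blast

lemma nrm_A0: "a \<in> A0 \<Longrightarrow> nrm a \<le> M"
  using A0_bounded by (simp add: proc_norm_eq)

lemma M_nonneg: "0 \<le> M"
  using A0_nonempty nrm_A0 l2_norm_nonneg by (meson all_not_in_conv order_trans)

lemma nrm_A0_diff: "a \<in> A0 \<Longrightarrow> b \<in> A0 \<Longrightarrow> nrm (a - b) \<le> 2 * M"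
  using l2_norm_diff_le[OF A0_sq A0_sq, of a b] nrm_A0[of a] nrm_A0[of b] by simp

lemma A0_convex: "a \<in> A0 \<Longrightarrow> b \<in> A0 \<Longrightarrow> 0 \<le> s \<Longrightarrow> s \<le> 1 \<Longrightarrow> (\<lambda>p. s * a p + (1 - s) * b p) \<in> A0"
  using A0_closed by (auto simp: closed_convex_in_def)

lemma U_lip: "a \<in> A0 \<Longrightarrow> a' \<in> A0 \<Longrightarrow> z \<in> K \<Longrightarrow> z' \<in> K \<Longrightarrow> h \<in> K \<Longrightarrow> h' \<in> K \<Longrightarrow>
    \<bar>U a z h - U a' z' h'\<bar> \<le> L * (nrm (a - a') + nrm (z - z') + nrm (h - h'))"
  using U_Lipschitz by (simp add: proc_norm_eq)

lemma A0_limit: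
  fixes f :: "nat \<Rightarrow> 'w process"
  assumes f: "\<And>n. f n \<in> A0" and step: "\<And>n. nrm (f n - f (Suc n)) \<le> C * q ^ n" and q: "0 \<le> q" "q < 1"
  shows "(\<lambda>p. lim (\<lambda>n. f n p)) \<in> A0" "\<And>n. nrm (f n - (\<lambda>p. lim (\<lambda>n. f n p))) \<le> C * q ^ n / (1 - q)"
proof -
  let ?g = "\<lambda>p. lim (\<lambda>n. f n p)"
  note G = l2_geometric_limit[OF finite_measure_time_prod[OF prob_space_axioms] A0_sq[OF f] step q]
  show bound: "nrm (f n - ?g) \<le> C * q ^ n / (1 - q)" for n by (rule G(2))
  have lim: "(\<lambda>n. nrm (f n - ?g)) \<longlonglongrightarrow> 0"
  proof (rule tendsto_sandwich[where f="\<lambda>_. 0" and h="\<lambda>n. C * q ^ n / (1 - q)"])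
    have "(\<lambda>n. C * q ^ n / (1 - q)) \<longlonglongrightarrow> C * 0 / (1 - q)"
      using q by (intro tendsto_intros LIMSEQ_power_zero) auto
    then show "(\<lambda>n. C * q ^ n / (1 - q)) \<longlonglongrightarrow> 0" by simp
  qed (auto intro!: always_eventually bound)
  have "?g \<in> K" by (rule proc_space_closed[OF prob_space_axioms A0_K[OF f] G(1) lim])
  moreover have "\<forall>\<sigma> a. (\<forall>n::nat. \<sigma> n \<in> A0) \<and> a \<in> K \<and> (\<lambda>n. nrm (\<sigma> n - a)) \<longlonglongrightarrow> 0 \<longrightarrow> a \<in> A0"
    using A0_closed unfolding closed_convex_in_def proc_norm_eq by (elim conjE)
  ultimately show "?g \<in> A0"
    using f lim by (auto dest!: spec[of _ f] spec[of _ ?g])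
qed

lemma strong_concavity:
  assumes a: "a \<in> K" and b: "b \<in> K" and z: "z \<in> K" and h: "h \<in> K" and s: "0 \<le> s" "s \<le> 1"
  shows "s * U a z h + (1 - s) * U b z h + \<alpha> / 2 * (s * (1 - s) * (nrm (a - b))\<^sup>2)
    \<le> U (\<lambda>p. s * a p + (1 - s) * b p) z h"
proof -
  have "concave_in P T F (\<lambda>a. U a z h + \<alpha> / 2 * (nrm a)\<^sup>2)"
    using regular z h by (simp add: regular_utility_def proc_norm_eq)
  then have "s * (U a z h + \<alpha> / 2 * (nrm a)\<^sup>2) + (1 - s) * (U b z h + \<alpha> / 2 * (nrm b)\<^sup>2)
      \<le> U (\<lambda>p. s * a p + (1 - s) * b p) z h + \<alpha> / 2 * (nrm (\<lambda>p. s * a p + (1 - s) * b p))\<^sup>2"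
    using a b s by (auto simp: concave_in_def)
  moreover have "s * x + (1 - s) * y + k * (s * (1 - s) * d) \<le> v"
    if "s * (x + k * a) + (1 - s) * (y + k * b) \<le> v + k * (s * a + (1 - s) * b - s * (1 - s) * d)"
    for x y v a b d k :: real
    using that by (simp add: algebra_simps)
  ultimately show ?thesis
    unfolding l2_norm_convex_comb_sq[OF K_sq[OF a] K_sq[OF b]] by blast
qed

text \<open>Strong concavity makes a maximizing sequence Cauchy, so completeness and closedness of
  \<open>A0\<close> yield the maximizer without weak compactness. The supremum is finite since the
  utility is Lipschitz and \<open>A0\<close> is bounded.\<close>

lemma best_exists:
  assumes z: "z \<in> K" and h: "h \<in> K"
  shows "\<exists>a. best z h a"
proof -
  define S where "S = (SUP a\<in>A0. U a z h)"
  obtain a0 where a0: "a0 \<in> A0" using A0_nonempty by auto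
  have "U a z h \<le> U a0 z h + L * (2 * M)" if "a \<in> A0" for a
  proof -
    have "\<bar>U a z h - U a0 z h\<bar> \<le> L * nrm (a - a0)" using U_lip[OF that a0 z z h h] by simp
    also have "\<dots> \<le> L * (2 * M)" using nrm_A0_diff[OF that a0] L_nonneg by (intro mult_left_mono)
    finally show ?thesis by linarith
  qed
  then have bdd: "bdd_above ((\<lambda>a. U a z h) ` A0)" by (auto intro!: bdd_aboveI)
  have upper: "U a z h \<le> S" if "a \<in> A0" for a
    unfolding S_def using that bdd by (intro cSUP_upper) auto
  \<comment> \<open>Comparing the utility at a midpoint with the supremum bounds
    \<open>\<alpha> / 8\<close> times the squared distance of consecutive elements by
    \<open>\<delta> n\<close>, hence the distance by \<open>(1 / 2) ^ n\<close>.\<close>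
  define \<delta> where "\<delta> n = \<alpha> / 8 * (1 / 4) ^ n" for n :: nat
  have \<delta>: "\<delta> n > 0" for n using \<alpha>_pos by (simp add: \<delta>_def)
  have "\<exists>a\<in>A0. S - \<delta> n < U a z h" for n
    using less_cSUP_iff[OF A0_nonempty bdd, of "S - \<delta> n"] \<delta>[of n] by (simp add: S_def)
  then obtain f where f: "\<And>n. f n \<in> A0" "\<And>n. S - \<delta> n < U (f n) z h" by metis
  have step: "nrm (f n - f (Suc n)) \<le> 1 * (1 / 2) ^ n" for n
  proof (rule power2_le_imp_le)
    have "1 / 2 * U (f n) z h + (1 - 1 / 2) * U (f (Suc n)) z h
        + \<alpha> / 2 * (1 / 2 * (1 - 1 / 2) * (nrm (f n - f (Suc n)))\<^sup>2) \<le> S"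
      using order_trans[OF strong_concavity[OF A0_K[OF f(1)] A0_K[OF f(1)] z h]
          upper[OF A0_convex[OF f(1) f(1)]], of "1 / 2" n "Suc n"] by simp
    moreover have "\<delta> (Suc n) \<le> \<delta> n" using \<alpha>_pos by (simp add: \<delta>_def)
    ultimately have "\<alpha> / 8 * (nrm (f n - f (Suc n)))\<^sup>2 \<le> \<delta> n"
      using f(2)[of n] f(2)[of "Suc n"] by simp
    then have "(nrm (f n - f (Suc n)))\<^sup>2 \<le> (1 / 4) ^ n"
      using \<alpha>_pos by (simp add: \<delta>_def)
    then show "(nrm (f n - f (Suc n)))\<^sup>2 \<le> (1 * (1 / 2) ^ n)\<^sup>2"
      by (simp add: power2_eq_square flip: power_mult_distrib)
  qed simp
  define g where "g p = lim (\<lambda>n. f n p)" for p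
  have g: "g \<in> A0" "nrm (f n - g) \<le> 2 * (1 / 2) ^ n" for n
    using A0_limit[where f=f and C=1 and q="1 / 2"] f(1) step by (simp_all add: g_def[abs_def] mult.commute)
  have lower: "S - \<delta> n - L * (2 * (1 / 2) ^ n) \<le> U g z h" for n
  proof -
    have "\<bar>U (f n) z h - U g z h\<bar> \<le> L * nrm (f n - g)" using U_lip[OF f(1) g(1) z z h h] by simp
    also have "\<dots> \<le> L * (2 * (1 / 2) ^ n)" using g(2) L_nonneg by (intro mult_left_mono)
    finally show ?thesis using f(2)[of n] by linarith
  qed
  have "(\<lambda>n. S - \<delta> n - L * (2 * (1 / 2) ^ n)) \<longlonglongrightarrow> S - \<alpha> / 8 * 0 - L * (2 * 0)"
    unfolding \<delta>_def by (intro tendsto_intros LIMSEQ_power_zero) auto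
  then have "S \<le> U g z h"
    using lower by (intro LIMSEQ_le_const2[of _ S]) auto
  then show ?thesis using upper g(1) order_trans unfolding best_iff by blast
qed

text \<open>Moving from \<open>a\<close> towards \<open>b\<close> by a fraction \<open>s\<close>
  cannot raise the utility. Strong concavity divided by \<open>s\<close> gives the bound up to the
  factor \<open>1 - s\<close>, and \<open>s\<close> tends to 0.\<close>

lemma best_quadratic_growth:
  assumes a: "best z h a" and b: "b \<in> A0" and z: "z \<in> K" and h: "h \<in> K"
  shows "\<alpha> / 2 * (nrm (a - b))\<^sup>2 \<le> U a z h - U b z h"
proof -
  have aA: "a \<in> A0" and opt: "\<And>c. c \<in> A0 \<Longrightarrow> U c z h \<le> U a z h" using a by (auto simp: best_iff)
  have *: "\<alpha> / 2 * ((1 - s) * (nrm (a - b))\<^sup>2) \<le> U a z h - U b z h" if s: "0 < s" "s \<le> 1" for s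
  proof -
    have "s * U b z h + (1 - s) * U a z h + \<alpha> / 2 * (s * (1 - s) * (nrm (b - a))\<^sup>2) \<le> U a z h"
      using order_trans[OF strong_concavity[OF A0_K[OF b] A0_K[OF aA] z h] opt[OF A0_convex[OF b aA]]] s
      by simp
    then have "s * (\<alpha> / 2 * ((1 - s) * (nrm (a - b))\<^sup>2)) \<le> s * (U a z h - U b z h)"
      by (simp add: l2_norm_minus_commute[of \<mu> a] algebra_simps)
    then show ?thesis using s by simp
  qed
  have "((\<lambda>s. \<alpha> / 2 * ((1 - s) * (nrm (a - b))\<^sup>2)) \<longlongrightarrow> \<alpha> / 2 * ((1 - 0) * (nrm (a - b))\<^sup>2)) (at_right 0)"
    by (intro tendsto_intros)
  moreover have "\<forall>\<^sub>F s in at_right 0. \<alpha> / 2 * ((1 - s) * (nrm (a - b))\<^sup>2) \<le> U a z h - U b z h"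
    by (rule eventually_mono[OF eventually_at_right_real[OF zero_less_one]]) (rule *; simp)
  ultimately have "\<alpha> / 2 * ((1 - 0) * (nrm (a - b))\<^sup>2) \<le> U a z h - U b z h"
    by (rule tendsto_upperbound[OF _ _ trivial_limit_at_right_real])
  then show ?thesis by simp
qed

text \<open>The gradient at the response to the perturbed data is tested against the difference of the
  two responses, so that only its variation in \<open>(z, h)\<close> enters.\<close>

lemma best_Lipschitz:
  assumes a: "best z h a" and a': "best z' h' a'"
    and z: "z \<in> K" "z' \<in> K" and h: "h \<in> K" "h' \<in> K"
  shows "\<alpha> * nrm (a - a') \<le> l * nrm (z - z') + l\<^sub>\<theta> * nrm (h - h')"
proof -
  have aA: "a \<in> A0" "a' \<in> A0" using a a' by (auto simp: best_iff)
  obtain DU where DU: "\<And>z h. z \<in> K \<Longrightarrow> h \<in> K \<Longrightarrow> continuous_gateaux_gradient P T F (\<lambda>a. U a z h) (\<lambda>a. DU a z h)"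
    "\<And>a z z' h h'. a \<in> K \<Longrightarrow> z \<in> K \<Longrightarrow> z' \<in> K \<Longrightarrow> h \<in> K \<Longrightarrow> h' \<in> K \<Longrightarrow>
       nrm (DU a z h - DU a z' h') \<le> l * nrm (z - z') + l\<^sub>\<theta> * nrm (h - h')"
  proof -
    from regular obtain DU where DU:
      "\<forall>z\<in>K. \<forall>h\<in>K. continuous_gateaux_gradient P T F (\<lambda>a. U a z h) (\<lambda>a. DU a z h)"
      "\<forall>a\<in>K. \<forall>z\<in>K. \<forall>z'\<in>K. \<forall>h\<in>K. \<forall>h'\<in>K.
         nrm (DU a z h - DU a z' h') \<le> l * nrm (z - z') + l\<^sub>\<theta> * nrm (h - h')"
      unfolding regular_utility_def proc_norm_eq by (elim conjE exE) (rule that)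
    then show thesis by (intro that[of DU]) blast+
  qed
  define v where "v = a - a'"
  have v: "v \<in> K" unfolding v_def by (intro proc_space_diff A0_K aA)
  have grad: "DU a' z h \<in> K"
      "((\<lambda>e. (U (\<lambda>p. a' p + e * v p) z h - U a' z h) / e) \<longlongrightarrow> (LINT p|\<mu>. DU a' z h p * v p)) (at_right 0)"
    if "z \<in> K" "h \<in> K" for z h
    using DU(1)[OF that] A0_K[OF aA(2)] v
    by (auto simp: continuous_gateaux_gradient_def has_gateaux_gradient_def proc_inner_def
        intro: filterlim_mono at_le)
  have comb: "(\<lambda>p. a' p + e * v p) = (\<lambda>p. e * a p + (1 - e) * a' p)" for e
    by (auto simp: v_def algebra_simps)
  have ev: "\<forall>\<^sub>F e in at_right 0. 0 < e \<and> e < (1::real)"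
    using eventually_at_right_real[of 0 1] by simp
  have lower: "U a z h - U a' z h + \<alpha> / 2 * (nrm (a - a'))\<^sup>2 \<le> (LINT p|\<mu>. DU a' z h p * v p)"
  proof (rule tendsto_le[OF _ grad(2)[OF z(1) h(1)]])
    show "((\<lambda>e. U a z h - U a' z h + \<alpha> / 2 * ((1 - e) * (nrm (a - a'))\<^sup>2)) \<longlongrightarrow>
        U a z h - U a' z h + \<alpha> / 2 * (nrm (a - a'))\<^sup>2) (at_right 0)"
      by (rule tendsto_eq_intros refl | simp)+
    show "\<forall>\<^sub>F e in at_right 0. U a z h - U a' z h + \<alpha> / 2 * ((1 - e) * (nrm (a - a'))\<^sup>2)
        \<le> (U (\<lambda>p. a' p + e * v p) z h - U a' z h) / e"
      using ev
    proof eventually_elim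
      case (elim e)
      have "e * U a z h + (1 - e) * U a' z h + \<alpha> / 2 * (e * (1 - e) * (nrm (a - a'))\<^sup>2)
          \<le> U (\<lambda>p. a' p + e * v p) z h"
        unfolding comb using elim by (intro strong_concavity A0_K aA z h) auto
      then have "(U a z h - U a' z h + \<alpha> / 2 * ((1 - e) * (nrm (a - a'))\<^sup>2)) * e
          \<le> U (\<lambda>p. a' p + e * v p) z h - U a' z h"
        by (simp add: algebra_simps)
      then show ?case using elim by (subst pos_le_divide_eq) auto
    qed
  qed simp
  \<comment> \<open>First order condition for \<open>a'\<close>, which is optimal for the data
    \<open>(z', h')\<close>; the segment towards \<open>a\<close> stays in
    \<open>A0\<close>.\<close>
  have upper: "(LINT p|\<mu>. DU a' z' h' p * v p) \<le> 0"
  proof (rule tendsto_upperbound[OF grad(2)[OF z(2) h(2)]])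
    show "\<forall>\<^sub>F e in at_right 0. (U (\<lambda>p. a' p + e * v p) z' h' - U a' z' h') / e \<le> 0"
      using ev
    proof eventually_elim
      case (elim e)
      have "U (\<lambda>p. a' p + e * v p) z' h' \<le> U a' z' h'"
        unfolding comb using a' A0_convex[OF aA] elim by (simp add: best_iff)
      then show ?case using elim by (simp add: divide_nonpos_pos)
    qed
  qed simp
  have sq: "square_integrable \<mu> (DU a' z h)" "square_integrable \<mu> (DU a' z' h')" "square_integrable \<mu> v"
    using grad(1) z h v by (auto intro: K_sq)
  \<comment> \<open>Concavity along the segment and quadratic growth at the maximizer contribute
    \<open>\<alpha> / 2\<close> each.\<close>
  have "\<alpha> * (nrm v)\<^sup>2 \<le> (LINT p|\<mu>. DU a' z h p * v p)"
    using lower best_quadratic_growth[OF a aA(2) z(1) h(1)] by (simp add: v_def)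
  also have "\<dots> \<le> (LINT p|\<mu>. DU a' z h p * v p) - (LINT p|\<mu>. DU a' z' h' p * v p)"
    using upper by simp
  also have "\<dots> = (LINT p|\<mu>. (DU a' z h - DU a' z' h') p * v p)"
    using integrable_mult_square[OF sq(1,3)] integrable_mult_square[OF sq(2,3)]
    by (simp add: left_diff_distrib)
  also have "\<dots> \<le> nrm (DU a' z h - DU a' z' h') * nrm v"
    using l2_Cauchy_Schwarz[OF square_integrable_diff[OF sq(1,2)] sq(3)] by linarith
  also have "\<dots> \<le> (l * nrm (z - z') + l\<^sub>\<theta> * nrm (h - h')) * nrm v"
    using DU(2)[OF A0_K[OF aA(2)] z h] by (intro mult_right_mono) auto
  finally have "\<alpha> * nrm v * nrm v \<le> (l * nrm (z - z') + l\<^sub>\<theta> * nrm (h - h')) * nrm v"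
    by (simp add: power2_eq_square mult.assoc)
  moreover have "0 \<le> l * nrm (z - z') + l\<^sub>\<theta> * nrm (h - h')"
    using l_nonneg l\<^sub>\<theta>_nonneg by simp
  ultimately show ?thesis
    using l2_norm_nonneg[of \<mu> v] unfolding v_def[symmetric]
    by (cases "nrm v = 0") (auto simp: mult_le_cancel_right)
qed

text \<open>Limits and measurable selections reproduce a maximizer only up to a null set; the
  utility does not see the difference.\<close>

lemma best_cong:
  assumes a: "best z h a" and b: "b \<in> A0" and ab: "nrm (a - b) = 0" and z: "z \<in> K" and h: "h \<in> K"
  shows "best z h b"
proof -
  have "a \<in> A0" using a by (simp add: best_iff)
  then have "AE p in \<mu>. (a - b) p = 0"
    using l2_norm_eq_0_iff[OF square_integrable_diff[OF A0_sq A0_sq]] ab b by blast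
  then have "proc_eq P T a b" by (simp add: proc_eq_def)
  moreover have "proc_eq P T z z" "proc_eq P T h h" by (simp_all add: proc_eq_def)
  ultimately have "U a z h = U b z h"
    by (intro U_eq[unfolded utility_respects_eq_def, rule_format, OF A0_K[OF \<open>a \<in> A0\<close>] A0_K[OF b] z z h h] conjI)
  then show ?thesis using a b by (simp add: best_iff)
qed

text \<open>Banach's fixed point argument in the supremum norm over the players. The set \<open>\<P>\<close> of
  admissible families accommodates both finitely many players and measurable profiles.\<close>

lemma equilibrium_exists:
  fixes I :: "'i set" and \<P> :: "('i \<Rightarrow> 'w process) set" and Z :: "('i \<Rightarrow> 'w process) \<Rightarrow> 'i \<Rightarrow> 'w process"
  assumes ne: "\<P> \<noteq> {}" and PA: "\<And>a i. a \<in> \<P> \<Longrightarrow> i \<in> I \<Longrightarrow> a i \<in> A0"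
    and ZK: "\<And>a i. a \<in> \<P> \<Longrightarrow> i \<in> I \<Longrightarrow> Z a i \<in> K"
    and Z: "\<And>a b c i. a \<in> \<P> \<Longrightarrow> b \<in> \<P> \<Longrightarrow> i \<in> I \<Longrightarrow> (\<And>j. j \<in> I \<Longrightarrow> nrm (a j - b j) \<le> c) \<Longrightarrow>
      nrm (Z a i - Z b i) \<le> c"
    and resp: "\<And>a. a \<in> \<P> \<Longrightarrow> \<exists>b\<in>\<P>. \<forall>i\<in>I. best (Z a i) (\<eta> i) (b i)"
    and \<eta>: "\<And>i. i \<in> I \<Longrightarrow> \<eta> i \<in> K"
    and lim: "\<And>a. (\<And>n::nat. a n \<in> \<P>) \<Longrightarrow> (\<And>i. i \<in> I \<Longrightarrow> (\<lambda>p. lim (\<lambda>n. a n i p)) \<in> A0) \<Longrightarrow>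
      (\<lambda>i p. lim (\<lambda>n. a n i p)) \<in> \<P>"
  shows "\<exists>a\<in>\<P>. \<forall>i\<in>I. best (Z a i) (\<eta> i) (a i)"
proof -
  define q where "q = l / \<alpha>"
  have q: "0 \<le> q" "q < 1" using l_nonneg l_less \<alpha>_pos by (auto simp: q_def)
  obtain R where R: "\<And>a. a \<in> \<P> \<Longrightarrow> R a \<in> \<P> \<and> (\<forall>i\<in>I. best (Z a i) (\<eta> i) (R a i))"
    using resp by metis
  obtain a0 where a0: "a0 \<in> \<P>" using ne by auto
  define a where "a n = (R ^^ n) a0" for n
  have aP: "a n \<in> \<P>" for n
    by (induction n) (auto simp: a_def a0 R)
  have aS: "best (Z (a n) i) (\<eta> i) (a (Suc n) i)" if "i \<in> I" for n i
    using R[OF aP[of n]] that by (simp add: a_def)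
  have contr: "nrm (b - b') \<le> q * nrm (z - z')"
    if "best z h b" "best z' h b'" "z \<in> K" "z' \<in> K" "h \<in> K" for b b' z z' h
  proof -
    have "nrm (h - h) = 0" by simp
    then show ?thesis
      using best_Lipschitz[OF that(1,2,3,4,5,5)] \<alpha>_pos by (simp add: q_def field_simps)
  qed
  have step: "nrm (a n i - a (Suc n) i) \<le> 2 * M * q ^ n" if "i \<in> I" for n i
    using that
  proof (induction n arbitrary: i)
    case 0
    then show ?case using nrm_A0_diff[OF PA[OF aP] PA[OF aP]]
      by (simp only: power_0 mult_1_right)
  next
    case (Suc n)
    have "nrm (a (Suc n) i - a (Suc (Suc n)) i) \<le> q * nrm (Z (a n) i - Z (a (Suc n)) i)"
      using aS Suc.prems aP \<eta> by (intro contr) (auto intro: ZK)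
    also have "\<dots> \<le> q * (2 * M * q ^ n)"
      by (intro mult_left_mono Z[OF aP aP Suc.prems] Suc.IH q(1))
    also have "\<dots> = 2 * M * q ^ Suc n" by simp
    finally show ?case .
  qed
  define b where "b i p = lim (\<lambda>n. a n i p)" for i p
  have b: "b i \<in> A0" "nrm (a n i - b i) \<le> 2 * M * q ^ n / (1 - q)" if "i \<in> I" for i n
    using A0_limit[where f="\<lambda>n. a n i" and C="2 * M" and q=q] PA[OF aP that] step[OF that] q
    by (simp_all add: b_def[abs_def])
  have bP: "b \<in> \<P>"
    using lim[OF aP] b(1) by (simp add: b_def[abs_def])
  have "best (Z b i) (\<eta> i) (b i)" if i: "i \<in> I" for i
  proof -
    \<comment> \<open>The limit \<open>b\<close> is compared with a true best response
      \<open>c\<close> to its own aggregate, and their distance turns out to vanish;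
      \<open>b\<close> is then optimal as another version of \<open>c\<close>. No limit is taken in
      the optimality inequalities.\<close>
    obtain c where c: "best (Z b i) (\<eta> i) c" using best_exists ZK[OF bP i] \<eta>[OF i] by blast
    have cA: "c \<in> A0" using c by (simp add: best_iff)
    have "nrm (c - b i) \<le> 4 * M / (1 - q) * q ^ n" for n
    proof -
      have "nrm (c - b i) \<le> nrm (c - a (Suc n) i) + nrm (a (Suc n) i - b i)"
        using cA PA[OF aP i] b(1)[OF i] by (intro l2_norm_diff_triangle A0_sq)
      also have "nrm (c - a (Suc n) i) \<le> q * nrm (Z b i - Z (a n) i)"
        using c aS[OF i] ZK[OF bP i] ZK[OF aP i] \<eta>[OF i] by (rule contr)
      also have "\<dots> \<le> q * (2 * M * q ^ n / (1 - q))"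
        using q b(2) by (intro mult_left_mono Z[OF bP aP i]) (auto simp: l2_norm_minus_commute[of \<mu> "b _"])
      also have "\<dots> \<le> 1 * (2 * M * q ^ n / (1 - q))"
        using q M_nonneg by (intro mult_right_mono) auto
      also have "nrm (a (Suc n) i - b i) \<le> 2 * M * q ^ Suc n / (1 - q)" by (rule b(2)[OF i])
      also have "\<dots> \<le> 2 * M * q ^ n / (1 - q)"
        using q M_nonneg by (intro divide_right_mono mult_left_mono power_decreasing) auto
      finally show ?thesis by (simp add: algebra_simps)
    qed
    then have "nrm (c - b i) \<le> 0" using q by (rule nonpos_if_le_geometric)
    then have "nrm (c - b i) = 0" using l2_norm_nonneg by (rule antisym)
    then show ?thesis by (rule best_cong[OF c b(1)[OF i] _ ZK[OF bP i] \<eta>[OF i]])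
  qed
  then show ?thesis using bP by blast
qed

end

section \<open>The index space\<close>

lemma unit_lebesgue_borel:
  assumes "extends_unit_lebesgue \<nu>" "B \<in> sets borel" "B \<subseteq> {0..1}"
  shows "B \<in> sets \<nu>" "emeasure \<nu> B = emeasure lborel B"
proof -
  have "B \<in> sets lebesgue" using assms(2) by simp
  then have B: "B \<in> sets (lebesgue_on {0..1})"
    using assms(3) by (auto simp: sets_restrict_space)
  then show "B \<in> sets \<nu>" using assms(1) by (auto simp: extends_unit_lebesgue_def)
  have "emeasure \<nu> B = emeasure (lebesgue_on {0..1}) B"
    using assms(1) B by (auto simp: extends_unit_lebesgue_def)
  also have "\<dots> = emeasure lebesgue B"
    using assms(3) by (intro emeasure_restrict_space) auto
  also have "\<dots> = emeasure lborel B" using assms(2) by simp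
  finally show "emeasure \<nu> B = emeasure lborel B" .
qed

lemma unit_lebesgue_measure:
  assumes "extends_unit_lebesgue \<nu>" "B \<in> sets borel" "B \<subseteq> {0..1}"
  shows "measure \<nu> B = measure lborel B"
  using unit_lebesgue_borel(2)[OF assms] by (simp add: measure_def)

lemma unit_lebesgue_ident:
  assumes "extends_unit_lebesgue \<nu>"
  shows "(\<lambda>x. x) \<in> \<nu> \<rightarrow>\<^sub>M borel"
proof (rule measurableI)
  fix A :: "real set" assume "A \<in> sets borel"
  moreover have "space \<nu> = {0..1}" using assms by (simp add: extends_unit_lebesgue_def)
  ultimately show "(\<lambda>x. x) -` A \<inter> space \<nu> \<in> sets \<nu>"
    by (auto intro!: unit_lebesgue_borel[OF assms])
qed simp

definition cell :: "nat \<Rightarrow> real \<Rightarrow> nat" where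
  "cell N x = (THE i. i \<in> {1..N} \<and> x \<in> unit_cell N i)"

lemma step_profile_cell: "step_profile N a x = a (cell N x)"
  by (simp add: step_profile_def cell_def)

lemma unit_cell_bounds:
  assumes "1 \<le> N" "i \<in> {1..N}" "x \<in> unit_cell N i"
  shows "(real i - 1) / real N \<le> x" "x \<le> real i / real N" "i < N \<Longrightarrow> x < real i / real N"
  using assms by (auto simp: unit_cell_def split: if_splits)

lemma unit_cell_unique:
  assumes "1 \<le> N" "i \<in> {1..N}" "x \<in> unit_cell N i" "j \<in> {1..N}" "x \<in> unit_cell N j"
  shows "i = j"
proof -
  have False if "i < j" "i \<in> {1..N}" "x \<in> unit_cell N i" "j \<in> {1..N}" "x \<in> unit_cell N j" for i j
  proof -
    have "x < real i / real N" using unit_cell_bounds(3)[OF assms(1) that(2,3)] that by simp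
    also have "\<dots> \<le> (real j - 1) / real N" using that by (intro divide_right_mono) auto
    also have "\<dots> \<le> x" by (rule unit_cell_bounds(1)[OF assms(1) that(4,5)])
    finally show False by simp
  qed
  then show ?thesis using assms(2-) by (metis linorder_neqE_nat)
qed

lemma unit_cell_exists:
  assumes N: "1 \<le> N" and x: "x \<in> {0..1}"
  shows "\<exists>i\<in>{1..N}. x \<in> unit_cell N i"
proof (cases "(real N - 1) / real N \<le> x")
  case True
  then show ?thesis using N x by (intro bexI[of _ N]) (auto simp: unit_cell_def)
next
  case False
  define k where "k = nat \<lfloor>real N * x\<rfloor>"
  have "real N * x < real N - 1" using False N by (simp add: field_simps)
  have k: "real k \<le> real N * x" "real N * x < real k + 1"
    using x N by (auto simp: k_def)
  then have "k + 1 < N" using \<open>real N * x < real N - 1\<close> by linarith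
  then show ?thesis using k N
    by (intro bexI[of _ "k + 1"]) (auto simp: unit_cell_def field_simps)
qed

lemma cell_unit_cell:
  assumes "1 \<le> N" "x \<in> {0..1}"
  shows "cell N x \<in> {1..N}" "x \<in> unit_cell N (cell N x)"
proof -
  have "\<exists>!i. i \<in> {1..N} \<and> x \<in> unit_cell N i"
    using unit_cell_exists[OF assms] unit_cell_unique[OF assms(1)] by blast
  from theI'[OF this] show "cell N x \<in> {1..N}" "x \<in> unit_cell N (cell N x)"
    by (simp_all add: cell_def)
qed

lemma cell_eq_iff:
  assumes "1 \<le> N" "x \<in> {0..1}" "i \<in> {1..N}"
  shows "cell N x = i \<longleftrightarrow> x \<in> unit_cell N i"
  using cell_unit_cell[OF assms(1,2)] unit_cell_unique[OF assms(1)] assms(3) by blast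

text \<open>Both the sampled intervention and the limit position of the \<open>i\<close>-th order
  statistic sit at \<open>i / N\<close>, so cells are matched with their right ends.\<close>

lemma cell_right_endpoint:
  assumes "1 \<le> N" "x \<in> {0..1}"
  shows "x \<le> real (cell N x) / real N" "real (cell N x) / real N \<le> x + 1 / real N"
    "real (cell N x) / real N \<in> {0..1}"
  using unit_cell_bounds[OF assms(1) cell_unit_cell[OF assms]] cell_unit_cell(1)[OF assms] assms
  by (auto simp: diff_divide_distrib)

lemma unit_cell_subset: "1 \<le> N \<Longrightarrow> i \<in> {1..N} \<Longrightarrow> unit_cell N i \<subseteq> {0..1}"
proof
  fix x assume N: "1 \<le> N" "i \<in> {1..N}" and x: "x \<in> unit_cell N i"
  have "0 \<le> (real i - 1) / real N" "real i / real N \<le> 1" using N by auto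
  then show "x \<in> {0..1}" using unit_cell_bounds(1,2)[OF N x] by auto
qed

lemma unit_cell_measure:
  assumes "extends_unit_lebesgue \<nu>" "1 \<le> N" "i \<in> {1..N}"
  shows "unit_cell N i \<in> sets \<nu>" "measure \<nu> (unit_cell N i) = 1 / real N"
proof -
  have b: "unit_cell N i \<in> sets borel" by (auto simp: unit_cell_def)
  show "unit_cell N i \<in> sets \<nu>"
    by (rule unit_lebesgue_borel(1)[OF assms(1) b unit_cell_subset[OF assms(2,3)]])
  have "measure lborel (unit_cell N i) = 1 / real N"
  proof (cases "i < N")
    case True
    have "(real i - 1) / real N \<le> real i / real N" by (simp add: divide_right_mono)
    then show ?thesis using True by (simp add: unit_cell_def diff_divide_distrib)
  next
    case False
    have "(real N - 1) / real N \<le> 1" using assms(2) by simp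
    then show ?thesis using False assms(2) by (simp add: unit_cell_def diff_divide_distrib)
  qed
  then show "measure \<nu> (unit_cell N i) = 1 / real N"
    by (simp add: unit_lebesgue_measure[OF assms(1) b unit_cell_subset[OF assms(2,3)]])
qed

lemma cell_measurable:
  assumes "extends_unit_lebesgue \<nu>" "1 \<le> N"
  shows "cell N \<in> \<nu> \<rightarrow>\<^sub>M count_space UNIV"
proof (subst measurable_count_space_eq2_countable, intro conjI ballI)
  have sp: "space \<nu> = {0..1}" using assms by (simp add: extends_unit_lebesgue_def)
  fix i :: nat
  show "cell N -` {i} \<inter> space \<nu> \<in> sets \<nu>"
  proof (cases "i \<in> {1..N}")
    case True
    then have "cell N -` {i} \<inter> space \<nu> = unit_cell N i"
      using cell_eq_iff[OF assms(2) _ True] unit_cell_subset[OF assms(2) True]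
      unfolding sp by blast
    then show ?thesis using unit_cell_measure[OF assms True] by simp
  next
    case False
    then have "cell N -` {i} \<inter> space \<nu> = {}" using cell_unit_cell(1)[OF assms(2)] by (auto simp: sp)
    then show ?thesis by simp
  qed
qed auto

text \<open>The dictionary between the two games: player averages in a network are integrals, over
  the index space, of functions of the cell.\<close>

lemma integral_cell:
  fixes f :: "nat \<Rightarrow> real"
  assumes \<nu>: "extends_unit_lebesgue \<nu>" and N: "1 \<le> N"
  shows "integrable \<nu> (\<lambda>x. f (cell N x))" "(LINT x|\<nu>. f (cell N x)) = 1 / real N * (\<Sum>i=1..N. f i)"
proof -
  have sp: "space \<nu> = {0..1}" and pr: "prob_space \<nu>" using \<nu> by (auto simp: extends_unit_lebesgue_def)
  interpret prob_space \<nu> by (rule pr)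
  have eq: "f (cell N x) = (\<Sum>i=1..N. f i * indicator (unit_cell N i) x)" if "x \<in> space \<nu>" for x
  proof -
    have "(\<Sum>i=1..N. f i * indicator (unit_cell N i) x) = (\<Sum>i=1..N. if i = cell N x then f i else 0)"
      using that cell_eq_iff[OF N] by (intro sum.cong refl) (auto simp: sp indicator_def)
    then show ?thesis using cell_unit_cell(1)[OF N] that by (simp add: sp)
  qed
  have int: "integrable \<nu> (\<lambda>x. f i * indicator (unit_cell N i) x)" if "i \<in> {1..N}" for i
    using unit_cell_measure[OF \<nu> N that]
    by (intro integrable_mult_right integrable_real_indicator) (auto simp: emeasure_eq_measure)
  then have "integrable \<nu> (\<lambda>x. \<Sum>i=1..N. f i * indicator (unit_cell N i) x)"
    by (intro Bochner_Integration.integrable_sum)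
  then show "integrable \<nu> (\<lambda>x. f (cell N x))"
    using eq by (subst Bochner_Integration.integrable_cong[OF refl]) auto
  have "(LINT x|\<nu>. f (cell N x)) = (LINT x|\<nu>. (\<Sum>i=1..N. f i * indicator (unit_cell N i) x))"
    using eq by (intro Bochner_Integration.integral_cong refl)
  also have "\<dots> = (\<Sum>i=1..N. LINT x|\<nu>. f i * indicator (unit_cell N i) x)"
    using int by (intro Bochner_Integration.integral_sum) auto
  also have "\<dots> = (\<Sum>i=1..N. f i * (1 / real N))"
    using unit_cell_measure[OF \<nu> N] by (intro sum.cong refl) (simp add: Int_absorb2 sets.sets_into_space)
  finally show "(LINT x|\<nu>. f (cell N x)) = 1 / real N * (\<Sum>i=1..N. f i)"
    by (simp add: sum_distrib_left mult.commute)
qed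

section \<open>Interval partitions and Borel measurability of the graphon\<close>

lemma bounded_interval_between:
  fixes I :: "real set"
  assumes "is_interval I" "bdd_above I" "bdd_below I" "I \<noteq> {}"
  shows "{Inf I<..<Sup I} \<subseteq> I" "I \<subseteq> {Inf I..Sup I}"
proof -
  show "I \<subseteq> {Inf I..Sup I}" using assms by (auto intro: cInf_lower cSup_upper)
  show "{Inf I<..<Sup I} \<subseteq> I"
  proof
    fix x assume x: "x \<in> {Inf I<..<Sup I}"
    then obtain a b where "a \<in> I" "a < x" "b \<in> I" "x < b"
      using x assms cInf_less_iff[of I x] less_cSup_iff[of I x] by auto
    then show "x \<in> I" using assms(1) unfolding is_interval_1 by (meson less_imp_le)
  qed
qed

lemma bounded_interval_borel:
  fixes I :: "real set"
  assumes "is_interval I" "bdd_above I" "bdd_below I"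
  shows "I \<in> sets borel"
proof (cases "I = {}")
  case False
  note between = bounded_interval_between[OF assms False]
  have eq: "I = {Inf I<..<Sup I} \<union> (I \<inter> {Inf I, Sup I})"
  proof (intro antisym subsetI)
    fix x assume "x \<in> I"
    then show "x \<in> {Inf I<..<Sup I} \<union> (I \<inter> {Inf I, Sup I})"
      using subsetD[OF between(2), of x] by (auto simp: less_le)
  qed (use between(1) in auto)
  have "I \<inter> {Inf I, Sup I} \<in> sets borel" by (intro borel_closed finite_imp_closed) simp
  then show ?thesis by (subst eq) (rule sets.Un; simp)
qed simp

text \<open>Each interval loses a closed strip of length \<open>D\<close> at either end, which
  accounts for \<open>2 * D\<close> per interval. A point outside all strips is farther than
  \<open>D\<close> from the ends of its own interval, so its neighbours within \<open>D\<close> stay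
  inside, whether or not the ends belong to the interval.\<close>

lemma interval_partition_near_boundary:
  assumes \<nu>: "extends_unit_lebesgue \<nu>" and part: "finite_interval_partition \<I>" and D: "0 \<le> D"
  obtains B where "B \<in> sets borel" "B \<subseteq> {0..1}" "measure \<nu> B \<le> 2 * real (card \<I>) * D"
    "\<And>x v. x \<in> {0..1} - B \<Longrightarrow> v \<in> {0..1} \<Longrightarrow> \<bar>x - v\<bar> \<le> D \<Longrightarrow> \<exists>I\<in>\<I>. x \<in> I \<and> v \<in> I"
proof -
  have fin: "finite \<I>" and un: "\<Union>\<I> = {0..1}" and int: "\<And>I. I \<in> \<I> \<Longrightarrow> is_interval I"
    using part by (auto simp: finite_interval_partition_def partition_on_def)
  have bdd: "bdd_above I" "bdd_below I" if "I \<in> \<I>" for I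
  proof -
    have "I \<subseteq> {0..1}" using that un by auto
    then show "bdd_above I" "bdd_below I" by (auto intro: bdd_above_mono bdd_below_mono)
  qed
  define E where "E I = {0..1} \<inter> ({Sup I - D..Sup I} \<union> {Inf I..Inf I + D})" for I :: "real set"
  define B where "B = (\<Union>I\<in>\<I>. E I)"
  have E: "E I \<in> sets borel" "E I \<subseteq> {0..1}" for I by (auto simp: E_def)
  have sp: "prob_space \<nu>" using \<nu> by (simp add: extends_unit_lebesgue_def)
  interpret prob_space \<nu> by (rule sp)
  have "measure \<nu> (E I) \<le> 2 * D" for I
  proof -
    have "measure \<nu> (E I) = measure lborel (E I)" using E by (rule unit_lebesgue_measure[OF \<nu>])
    also have "\<dots> \<le> measure lborel ({Sup I - D..Sup I} \<union> {Inf I..Inf I + D})"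
      using E by (intro measure_mono_fmeasurable fmeasurable.Un)
        (auto simp: E_def fmeasurable_def emeasure_lborel_Icc_eq)
    also have "\<dots> \<le> measure lborel {Sup I - D..Sup I} + measure lborel {Inf I..Inf I + D}"
      by (rule measure_Un_le) auto
    also have "\<dots> \<le> 2 * D" using D by simp
    finally show ?thesis .
  qed
  then have "measure \<nu> B \<le> (\<Sum>I\<in>\<I>. 2 * D)"
    unfolding B_def using fin unit_lebesgue_borel(1)[OF \<nu> E]
    by (intro order_trans[OF finite_measure_subadditive_finite] sum_mono) auto
  then have "measure \<nu> B \<le> 2 * real (card \<I>) * D" by simp
  moreover have "\<exists>I\<in>\<I>. x \<in> I \<and> v \<in> I" if x: "x \<in> {0..1} - B" and v: "v \<in> {0..1}" "\<bar>x - v\<bar> \<le> D" for x v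
  proof -
    have "x \<in> \<Union>\<I>" unfolding un using x by simp
    then obtain I where I: "I \<in> \<I>" "x \<in> I" by (rule UnionE)
    then have I0: "I \<noteq> {}" by auto
    have xI: "Inf I \<le> x" "x \<le> Sup I"
      using bounded_interval_between(2)[OF int[OF I(1)] bdd[OF I(1)] I0] I(2) by auto
    have xE: "x \<notin> E I" using x I(1) by (auto simp: B_def)
    have "v \<in> I"
    proof (rule ccontr)
      assume "v \<notin> I"
      then have "v \<le> Inf I \<or> Sup I \<le> v"
        using bounded_interval_between(1)[OF int[OF I(1)] bdd[OF I(1)] I0] by (meson greaterThanLessThan_iff not_le subsetD)
      then have "x \<in> E I" using v x xI by (auto simp: E_def)
      then show False using xE by simp
    qed
    then show ?thesis using I by auto
  qed
  moreover have "B \<in> sets borel" "B \<subseteq> {0..1}" using fin E by (auto simp: B_def)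
  ultimately show ?thesis using that by blast
qed

text \<open>A graphon is only Lebesgue measurable, which does not survive composition with random
  positions. The Lipschitz condition makes it continuous on finitely many Borel rectangles; the
  indicator cuts off the unspecified values outside the unit square.\<close>

lemma graphon_borel:
  assumes "graphon W" "piecewise_lipschitz_graphon W"
  shows "(\<lambda>q. indicator ({0..1} \<times> {0..1}) q * W (fst q) (snd q)) \<in> borel_measurable borel"
proof -
  from assms(2) obtain L \<I> where part: "finite_interval_partition \<I>" and
    lip': "\<forall>I\<in>\<I>. \<forall>J\<in>\<I>. \<forall>x\<in>I. \<forall>x'\<in>I. \<forall>y\<in>J. \<forall>y'\<in>J.
      \<bar>W x y - W x' y'\<bar> \<le> L * (\<bar>x - x'\<bar> + \<bar>y - y'\<bar>)"
    unfolding piecewise_lipschitz_graphon_def by (elim exE conjE)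
  note lip = lip'[rule_format]
  have fin: "finite \<I>" and un: "\<Union>\<I> = {0..1}" and disj: "disjoint \<I>" and int: "\<And>I. I \<in> \<I> \<Longrightarrow> is_interval I"
    using part by (auto simp: finite_interval_partition_def partition_on_def)
  have borel: "I \<in> sets borel" if "I \<in> \<I>" for I
  proof (rule bounded_interval_borel[OF int[OF that]])
    have "I \<subseteq> {0..1}" using that un by auto
    then show "bdd_above I" "bdd_below I" by (auto intro: bdd_above_mono bdd_below_mono)
  qed
  have cont: "continuous_on (I \<times> J) (\<lambda>q. W (fst q) (snd q))" if "I \<in> \<I>" "J \<in> \<I>" for I J
  proof (rule continuous_onI)
    fix q :: "real \<times> real" and e :: real assume q: "q \<in> I \<times> J" and e: "0 < e"
    \<comment> \<open>The sign of \<open>L\<close> is unknown, so its modulus is used, and the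
      summand 1 keeps the divisor positive.\<close>
    define k where "k = 2 * \<bar>L\<bar> + 1"
    have k: "k > 0" by (simp add: k_def)
    show "\<exists>d>0. \<forall>q'\<in>I \<times> J. dist q' q < d \<longrightarrow> dist (W (fst q') (snd q')) (W (fst q) (snd q)) \<le> e"
    proof (intro exI[of _ "e / k"] conjI ballI impI)
      fix q' assume q': "q' \<in> I \<times> J" and d: "dist q' q < e / k"
      have "\<bar>fst q' - fst q\<bar> \<le> dist q' q" "\<bar>snd q' - snd q\<bar> \<le> dist q' q"
        using dist_fst_le[of q' q] dist_snd_le[of q' q] by (simp_all add: dist_real_def)
      then have s: "\<bar>fst q' - fst q\<bar> + \<bar>snd q' - snd q\<bar> \<le> 2 * dist q' q" by simp
      have "dist (W (fst q') (snd q')) (W (fst q) (snd q))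
          \<le> L * (\<bar>fst q' - fst q\<bar> + \<bar>snd q' - snd q\<bar>)"
        using lip[OF that, of "fst q'" "fst q" "snd q'" "snd q"] q q' by (auto simp: dist_real_def)
      also have "\<dots> \<le> \<bar>L\<bar> * (\<bar>fst q' - fst q\<bar> + \<bar>snd q' - snd q\<bar>)"
        by (intro mult_right_mono) auto
      also have "\<dots> \<le> \<bar>L\<bar> * (2 * dist q' q)" by (intro mult_left_mono s) simp
      also have "\<dots> \<le> k * dist q' q" by (simp add: k_def algebra_simps)
      also have "\<dots> \<le> e" using d k by (simp add: field_simps)
      finally show "dist (W (fst q') (snd q')) (W (fst q) (snd q)) \<le> e" .
    qed (use e k in auto)
  qed
  have "(\<lambda>q. indicator (fst p \<times> snd p) q *\<^sub>R W (fst q) (snd q)) \<in> borel_measurable borel"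
    if "p \<in> \<I> \<times> \<I>" for p
    using that borel cont by (intro borel_measurable_continuous_on_indicator borel_Times) auto
  then have "(\<lambda>q. \<Sum>p\<in>\<I> \<times> \<I>. indicator (fst p \<times> snd p) q *\<^sub>R W (fst q) (snd q)) \<in> borel_measurable borel"
    by (rule borel_measurable_sum)
  moreover have "(\<Sum>p\<in>\<I> \<times> \<I>. indicator (fst p \<times> snd p) q *\<^sub>R W (fst q) (snd q))
      = indicator ({0..1} \<times> {0..1}) q * W (fst q) (snd q)" for q
  proof -
    have one: "(\<Sum>I\<in>\<I>. indicator I x) = (indicator {0..1} x :: real)" for x
    proof (cases "x \<in> \<Union>\<I>")
      case True
      then obtain I where I: "I \<in> \<I>" "x \<in> I" by (rule UnionE)
      have "(\<Sum>J\<in>\<I>. indicator J x) = (\<Sum>J\<in>\<I>. if J = I then 1 else 0 :: real)"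
      proof (rule sum.cong[OF refl])
        fix J assume J: "J \<in> \<I>"
        have "x \<notin> J" if "J \<noteq> I"
          using disjointD[OF disj J I(1) that] I(2) by blast
        then show "indicator J x = (if J = I then 1 else 0 :: real)" using I(2) by auto
      qed
      then show ?thesis using True fin I(1) unfolding un by simp
    next
      case False
      then have "indicator J x = (0::real)" if "J \<in> \<I>" for J using that by auto
      then show ?thesis using False unfolding un by simp
    qed
    have "(\<Sum>p\<in>\<I> \<times> \<I>. indicator (fst p \<times> snd p) q)
        = (\<Sum>I\<in>\<I>. \<Sum>J\<in>\<I>. indicator I (fst q) * indicator J (snd q) :: real)"
      by (subst sum.cartesian_product) (auto simp: indicator_def mem_Times_iff intro!: sum.cong)
    also have "\<dots> = indicator {0..1} (fst q) * indicator {0..1} (snd q)"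
      by (simp only: sum_product[symmetric] one)
    also have "\<dots> = indicator ({0..1} \<times> {0..1}) q" by (auto simp: indicator_def mem_Times_iff)
    finally have "(\<Sum>p\<in>\<I> \<times> \<I>. indicator (fst p \<times> snd p) q)
        = (indicator ({0..1} \<times> {0..1}) q :: real)" .
    then show ?thesis unfolding real_scaleR_def sum_distrib_right[symmetric] 
      by (rule arg_cong[where f="\<lambda>s. s * W (fst q) (snd q)"])
  qed
  ultimately show ?thesis by (simp only:)
qed

section \<open>Stability of weighted averages\<close>

context index_product
begin

text \<open>Averages are defined pointwise and are 0 where the integrand is not integrable, so two
  averages may be subtracted under the integral only at those \<open>p\<close> where both integrals
  exist.\<close>

lemma weighted_AE_integrable:
  assumes c: "L2_profile \<nu> M c" and w: "w \<in> borel_measurable \<nu>"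
    and w1: "\<And>y. y \<in> space \<nu> \<Longrightarrow> \<bar>w y\<bar> \<le> 1"
  shows "AE p in M. integrable \<nu> (\<lambda>y. w y * c y p)"
proof -
  have [measurable]: "case_prod c \<in> borel_measurable (\<nu> \<Otimes>\<^sub>M M)" using c by (simp add: L2_profile_def)
  have [measurable]: "w \<in> borel_measurable \<nu>" by (rule w)
  have "square_integrable (\<nu> \<Otimes>\<^sub>M M) (\<lambda>q. w (fst q))"
    by (rule square_integrable_bounded[where B=1]) (auto simp: space_pair_measure w1 PP.finite_measure_axioms)
  from integrable_mult_square[OF this L2_profile_square_integrable[OF c]]
  have "integrable (\<nu> \<Otimes>\<^sub>M M) (\<lambda>(y, p). w y * c y p)" by (simp add: case_prod_beta')
  from AE_integrable_snd[OF this] show ?thesis by simp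
qed

lemma weighted_average_diff_profile:
  assumes a: "L2_profile \<nu> M a" and b: "L2_profile \<nu> M b" and w: "w \<in> borel_measurable \<nu>"
    and w1: "\<And>y. y \<in> space \<nu> \<Longrightarrow> \<bar>w y\<bar> \<le> 1"
  shows "l2_norm M ((\<lambda>p. LINT y|\<nu>. w y * a y p) - (\<lambda>p. LINT y|\<nu>. w y * b y p))
    \<le> (LINT y|\<nu>. \<bar>w y\<bar> * l2_norm M (a y - b y))"
proof -
  note ab = L2_profile_diff[OF a b]
  have sq: "square_integrable M (\<lambda>p. LINT y|\<nu>. w y * a y p)" "square_integrable M (\<lambda>p. LINT y|\<nu>. w y * b y p)"
    using weighted_average(1)[OF a w w1] weighted_average(1)[OF b w w1] by auto
  have ia: "AE p in M. integrable \<nu> (\<lambda>y. w y * a y p)" by (rule weighted_AE_integrable[OF a w]) (rule w1)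
  have ib: "AE p in M. integrable \<nu> (\<lambda>y. w y * b y p)" by (rule weighted_AE_integrable[OF b w]) (rule w1)
  have "AE p in M. ((\<lambda>p. LINT y|\<nu>. w y * a y p) - (\<lambda>p. LINT y|\<nu>. w y * b y p)) p
      = (LINT y|\<nu>. w y * (a - b) y p)"
    using ia ib by eventually_elim (simp add: right_diff_distrib)
  then have "l2_norm M ((\<lambda>p. LINT y|\<nu>. w y * a y p) - (\<lambda>p. LINT y|\<nu>. w y * b y p))
      = l2_norm M (\<lambda>p. LINT y|\<nu>. w y * (a - b) y p)"
    using weighted_average(1)[OF ab w w1] square_integrable_diff[OF sq]
    by (intro l2_norm_cong_AE square_integrable_measurable)
  also have "\<dots> \<le> (LINT y|\<nu>. \<bar>w y\<bar> * l2_norm M ((a - b) y))"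
    by (rule weighted_average(2)[OF ab w w1])
  finally show ?thesis by simp
qed

lemma weighted_average_diff_weight:
  assumes a: "L2_profile \<nu> M a" and w: "w \<in> borel_measurable \<nu>" and v: "v \<in> borel_measurable \<nu>"
    and w1: "\<And>y. y \<in> space \<nu> \<Longrightarrow> w y \<in> {0..1}" and v1: "\<And>y. y \<in> space \<nu> \<Longrightarrow> v y \<in> {0..1}"
  shows "l2_norm M ((\<lambda>p. LINT y|\<nu>. w y * a y p) - (\<lambda>p. LINT y|\<nu>. v y * a y p))
    \<le> (LINT y|\<nu>. \<bar>w y - v y\<bar> * l2_norm M (a y))"
proof -
  have w': "\<bar>w y\<bar> \<le> 1" and v': "\<bar>v y\<bar> \<le> 1" and d': "\<bar>w y - v y\<bar> \<le> 1" if "y \<in> space \<nu>" for y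
    using w1[OF that] v1[OF that] by auto
  have d: "(\<lambda>y. w y - v y) \<in> borel_measurable \<nu>" using w v by simp
  have sq: "square_integrable M (\<lambda>p. LINT y|\<nu>. w y * a y p)" "square_integrable M (\<lambda>p. LINT y|\<nu>. v y * a y p)"
    using weighted_average(1)[OF a w w'] weighted_average(1)[OF a v v'] by auto
  have iw: "AE p in M. integrable \<nu> (\<lambda>y. w y * a y p)" by (rule weighted_AE_integrable[OF a w]) (rule w')
  have iv: "AE p in M. integrable \<nu> (\<lambda>y. v y * a y p)" by (rule weighted_AE_integrable[OF a v]) (rule v')
  have "AE p in M. ((\<lambda>p. LINT y|\<nu>. w y * a y p) - (\<lambda>p. LINT y|\<nu>. v y * a y p)) p
      = (LINT y|\<nu>. (w y - v y) * a y p)"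
    using iw iv by eventually_elim (simp add: left_diff_distrib)
  then have "l2_norm M ((\<lambda>p. LINT y|\<nu>. w y * a y p) - (\<lambda>p. LINT y|\<nu>. v y * a y p))
      = l2_norm M (\<lambda>p. LINT y|\<nu>. (w y - v y) * a y p)"
    using weighted_average(1)[OF a d d'] square_integrable_diff[OF sq]
    by (intro l2_norm_cong_AE square_integrable_measurable)
  also have "\<dots> \<le> (LINT y|\<nu>. \<bar>w y - v y\<bar> * l2_norm M (a y))"
    by (rule weighted_average(2)[OF a d d'])
  finally show ?thesis .
qed

lemma integral_weight_le:
  fixes f w :: "'i \<Rightarrow> real"
  assumes "integrable \<nu> f" "\<And>y. y \<in> space \<nu> \<Longrightarrow> 0 \<le> f y" "w \<in> borel_measurable \<nu>"
    "\<And>y. y \<in> space \<nu> \<Longrightarrow> \<bar>w y\<bar> \<le> 1"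
  shows "(LINT y|\<nu>. \<bar>w y\<bar> * f y) \<le> (LINT y|\<nu>. f y)" "integrable \<nu> (\<lambda>y. \<bar>w y\<bar> * f y)"
proof -
  show i: "integrable \<nu> (\<lambda>y. \<bar>w y\<bar> * f y)"
    using assms by (intro Bochner_Integration.integrable_bound[OF assms(1)])
      (auto intro!: AE_I2 mult_left_le_one_le simp: abs_mult)
  show "(LINT y|\<nu>. \<bar>w y\<bar> * f y) \<le> (LINT y|\<nu>. f y)"
    using assms by (intro integral_mono i) (auto intro!: mult_left_le_one_le)
qed

end

section \<open>Graphon games and network games\<close>

locale graphon_game = concave_game P T F U A0 \<alpha> l l\<^sub>\<theta> L M
  for P :: "'w measure" and T F U A0 \<alpha> l l\<^sub>\<theta> L M +
  fixes \<nu> :: "real measure" and W :: "real \<Rightarrow> real \<Rightarrow> real"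
  assumes index: "extends_unit_lebesgue \<nu>" and W_graphon: "graphon W"
    and W_Lipschitz: "piecewise_lipschitz_graphon W"
begin

lemma prob_\<nu>: "prob_space \<nu>" using index by (simp add: extends_unit_lebesgue_def)

lemma space_\<nu>: "space \<nu> = {0..1}" using index by (simp add: extends_unit_lebesgue_def)

sublocale index_product \<nu> "time_prod P T"
  using prob_\<nu> finite_measure_time_prod[OF prob_space_axioms] by (simp add: index_product_def)

lemma W_bounds: "x \<in> {0..1} \<Longrightarrow> y \<in> {0..1} \<Longrightarrow> W x y \<in> {0..1}"
  using W_graphon unfolding graphon_def by blast

text \<open>\<open>\<nu>\<close> may have more measurable sets than the Lebesgue space, so the Borel
  version of the graphon is composed with the identity from \<open>\<nu>\<close> to the Borel
  line.\<close>

lemma W_measurable: "(\<lambda>q. W (fst q) (snd q)) \<in> borel_measurable (\<nu> \<Otimes>\<^sub>M \<nu>)"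
proof -
  have id: "(\<lambda>q. (fst q, snd q)) \<in> \<nu> \<Otimes>\<^sub>M \<nu> \<rightarrow>\<^sub>M borel \<Otimes>\<^sub>M borel"
    using unit_lebesgue_ident[OF index]
    by (intro measurable_Pair measurable_compose[OF measurable_fst] measurable_compose[OF measurable_snd])
  have "(\<lambda>q. indicator ({0..1} \<times> {0..1}) (fst q, snd q) * W (fst (fst q, snd q)) (snd (fst q, snd q)))
      \<in> borel_measurable (\<nu> \<Otimes>\<^sub>M \<nu>)"
    using graphon_borel[OF W_graphon W_Lipschitz] by (intro measurable_compose[OF id]) (simp add: borel_prod)
  then show ?thesis
    by (rule measurable_cong[THEN iffD1, rotated]) (auto simp: space_pair_measure space_\<nu>)
qed

lemma W_section: "x \<in> {0..1} \<Longrightarrow> W x \<in> borel_measurable \<nu>"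
  using measurable_compose[OF measurable_Pair1' W_measurable, of x] by (simp add: space_\<nu>)

abbreviation Z :: "(real \<Rightarrow> 'w process) \<Rightarrow> real \<Rightarrow> 'w process" where "Z \<equiv> graphon_op \<nu> W"

text \<open>Joint measurability and values in \<open>A0\<close> suffice: boundedness of
  \<open>A0\<close> makes such a family square integrable, so these are exactly the admissible
  profiles.\<close>

definition families :: "(real \<Rightarrow> 'w process) set" where
  "families = {a. case_prod a \<in> borel_measurable (\<nu> \<Otimes>\<^sub>M \<mu>) \<and> (\<forall>x\<in>{0..1}. a x \<in> A0)}"

lemma families_A0: "a \<in> families \<Longrightarrow> x \<in> {0..1} \<Longrightarrow> a x \<in> A0"
  by (simp add: families_def)

lemma families_L2: "a \<in> families \<Longrightarrow> L2_profile \<nu> \<mu> a"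
  by (rule L2_profile_bounded[where B=M]) (auto simp: families_def space_\<nu> A0_sq nrm_A0)

lemma profile_space_iff: "a \<in> profile_space \<nu> P T F \<longleftrightarrow> L2_profile \<nu> \<mu> a \<and> (\<forall>x\<in>{0..1}. a x \<in> K)"
  by (auto simp: profile_space_def L2_profile_def space_\<nu> K_sq)

lemma profile_norm_eq: "profile_norm \<nu> P T a = l2_norm (\<nu> \<Otimes>\<^sub>M \<mu>) (case_prod a)"
  by (simp add: profile_norm_def l2_norm_def case_prod_beta')

lemma Z_measurable:
  assumes "a \<in> families" shows "case_prod (Z a) \<in> borel_measurable (\<nu> \<Otimes>\<^sub>M \<mu>)"
proof -
  have a: "case_prod a \<in> borel_measurable (\<nu> \<Otimes>\<^sub>M \<mu>)" using assms by (simp add: families_def)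
  have "(\<lambda>r. W (fst (fst (fst r), snd r)) (snd (fst (fst r), snd r))) \<in> borel_measurable ((\<nu> \<Otimes>\<^sub>M \<mu>) \<Otimes>\<^sub>M \<nu>)"
    by (rule measurable_compose[OF _ W_measurable]) simp
  moreover have "(\<lambda>r. case_prod a (snd r, snd (fst r))) \<in> borel_measurable ((\<nu> \<Otimes>\<^sub>M \<mu>) \<Otimes>\<^sub>M \<nu>)"
    by (rule measurable_compose[OF _ a]) simp
  ultimately have "(\<lambda>(q, y). W (fst q) y * a y (snd q)) \<in> borel_measurable ((\<nu> \<Otimes>\<^sub>M \<mu>) \<Otimes>\<^sub>M \<nu>)"
    by (simp add: case_prod_beta')
  from I.borel_measurable_lebesgue_integral[OF this]
  show ?thesis by (simp add: graphon_op_def case_prod_beta')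
qed

lemma Z_bounded:
  assumes a: "a \<in> families" and x: "x \<in> {0..1}"
  shows "square_integrable \<mu> (Z a x)" "nrm (Z a x) \<le> M"
proof -
  have w1: "\<And>y. y \<in> space \<nu> \<Longrightarrow> \<bar>W x y\<bar> \<le> 1" using W_bounds[OF x] by (auto simp: space_\<nu>)
  note avg = weighted_average[OF families_L2[OF a] W_section[OF x] w1]
  show "square_integrable \<mu> (Z a x)" using avg(1) by (simp add: graphon_op_def)
  have "nrm (Z a x) \<le> (LINT y|\<nu>. \<bar>W x y\<bar> * nrm (a y))" using avg(2) by (simp add: graphon_op_def)
  also have "\<dots> \<le> (LINT y|\<nu>. nrm (a y))"
    using L2_profile_mean_norm(1)[OF families_L2[OF a]] W_section[OF x] w1 by (intro integral_weight_le) auto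
  also have "\<dots> \<le> (LINT y|\<nu>. M)"
    using families_A0[OF a] nrm_A0 by (intro integral_mono L2_profile_mean_norm(1)[OF families_L2[OF a]])
      (auto simp: space_\<nu>)
  finally show "nrm (Z a x) \<le> M" by (simp add: I.prob_space)
qed

lemma Z_L2: "a \<in> families \<Longrightarrow> L2_profile \<nu> \<mu> (Z a)"
  using Z_measurable Z_bounded by (intro L2_profile_bounded[where B=M]) (auto simp: space_\<nu>)

lemma Z_diff:
  assumes a: "a \<in> families" and b: "b \<in> families" and x: "x \<in> {0..1}"
  shows "nrm (Z a x - Z b x) \<le> (LINT y|\<nu>. nrm (a y - b y))"
proof -
  have w1: "\<And>y. y \<in> space \<nu> \<Longrightarrow> \<bar>W x y\<bar> \<le> 1" using W_bounds[OF x] by (auto simp: space_\<nu>)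
  have "nrm (Z a x - Z b x) \<le> (LINT y|\<nu>. \<bar>W x y\<bar> * nrm (a y - b y))"
    unfolding graphon_op_def
    by (rule weighted_average_diff_profile[OF families_L2[OF a] families_L2[OF b] W_section[OF x] w1])
  also have "\<dots> \<le> (LINT y|\<nu>. nrm (a y - b y))"
    using L2_profile_mean_norm(1)[OF L2_profile_diff[OF families_L2[OF a] families_L2[OF b]]] W_section[OF x] w1
    by (intro integral_weight_le) auto
  finally show ?thesis .
qed

text \<open>The average is approximated by averages of families that take finitely many values, which are
  finite linear combinations of elements of \<open>\<A>\<close>.\<close>

lemma Z_in_K:
  assumes a: "a \<in> families" and x: "x \<in> {0..1}"
  shows "Z a x \<in> K"
proof -
  have aL: "L2_profile \<nu> \<mu> a" by (rule families_L2[OF a])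
  have am: "case_prod a \<in> borel_measurable (\<nu> \<Otimes>\<^sub>M \<mu>)" using a by (simp add: families_def)
  have aA: "\<And>y. y \<in> space \<nu> \<Longrightarrow> a y \<in> A0" using families_A0[OF a] by (simp add: space_\<nu>)
  obtain d :: "nat \<Rightarrow> real" and \<kappa> where d: "\<And>n. d n \<in> space \<nu>" and \<kappa>: "\<And>m. \<kappa> m \<in> \<nu> \<rightarrow>\<^sub>M count_space UNIV"
    and app: "\<And>m y. y \<in> space \<nu> \<Longrightarrow> nrm (a y - a (d (\<kappa> m y))) + nrm (a y - a (d (\<kappa> m y))) < (1 / 2) ^ m"
    using countable_index_approximation[OF am A0_sq[OF aA] am A0_sq[OF aA]] by blast
  define b where "b m y = a (d (\<kappa> m y))" for m y
  have bf: "b m \<in> families" for m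
  proof -
    have "(\<lambda>q. a (d (\<kappa> m (fst q))) (snd q)) \<in> borel_measurable (\<nu> \<Otimes>\<^sub>M \<mu>)"
    proof (rule measurable_compose_countable[where g="\<lambda>q. \<kappa> m (fst q)" and f="\<lambda>n q. a (d n) (snd q)"])
      show "(\<lambda>q. a (d n) (snd q)) \<in> borel_measurable (\<nu> \<Otimes>\<^sub>M \<mu>)" for n
        by (rule measurable_compose[OF measurable_snd square_integrable_measurable[OF A0_sq[OF aA[OF d]]]])
      show "(\<lambda>q. \<kappa> m (fst q)) \<in> \<nu> \<Otimes>\<^sub>M \<mu> \<rightarrow>\<^sub>M count_space UNIV"
        by (rule measurable_compose[OF measurable_fst \<kappa>])
    qed
    then show ?thesis using aA d by (simp add: families_def b_def case_prod_beta')
  qed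
  have near: "nrm (Z a x - Z (b m) x) \<le> (1 / 2) ^ m" for m
  proof -
    have "nrm (Z a x - Z (b m) x) \<le> (LINT y|\<nu>. nrm (a y - b m y))" by (rule Z_diff[OF a bf x])
    also have "\<dots> \<le> (LINT y|\<nu>. (1 / 2) ^ m)"
    proof (rule integral_mono)
      show "integrable \<nu> (\<lambda>y. nrm (a y - b m y))"
        using L2_profile_mean_norm(1)[OF L2_profile_diff[OF aL families_L2[OF bf]]] by simp
      fix y assume "y \<in> space \<nu>"
      from app[OF this, of m] show "nrm (a y - b m y) \<le> (1 / 2) ^ m"
        using l2_norm_nonneg[of \<mu> "a y - b m y"] unfolding b_def by linarith
    qed simp
    finally show ?thesis by (simp add: I.prob_space)
  qed
  have bK: "Z (b m) x \<in> K" for m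
  proof -
    \<comment> \<open>Truncating the weight to the first \<open>n\<close> values of
      \<open>\<kappa> m\<close> leaves a finite linear combination of elements of \<open>A0\<close>.
      The mass that is cut off tends to 0 because the sets \<open>\<kappa> m y < n\<close> exhaust
      the index space.\<close>
    define w where "w n y = W x y * indicator {y. \<kappa> m y < n} y" for n y
    define c where "c n p = (LINT y|\<nu>. w n y * b m y p)" for n p
    have set: "{y \<in> space \<nu>. \<kappa> m y < n} \<in> sets \<nu>" for n using \<kappa>[of m] by measurable
    have wm: "w n \<in> borel_measurable \<nu>" for n
    proof -
      have "(\<lambda>y. W x y * indicator {y \<in> space \<nu>. \<kappa> m y < n} y) \<in> borel_measurable \<nu>"
        using W_section[OF x] set by simp
      then show ?thesis by (rule measurable_cong[THEN iffD1, rotated]) (auto simp: w_def indicator_def)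
    qed
    have w01: "w n y \<in> {0..1}" if "y \<in> space \<nu>" for n y
      using W_bounds[OF x, of y] that by (auto simp: w_def indicator_def space_\<nu>)
    have cK: "c n \<in> K" for n
    proof -
      have "w n y * b m y p = (\<Sum>k<n. (W x y * indicator {y. \<kappa> m y = k} y) * a (d k) p)" for y p
      proof -
        have "(\<Sum>k<n. (W x y * indicator {y. \<kappa> m y = k} y) * a (d k) p)
            = (\<Sum>k<n. if k = \<kappa> m y then W x y * a (d k) p else 0)"
          by (intro sum.cong) (auto simp: indicator_def)
        then show ?thesis by (simp add: w_def b_def indicator_def)
      qed
      moreover have "integrable \<nu> (\<lambda>y. W x y * indicator {y. \<kappa> m y = k} y)" for k
      proof (rule I.integrable_const_bound[where B=1])
        have "{y \<in> space \<nu>. \<kappa> m y = k} \<in> sets \<nu>" using \<kappa>[of m] by measurable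
        then have "(\<lambda>y. W x y * indicator {y \<in> space \<nu>. \<kappa> m y = k} y) \<in> borel_measurable \<nu>"
          using W_section[OF x] by simp
        then show "(\<lambda>y. W x y * indicator {y. \<kappa> m y = k} y) \<in> borel_measurable \<nu>"
          by (rule measurable_cong[THEN iffD1, rotated]) (auto simp: indicator_def)
      qed (use W_bounds[OF x] in \<open>auto simp: space_\<nu> indicator_def\<close>)
      ultimately have "c n = (\<lambda>p. \<Sum>k<n. (LINT y|\<nu>. W x y * indicator {y. \<kappa> m y = k} y) * a (d k) p)"
        by (simp add: c_def fun_eq_iff)
      then show ?thesis using A0_K[OF aA[OF d]] by (auto intro: proc_space_sum)
    qed
    have cn: "nrm (c n - Z (b m) x) \<le> M * (1 - measure \<nu> {y \<in> space \<nu>. \<kappa> m y < n})" for n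
    proof -
      let ?R = "space \<nu> - {y \<in> space \<nu>. \<kappa> m y < n}"
      have "nrm (Z (b m) x - c n) \<le> (LINT y|\<nu>. \<bar>W x y - w n y\<bar> * nrm (b m y))"
        unfolding graphon_op_def c_def
        using W_bounds[OF x] w01
        by (intro weighted_average_diff_weight families_L2 bf W_section[OF x] wm) (auto simp: space_\<nu>)
      also have "\<dots> \<le> (LINT y|\<nu>. M * indicator ?R y)"
      proof (rule integral_mono)
        show "integrable \<nu> (\<lambda>y. \<bar>W x y - w n y\<bar> * nrm (b m y))"
        proof (rule integral_weight_le(2))
          show "\<bar>W x y - w n y\<bar> \<le> 1" if "y \<in> space \<nu>" for y
            using W_bounds[OF x, of y] w01[OF that, of n] that by (auto simp: space_\<nu> abs_le_iff)
        qed (use W_section[OF x] wm[of n] L2_profile_mean_norm(1)[OF families_L2[OF bf]] in auto)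
        show "integrable \<nu> (\<lambda>y. M * indicator ?R y)"
          using set[of n] by (intro integrable_mult_right integrable_real_indicator)
            (auto simp: I.emeasure_eq_measure)
        fix y assume y: "y \<in> space \<nu>"
        have "nrm (b m y) \<le> M" using families_A0[OF bf, of y m] y by (simp add: nrm_A0 space_\<nu>)
        moreover have "\<bar>W x y\<bar> \<le> 1" using W_bounds[OF x, of y] y by (auto simp: space_\<nu>)
        ultimately have "\<bar>W x y\<bar> * nrm (b m y) \<le> 1 * M" by (intro mult_mono) auto
        then show "\<bar>W x y - w n y\<bar> * nrm (b m y) \<le> M * indicator ?R y"
          using y by (auto simp: w_def indicator_def)
      qed
      also have "\<dots> = M * measure \<nu> ?R" using set[of n] by simp
      also have "measure \<nu> ?R = 1 - measure \<nu> {y \<in> space \<nu>. \<kappa> m y < n}"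
        by (rule I.prob_compl[OF set])
      finally show ?thesis by (subst l2_norm_minus_commute)
    qed
    have "(\<lambda>n. measure \<nu> {y \<in> space \<nu>. \<kappa> m y < n}) \<longlonglongrightarrow> measure \<nu> (\<Union>n. {y \<in> space \<nu>. \<kappa> m y < n})"
      using set by (intro I.finite_Lim_measure_incseq) (auto simp: incseq_def)
    also have "(\<Union>n. {y \<in> space \<nu>. \<kappa> m y < n}) = space \<nu>" by auto
    finally have "(\<lambda>n. M * (1 - measure \<nu> {y \<in> space \<nu>. \<kappa> m y < n})) \<longlonglongrightarrow> M * (1 - 1)"
      unfolding I.prob_space by (intro tendsto_intros)
    then have upper: "(\<lambda>n. M * (1 - measure \<nu> {y \<in> space \<nu>. \<kappa> m y < n})) \<longlonglongrightarrow> 0" by simp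
    have lim: "(\<lambda>n. nrm (c n - Z (b m) x)) \<longlonglongrightarrow> 0"
      by (rule tendsto_sandwich[OF _ _ tendsto_const upper]) (simp_all add: cn)
    show ?thesis by (rule proc_space_closed[OF prob_space_axioms cK Z_bounded(1)[OF bf x] lim])
  qed
  have "(\<lambda>m. nrm (Z (b m) x - Z a x)) \<longlonglongrightarrow> 0"
  proof (rule tendsto_sandwich[where f="\<lambda>_. 0" and h="\<lambda>m. (1 / 2) ^ m"])
    show "(\<lambda>m. (1 / 2) ^ m) \<longlonglongrightarrow> (0::real)" by (rule LIMSEQ_power_zero) simp
    show "\<forall>\<^sub>F m in sequentially. nrm (Z (b m) x - Z a x) \<le> (1 / 2) ^ m"
      by (intro always_eventually allI) (subst l2_norm_minus_commute, rule near)
  qed auto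
  then show ?thesis by (rule proc_space_closed[OF prob_space_axioms bK Z_bounded(1)[OF a x]])
qed

text \<open>Closedness, applied to the constant sequence \<open>a\<close>, also covers limits at
  distance 0. This keeps the measurable version of a best response inside the action set.\<close>

lemma A0_equivalent:
  assumes a: "a \<in> A0" and b: "square_integrable \<mu> b" and ab: "nrm (a - b) = 0"
  shows "b \<in> A0"
proof -
  have lim: "(\<lambda>n::nat. nrm (a - b)) \<longlonglongrightarrow> 0" using ab by simp
  have "b \<in> K" by (rule proc_space_closed[OF prob_space_axioms A0_K[OF a] b lim])
  moreover have "\<forall>\<sigma> a. (\<forall>n::nat. \<sigma> n \<in> A0) \<and> a \<in> K \<and> (\<lambda>n. nrm (\<sigma> n - a)) \<longlonglongrightarrow> 0 \<longrightarrow> a \<in> A0"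
    using A0_closed unfolding closed_convex_in_def proc_norm_eq by (elim conjE)
  ultimately show ?thesis using a lim by (auto dest!: spec[of _ "\<lambda>_. a"] spec[of _ b])
qed

definition gnash :: "(real \<Rightarrow> 'w process) \<Rightarrow> (real \<Rightarrow> 'w process) \<Rightarrow> bool" where
  "gnash \<eta> a \<longleftrightarrow> a \<in> families \<and> (\<forall>x\<in>{0..1}. best (Z a x) (\<eta> x) (a x))"

lemma graphon_nash_iff:
  assumes "\<And>y. y \<in> {0..1} \<Longrightarrow> A y = A0"
  shows "graphon_nash \<nu> P T F A U \<eta> W a \<longleftrightarrow> gnash \<eta> a"
proof
  assume "graphon_nash \<nu> P T F A U \<eta> W a"
  then show "gnash \<eta> a"
    using assms by (auto simp: graphon_nash_def gnash_def best_def admissible_profiles_def families_def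
        profile_space_iff L2_profile_def)
next
  assume "gnash \<eta> a"
  then show "graphon_nash \<nu> P T F A U \<eta> W a"
    using assms families_L2[of a] families_A0[of a] A0_K
    by (auto simp: graphon_nash_def gnash_def best_def admissible_profiles_def profile_space_iff)
qed

lemma best_Lipschitz_const:
  assumes "best z h a" "best z' h' a'" "z \<in> K" "z' \<in> K" "h \<in> K" "h' \<in> K"
  shows "nrm (a - a') \<le> (l + l\<^sub>\<theta>) / \<alpha> * (nrm (z - z') + nrm (h - h'))"
proof -
  have "l * nrm (z - z') + l\<^sub>\<theta> * nrm (h - h') \<le> (l + l\<^sub>\<theta>) * (nrm (z - z') + nrm (h - h'))"
    using l_nonneg l\<^sub>\<theta>_nonneg by (simp add: algebra_simps)
  then have "\<alpha> * nrm (a - a') \<le> (l + l\<^sub>\<theta>) * (nrm (z - z') + nrm (h - h'))"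
    using best_Lipschitz[OF assms] by linarith
  then show ?thesis using \<alpha>_pos by (simp add: pos_le_divide_eq mult.commute)
qed

text \<open>The iteration needs best responses that again form a measurable family. Their Lipschitz
  dependence on aggregate and heterogeneity allows the choices made player by player to be replaced
  by a jointly measurable version.\<close>

lemma gnash_exists:
  assumes \<eta>: "\<eta> \<in> profile_space \<nu> P T F"
  shows "\<exists>a. gnash \<eta> a"
proof -
  have \<eta>K: "\<And>x. x \<in> {0..1} \<Longrightarrow> \<eta> x \<in> K" and \<eta>L: "L2_profile \<nu> \<mu> \<eta>"
    using \<eta> by (auto simp: profile_space_iff)
  have "\<exists>a\<in>families. \<forall>x\<in>{0..1}. best (Z a x) (\<eta> x) (a x)"
  proof (rule equilibrium_exists)
    obtain a0 where a0: "a0 \<in> A0" using A0_nonempty by auto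
    have "case_prod (\<lambda>x::real. a0) \<in> borel_measurable (\<nu> \<Otimes>\<^sub>M \<mu>)"
      using square_integrable_measurable[OF A0_sq[OF a0]] by (simp add: case_prod_beta')
    then have "(\<lambda>x. a0) \<in> families" using a0 by (simp add: families_def)
    then show "families \<noteq> {}" by auto
    show "nrm (Z a x - Z b x) \<le> c" if ab: "a \<in> families" "b \<in> families" and x: "x \<in> {0..1}"
      and c: "\<And>y. y \<in> {0..1} \<Longrightarrow> nrm (a y - b y) \<le> c" for a b c x
    proof -
      have "nrm (Z a x - Z b x) \<le> (LINT y|\<nu>. nrm (a y - b y))" by (rule Z_diff[OF ab x])
      also have "\<dots> \<le> (LINT y|\<nu>. c)"
        using L2_profile_mean_norm(1)[OF L2_profile_diff[OF families_L2[OF ab(1)] families_L2[OF ab(2)]]] c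
        by (intro integral_mono) (auto simp: space_\<nu>)
      finally show ?thesis by (simp add: I.prob_space)
    qed
    show "\<exists>b\<in>families. \<forall>x\<in>{0..1}. best (Z a x) (\<eta> x) (b x)" if a: "a \<in> families" for a
    proof -
      have "\<forall>x. \<exists>c. x \<in> {0..1} \<longrightarrow> best (Z a x) (\<eta> x) c"
        using best_exists Z_in_K[OF a] \<eta>K by blast
      then have "\<exists>r. \<forall>x. x \<in> {0..1} \<longrightarrow> best (Z a x) (\<eta> x) (r x)" by (rule choice)
      then obtain r where r: "\<And>x. x \<in> {0..1} \<Longrightarrow> best (Z a x) (\<eta> x) (r x)" by auto
      have rA: "\<And>x. x \<in> {0..1} \<Longrightarrow> r x \<in> A0" using r by (auto simp: best_iff)
      have c: "0 \<le> (l + l\<^sub>\<theta>) / \<alpha>" using l_nonneg l\<^sub>\<theta>_nonneg \<alpha>_pos by simp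
      have \<eta>m: "case_prod \<eta> \<in> borel_measurable (\<nu> \<Otimes>\<^sub>M \<mu>)" using \<eta>L by (simp add: L2_profile_def)
      obtain r' where r': "case_prod r' \<in> borel_measurable (\<nu> \<Otimes>\<^sub>M \<mu>)"
        "\<And>x. x \<in> space \<nu> \<Longrightarrow> square_integrable \<mu> (r' x) \<and> nrm (r x - r' x) = 0"
      proof (rule Lipschitz_selection[where f="Z a" and g=\<eta> and r=r and c="(l + l\<^sub>\<theta>) / \<alpha>"])
        show "nrm (r x - r y) \<le> (l + l\<^sub>\<theta>) / \<alpha> * (nrm (Z a x - Z a y) + nrm (\<eta> x - \<eta> y))"
          if "x \<in> space \<nu>" "y \<in> space \<nu>" for x y
          using that r Z_in_K[OF a] \<eta>K by (intro best_Lipschitz_const) (auto simp: space_\<nu>)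
      qed (use Z_measurable[OF a] \<eta>m Z_bounded(1)[OF a] \<eta>K K_sq rA A0_sq c in \<open>auto simp: space_\<nu>\<close>)
      have r'A: "r' x \<in> A0" if "x \<in> {0..1}" for x
        using r'(2)[of x] rA[OF that] A0_equivalent that by (auto simp: space_\<nu>)
      have "best (Z a x) (\<eta> x) (r' x)" if "x \<in> {0..1}" for x
        using best_cong[OF r[OF that] r'A[OF that] _ Z_in_K[OF a that] \<eta>K[OF that]] r'(2)[of x] that
        by (simp add: space_\<nu>)
      then show ?thesis using r'(1) r'A by (intro bexI[of _ r']) (auto simp: families_def)
    qed
    show "(\<lambda>x p. lim (\<lambda>n. a n x p)) \<in> families"
      if a: "\<And>n::nat. a n \<in> families" and lim: "\<And>x. x \<in> {0..1} \<Longrightarrow> (\<lambda>p. lim (\<lambda>n. a n x p)) \<in> A0" for a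
    proof -
      have "(\<lambda>q. lim (\<lambda>n. case_prod (a n) q)) \<in> borel_measurable (\<nu> \<Otimes>\<^sub>M \<mu>)"
        using a by (intro borel_measurable_lim_metric) (auto simp: families_def)
      then show ?thesis using lim by (simp add: families_def case_prod_beta')
    qed
  qed (use families_A0 Z_in_K \<eta>K in auto)
  then show ?thesis by (auto simp: gnash_def)
qed

text \<open>Best responses are Lipschitz in aggregate and heterogeneity, hence so is the integrand,
  which gives its measurability. The bound compares it with the utility at a fixed action and zero
  data.\<close>

lemma gnash_welfare_integrable:
  assumes \<eta>: "\<eta> \<in> profile_space \<nu> P T F" and a: "gnash \<eta> a"
  shows "integrable \<nu> (\<lambda>x. U (a x) (Z a x) (\<eta> x))"
proof -
  have \<eta>K: "\<And>x. x \<in> {0..1} \<Longrightarrow> \<eta> x \<in> K" and \<eta>L: "L2_profile \<nu> \<mu> \<eta>"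
    using \<eta> by (auto simp: profile_space_iff)
  have af: "a \<in> families" and ab: "\<And>x. x \<in> {0..1} \<Longrightarrow> best (Z a x) (\<eta> x) (a x)"
    using a by (auto simp: gnash_def)
  have aA: "\<And>x. x \<in> {0..1} \<Longrightarrow> a x \<in> A0" and ZK: "\<And>x. x \<in> {0..1} \<Longrightarrow> Z a x \<in> K"
    using families_A0[OF af] Z_in_K[OF af] by auto
  let ?\<phi> = "\<lambda>x. U (a x) (Z a x) (\<eta> x)"
  let ?c = "(l + l\<^sub>\<theta>) / \<alpha>"
  have c: "0 \<le> ?c" using l_nonneg l\<^sub>\<theta>_nonneg \<alpha>_pos by simp
  have meas: "?\<phi> \<in> borel_measurable \<nu>"
  proof (rule Lipschitz_functional_measurable[where f="Z a" and g=\<eta> and c="L * (?c + 1)"])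
    fix x y assume xy: "x \<in> space \<nu>" "y \<in> space \<nu>"
    then have x: "x \<in> {0..1}" and y: "y \<in> {0..1}" by (auto simp: space_\<nu>)
    have "\<bar>?\<phi> x - ?\<phi> y\<bar> \<le> L * (nrm (a x - a y) + nrm (Z a x - Z a y) + nrm (\<eta> x - \<eta> y))"
      using x y by (intro U_lip aA ZK \<eta>K)
    also have "\<dots> \<le> L * (?c * (nrm (Z a x - Z a y) + nrm (\<eta> x - \<eta> y)) + nrm (Z a x - Z a y) + nrm (\<eta> x - \<eta> y))"
      using x y by (intro mult_left_mono add_mono best_Lipschitz_const ab ZK \<eta>K L_nonneg order_refl)
    finally show "\<bar>?\<phi> x - ?\<phi> y\<bar> \<le> L * (?c + 1) * (nrm (Z a x - Z a y) + nrm (\<eta> x - \<eta> y))"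
      by (simp add: algebra_simps)
  qed (use Z_measurable[OF af] \<eta>L \<eta>K K_sq ZK c L_nonneg in \<open>auto simp: space_\<nu> L2_profile_def\<close>)
  obtain a0 where a0: "a0 \<in> A0" using A0_nonempty by auto
  let ?u = "U a0 (\<lambda>p. 0) (\<lambda>p. 0)"
  show ?thesis
  proof (rule Bochner_Integration.integrable_bound[OF _ meas])
    show "integrable \<nu> (\<lambda>x. \<bar>?u\<bar> + L * (2 * M + M + nrm (\<eta> x)))"
      using L2_profile_mean_norm(1)[OF \<eta>L]
      by (intro Bochner_Integration.integrable_add integrable_mult_right) auto
    show "AE x in \<nu>. norm (?\<phi> x) \<le> norm (\<bar>?u\<bar> + L * (2 * M + M + nrm (\<eta> x)))"
    proof (rule AE_I2)
      fix x assume "x \<in> space \<nu>"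
      then have x: "x \<in> {0..1}" by (simp add: space_\<nu>)
      have zero: "b - (\<lambda>p. 0) = b" for b :: "'w process" by (simp add: fun_eq_iff)
      have "\<bar>?\<phi> x - ?u\<bar> \<le> L * (nrm (a x - a0) + nrm (Z a x) + nrm (\<eta> x))"
        using U_lip[OF aA[OF x] a0 ZK[OF x] proc_space_zero \<eta>K[OF x] proc_space_zero] by (simp only: zero)
      also have "\<dots> \<le> L * (2 * M + M + nrm (\<eta> x))"
        using nrm_A0_diff[OF aA[OF x] a0] Z_bounded(2)[OF af x] L_nonneg by (intro mult_left_mono add_mono) auto
      finally show "norm (?\<phi> x) \<le> norm (\<bar>?u\<bar> + L * (2 * M + M + nrm (\<eta> x)))" by simp
    qed
  qed
qed

end

text \<open>\<open>\<Delta>\<close>, \<open>z\<close> and \<open>h\<close> stand for the mean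
  distances of actions, aggregates and heterogeneities of two equilibria, and \<open>e\<close> for
  the discrepancy of the aggregation operators on a fixed action profile. Since
  \<open>l < \<alpha>\<close>, inserting the bound on \<open>z\<close> lets \<open>\<Delta>\<close>
  be absorbed on the left.\<close>

lemma contraction_estimate:
  fixes \<alpha> l k \<Delta> z e h :: real
  assumes "0 \<le> l" "0 \<le> k" "l < \<alpha>" "0 \<le> e" "0 \<le> h" "\<alpha> * \<Delta> \<le> l * z + k * h" "z \<le> \<Delta> + e"
  shows "\<Delta> + z + h \<le> (2 * (l + k) / (\<alpha> - l) + 1) * (e + h)"
proof -
  have "l * z \<le> l * (\<Delta> + e)" using assms by (intro mult_left_mono)
  then have "(\<alpha> - l) * \<Delta> \<le> l * e + k * h" using assms(6) by (simp add: algebra_simps)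
  also have "\<dots> \<le> (l + k) * (e + h)" using assms by (simp add: algebra_simps)
  finally have "\<Delta> \<le> (l + k) * (e + h) / (\<alpha> - l)" using assms by (simp add: pos_le_divide_eq mult.commute)
  moreover have "(2 * (l + k) / (\<alpha> - l) + 1) * (e + h) = 2 * ((l + k) * (e + h) / (\<alpha> - l)) + (e + h)"
    by (simp add: algebra_simps)
  ultimately show ?thesis using assms(7) by linarith
qed

text \<open>Here \<open>f\<close> is the graphon solution and \<open>g\<close> the step profile of
  its samples. Rescaling \<open>g\<close> to the norm of \<open>f\<close> moves it by the difference
  of the two norms, which costs the distance of \<open>f\<close> and \<open>g\<close> once
  more.\<close>

lemma l2_norm_rescaled_diff:
  assumes f: "square_integrable M f" and g: "square_integrable M g"
  defines "s \<equiv> l2_norm M g / l2_norm M f"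
  shows "l2_norm M (f - (\<lambda>x. g x / s)) \<le> 2 * l2_norm M (f - g)" "l2_norm M (\<lambda>x. g x / s) \<le> l2_norm M f"
proof -
  have gs: "(\<lambda>x. g x / s) = (\<lambda>x. (1 / s) * g x)" by simp
  have sq: "square_integrable M (\<lambda>x. g x / s)" unfolding gs by (rule square_integrable_cmult[OF g])
  have n: "l2_norm M (\<lambda>x. g x / s) = \<bar>1 / s\<bar> * l2_norm M g" unfolding gs by (rule l2_norm_cmult)
  show "l2_norm M (\<lambda>x. g x / s) \<le> l2_norm M f" unfolding n
    by (cases "l2_norm M g = 0") (simp_all add: s_def)
  have rev: "\<bar>l2_norm M f - l2_norm M g\<bar> \<le> l2_norm M (f - g)"
    using l2_norm_le_add[OF f g] l2_norm_le_add[OF g f] l2_norm_minus_commute[of M f g] by linarith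
  show "l2_norm M (f - (\<lambda>x. g x / s)) \<le> 2 * l2_norm M (f - g)"
  proof (cases "s = 0")
    \<comment> \<open>One of the norms is 0, and division by \<open>s\<close> yields 0 by
      convention. The distance is then the norm of \<open>f\<close>, which the reverse triangle
      inequality bounds.\<close>
    case True
    then have "l2_norm M f = 0 \<or> l2_norm M g = 0" by (auto simp: s_def)
    moreover have "f - (\<lambda>x. g x / s) = f" using True by (simp add: fun_eq_iff)
    ultimately have "l2_norm M (f - (\<lambda>x. g x / s)) \<le> l2_norm M (f - g)" using rev by auto
    also have "\<dots> \<le> 2 * l2_norm M (f - g)" by simp
    finally show ?thesis .
  next
    case False
    then have fg: "l2_norm M f > 0" "l2_norm M g > 0" by (auto simp: s_def less_le)
    have "g - (\<lambda>x. g x / s) = (\<lambda>x. (1 - 1 / s) * g x)" by (simp add: fun_eq_iff algebra_simps)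
    then have "l2_norm M (g - (\<lambda>x. g x / s)) = \<bar>1 - 1 / s\<bar> * l2_norm M g" by (simp only: l2_norm_cmult)
    also have "\<dots> = \<bar>(1 - 1 / s) * l2_norm M g\<bar>" by (simp add: abs_mult)
    also have "(1 - 1 / s) * l2_norm M g = l2_norm M g - l2_norm M f" using fg by (simp add: s_def field_simps)
    finally show ?thesis using l2_norm_diff_triangle[OF f g sq] rev by linarith
  qed
qed

section \<open>Equilibria of network games\<close>

context graphon_game
begin

definition unit_weights :: "nat \<Rightarrow> (nat \<Rightarrow> nat \<Rightarrow> real) \<Rightarrow> bool" where
  "unit_weights N G \<longleftrightarrow> (\<forall>i\<in>{1..N}. \<forall>j\<in>{1..N}. G i j \<in> {0..1})"

definition nnash :: "nat \<Rightarrow> (nat \<Rightarrow> nat \<Rightarrow> real) \<Rightarrow> (nat \<Rightarrow> 'w process) \<Rightarrow> (nat \<Rightarrow> 'w process) \<Rightarrow> bool" where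
  "nnash N G \<eta> b \<longleftrightarrow> (\<forall>i\<in>{1..N}. best (network_agg N G b i) (\<eta> i) (b i))"

lemma network_nash_iff: "network_nash N A0 U \<eta> G b \<longleftrightarrow> nnash N G \<eta> b"
  by (simp add: network_nash_def nnash_def best_def)

lemma nnash_A0: "nnash N G \<eta> b \<Longrightarrow> i \<in> {1..N} \<Longrightarrow> b i \<in> A0"
  by (auto simp: nnash_def best_iff)

lemma network_agg_eq: "network_agg N G b i = (\<lambda>p. \<Sum>j=1..N. (1 / real N * G i j) * b j p)"
  by (simp add: network_agg_def sum_distrib_left mult.assoc)

lemma network_agg_K:
  assumes "\<And>j. j \<in> {1..N} \<Longrightarrow> b j \<in> A0" shows "network_agg N G b i \<in> K"
  unfolding network_agg_eq using assms A0_K by (intro proc_space_sum) auto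

text \<open>The bound is a mean over the players and does not depend on \<open>i\<close> or on the
  graph. The contraction condition thus needs no information on the spectrum of
  \<open>G\<close>.\<close>

lemma network_agg_diff:
  assumes G: "unit_weights N G" and i: "i \<in> {1..N}"
    and b: "\<And>j. j \<in> {1..N} \<Longrightarrow> b j \<in> A0" and b': "\<And>j. j \<in> {1..N} \<Longrightarrow> b' j \<in> A0"
  shows "nrm (network_agg N G b i - network_agg N G b' i) \<le> 1 / real N * (\<Sum>j=1..N. nrm (b j - b' j))"
proof -
  have "network_agg N G b i - network_agg N G b' i = (\<lambda>p. \<Sum>j=1..N. (1 / real N * G i j) * (b j - b' j) p)"
    by (simp add: network_agg_eq fun_eq_iff right_diff_distrib sum_subtractf)
  then have "nrm (network_agg N G b i - network_agg N G b' i) \<le> (\<Sum>j=1..N. \<bar>1 / real N * G i j\<bar> * nrm (b j - b' j))"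
    using b b' A0_sq by (simp only:) (intro l2_norm_sum square_integrable_diff, auto)
  also have "\<dots> \<le> (\<Sum>j=1..N. 1 / real N * nrm (b j - b' j))"
  proof (intro sum_mono mult_right_mono l2_norm_nonneg)
    fix j assume "j \<in> {1..N}"
    then have "G i j \<in> {0..1}" using G i by (auto simp: unit_weights_def)
    then show "\<bar>1 / real N * G i j\<bar> \<le> 1 / real N" by (auto simp: abs_mult divide_right_mono)
  qed
  finally show ?thesis by (simp add: sum_distrib_left)
qed

lemma network_agg_diff_weights:
  assumes b: "\<And>j. j \<in> {1..N} \<Longrightarrow> b j \<in> A0"
  shows "nrm (network_agg N G b i - network_agg N G' b i) \<le> 1 / real N * (\<Sum>j=1..N. \<bar>G i j - G' i j\<bar> * M)"
proof -
  have "network_agg N G b i - network_agg N G' b i = (\<lambda>p. \<Sum>j=1..N. (1 / real N * (G i j - G' i j)) * b j p)"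
    by (simp add: network_agg_eq fun_eq_iff right_diff_distrib left_diff_distrib sum_subtractf)
  then have "nrm (network_agg N G b i - network_agg N G' b i) \<le> (\<Sum>j=1..N. \<bar>1 / real N * (G i j - G' i j)\<bar> * nrm (b j))"
    using b A0_sq by (simp only:) (intro l2_norm_sum, auto)
  also have "\<dots> \<le> (\<Sum>j=1..N. \<bar>1 / real N * (G i j - G' i j)\<bar> * M)"
    using b nrm_A0 by (intro sum_mono mult_left_mono) auto
  finally show ?thesis by (simp add: sum_distrib_left abs_mult mult.assoc)
qed

lemma nnash_exists:
  assumes N: "1 \<le> N" and G: "unit_weights N G" and \<eta>: "\<eta> \<in> net_space P T F N"
  shows "\<exists>b. nnash N G \<eta> b"
proof -
  let ?\<P> = "{b. \<forall>i\<in>{1..N}. b i \<in> A0}"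
  have \<eta>K: "\<And>i. i \<in> {1..N} \<Longrightarrow> \<eta> i \<in> K" using \<eta> by (auto simp: net_space_def)
  have "\<exists>b\<in>?\<P>. \<forall>i\<in>{1..N}. best (network_agg N G b i) (\<eta> i) (b i)"
  proof (rule equilibrium_exists)
    show "?\<P> \<noteq> {}" using A0_nonempty by auto
    show "nrm (network_agg N G a i - network_agg N G b i) \<le> c"
      if "a \<in> ?\<P>" "b \<in> ?\<P>" "i \<in> {1..N}" and c: "\<And>j. j \<in> {1..N} \<Longrightarrow> nrm (a j - b j) \<le> c" for a b c i
    proof -
      have "nrm (network_agg N G a i - network_agg N G b i) \<le> 1 / real N * (\<Sum>j=1..N. nrm (a j - b j))"
        using that by (intro network_agg_diff G) auto
      also have "\<dots> \<le> 1 / real N * (\<Sum>j=1..N. c)" using c by (intro mult_left_mono sum_mono) auto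
      finally show ?thesis using N by simp
    qed
    show "\<exists>b\<in>?\<P>. \<forall>i\<in>{1..N}. best (network_agg N G a i) (\<eta> i) (b i)" if a: "a \<in> ?\<P>" for a
    proof -
      have "network_agg N G a i \<in> K" for i using a by (intro network_agg_K) auto
      then have "\<forall>i. \<exists>c. i \<in> {1..N} \<longrightarrow> best (network_agg N G a i) (\<eta> i) c"
        using best_exists \<eta>K by blast
      then have "\<exists>r. \<forall>i. i \<in> {1..N} \<longrightarrow> best (network_agg N G a i) (\<eta> i) (r i)" by (rule choice)
      then obtain r where r: "\<And>i. i \<in> {1..N} \<Longrightarrow> best (network_agg N G a i) (\<eta> i) (r i)" by auto
      then show ?thesis by (intro bexI[of _ r]) (auto simp: best_iff)
    qed
  qed (use \<eta>K in \<open>auto intro: network_agg_K\<close>)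
  then show ?thesis by (auto simp: nnash_def)
qed

text \<open>The amplification factor from \<open>contraction_estimate\<close>, common to graphon and
  network games.\<close>

definition \<kappa> :: real where "\<kappa> = 2 * (l + l\<^sub>\<theta>) / (\<alpha> - l) + 1"

lemma \<kappa>_nonneg: "0 \<le> \<kappa>" using l_nonneg l\<^sub>\<theta>_nonneg l_less by (simp add: \<kappa>_def)

text \<open>Used twice: with equal graphs it gives uniqueness, and with different graphs it shows
  that equilibria vary continuously with the edge weights, on which measurability of the gap
  rests.\<close>

lemma network_comparison:
  assumes N: "1 \<le> N" and G: "unit_weights N G" and \<eta>: "\<eta> \<in> net_space P T F N"
    and b: "nnash N G \<eta> b" and b': "nnash N G' \<eta> b'"
  defines "e \<equiv> 1 / real N * (\<Sum>i=1..N. 1 / real N * (\<Sum>j=1..N. \<bar>G i j - G' i j\<bar> * M))"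
  shows "1 / real N * (\<Sum>i=1..N. nrm (b i - b' i) + nrm (network_agg N G b i - network_agg N G' b' i)) \<le> \<kappa> * e"
proof -
  have bA: "\<And>j. j \<in> {1..N} \<Longrightarrow> b j \<in> A0" and bA': "\<And>j. j \<in> {1..N} \<Longrightarrow> b' j \<in> A0"
    using b b' by (auto intro: nnash_A0)
  have \<eta>K: "\<And>i. i \<in> {1..N} \<Longrightarrow> \<eta> i \<in> K" using \<eta> by (auto simp: net_space_def)
  define \<Delta> where "\<Delta> = 1 / real N * (\<Sum>i=1..N. nrm (b i - b' i))"
  define z where "z = 1 / real N * (\<Sum>i=1..N. nrm (network_agg N G b i - network_agg N G' b' i))"
  have zi: "nrm (network_agg N G b i - network_agg N G' b' i) \<le> \<Delta> + 1 / real N * (\<Sum>j=1..N. \<bar>G i j - G' i j\<bar> * M)"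
    if i: "i \<in> {1..N}" for i
  proof -
    have "nrm (network_agg N G b i - network_agg N G' b' i)
        \<le> nrm (network_agg N G b i - network_agg N G b' i) + nrm (network_agg N G b' i - network_agg N G' b' i)"
      using bA bA' by (intro l2_norm_diff_triangle K_sq network_agg_K)
    also have "nrm (network_agg N G b i - network_agg N G b' i) \<le> \<Delta>"
      unfolding \<Delta>_def using bA bA' by (intro network_agg_diff G i)
    also have "nrm (network_agg N G b' i - network_agg N G' b' i) \<le> 1 / real N * (\<Sum>j=1..N. \<bar>G i j - G' i j\<bar> * M)"
      using bA' by (rule network_agg_diff_weights)
    finally show ?thesis by simp
  qed
  have "z \<le> 1 / real N * (\<Sum>i=1..N. \<Delta> + 1 / real N * (\<Sum>j=1..N. \<bar>G i j - G' i j\<bar> * M))"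
    unfolding z_def using zi by (intro mult_left_mono sum_mono) auto
  also have "\<dots> = \<Delta> + e" using N by (simp add: e_def sum.distrib distrib_left)
  finally have z\<Delta>: "z \<le> \<Delta> + e" .
  have "\<alpha> * \<Delta> = 1 / real N * (\<Sum>i=1..N. \<alpha> * nrm (b i - b' i))"
    by (simp add: \<Delta>_def sum_distrib_left)
  also have "\<dots> \<le> 1 / real N * (\<Sum>i=1..N. l * nrm (network_agg N G b i - network_agg N G' b' i))"
  proof (intro mult_left_mono sum_mono)
    fix i assume i: "i \<in> {1..N}"
    have "\<alpha> * nrm (b i - b' i) \<le> l * nrm (network_agg N G b i - network_agg N G' b' i) + l\<^sub>\<theta> * nrm (\<eta> i - \<eta> i)"
      using b b' i bA bA' \<eta>K by (intro best_Lipschitz network_agg_K) (auto simp: nnash_def)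
    then show "\<alpha> * nrm (b i - b' i) \<le> l * nrm (network_agg N G b i - network_agg N G' b' i)" by simp
  qed simp
  also have "\<dots> = l * z + l\<^sub>\<theta> * 0" by (simp add: z_def sum_distrib_left mult.left_commute)
  finally have "\<alpha> * \<Delta> \<le> l * z + l\<^sub>\<theta> * 0" .
  moreover have "0 \<le> e" using M_nonneg by (auto simp: e_def intro!: sum_nonneg mult_nonneg_nonneg divide_nonneg_nonneg)
  ultimately have "\<Delta> + z + 0 \<le> \<kappa> * (e + 0)"
    unfolding \<kappa>_def using l_nonneg l\<^sub>\<theta>_nonneg l_less z\<Delta> by (intro contraction_estimate) auto
  then show ?thesis by (simp add: \<Delta>_def z_def sum.distrib distrib_left)
qed

lemma nnash_unique:
  assumes N: "1 \<le> N" and G: "unit_weights N G" and \<eta>: "\<eta> \<in> net_space P T F N"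
    and b: "nnash N G \<eta> b" and b': "nnash N G \<eta> b'" and i: "i \<in> {1..N}"
  shows "proc_eq P T (b i) (b' i)"
proof -
  have "1 / real N * (\<Sum>i=1..N. nrm (b i - b' i) + nrm (network_agg N G b i - network_agg N G b' i)) \<le> 0"
    using network_comparison[OF N G \<eta> b b'] by simp
  then have "(\<Sum>i=1..N. nrm (b i - b' i) + nrm (network_agg N G b i - network_agg N G b' i)) \<le> 0"
    using N by (simp add: divide_le_0_iff)
  then have "nrm (b i - b' i) + nrm (network_agg N G b i - network_agg N G b' i) = 0"
    using i sum_nonneg_0[of "{1..N}" "\<lambda>i. nrm (b i - b' i) + nrm (network_agg N G b i - network_agg N G b' i)" i]
      sum_nonneg[of "{1..N}" "\<lambda>i. nrm (b i - b' i) + nrm (network_agg N G b i - network_agg N G b' i)"]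
    by (auto intro: antisym)
  then have "nrm (b i - b' i) = 0"
    using l2_norm_nonneg[of \<mu> "b i - b' i"] l2_norm_nonneg[of \<mu> "network_agg N G b i - network_agg N G b' i"]
    by linarith
  then have "AE p in \<mu>. (b i - b' i) p = 0"
    using l2_norm_eq_0_iff[OF square_integrable_diff[OF A0_sq[OF nnash_A0[OF b i]] A0_sq[OF nnash_A0[OF b' i]]]] by simp
  then show ?thesis by (simp add: proc_eq_def)
qed

lemma unique_network_nash_unit_weights:
  assumes "1 \<le> N" "unit_weights N G" "\<eta> \<in> net_space P T F N"
  shows "unique_network_nash P T N A0 U \<eta> G"
  unfolding unique_network_nash_def network_nash_iff
  using nnash_exists[OF assms] nnash_unique[OF assms] by blast

text \<open>The embedding of network profiles is an isometry for the normalized norm, so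
  intervention budgets are preserved.\<close>

lemma step_profile_space:
  assumes N: "1 \<le> N" and c: "\<And>i. i \<in> {1..N} \<Longrightarrow> c i \<in> K"
  shows "step_profile N c \<in> profile_space \<nu> P T F"
    "(profile_norm \<nu> P T (step_profile N c))\<^sup>2 = 1 / real N * (net_norm P T N c)\<^sup>2"
proof -
  \<comment> \<open>\<open>c\<close> is controlled only for the players, while the case distinction
    over the values of \<open>cell N\<close> ranges over all natural numbers.\<close>
  define c' where "c' i = (if i \<in> {1..N} then c i else (\<lambda>p. 0))" for i
  have eq: "step_profile N c x = c' (cell N x)" if "x \<in> {0..1}" for x
    using cell_unit_cell(1)[OF N that] by (simp add: step_profile_cell c'_def)
  have c'K: "c' i \<in> K" for i using c by (auto simp: c'_def proc_space_zero)
  have "(\<lambda>q. c' (cell N (fst q)) (snd q)) \<in> borel_measurable (\<nu> \<Otimes>\<^sub>M \<mu>)"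
  proof (rule measurable_compose_countable[where g="\<lambda>q. cell N (fst q)" and f="\<lambda>i q. c' i (snd q)"])
    show "(\<lambda>q. c' i (snd q)) \<in> borel_measurable (\<nu> \<Otimes>\<^sub>M \<mu>)" for i
      by (rule measurable_compose[OF measurable_snd square_integrable_measurable[OF K_sq[OF c'K]]])
    show "(\<lambda>q. cell N (fst q)) \<in> \<nu> \<Otimes>\<^sub>M \<mu> \<rightarrow>\<^sub>M count_space UNIV"
      by (rule measurable_compose[OF measurable_fst cell_measurable[OF index N]])
  qed
  then have m: "case_prod (step_profile N c) \<in> borel_measurable (\<nu> \<Otimes>\<^sub>M \<mu>)"
    by (rule measurable_cong[THEN iffD1, rotated]) (auto simp: space_pair_measure space_\<nu> eq)
  have L: "L2_profile \<nu> \<mu> (step_profile N c)"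
  proof (rule L2_profile_bounded[OF m])
    fix x assume "x \<in> space \<nu>"
    then have x: "x \<in> {0..1}" by (simp add: space_\<nu>)
    show "square_integrable \<mu> (step_profile N c x)" unfolding eq[OF x] by (rule K_sq[OF c'K])
    have "nrm (c (cell N x)) \<le> (\<Sum>i=1..N. nrm (c i))"
      using cell_unit_cell(1)[OF N x] by (intro member_le_sum) auto
    then show "nrm (step_profile N c x) \<le> (\<Sum>i=1..N. nrm (c i))" by (simp add: step_profile_cell)
  qed
  then show "step_profile N c \<in> profile_space \<nu> P T F"
    using c'K by (auto simp: profile_space_iff eq)
  have "(profile_norm \<nu> P T (step_profile N c))\<^sup>2 = (LINT x|\<nu>. (nrm (step_profile N c x))\<^sup>2)"
    unfolding profile_norm_eq L2_profile_norm(2)[OF L, symmetric] by (simp add: l2_norm_sq[of \<nu>])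
  also have "\<dots> = 1 / real N * (\<Sum>i=1..N. (nrm (c i))\<^sup>2)"
    unfolding step_profile_cell by (rule integral_cell(2)[OF index N])
  also have "\<dots> = 1 / real N * (net_norm P T N c)\<^sup>2"
    by (simp add: net_norm_def proc_norm_eq sum_nonneg)
  finally show "(profile_norm \<nu> P T (step_profile N c))\<^sup>2 = 1 / real N * (net_norm P T N c)\<^sup>2" .
qed

lemma step_profile_families:
  assumes N: "1 \<le> N" and b: "\<And>i. i \<in> {1..N} \<Longrightarrow> b i \<in> A0"
  shows "step_profile N b \<in> families"
  using step_profile_space(1)[OF N A0_K[OF b]] cell_unit_cell(1)[OF N] b
  by (auto simp: families_def profile_space_iff L2_profile_def step_profile_cell)

text \<open>This takes the place of an operator norm distance. The comparison of equilibria tests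
  the operators only on actions in \<open>A0\<close> and measures the error in the mean over the
  players.\<close>

definition close_to_graphon :: "nat \<Rightarrow> (nat \<Rightarrow> nat \<Rightarrow> real) \<Rightarrow> real \<Rightarrow> bool" where
  "close_to_graphon N G e \<longleftrightarrow> (\<forall>b. (\<forall>j\<in>{1..N}. b j \<in> A0) \<longrightarrow>
     (LINT x|\<nu>. nrm (Z (step_profile N b) x - network_agg N G b (cell N x))) \<le> e)"

text \<open>A network equilibrium is compared with a graphon equilibrium through its step profile; the
  distances are averaged over the players without squaring, so that the contraction applies.\<close>

lemma graphon_comparison:
  assumes N: "1 \<le> N" and G: "unit_weights N G" and close: "close_to_graphon N G e"
    and \<eta>: "\<eta> \<in> profile_space \<nu> P T F" and a: "gnash \<eta> a"
    and \<eta>N: "\<eta>N \<in> net_space P T F N" and b: "nnash N G \<eta>N b"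
  shows "\<bar>(LINT x|\<nu>. U (a x) (Z a x) (\<eta> x)) - 1 / real N * (\<Sum>i=1..N. U (b i) (network_agg N G b i) (\<eta>N i))\<bar>
    \<le> L * (\<kappa> * (e + profile_norm \<nu> P T (\<eta> - step_profile N \<eta>N)))"
proof -
  let ?b = "step_profile N b" and ?\<eta> = "step_profile N \<eta>N" and ?z = "step_profile N (network_agg N G b)"
  have bA: "\<And>j. j \<in> {1..N} \<Longrightarrow> b j \<in> A0" using b by (auto intro: nnash_A0)
  have \<eta>NK: "\<And>i. i \<in> {1..N} \<Longrightarrow> \<eta>N i \<in> K" using \<eta>N by (auto simp: net_space_def)
  have zK: "network_agg N G b i \<in> K" for i using bA by (rule network_agg_K)
  have af: "a \<in> families" using a by (simp add: gnash_def)
  have bf: "?b \<in> families" by (rule step_profile_families[OF N bA])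
  have aL: "L2_profile \<nu> \<mu> a" and bL: "L2_profile \<nu> \<mu> ?b" using families_L2 af bf by auto
  have \<eta>L: "L2_profile \<nu> \<mu> \<eta>" and \<eta>K: "\<And>x. x \<in> {0..1} \<Longrightarrow> \<eta> x \<in> K"
    using \<eta> by (auto simp: profile_space_iff)
  have \<eta>NL: "L2_profile \<nu> \<mu> ?\<eta>" using step_profile_space(1)[OF N \<eta>NK] by (simp add: profile_space_iff)
  have zL: "L2_profile \<nu> \<mu> ?z" using step_profile_space(1)[OF N zK] by (simp add: profile_space_iff)
  define da where "da x = nrm (a x - b (cell N x))" for x
  define dz where "dz x = nrm (Z a x - network_agg N G b (cell N x))" for x
  define dh where "dh x = nrm (\<eta> x - \<eta>N (cell N x))" for x
  define de where "de x = nrm (Z ?b x - network_agg N G b (cell N x))" for x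
  have ia: "integrable \<nu> da" and iz: "integrable \<nu> dz" and ih: "integrable \<nu> dh" and ie: "integrable \<nu> de"
    using L2_profile_mean_norm(1)[OF L2_profile_diff[OF aL bL]]
      L2_profile_mean_norm(1)[OF L2_profile_diff[OF Z_L2[OF af] zL]]
      L2_profile_mean_norm(1)[OF L2_profile_diff[OF \<eta>L \<eta>NL]]
      L2_profile_mean_norm(1)[OF L2_profile_diff[OF Z_L2[OF bf] zL]]
    unfolding da_def[abs_def] dz_def[abs_def] dh_def[abs_def] de_def[abs_def] by (simp_all add: step_profile_cell)
  define \<Delta> z h where "\<Delta> = (LINT x|\<nu>. da x)" and "z = (LINT x|\<nu>. dz x)" and "h = (LINT x|\<nu>. dh x)"
  have e: "(LINT x|\<nu>. de x) \<le> e" using close bA unfolding close_to_graphon_def de_def by blast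
  have "0 \<le> (LINT x|\<nu>. de x)" by (rule Bochner_Integration.integral_nonneg) (simp add: de_def)
  then have e0: "0 \<le> e" using e by simp
  have h0: "0 \<le> h" unfolding h_def by (rule Bochner_Integration.integral_nonneg) (simp add: dh_def)
  have hle: "h \<le> profile_norm \<nu> P T (\<eta> - ?\<eta>)"
    using L2_profile_mean_norm(2)[OF L2_profile_diff[OF \<eta>L \<eta>NL]]
    unfolding h_def dh_def profile_norm_eq by (simp add: step_profile_cell)
  have dz_le: "dz x \<le> \<Delta> + de x" if x: "x \<in> {0..1}" for x
  proof -
    have "dz x \<le> nrm (Z a x - Z ?b x) + de x"
      unfolding dz_def de_def using Z_bounded(1)[OF af x] Z_bounded(1)[OF bf x] K_sq[OF zK]
      by (intro l2_norm_diff_triangle)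
    also have "nrm (Z a x - Z ?b x) \<le> \<Delta>"
      using Z_diff[OF af bf x] by (simp add: \<Delta>_def da_def step_profile_cell)
    finally show ?thesis by simp
  qed
  have "z \<le> (LINT x|\<nu>. \<Delta> + de x)"
    unfolding z_def using dz_le iz ie by (intro integral_mono) (auto simp: space_\<nu>)
  also have "\<dots> = \<Delta> + (LINT x|\<nu>. de x)" using ie by (simp add: I.prob_space)
  finally have z: "z \<le> \<Delta> + e" using e by simp
  have da_le: "\<alpha> * da x \<le> l * dz x + l\<^sub>\<theta> * dh x" if x: "x \<in> {0..1}" for x
    unfolding da_def dz_def dh_def
    using a b cell_unit_cell(1)[OF N x] x
    by (intro best_Lipschitz Z_in_K[OF af x] zK \<eta>K[OF x] \<eta>NK) (auto simp: gnash_def nnash_def)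
  have "\<alpha> * \<Delta> = (LINT x|\<nu>. \<alpha> * da x)" by (simp add: \<Delta>_def)
  also have "\<dots> \<le> (LINT x|\<nu>. l * dz x + l\<^sub>\<theta> * dh x)"
    using da_le ia iz ih by (intro integral_mono) (auto simp: space_\<nu>)
  also have "\<dots> = l * z + l\<^sub>\<theta> * h" using iz ih by (simp add: z_def h_def)
  finally have "\<Delta> + z + h \<le> \<kappa> * (e + h)"
    unfolding \<kappa>_def using l_nonneg l\<^sub>\<theta>_nonneg l_less e0 h0 z by (intro contraction_estimate)
  also have "\<dots> \<le> \<kappa> * (e + profile_norm \<nu> P T (\<eta> - ?\<eta>))"
    using hle \<kappa>_nonneg by (intro mult_left_mono) auto
  finally have bound: "\<Delta> + z + h \<le> \<kappa> * (e + profile_norm \<nu> P T (\<eta> - ?\<eta>))" .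
  let ?\<psi> = "\<lambda>i. U (b i) (network_agg N G b i) (\<eta>N i)"
  have i\<phi>: "integrable \<nu> (\<lambda>x. U (a x) (Z a x) (\<eta> x))" by (rule gnash_welfare_integrable[OF \<eta> a])
  note i\<psi> = integral_cell[OF index N, of ?\<psi>]
  have "\<bar>(LINT x|\<nu>. U (a x) (Z a x) (\<eta> x)) - 1 / real N * (\<Sum>i=1..N. ?\<psi> i)\<bar>
      = \<bar>LINT x|\<nu>. U (a x) (Z a x) (\<eta> x) - ?\<psi> (cell N x)\<bar>"
    using i\<phi> i\<psi> by simp
  also have "\<dots> \<le> (LINT x|\<nu>. \<bar>U (a x) (Z a x) (\<eta> x) - ?\<psi> (cell N x)\<bar>)"
    by (rule integral_abs_bound)
  also have "\<dots> \<le> (LINT x|\<nu>. L * (da x + dz x + dh x))"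
  proof (rule integral_mono)
    show "integrable \<nu> (\<lambda>x. \<bar>U (a x) (Z a x) (\<eta> x) - ?\<psi> (cell N x)\<bar>)"
      using i\<phi> i\<psi>(1) by (intro integrable_abs Bochner_Integration.integrable_diff)
    show "integrable \<nu> (\<lambda>x. L * (da x + dz x + dh x))"
      using ia iz ih by (intro integrable_mult_right Bochner_Integration.integrable_add)
    fix x assume "x \<in> space \<nu>"
    then have x: "x \<in> {0..1}" by (simp add: space_\<nu>)
    show "\<bar>U (a x) (Z a x) (\<eta> x) - ?\<psi> (cell N x)\<bar> \<le> L * (da x + dz x + dh x)"
      unfolding da_def dz_def dh_def using cell_unit_cell(1)[OF N x] x
      by (intro U_lip families_A0[OF af] bA Z_in_K[OF af x] zK \<eta>K \<eta>NK)
  qed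
  also have "\<dots> = L * (\<Delta> + z + h)" using ia iz ih by (simp add: \<Delta>_def z_def h_def)
  also have "\<dots> \<le> L * (\<kappa> * (e + profile_norm \<nu> P T (\<eta> - ?\<eta>)))"
    using bound L_nonneg by (rule mult_left_mono)
  finally show ?thesis .
qed

end

section \<open>The intervention gap\<close>

locale intervention_game = graphon_game P T F U A0 \<alpha> l l\<^sub>\<theta> L M \<nu> W
  for P :: "'w measure" and T F U A0 \<alpha> l l\<^sub>\<theta> L M \<nu> W +
  fixes A :: "real \<Rightarrow> 'w process set" and \<theta> \<theta>b :: "real \<Rightarrow> 'w process"
    and \<theta>N :: "nat \<Rightarrow> nat \<Rightarrow> 'w process" and C\<^sub>B :: real
  assumes homogeneous: "\<And>y. y \<in> {0..1} \<Longrightarrow> A y = A0"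
    and \<theta>_profile: "\<theta> \<in> profile_space \<nu> P T F"
    and \<theta>N_space: "\<And>N. N \<ge> 1 \<Longrightarrow> \<theta>N N \<in> net_space P T F N"
    and budget: "C\<^sub>B > 0"
    and solution: "graphon_intervention_solution \<nu> P T F A U \<theta> W C\<^sub>B \<theta>b"
begin

abbreviation GW :: "(real \<Rightarrow> 'w process) \<Rightarrow> real" where
  "GW \<equiv> graphon_welfare \<nu> P T F A U \<theta> W"
abbreviation NW :: "nat \<Rightarrow> (nat \<Rightarrow> nat \<Rightarrow> real) \<Rightarrow> (nat \<Rightarrow> 'w process) \<Rightarrow> real" where
  "NW N \<equiv> network_welfare N A0 U (\<theta>N N)"
abbreviation gap :: "nat \<Rightarrow> (nat \<Rightarrow> nat \<Rightarrow> real) \<Rightarrow> real" where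
  "gap N G \<equiv> intervention_gap \<nu> P T F N A0 U (\<theta>N N) G C\<^sub>B \<theta>b"
text \<open>The two errors unrelated to the random graph: \<open>r\<close> comes from the given
  heterogeneities, \<open>s\<close> from reading the solution at the points
  \<open>i / N\<close>.\<close>

definition r :: "nat \<Rightarrow> real" where
  "r N = profile_norm \<nu> P T (\<theta> - step_profile N (\<theta>N N))"
definition s :: "nat \<Rightarrow> real" where
  "s N = profile_norm \<nu> P T (\<theta>b - step_profile N (\<lambda>i. \<theta>b (real i / real N)))"
definition feasible :: "nat \<Rightarrow> (nat \<Rightarrow> 'w process) set" where
  "feasible N = {\<theta>h \<in> net_space P T F N. 1 / real N * (net_norm P T N \<theta>h)\<^sup>2 \<le> C\<^sub>B}"

lemma \<theta>b_profile: "\<theta>b \<in> profile_space \<nu> P T F" and \<theta>b_budget: "(profile_norm \<nu> P T \<theta>b)\<^sup>2 \<le> C\<^sub>B"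
  and \<theta>b_optimal: "\<And>\<theta>h. \<theta>h \<in> profile_space \<nu> P T F \<Longrightarrow> (profile_norm \<nu> P T \<theta>h)\<^sup>2 \<le> C\<^sub>B \<Longrightarrow> GW \<theta>h \<le> GW \<theta>b"
  using solution by (auto simp: graphon_intervention_solution_def is_arg_max_def not_less)

lemma profile_space_add:
  "a \<in> profile_space \<nu> P T F \<Longrightarrow> b \<in> profile_space \<nu> P T F \<Longrightarrow> a + b \<in> profile_space \<nu> P T F"
  by (auto simp: profile_space_iff L2_profile_add proc_space_add)

lemma net_space_add: "a \<in> net_space P T F N \<Longrightarrow> b \<in> net_space P T F N \<Longrightarrow> a + b \<in> net_space P T F N"
  by (auto simp: net_space_def proc_space_add)

lemma net_space_step:
  assumes "N \<ge> 1" "\<theta>h \<in> net_space P T F N"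
  shows "step_profile N \<theta>h \<in> profile_space \<nu> P T F"
    "(profile_norm \<nu> P T (step_profile N \<theta>h))\<^sup>2 = 1 / real N * (net_norm P T N \<theta>h)\<^sup>2"
  using step_profile_space[OF assms(1), of \<theta>h] assms(2) by (auto simp: net_space_def)

lemma profile_norm_triangle:
  assumes "a \<in> profile_space \<nu> P T F" "b \<in> profile_space \<nu> P T F" "c \<in> profile_space \<nu> P T F" "d \<in> profile_space \<nu> P T F"
  shows "profile_norm \<nu> P T ((a + b) - (c + d)) \<le> profile_norm \<nu> P T (a - c) + profile_norm \<nu> P T (b - d)"
proof -
  have L: "square_integrable (\<nu> \<Otimes>\<^sub>M \<mu>) (case_prod (a - c))" "square_integrable (\<nu> \<Otimes>\<^sub>M \<mu>) (case_prod (b - d))"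
    using assms by (auto simp: profile_space_iff intro!: L2_profile_square_integrable L2_profile_diff)
  have "case_prod ((a + b) - (c + d)) = case_prod (a - c) + case_prod (b - d)" by (auto simp: fun_eq_iff)
  then show ?thesis using l2_norm_triangle[OF L] by (simp add: profile_norm_eq)
qed

text \<open>Both welfares are evaluated at an equilibrium chosen by \<open>SOME\<close>. The
  comparison holds for any pair of equilibria, so existence settles the choice. The heterogeneity
  error splits into a given part and the part due to the interventions.\<close>

lemma welfare_comparison:
  assumes N: "1 \<le> N" and G: "unit_weights N G" and close: "close_to_graphon N G e"
    and \<theta>h: "\<theta>h \<in> profile_space \<nu> P T F" and \<theta>hN: "\<theta>hN \<in> net_space P T F N"
  shows "\<bar>GW \<theta>h - NW N G \<theta>hN\<bar>
    \<le> L * (\<kappa> * (e + (r N + profile_norm \<nu> P T (\<theta>h - step_profile N \<theta>hN))))"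
proof -
  define a where "a = (SOME a. gnash (\<theta> + \<theta>h) a)"
  define b where "b = (SOME b. nnash N G (\<theta>N N + \<theta>hN) b)"
  note \<eta> = profile_space_add[OF \<theta>_profile \<theta>h] and \<eta>N = net_space_add[OF \<theta>N_space[OF N] \<theta>hN]
  have a: "gnash (\<theta> + \<theta>h) a" unfolding a_def by (rule someI_ex[OF gnash_exists[OF \<eta>]])
  have b: "nnash N G (\<theta>N N + \<theta>hN) b" unfolding b_def by (rule someI_ex[OF nnash_exists[OF N G \<eta>N]])
  have GW: "GW \<theta>h = (LINT x|\<nu>. U (a x) (Z a x) ((\<theta> + \<theta>h) x))"
  proof -
    have "graphon_nash \<nu> P T F A U (\<theta> + \<theta>h) W = gnash (\<theta> + \<theta>h)"
      by (intro ext graphon_nash_iff homogeneous)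
    then show ?thesis unfolding graphon_welfare_def Let_def a_def by simp
  qed
  have NW: "NW N G \<theta>hN = 1 / real N * (\<Sum>i=1..N. U (b i) (network_agg N G b i) ((\<theta>N N + \<theta>hN) i))"
  proof -
    have "network_nash N A0 U (\<theta>N N + \<theta>hN) G = nnash N G (\<theta>N N + \<theta>hN)"
      by (intro ext network_nash_iff)
    then show ?thesis unfolding network_welfare_def Let_def b_def by simp
  qed
  have "\<bar>GW \<theta>h - NW N G \<theta>hN\<bar>
      \<le> L * (\<kappa> * (e + profile_norm \<nu> P T ((\<theta> + \<theta>h) - step_profile N (\<theta>N N + \<theta>hN))))"
    unfolding GW NW by (rule graphon_comparison[OF N G close \<eta> a \<eta>N b])
  also have "step_profile N (\<theta>N N + \<theta>hN) = step_profile N (\<theta>N N) + step_profile N \<theta>hN"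
    by (simp add: step_profile_cell fun_eq_iff)
  also have "L * (\<kappa> * (e + profile_norm \<nu> P T ((\<theta> + \<theta>h) - (step_profile N (\<theta>N N) + step_profile N \<theta>hN))))
      \<le> L * (\<kappa> * (e + (r N + profile_norm \<nu> P T (\<theta>h - step_profile N \<theta>hN))))"
    unfolding r_def using L_nonneg \<kappa>_nonneg
    by (intro mult_left_mono add_left_mono profile_norm_triangle \<theta>_profile \<theta>h net_space_step(1)[OF N] \<theta>N_space[OF N] \<theta>hN)
  finally show ?thesis .
qed

text \<open>The graphon intervention used here is the step profile of \<open>\<theta>h\<close>
  itself, so the distance between the two interventions vanishes and no sampling error arises on
  this side.\<close>

lemma feasible_upper:
  assumes N: "1 \<le> N" and G: "unit_weights N G" and close: "close_to_graphon N G e" and \<theta>h: "\<theta>h \<in> feasible N"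
  shows "NW N G \<theta>h \<le> GW \<theta>b + L * (\<kappa> * (e + r N))"
proof -
  have h: "\<theta>h \<in> net_space P T F N" and b: "1 / real N * (net_norm P T N \<theta>h)\<^sup>2 \<le> C\<^sub>B"
    using \<theta>h by (auto simp: feasible_def)
  note step = net_space_step[OF N h]
  have "profile_norm \<nu> P T (step_profile N \<theta>h - step_profile N \<theta>h) = 0"
    by (simp add: profile_norm_eq case_prod_beta')
  then have "\<bar>GW (step_profile N \<theta>h) - NW N G \<theta>h\<bar> \<le> L * (\<kappa> * (e + r N))"
    using welfare_comparison[OF N G close step(1) h] by simp
  moreover have "GW (step_profile N \<theta>h) \<le> GW \<theta>b"
    using step b by (intro \<theta>b_optimal) auto
  ultimately show ?thesis by linarith
qed

lemma sampled_\<theta>b: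
  assumes N: "1 \<le> N"
  shows "(\<lambda>i. \<theta>b (real i / real N)) \<in> net_space P T F N"
  using \<theta>b_profile N by (auto simp: net_space_def profile_space_iff)

text \<open>Rescaling keeps the norm at most that of the solution, also in the degenerate cases
  where division by 0 gives the zero intervention; the budget of the solution is therefore
  respected.\<close>

lemma approx_intervention_feasible:
  assumes N: "1 \<le> N"
  shows "approx_intervention \<nu> P T \<theta>b N \<in> feasible N"
    "profile_norm \<nu> P T (\<theta>b - step_profile N (approx_intervention \<nu> P T \<theta>b N)) \<le> 2 * s N"
proof -
  let ?t = "\<lambda>i. \<theta>b (real i / real N)" and ?A = "approx_intervention \<nu> P T \<theta>b N"
  note step = net_space_step[OF N sampled_\<theta>b[OF N]]
  define f where "f = case_prod \<theta>b"
  define g where "g = case_prod (step_profile N ?t)"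
  define S where "S = intervention_scale \<nu> P T \<theta>b N"
  have fg: "square_integrable (\<nu> \<Otimes>\<^sub>M \<mu>) f" "square_integrable (\<nu> \<Otimes>\<^sub>M \<mu>) g"
    using \<theta>b_profile step(1) unfolding f_def g_def by (auto simp: profile_space_iff intro!: L2_profile_square_integrable)
  have S: "S = l2_norm (\<nu> \<Otimes>\<^sub>M \<mu>) g / l2_norm (\<nu> \<Otimes>\<^sub>M \<mu>) f"
    unfolding S_def intervention_scale_def step(2)[symmetric] by (simp add: profile_norm_eq f_def g_def)
  have A_eq: "?A = (\<lambda>i p. (1 / S) * ?t i p)" by (simp add: approx_intervention_def S_def fun_eq_iff)
  have A_net: "?A \<in> net_space P T F N"
    using sampled_\<theta>b[OF N] unfolding A_eq net_space_def by (auto intro!: proc_space_cmult simp del: times_divide_eq_left)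
  have A_step: "case_prod (step_profile N ?A) = (\<lambda>q. g q / S)"
    by (simp add: A_eq step_profile_cell g_def fun_eq_iff)
  note scaled = l2_norm_rescaled_diff[OF fg, folded S]
  have "profile_norm \<nu> P T (step_profile N ?A) \<le> profile_norm \<nu> P T \<theta>b"
    unfolding profile_norm_eq A_step using scaled(2) by (simp add: f_def)
  then have "(profile_norm \<nu> P T (step_profile N ?A))\<^sup>2 \<le> (profile_norm \<nu> P T \<theta>b)\<^sup>2"
    by (intro power_mono) (auto simp: profile_norm_eq)
  then show "?A \<in> feasible N"
    using A_net net_space_step(2)[OF N A_net] \<theta>b_budget by (simp add: feasible_def)
  have "case_prod (\<theta>b - step_profile N ?A) = f - (\<lambda>q. g q / S)"
    unfolding A_step[symmetric] by (simp add: f_def fun_eq_iff)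
  moreover have "case_prod (\<theta>b - step_profile N ?t) = f - g" by (simp add: f_def g_def fun_eq_iff)
  ultimately show "profile_norm \<nu> P T (\<theta>b - step_profile N ?A) \<le> 2 * s N"
    using scaled(1) by (simp add: profile_norm_eq s_def)
qed

lemma approx_lower:
  assumes N: "1 \<le> N" and G: "unit_weights N G" and close: "close_to_graphon N G e"
  shows "GW \<theta>b - L * (\<kappa> * (e + (r N + 2 * s N))) \<le> NW N G (approx_intervention \<nu> P T \<theta>b N)"
proof -
  note A = approx_intervention_feasible[OF N]
  have "\<bar>GW \<theta>b - NW N G (approx_intervention \<nu> P T \<theta>b N)\<bar>
      \<le> L * (\<kappa> * (e + (r N + profile_norm \<nu> P T (\<theta>b - step_profile N (approx_intervention \<nu> P T \<theta>b N)))))"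
    using A(1) by (intro welfare_comparison[OF N G close \<theta>b_profile]) (simp add: feasible_def)
  also have "\<dots> \<le> L * (\<kappa> * (e + (r N + 2 * s N)))"
    using A(2) L_nonneg \<kappa>_nonneg by (intro mult_left_mono add_left_mono)
  finally show ?thesis by linarith
qed

text \<open>A crude bound valid for all graphs. It serves to bound the network welfare over the
  feasible set, without which the supremum of reals would have no meaning.\<close>

lemma close_to_graphon_trivial:
  assumes N: "1 \<le> N" and G: "unit_weights N G"
  shows "close_to_graphon N G (2 * M)"
  unfolding close_to_graphon_def
proof (intro allI impI)
  fix b :: "nat \<Rightarrow> 'w process" assume "\<forall>j\<in>{1..N}. b j \<in> A0"
  then have b: "\<And>j. j \<in> {1..N} \<Longrightarrow> b j \<in> A0" by auto
  have bf: "step_profile N b \<in> families" by (rule step_profile_families[OF N b])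
  have zL: "L2_profile \<nu> \<mu> (step_profile N (network_agg N G b))"
    using step_profile_space(1)[OF N network_agg_K[OF b]] by (simp add: profile_space_iff)
  have agg: "nrm (network_agg N G b i) \<le> M" if i: "i \<in> {1..N}" for i
  proof -
    have "nrm (network_agg N G b i) \<le> (\<Sum>j=1..N. \<bar>1 / real N * G i j\<bar> * nrm (b j))"
      unfolding network_agg_eq using b A0_sq by (intro l2_norm_sum) auto
    also have "\<dots> \<le> (\<Sum>j=1..N. 1 / real N * M)"
    proof (intro sum_mono mult_mono)
      fix j assume j: "j \<in> {1..N}"
      then have "G i j \<in> {0..1}" using G i by (auto simp: unit_weights_def)
      then show "\<bar>1 / real N * G i j\<bar> \<le> 1 / real N" by (auto simp: abs_mult divide_right_mono)
      show "nrm (b j) \<le> M" by (rule nrm_A0[OF b[OF j]])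
    qed auto
    finally show ?thesis using N by simp
  qed
  have "(LINT x|\<nu>. nrm (Z (step_profile N b) x - network_agg N G b (cell N x))) \<le> (LINT x|\<nu>. 2 * M)"
  proof (rule integral_mono)
    show "integrable \<nu> (\<lambda>x. nrm (Z (step_profile N b) x - network_agg N G b (cell N x)))"
      using L2_profile_mean_norm(1)[OF L2_profile_diff[OF Z_L2[OF bf] zL]] by (simp add: step_profile_cell)
    fix x assume "x \<in> space \<nu>"
    then have x: "x \<in> {0..1}" by (simp add: space_\<nu>)
    have "square_integrable \<mu> (network_agg N G b (cell N x))" by (intro K_sq network_agg_K b)
    then show "nrm (Z (step_profile N b) x - network_agg N G b (cell N x)) \<le> 2 * M"
      using l2_norm_diff_le[OF Z_bounded(1)[OF bf x], of "network_agg N G b (cell N x)"]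
        Z_bounded(2)[OF bf x] agg[OF cell_unit_cell(1)[OF N x]] by linarith
  qed simp
  then show "(LINT x|\<nu>. nrm (Z (step_profile N b) x - network_agg N G b (cell N x))) \<le> 2 * M"
    by (simp add: I.prob_space)
qed

lemma welfare_bdd:
  assumes "1 \<le> N" "unit_weights N G"
  shows "bdd_above (NW N G ` feasible N)"
  using feasible_upper[OF assms close_to_graphon_trivial[OF assms]] by (rule bdd_aboveI2)

lemma gap_eq: "gap N G = (SUP \<theta>h\<in>feasible N. NW N G \<theta>h) - NW N G (approx_intervention \<nu> P T \<theta>b N)"
  by (simp add: intervention_gap_def network_optimum_def feasible_def)

text \<open>The approximate intervention itself competes for the optimum. The sign reduces almost
  sure convergence of the gap to upper bounds.\<close>

lemma gap_nonneg:
  assumes N: "1 \<le> N" and G: "unit_weights N G"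
  shows "0 \<le> gap N G"
  unfolding gap_eq using cSUP_upper[OF approx_intervention_feasible(1)[OF N] welfare_bdd[OF N G]] by simp

text \<open>The optimum and the welfare of the approximate intervention are both compared with the
  optimal graphon welfare. Each comparison costs \<open>L * \<kappa>\<close> times
  \<open>e + r N\<close>, and the second adds \<open>2 * s N\<close>, which explains the common
  factor 2.\<close>

lemma gap_upper:
  assumes N: "1 \<le> N" and G: "unit_weights N G" and close: "close_to_graphon N G e"
  shows "gap N G \<le> 2 * L * \<kappa> * (e + r N + s N)"
proof -
  have "(SUP \<theta>h\<in>feasible N. NW N G \<theta>h) \<le> GW \<theta>b + L * (\<kappa> * (e + r N))"
    using approx_intervention_feasible(1)[OF N] by (intro cSUP_least feasible_upper[OF N G close]) auto
  then show ?thesis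
    unfolding gap_eq using approx_lower[OF N G close] by (simp add: algebra_simps)
qed

lemma network_welfare_Lipschitz:
  assumes N: "1 \<le> N" and G: "unit_weights N G" and G': "unit_weights N G'" and \<theta>h: "\<theta>h \<in> net_space P T F N"
  shows "\<bar>NW N G \<theta>h - NW N G' \<theta>h\<bar> \<le> L * (\<kappa> * (1 / real N * (\<Sum>i=1..N. 1 / real N * (\<Sum>j=1..N. \<bar>G i j - G' i j\<bar> * M))))"
    (is "_ \<le> L * (\<kappa> * ?e)")
proof -
  define b where "b = (SOME b. nnash N G (\<theta>N N + \<theta>h) b)"
  define b' where "b' = (SOME b. nnash N G' (\<theta>N N + \<theta>h) b)"
  note \<eta> = net_space_add[OF \<theta>N_space[OF N] \<theta>h]
  have b: "nnash N G (\<theta>N N + \<theta>h) b" unfolding b_def by (rule someI_ex[OF nnash_exists[OF N G \<eta>]])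
  have b': "nnash N G' (\<theta>N N + \<theta>h) b'" unfolding b'_def by (rule someI_ex[OF nnash_exists[OF N G' \<eta>]])
  have bA: "\<And>j. j \<in> {1..N} \<Longrightarrow> b j \<in> A0" and bA': "\<And>j. j \<in> {1..N} \<Longrightarrow> b' j \<in> A0"
    using b b' by (auto intro: nnash_A0)
  let ?u = "\<lambda>G b i. U (b i) (network_agg N G b i) ((\<theta>N N + \<theta>h) i)"
  have NW: "NW N G \<theta>h = 1 / real N * (\<Sum>i=1..N. ?u G b i)" "NW N G' \<theta>h = 1 / real N * (\<Sum>i=1..N. ?u G' b' i)"
  proof -
    have "network_nash N A0 U (\<theta>N N + \<theta>h) G = nnash N G (\<theta>N N + \<theta>h)" for G
      by (intro ext network_nash_iff)
    then show "NW N G \<theta>h = 1 / real N * (\<Sum>i=1..N. ?u G b i)" "NW N G' \<theta>h = 1 / real N * (\<Sum>i=1..N. ?u G' b' i)"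
      unfolding network_welfare_def Let_def b_def b'_def by simp_all
  qed
  have "\<bar>NW N G \<theta>h - NW N G' \<theta>h\<bar> = 1 / real N * \<bar>\<Sum>i=1..N. ?u G b i - ?u G' b' i\<bar>"
    unfolding NW by (simp add: sum_subtractf abs_mult flip: right_diff_distrib diff_divide_distrib)
  also have "\<dots> \<le> 1 / real N * (\<Sum>i=1..N. L * (nrm (b i - b' i) + nrm (network_agg N G b i - network_agg N G' b' i)))"
  proof (intro mult_left_mono order_trans[OF sum_abs] sum_mono)
    fix i assume i: "i \<in> {1..N}"
    have "\<bar>?u G b i - ?u G' b' i\<bar> \<le> L * (nrm (b i - b' i) + nrm (network_agg N G b i - network_agg N G' b' i)
        + nrm ((\<theta>N N + \<theta>h) i - (\<theta>N N + \<theta>h) i))"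
      using \<eta> i by (intro U_lip bA bA' network_agg_K) (auto simp: net_space_def)
    then show "\<bar>?u G b i - ?u G' b' i\<bar> \<le> L * (nrm (b i - b' i) + nrm (network_agg N G b i - network_agg N G' b' i))"
      by simp
  qed simp
  also have "\<dots> = L * (1 / real N * (\<Sum>i=1..N. nrm (b i - b' i) + nrm (network_agg N G b i - network_agg N G' b' i)))"
    by (simp only: sum_distrib_left mult.left_commute)
  also have "\<dots> \<le> L * (\<kappa> * ?e)"
    using network_comparison[OF N G \<eta> b b'] L_nonneg by (rule mult_left_mono)
  finally show ?thesis .
qed

text \<open>The bound on the change of network welfare is uniform over interventions and hence
  passes to the supremum. It is used for the measurability of the gap of a random graph.\<close>

lemma gap_Lipschitz:
  assumes N: "1 \<le> N" and G: "unit_weights N G" and G': "unit_weights N G'"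
  shows "\<bar>gap N G - gap N G'\<bar> \<le> 2 * (L * (\<kappa> * (1 / real N * (\<Sum>i=1..N. 1 / real N * (\<Sum>j=1..N. \<bar>G i j - G' i j\<bar> * M)))))"
    (is "_ \<le> 2 * ?B G G'")
proof -
  have ne: "feasible N \<noteq> {}" using approx_intervention_feasible(1)[OF N] by auto
  have opt: "(SUP \<theta>h\<in>feasible N. NW N G \<theta>h) \<le> (SUP \<theta>h\<in>feasible N. NW N G' \<theta>h) + ?B G G'"
    if G: "unit_weights N G" and G': "unit_weights N G'" for G G'
  proof (rule cSUP_least[OF ne])
    fix \<theta>h assume h: "\<theta>h \<in> feasible N"
    have "NW N G \<theta>h \<le> NW N G' \<theta>h + ?B G G'"
      using network_welfare_Lipschitz[OF N G G', of \<theta>h] h by (simp add: feasible_def abs_le_iff)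
    also have "NW N G' \<theta>h \<le> (SUP \<theta>h\<in>feasible N. NW N G' \<theta>h)"
      by (rule cSUP_upper[OF h welfare_bdd[OF N G']])
    finally show "NW N G \<theta>h \<le> (SUP \<theta>h\<in>feasible N. NW N G' \<theta>h) + ?B G G'" by simp
  qed
  have sym: "?B G' G = ?B G G'" by (simp add: abs_minus_commute)
  have "\<bar>NW N G (approx_intervention \<nu> P T \<theta>b N) - NW N G' (approx_intervention \<nu> P T \<theta>b N)\<bar> \<le> ?B G G'"
    using approx_intervention_feasible(1)[OF N] by (intro network_welfare_Lipschitz[OF N G G']) (simp add: feasible_def)
  then show ?thesis unfolding gap_eq using opt[OF G G'] opt[OF G' G, unfolded sym] by linarith
qed

text \<open>Away from the ends of the partition intervals the Lipschitz bound gives a squared error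
  of order \<open>1 / N ^ 2\<close>. Near them only boundedness is left, on a set of measure of
  order \<open>1 / N\<close>; this part dominates, so the norm is of order
  \<open>1 / sqrt N\<close>.\<close>

lemma sampling_error:
  assumes bounded: "\<And>y. y \<in> {0..1} \<Longrightarrow> proc_norm P T (\<theta>b y) \<le> B"
    and lip: "piecewise_lipschitz_profile P T \<theta>b"
  obtains c where "0 \<le> c" "\<And>N. 1 \<le> N \<Longrightarrow> s N \<le> c / sqrt (real N)"
proof -
  from lip obtain l' \<I> where part: "finite_interval_partition \<I>" and
    l': "\<forall>I\<in>\<I>. \<forall>x\<in>I. \<forall>x'\<in>I. nrm (\<theta>b x - \<theta>b x') \<le> l' * \<bar>x - x'\<bar>"
    unfolding piecewise_lipschitz_profile_def proc_norm_eq by (elim exE conjE)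
  have B: "nrm (\<theta>b y) \<le> B" if "y \<in> {0..1}" for y using bounded[OF that] by (simp add: proc_norm_eq)
  have \<theta>L: "L2_profile \<nu> \<mu> \<theta>b" and \<theta>K: "\<And>y. y \<in> {0..1} \<Longrightarrow> \<theta>b y \<in> K" using \<theta>b_profile by (auto simp: profile_space_iff)
  define c where "c = sqrt (l'\<^sup>2 + (2 * B)\<^sup>2 * (2 * real (card \<I>)))"
  have "s N \<le> c / sqrt (real N)" if N: "1 \<le> N" for N
  proof (rule power2_le_imp_le)
    let ?t = "step_profile N (\<lambda>i. \<theta>b (real i / real N))"
    have tL: "L2_profile \<nu> \<mu> ?t" using net_space_step(1)[OF N sampled_\<theta>b[OF N]] by (simp add: profile_space_iff)
    note dL = L2_profile_diff[OF \<theta>L tL]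
    have N1: "0 \<le> 1 / real N" by simp
    obtain E where E: "E \<in> sets borel" "E \<subseteq> {0..1}" "measure \<nu> E \<le> 2 * real (card \<I>) * (1 / real N)"
      "\<And>x v. x \<in> {0..1} - E \<Longrightarrow> v \<in> {0..1} \<Longrightarrow> \<bar>x - v\<bar> \<le> 1 / real N \<Longrightarrow> \<exists>I\<in>\<I>. x \<in> I \<and> v \<in> I"
      using interval_partition_near_boundary[OF index part N1] by blast
    have E\<nu>: "E \<in> sets \<nu>" by (rule unit_lebesgue_borel(1)[OF index E(1,2)])
    have "(s N)\<^sup>2 = (LINT x|\<nu>. (nrm ((\<theta>b - ?t) x))\<^sup>2)"
      unfolding s_def profile_norm_eq L2_profile_norm(2)[OF dL, symmetric] by (simp add: l2_norm_sq[of \<nu>])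
    also have "\<dots> \<le> (LINT x|\<nu>. (l' / real N)\<^sup>2 + (2 * B)\<^sup>2 * indicator E x)"
    proof (rule integral_mono)
      show "integrable \<nu> (\<lambda>x. (nrm ((\<theta>b - ?t) x))\<^sup>2)"
        using L2_profile_norm(1)[OF dL] by (simp add: square_integrable_def)
      show "integrable \<nu> (\<lambda>x. (l' / real N)\<^sup>2 + (2 * B)\<^sup>2 * indicator E x)"
        using E\<nu> by (intro Bochner_Integration.integrable_add integrable_mult_right integrable_real_indicator)
          (auto simp: I.emeasure_eq_measure)
      fix x assume "x \<in> space \<nu>"
      then have x: "x \<in> {0..1}" by (simp add: space_\<nu>)
      let ?v = "real (cell N x) / real N"
      have v: "?v \<in> {0..1}" "\<bar>x - ?v\<bar> \<le> 1 / real N" using cell_right_endpoint[OF N x] by auto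
      have eq: "(\<theta>b - ?t) x = \<theta>b x - \<theta>b ?v" by (simp add: step_profile_cell)
      show "(nrm ((\<theta>b - ?t) x))\<^sup>2 \<le> (l' / real N)\<^sup>2 + (2 * B)\<^sup>2 * indicator E x"
      proof (cases "x \<in> E")
        case True
        have "nrm (\<theta>b x - \<theta>b ?v) \<le> 2 * B"
          using l2_norm_diff_le[OF K_sq[OF \<theta>K[OF x]] K_sq[OF \<theta>K[OF v(1)]]] B[OF x] B[OF v(1)] by linarith
        then have "(nrm (\<theta>b x - \<theta>b ?v))\<^sup>2 \<le> (2 * B)\<^sup>2" by (intro power_mono) auto
        also have "\<dots> \<le> (l' / real N)\<^sup>2 + (2 * B)\<^sup>2" by simp
        finally show ?thesis unfolding eq using True by simp
      next
        case False
        then obtain I where I: "I \<in> \<I>" "x \<in> I" "?v \<in> I" using E(4)[of x ?v] x v by blast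
        have "nrm (\<theta>b x - \<theta>b ?v) \<le> l' * \<bar>x - ?v\<bar>" using l' I by blast
        also have "\<dots> \<le> \<bar>l'\<bar> * (1 / real N)" using v(2) by (intro mult_mono) auto
        finally have "(nrm (\<theta>b x - \<theta>b ?v))\<^sup>2 \<le> (\<bar>l'\<bar> * (1 / real N))\<^sup>2" by (intro power_mono) auto
        then show ?thesis unfolding eq using False by (simp add: power_divide)
      qed
    qed
    also have "\<dots> = (l' / real N)\<^sup>2 + (2 * B)\<^sup>2 * measure \<nu> E"
      using E\<nu> by (subst Bochner_Integration.integral_add) (auto simp: I.prob_space I.emeasure_eq_measure)
    also have "\<dots> \<le> l'\<^sup>2 * (1 / real N) + (2 * B)\<^sup>2 * (2 * real (card \<I>) * (1 / real N))"
    proof (intro add_mono mult_left_mono E(3))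
      have "1 / (real N * real N) \<le> 1 / real N" using N by (intro divide_left_mono) auto
      then have "l'\<^sup>2 * (1 / (real N * real N)) \<le> l'\<^sup>2 * (1 / real N)" by (intro mult_left_mono) auto
      then show "(l' / real N)\<^sup>2 \<le> l'\<^sup>2 * (1 / real N)" by (simp add: power2_eq_square)
    qed simp
    also have "\<dots> = (c / sqrt (real N))\<^sup>2"
      by (simp add: c_def power_divide add_divide_distrib)
    finally show "(s N)\<^sup>2 \<le> (c / sqrt (real N))\<^sup>2" .
  qed (simp add: c_def)
  then show ?thesis using that[of c] by (simp add: c_def)
qed

end

section \<open>Concentration of the samples\<close>

lemma sorted_nth_le_iff:
  fixes ys :: "'a::linorder list"
  assumes "sorted ys" "k < length ys"
  shows "ys ! k \<le> t \<longleftrightarrow> k < length (filter (\<lambda>y. y \<le> t) ys)"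
  using assms
proof (induction ys arbitrary: k)
  case (Cons a ys)
  show ?case
  proof (cases "a \<le> t")
    case True
    then show ?thesis using Cons by (cases k) auto
  next
    case False
    then have "filter (\<lambda>y. y \<le> t) (a # ys) = []" using Cons.prems(1) by (auto simp: filter_empty_conv)
    moreover have "(a # ys) ! k \<in> set (a # ys)" using Cons.prems(2) by (rule nth_mem)
    then have "a \<le> (a # ys) ! k" using Cons.prems(1) by auto
    ultimately show ?thesis using False by auto
  qed
qed simp

text \<open>Events about the ordered sample become events about counts, which are sums of
  independent indicators and do not see the ordering.\<close>

lemma order_statistic_le_iff:
  assumes i: "i \<in> {1..N}"
  shows "order_statistic N u i \<omega> \<le> t \<longleftrightarrow> i \<le> card {k\<in>{1..N}. u k \<omega> \<le> t}"
proof -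
  let ?xs = "map (\<lambda>k. u k \<omega>) [1..<Suc N]"
  have "mset (filter (\<lambda>y. y \<le> t) (sort ?xs)) = mset (filter (\<lambda>y. y \<le> t) ?xs)" by simp
  then have "length (filter (\<lambda>y. y \<le> t) (sort ?xs)) = length (filter (\<lambda>y. y \<le> t) ?xs)"
    by (rule mset_eq_length)
  also have "\<dots> = length (filter (\<lambda>k. u k \<omega> \<le> t) [1..<Suc N])"
    by (simp add: filter_map comp_def del: upt_Suc)
  also have "\<dots> = card {k\<in>{1..N}. u k \<omega> \<le> t}"
    by (subst distinct_length_filter) (auto intro!: arg_cong[where f=card] simp del: upt_Suc)
  finally have "length (filter (\<lambda>y. y \<le> t) (sort ?xs)) = card {k\<in>{1..N}. u k \<omega> \<le> t}" .
  moreover have "1 \<le> i" "i \<le> N" using i by auto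
  then have "i - 1 < N" by linarith
  then have "i - 1 < length (sort ?xs)" by simp
  ultimately show ?thesis
    unfolding order_statistic_def using i sorted_nth_le_iff[of "sort ?xs" "i - 1" t] by (auto simp del: upt_Suc)
qed

lemma order_statistic_range:
  assumes "i \<in> {1..N}" "\<And>k. k \<in> {1..N} \<Longrightarrow> u k \<omega> \<in> R"
  shows "order_statistic N u i \<omega> \<in> R"
proof -
  have "order_statistic N u i \<omega> \<in> set (sort (map (\<lambda>k. u k \<omega>) [1..<Suc N]))"
  proof -
    have "1 \<le> i" "i \<le> N" using assms(1) by auto
    then have "i - 1 < N" by linarith
    then show ?thesis unfolding order_statistic_def by (intro nth_mem) simp
  qed
  then show ?thesis using assms(2) by (auto simp del: upt_Suc)
qed

lemma card_eq_sum_indicator: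
  fixes t :: real and N :: nat
  shows "real (card {k\<in>{1..N}. u k \<le> t}) = (\<Sum>k\<in>{1..N}. indicator {..t} (u k))"
proof -
  have "(\<Sum>k\<in>{1..N}. indicator {..t} (u k)) = (\<Sum>k\<in>{1..N}. if u k \<le> t then 1 else 0 :: real)"
    by (intro sum.cong) auto
  also have "\<dots> = (\<Sum>k\<in>{k\<in>{1..N}. u k \<le> t}. 1)" by (rule sum.inter_filter[symmetric]) simp
  finally show ?thesis by simp
qed

lemma order_statistic_measurable:
  assumes u: "\<And>k. k \<in> {1..N} \<Longrightarrow> u k \<in> borel_measurable Q" and i: "i \<in> {1..N}"
  shows "order_statistic N u i \<in> borel_measurable Q"
  unfolding borel_measurable_iff_le
proof
  fix t
  have m: "(\<lambda>\<omega>. \<Sum>k\<in>{1..N}. indicator {..t} (u k \<omega>) :: real) \<in> borel_measurable Q"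
    using u by (intro borel_measurable_sum) measurable
  have "{\<omega> \<in> space Q. order_statistic N u i \<omega> \<le> t}
      = {\<omega> \<in> space Q. real i \<le> (\<Sum>k\<in>{1..N}. indicator {..t} (u k \<omega>))}"
    unfolding order_statistic_le_iff[OF i] card_eq_sum_indicator[symmetric] by simp
  also have "\<dots> \<in> sets Q" using m by measurable
  finally show "{\<omega> \<in> space Q. order_statistic N u i \<omega> \<le> t} \<in> sets Q" .
qed

lemma iid_uniform_measurable:
  assumes "prob_space Q" "iid_uniform Q N u" "k \<in> {1..N}"
  shows "u k \<in> borel_measurable Q"
  using assms by (auto simp: iid_uniform_def prob_space.indep_vars_def)

lemma iid_uniform_count_concentration:
  assumes Q: "prob_space Q" and u: "iid_uniform Q N u" and N: "1 \<le> N" and t: "t \<in> {0..1}" and \<epsilon>: "0 \<le> \<epsilon>"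
  shows "measure Q {\<omega>\<in>space Q. \<bar>real (card {k\<in>{1..N}. u k \<omega> \<le> t}) - real N * t\<bar> \<ge> real N * \<epsilon>}
    \<le> 2 * exp (- 2 * real N * \<epsilon>\<^sup>2)"
proof -
  interpret Q: prob_space Q by (rule Q)
  have um: "\<And>k. k \<in> {1..N} \<Longrightarrow> u k \<in> borel_measurable Q" using iid_uniform_measurable[OF Q u] .
  let ?X = "\<lambda>k \<omega>. indicator {..t} (u k \<omega>) :: real"
  have ind: "Q.indep_vars (\<lambda>_. borel) ?X {1..N}"
    using u by (intro Q.indep_vars_compose2[where Y="\<lambda>_. indicator {..t}" and M'="\<lambda>_. borel"]) (auto simp: iid_uniform_def)
  have exp: "Q.expectation (?X k) = t" if k: "k \<in> {1..N}" for k
  proof -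
    have "Q.expectation (?X k) = Q.expectation (indicator (u k -` {..t} \<inter> space Q))"
      by (intro Bochner_Integration.integral_cong) (auto simp: indicator_def)
    also have "\<dots> = measure Q (u k -` {..t} \<inter> space Q)" by simp
    also have "\<dots> = measure (distr Q borel (u k)) {..t}" using um[OF k] by (subst measure_distr) auto
    also have "distr Q borel (u k) = uniform_measure lborel {0..1}" using u k by (simp add: iid_uniform_def)
    also have "measure (uniform_measure lborel {0..1}) {..t} = t"
    proof -
      have "{0..1} \<inter> {..t} = {0..t}" using t by auto
      then show ?thesis using t by (subst measure_uniform_measure) auto
    qed
    finally show ?thesis .
  qed
  interpret H: Hoeffding_ineq Q "{1..N}" ?X "\<lambda>_. 0" "\<lambda>_. 1" "\<Sum>k\<in>{1..N}. Q.expectation (?X k)"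
  proof unfold_locales
    show "AE \<omega> in Q. ?X k \<omega> \<in> {0..1}" for k by (auto simp: indicator_def)
  qed (use ind in auto)
  have \<mu>: "(\<Sum>k\<in>{1..N}. Q.expectation (?X k)) = real N * t" using exp by simp
  have "Q.prob {\<omega>\<in>space Q. \<bar>(\<Sum>k\<in>{1..N}. ?X k \<omega>) - real N * t\<bar> \<ge> real N * \<epsilon>}
      \<le> 2 * exp (-2 * (real N * \<epsilon>)\<^sup>2 / (\<Sum>k\<in>{1..N}. (1 - 0)\<^sup>2))"
    using H.Hoeffding_ineq_abs_ge[of "real N * \<epsilon>"] \<epsilon> N unfolding \<mu> by simp
  also have "-2 * (real N * \<epsilon>)\<^sup>2 / (\<Sum>k\<in>{1..N}. (1 - 0)\<^sup>2) = - 2 * real N * \<epsilon>\<^sup>2"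
    using N by (simp add: power2_eq_square)
  finally show ?thesis unfolding card_eq_sum_indicator .
qed

text \<open>A union bound over the \<open>N\<close> levels \<open>j / N\<close> controls the counts;
  the order statistic is then enclosed between grid levels about \<open>N * \<epsilon>\<close> steps
  away from \<open>i\<close>. Rounding to the grid costs the extra \<open>1 / N\<close>.\<close>

lemma order_statistics_concentration:
  assumes Q: "prob_space Q" and u: "iid_uniform Q N u" and N: "1 \<le> N" and \<epsilon>: "0 < \<epsilon>"
  obtains E where "E \<in> sets Q" "measure Q E \<le> 2 * real N * exp (- 2 * real N * \<epsilon>\<^sup>2)"
    "\<And>\<omega> i. \<omega> \<in> space Q - E \<Longrightarrow> i \<in> {1..N} \<Longrightarrow> \<bar>order_statistic N u i \<omega> - real i / real N\<bar> \<le> \<epsilon> + 1 / real N"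
proof -
  interpret Q: prob_space Q by (rule Q)
  have um: "\<And>k. k \<in> {1..N} \<Longrightarrow> u k \<in> borel_measurable Q" using iid_uniform_measurable[OF Q u] .
  let ?c = "\<lambda>\<omega> t. real (card {k\<in>{1..N}. u k \<omega> \<le> t})"
  define B where "B j = {\<omega>\<in>space Q. \<bar>?c \<omega> (real j / real N) - real N * (real j / real N)\<bar> \<ge> real N * \<epsilon>}" for j :: nat
  have cm: "(\<lambda>\<omega>. \<Sum>k\<in>{1..N}. indicator {..t} (u k \<omega>) :: real) \<in> borel_measurable Q" for t
    using um by (intro borel_measurable_sum) measurable
  have Bm: "B j \<in> sets Q" for j
    unfolding B_def card_eq_sum_indicator using cm[of "real j / real N"] by measurable
  have Bp: "measure Q (B j) \<le> 2 * exp (- 2 * real N * \<epsilon>\<^sup>2)" if "j \<in> {1..N}" for j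
    unfolding B_def using that \<epsilon> N by (intro iid_uniform_count_concentration[OF Q u N]) auto
  show ?thesis
  proof (rule that[of "\<Union>j\<in>{1..N}. B j"])
    show "(\<Union>j\<in>{1..N}. B j) \<in> sets Q" using Bm by auto
    have "measure Q (\<Union>j\<in>{1..N}. B j) \<le> (\<Sum>j\<in>{1..N}. measure Q (B j))"
      using Bm by (intro Q.finite_measure_subadditive_finite) auto
    also have "\<dots> \<le> (\<Sum>j\<in>{1..N}. 2 * exp (- 2 * real N * \<epsilon>\<^sup>2))" by (intro sum_mono Bp)
    finally show "measure Q (\<Union>j\<in>{1..N}. B j) \<le> 2 * real N * exp (- 2 * real N * \<epsilon>\<^sup>2)" by simp
    fix \<omega> i assume \<omega>: "\<omega> \<in> space Q - (\<Union>j\<in>{1..N}. B j)" and i: "i \<in> {1..N}"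
    have close: "\<bar>?c \<omega> (real j / real N) - real j\<bar> < real N * \<epsilon>" if "j \<in> {1..N}" for j
      using \<omega> that N by (auto simp: B_def not_le)
    have range: "order_statistic N u i \<omega> \<in> {0..1}"
    proof (rule order_statistic_range[OF i])
      fix k assume "k \<in> {1..N}"
      then have "u k \<in> space Q \<rightarrow> {0..1}" using u by (simp add: iid_uniform_def)
      then show "u k \<omega> \<in> {0..1}" using \<omega> by blast
    qed
    have upper: "order_statistic N u i \<omega> \<le> real i / real N + \<epsilon> + 1 / real N"
    proof -
      \<comment> \<open>A grid level, rounded up, at which the count must exceed \<open>i\<close>.
        If it lies beyond \<open>N\<close>, the asserted bound exceeds 1 and holds since samples lie
        in [0,1].\<close>
      define j where "j = nat \<lceil>real i + real N * \<epsilon>\<rceil>"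
      have ij: "real i + real N * \<epsilon> \<le> real j" "real j < real i + real N * \<epsilon> + 1"
        using \<epsilon> unfolding j_def by (auto simp: of_nat_nat) linarith+
      show ?thesis
      proof (cases "j \<le> N")
        case True
        have "i \<le> j" using ij(1) \<epsilon> N by (smt (verit) mult_pos_pos of_nat_0_less_iff of_nat_le_iff less_le_trans zero_less_one)
        then have "j \<in> {1..N}" using True i by auto
        then have "real i < ?c \<omega> (real j / real N)" using close[of j] ij(1) by linarith
        then have "order_statistic N u i \<omega> \<le> real j / real N"
          unfolding order_statistic_le_iff[OF i] by simp
        also have "\<dots> \<le> (real i + real N * \<epsilon> + 1) / real N" using ij(2) by (intro divide_right_mono) auto
        also have "\<dots> = real i / real N + \<epsilon> + 1 / real N" using N by (simp add: add_divide_distrib)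
        finally show ?thesis .
      next
        case False
        then have "real N < real i + real N * \<epsilon> + 1" using ij(2) by linarith
        then have "real N / real N \<le> (real i + real N * \<epsilon> + 1) / real N" by (intro divide_right_mono) auto
        then have "1 \<le> real i / real N + \<epsilon> + 1 / real N" using N by (simp add: add_divide_distrib)
        then show ?thesis using range by simp
      qed
    qed
    have lower: "real i / real N - \<epsilon> - 1 / real N \<le> order_statistic N u i \<omega>"
    proof (cases "1 \<le> real i - real N * \<epsilon>")
      case True
      \<comment> \<open>Rounded down, so that the count at level \<open>j / N\<close> stays below
        \<open>i\<close>. When no such level exists, the asserted lower bound is not
        positive.\<close>
      define j where "j = nat \<lfloor>real i - real N * \<epsilon>\<rfloor>"
      have ij: "real j \<le> real i - real N * \<epsilon>" "real i - real N * \<epsilon> < real j + 1"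
        using True unfolding j_def by (auto simp: of_nat_nat)
      have "1 \<le> j" using True unfolding j_def by (simp add: le_nat_iff le_floor_iff)
      moreover have "real j \<le> real i" using ij(1) \<epsilon> N by (smt (verit) mult_nonneg_nonneg of_nat_0_le_iff)
      ultimately have "j \<in> {1..N}" using i by auto
      then have "?c \<omega> (real j / real N) < real i" using close[of j] ij(1) by linarith
      then have "\<not> order_statistic N u i \<omega> \<le> real j / real N"
        unfolding order_statistic_le_iff[OF i] by simp
      moreover have "(real i - real N * \<epsilon> - 1) / real N \<le> real j / real N" using ij(2) by (intro divide_right_mono) auto
      moreover have "(real i - real N * \<epsilon> - 1) / real N = real i / real N - \<epsilon> - 1 / real N"
        using N by (simp add: diff_divide_distrib)
      ultimately show ?thesis by linarith
    next
      case False
      then have "(real i - real N * \<epsilon> - 1) / real N \<le> 0" by (simp add: divide_le_0_iff)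
      moreover have "(real i - real N * \<epsilon> - 1) / real N = real i / real N - \<epsilon> - 1 / real N"
        using N by (simp add: diff_divide_distrib)
      ultimately show ?thesis using range by simp
    qed
    show "\<bar>order_statistic N u i \<omega> - real i / real N\<bar> \<le> \<epsilon> + 1 / real N"
      using upper lower by (simp add: abs_le_iff)
  qed
qed

section \<open>Codegrees of a random simple graph\<close>

definition edge :: "nat \<Rightarrow> nat \<Rightarrow> nat \<times> nat" where
  "edge i j = (min i j, max i j)"

lemma edge_node_pairs: "i \<in> {1..N} \<Longrightarrow> j \<in> {1..N} \<Longrightarrow> i \<noteq> j \<Longrightarrow> edge i j \<in> node_pairs N"
  by (auto simp: edge_def node_pairs_def)

lemma edge_eq_iff: "edge i j = edge i' j' \<longleftrightarrow> (i = i' \<and> j = j') \<or> (i = j' \<and> j = i')"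
  by (auto simp: edge_def min_def max_def split: if_splits)

lemma finite_node_pairs: "finite (node_pairs N)"
  by (rule finite_subset[of _ "{1..N} \<times> {1..N}"]) (auto simp: node_pairs_def)

text \<open>The conditional law of the edges given the positions, as a product of Bernoulli laws.
  Each unordered pair is one coordinate, indexed with the smaller node first.\<close>

definition random_graph :: "nat \<Rightarrow> (nat \<Rightarrow> nat \<Rightarrow> real) \<Rightarrow> (nat \<times> nat \<Rightarrow> bool) pmf" where
  "random_graph N G = Pi_pmf (node_pairs N) False (\<lambda>q. bernoulli_pmf (G (fst q) (snd q)))"

text \<open>An entry of \<open>B\<^sup>T B\<close> with the rows \<open>j\<close> and
  \<open>k\<close> left out. Those rows meet the diagonal of \<open>B\<close>, which is not centered
  since the graph has no loops.\<close>

definition codegree :: "nat \<Rightarrow> (nat \<Rightarrow> nat \<Rightarrow> real) \<Rightarrow> nat \<Rightarrow> nat \<Rightarrow> real" where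
  "codegree N B j k = (\<Sum>i\<in>{1..N} - {j, k}. B i j * B i k)"

definition centered_edge :: "(nat \<Rightarrow> nat \<Rightarrow> real) \<Rightarrow> (nat \<times> nat \<Rightarrow> bool) \<Rightarrow> nat \<Rightarrow> nat \<Rightarrow> real" where
  "centered_edge G f i j = of_bool (f (edge i j)) - G i j"

text \<open>For fixed \<open>j \<noteq> k\<close> the summands depend on disjoint sets of edges and
  are therefore independent. Each is a product of two independent centered factors of modulus at
  most 1, so Hoeffding's inequality applies with range 2 per summand.\<close>

lemma codegree_concentration:
  assumes G: "\<And>i j. i \<in> {1..N} \<Longrightarrow> j \<in> {1..N} \<Longrightarrow> G i j \<in> {0..1} \<and> G i j = G j i"
    and jk: "j \<in> {1..N}" "k \<in> {1..N}" "j \<noteq> k" and t: "0 < t"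
  shows "measure_pmf.prob (random_graph N G) {f. \<bar>codegree N (centered_edge G f) j k\<bar> \<ge> t}
    \<le> 2 * exp (- t\<^sup>2 / (2 * real N))"
proof (cases "{1..N} - {j, k} = {}")
  case True
  show ?thesis unfolding codegree_def True using t by simp
next
  case False
  let ?p = "random_graph N G" and ?I = "{1..N} - {j, k}" and ?m = "measure_pmf (random_graph N G)"
  note PS = measure_pmf.prob_space_axioms[of ?p]
  let ?V = "\<lambda>j i f. centered_edge G f i j"
  define X where "X i f = centered_edge G f i j * centered_edge G f i k" for i f
  have ind0: "prob_space.indep_vars ?m (\<lambda>_. count_space UNIV) (\<lambda>q f. f q) (node_pairs N)"
    unfolding random_graph_def by (rule indep_vars_Pi_pmf[OF finite_node_pairs])
  let ?K = "\<lambda>i. {edge i j, edge i k}"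
  have K: "?K i \<subseteq> node_pairs N" if "i \<in> ?I" for i using that jk by (auto intro: edge_node_pairs)
  have disj: "disjoint_family_on ?K ?I" by (auto simp: disjoint_family_on_def edge_eq_iff)
  have ind1: "prob_space.indep_vars ?m (\<lambda>i. PiM (?K i) (\<lambda>_. count_space UNIV)) (\<lambda>i f. restrict (\<lambda>q. f q) (?K i)) ?I"
    by (rule prob_space.indep_vars_restrict[OF PS ind0 K disj])
  have "prob_space.indep_vars ?m (\<lambda>_. borel) (\<lambda>i f. (\<lambda>i g. (of_bool (g (edge i j)) - G i j) * (of_bool (g (edge i k)) - G i k)) i
      (restrict (\<lambda>q. f q) (?K i))) ?I"
  proof (rule prob_space.indep_vars_compose2[OF PS ind1])
    fix i assume "i \<in> ?I"
    have comp: "(\<lambda>g. g (edge i m)) \<in> PiM (?K i) (\<lambda>_. count_space UNIV) \<rightarrow>\<^sub>M count_space (UNIV :: bool set)"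
      if "edge i m \<in> ?K i" for m
      using that by (rule measurable_component_singleton)
    have "(\<lambda>g. of_bool (g (edge i m)) :: real) \<in> borel_measurable (PiM (?K i) (\<lambda>_. count_space UNIV))"
      if "edge i m \<in> ?K i" for m
      by (rule measurable_compose[OF comp[OF that]]) simp
    then show "(\<lambda>g. (of_bool (g (edge i j)) - G i j) * (of_bool (g (edge i k)) - G i k))
        \<in> borel_measurable (PiM (?K i) (\<lambda>_. count_space UNIV))"
      by (intro borel_measurable_times borel_measurable_diff borel_measurable_const) auto
  qed
  then have ind: "prob_space.indep_vars ?m (\<lambda>_. borel) X ?I"
    unfolding X_def[abs_def] centered_edge_def by simp
  have bound1: "\<bar>centered_edge G f i m\<bar> \<le> 1" if "i \<in> ?I" "m \<in> {j, k}" for i f m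
  proof -
    have "G i m \<in> {0..1}" using G[of i m] that jk by auto
    then show ?thesis by (auto simp: centered_edge_def abs_le_iff)
  qed
  have bound: "X i f \<in> {-1..1}" if "i \<in> ?I" for i f
  proof -
    have "\<bar>X i f\<bar> \<le> 1 * 1" unfolding X_def abs_mult using bound1[OF that] by (intro mult_mono) auto
    then show ?thesis by (simp add: abs_le_iff)
  qed
  have mean0: "measure_pmf.expectation ?p (\<lambda>f. centered_edge G f i m) = 0" if i: "i \<in> ?I" and m: "m \<in> {j, k}" for i m
  proof -
    have im: "edge i m \<in> node_pairs N" using i m jk by (intro edge_node_pairs) auto
    have Gim: "G (fst (edge i m)) (snd (edge i m)) = G i m" "G i m \<in> {0..1}"
      using G[of i m] G[of m i] i m jk by (auto simp: edge_def min_def max_def)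
    have comp: "map_pmf (\<lambda>f. f (edge i m)) ?p = bernoulli_pmf (G i m)"
      unfolding random_graph_def using im finite_node_pairs by (subst Pi_pmf_component) (auto simp: Gim)
    have "measure_pmf.expectation ?p (\<lambda>f. of_bool (f (edge i m)) - G i m)
        = measure_pmf.expectation (map_pmf (\<lambda>f. f (edge i m)) ?p) (\<lambda>b. of_bool b - G i m)"
      by (rule integral_map_pmf[symmetric])
    also have "\<dots> = measure_pmf.expectation (bernoulli_pmf (G i m)) (\<lambda>b. of_bool b - G i m)"
      unfolding comp ..
    also have "\<dots> = 0" using Gim(2) by (subst integral_bernoulli_pmf) (auto simp: algebra_simps)
    finally show ?thesis by (simp add: centered_edge_def)
  qed
  have mean: "measure_pmf.expectation ?p (X i) = 0" if i: "i \<in> ?I" for i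
  proof -
    have ne: "edge i j \<noteq> edge i k" using jk by (auto simp: edge_eq_iff)
    have ind2: "prob_space.indep_vars ?m (\<lambda>_. borel) (\<lambda>m f. centered_edge G f i m) {j, k}"
    proof -
      have sub: "{edge i m} \<subseteq> node_pairs N" if "m \<in> {j, k}" for m using K[OF i] that by auto
      have dis: "disjoint_family_on (\<lambda>m. {edge i m}) {j, k}"
        by (auto simp: disjoint_family_on_def edge_eq_iff)
      have "prob_space.indep_vars ?m (\<lambda>_. borel)
          (\<lambda>m f. (\<lambda>m g. of_bool (g (edge i m)) - G i m :: real) m (restrict (\<lambda>q. f q) {edge i m})) {j, k}"
      proof (rule prob_space.indep_vars_compose2[OF PS prob_space.indep_vars_restrict[OF PS ind0 sub dis]])
        fix m
        have "(\<lambda>g. g (edge i m)) \<in> PiM {edge i m} (\<lambda>_. count_space UNIV) \<rightarrow>\<^sub>M count_space (UNIV :: bool set)"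
          by (rule measurable_component_singleton) simp
        then have "(\<lambda>g. of_bool (g (edge i m)) :: real) \<in> borel_measurable (PiM {edge i m} (\<lambda>_. count_space UNIV))"
          by (rule measurable_compose) simp
        then show "(\<lambda>g. of_bool (g (edge i m)) - G i m)
            \<in> borel_measurable (PiM {edge i m} (\<lambda>_. count_space UNIV))"
          by (intro borel_measurable_diff borel_measurable_const)
      qed
      then show ?thesis by (simp add: centered_edge_def)
    qed
    have int: "integrable ?m (\<lambda>f. centered_edge G f i m)" if "m \<in> {j, k}" for m
      using bound1[OF i that] by (intro measure_pmf.integrable_const_bound[where B=1]) auto
    have "measure_pmf.expectation ?p (\<lambda>f. \<Prod>m\<in>{j, k}. centered_edge G f i m)
        = (\<Prod>m\<in>{j, k}. measure_pmf.expectation ?p (\<lambda>f. centered_edge G f i m))"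
      by (rule prob_space.indep_vars_lebesgue_integral[OF PS _ ind2 int]) auto
    then have "measure_pmf.expectation ?p (X i)
        = measure_pmf.expectation ?p (\<lambda>f. centered_edge G f i j) * measure_pmf.expectation ?p (\<lambda>f. centered_edge G f i k)"
      using jk(3) by (simp add: X_def[abs_def])
    then show ?thesis using mean0[OF i] by simp
  qed
  interpret H: Hoeffding_ineq "measure_pmf ?p" ?I X "\<lambda>_. -1" "\<lambda>_. 1" "\<Sum>i\<in>?I. measure_pmf.expectation ?p (X i)"
    by unfold_locales (use ind bound in auto)
  have \<mu>: "(\<Sum>i\<in>?I. measure_pmf.expectation ?p (X i)) = 0" using mean by simp
  have card: "0 < real (card ?I)" "real (card ?I) \<le> real N"
  proof -
    show "0 < real (card ?I)" using False by (simp add: card_gt_0_iff)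
    have "card ?I \<le> card {1..N}" by (intro card_mono) auto
    then show "real (card ?I) \<le> real N" by simp
  qed
  have var: "(\<Sum>i\<in>?I. (1 - - 1 :: real)\<^sup>2) = 4 * real (card ?I)" by simp
  have "measure_pmf.prob ?p {f\<in>space (measure_pmf ?p). \<bar>(\<Sum>i\<in>?I. X i f) - 0\<bar> \<ge> t} \<le> 2 * exp (-2 * t\<^sup>2 / (4 * real (card ?I)))"
    using H.Hoeffding_ineq_abs_ge[of t] t card(1) unfolding \<mu> var by simp
  also have "\<dots> \<le> 2 * exp (- t\<^sup>2 / (2 * real N))"
  proof -
    have "t\<^sup>2 / (2 * real N) \<le> t\<^sup>2 / (2 * real (card ?I))" using card by (intro divide_left_mono) auto
    then show ?thesis by simp
  qed
  finally show ?thesis by (simp add: codegree_def X_def)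
qed

lemma codegrees_concentration:
  assumes G: "\<And>i j. i \<in> {1..N} \<Longrightarrow> j \<in> {1..N} \<Longrightarrow> G i j \<in> {0..1} \<and> G i j = G j i" and t: "0 < t"
  shows "measure_pmf.prob (random_graph N G)
      {f. \<exists>j\<in>{1..N}. \<exists>k\<in>{1..N}. j \<noteq> k \<and> \<bar>codegree N (centered_edge G f) j k\<bar> \<ge> t}
    \<le> 2 * (real N)\<^sup>2 * exp (- t\<^sup>2 / (2 * real N))"
proof -
  let ?J = "{(j, k). j \<in> {1..N} \<and> k \<in> {1..N} \<and> j \<noteq> k}"
  let ?B = "\<lambda>q. {f. \<bar>codegree N (centered_edge G f) (fst q) (snd q)\<bar> \<ge> t}"
  have sub: "?J \<subseteq> {1..N} \<times> {1..N}" by auto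
  have fin: "finite ?J" by (rule finite_subset[OF sub]) simp
  have "card ?J \<le> N * N" using card_mono[OF _ sub] by simp
  then have "real (card ?J) \<le> real (N * N)" by (rule of_nat_mono)
  then have card: "real (card ?J) \<le> (real N)\<^sup>2" by (simp only: power2_eq_square of_nat_mult)
  have eq: "{f. \<exists>j\<in>{1..N}. \<exists>k\<in>{1..N}. j \<noteq> k \<and> \<bar>codegree N (centered_edge G f) j k\<bar> \<ge> t} = (\<Union>q\<in>?J. ?B q)"
    (is "?L = _")
  proof (intro set_eqI iffI)
    fix f assume "f \<in> ?L"
    then obtain j k where jk: "j \<in> {1..N}" "k \<in> {1..N}" "j \<noteq> k" "\<bar>codegree N (centered_edge G f) j k\<bar> \<ge> t"
      by (elim CollectE bexE conjE) (rule that)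
    then have "(j, k) \<in> ?J" "f \<in> ?B (j, k)" by simp_all
    then show "f \<in> (\<Union>q\<in>?J. ?B q)" by (rule UN_I)
  next
    fix f assume "f \<in> (\<Union>q\<in>?J. ?B q)"
    then obtain j k where "j \<in> {1..N}" "k \<in> {1..N}" "j \<noteq> k" "\<bar>codegree N (centered_edge G f) j k\<bar> \<ge> t"
      by (elim UN_E CollectE case_prodE conjE) auto
    then have "\<exists>k\<in>{1..N}. j \<noteq> k \<and> \<bar>codegree N (centered_edge G f) j k\<bar> \<ge> t"
      by (intro bexI[of _ k] conjI)
    from bexI[of "\<lambda>j. \<exists>k\<in>{1..N}. j \<noteq> k \<and> \<bar>codegree N (centered_edge G f) j k\<bar> \<ge> t", OF this \<open>j \<in> {1..N}\<close>]
    show "f \<in> ?L" unfolding mem_Collect_eq .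
  qed
  have "measure_pmf.prob (random_graph N G) (\<Union>q\<in>?J. ?B q) \<le> (\<Sum>q\<in>?J. measure_pmf.prob (random_graph N G) (?B q))"
    using fin by (intro measure_pmf.finite_measure_subadditive_finite) auto
  also have "\<dots> \<le> (\<Sum>q\<in>?J. 2 * exp (- t\<^sup>2 / (2 * real N)))"
  proof (rule sum_mono)
    fix q assume "q \<in> ?J"
    then have "fst q \<in> {1..N}" "snd q \<in> {1..N}" "fst q \<noteq> snd q" by auto
    from codegree_concentration[OF G this t]
    show "measure_pmf.prob (random_graph N G) (?B q) \<le> 2 * exp (- t\<^sup>2 / (2 * real N))" .
  qed
  also have "\<dots> = real (card ?J) * (2 * exp (- t\<^sup>2 / (2 * real N)))" by simp
  also have "\<dots> \<le> (real N)\<^sup>2 * (2 * exp (- t\<^sup>2 / (2 * real N)))" using card by (intro mult_right_mono) auto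
  finally show ?thesis unfolding eq by (simp only: mult.left_commute mult.assoc)
qed

lemma l2_norm_sum_sq:
  assumes b: "\<And>j. j \<in> J \<Longrightarrow> square_integrable M (b j)"
  shows "(l2_norm M (\<lambda>p. \<Sum>j\<in>J. c j * b j p))\<^sup>2 = (\<Sum>j\<in>J. \<Sum>k\<in>J. c j * c k * (LINT p|M. b j p * b k p))"
proof -
  have i: "integrable M (\<lambda>p. c j * c k * (b j p * b k p))" if "j \<in> J" "k \<in> J" for j k
    using integrable_mult_square[OF b[OF that(1)] b[OF that(2)]] by (rule integrable_mult_right)
  have "(l2_norm M (\<lambda>p. \<Sum>j\<in>J. c j * b j p))\<^sup>2 = (LINT p|M. (\<Sum>j\<in>J. \<Sum>k\<in>J. c j * c k * (b j p * b k p)))"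
    unfolding l2_norm_sq by (simp only: power2_eq_square sum_product mult_ac)
  also have "\<dots> = (\<Sum>j\<in>J. LINT p|M. (\<Sum>k\<in>J. c j * c k * (b j p * b k p)))"
    using i by (intro Bochner_Integration.integral_sum Bochner_Integration.integrable_sum)
  also have "\<dots> = (\<Sum>j\<in>J. \<Sum>k\<in>J. LINT p|M. c j * c k * (b j p * b k p))"
    using i by (intro sum.cong refl Bochner_Integration.integral_sum)
  finally show ?thesis by (simp only: integral_mult_right_zero)
qed

text \<open>The rows \<open>j\<close> and \<open>k\<close> are restored at the cost of at most 1
  each.\<close>

lemma codegree_full_sum_bound:
  fixes B :: "nat \<Rightarrow> nat \<Rightarrow> real"
  assumes B: "\<And>i j. i \<in> {1..N} \<Longrightarrow> j \<in> {1..N} \<Longrightarrow> \<bar>B i j\<bar> \<le> 1" and jk: "j \<in> {1..N}" "k \<in> {1..N}"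
  shows "\<bar>\<Sum>i=1..N. B i j * B i k\<bar> \<le> \<bar>codegree N B j k\<bar> + 2"
proof -
  have entry: "\<bar>B i j * B i k\<bar> \<le> 1" if "i \<in> {1..N}" for i
    using mult_mono[OF B[OF that jk(1)] B[OF that jk(2)]] by (simp add: abs_mult)
  have sub: "{j, k} \<subseteq> {1..N}" using jk by simp
  have split: "(\<Sum>i=1..N. B i j * B i k) = codegree N B j k + (\<Sum>i\<in>{j, k}. B i j * B i k)"
    unfolding codegree_def by (rule sum.subset_diff[OF sub finite_atLeastAtMost])
  have "\<bar>\<Sum>i\<in>{j, k}. B i j * B i k\<bar> \<le> (\<Sum>i\<in>{j, k}. 1)"
    using sub entry by (intro order_trans[OF sum_abs] sum_mono) blast
  also have "\<dots> \<le> 2" by (simp add: card_insert_if)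
  finally show ?thesis unfolding split by linarith
qed

section \<open>Distance of sampled graphs to the graphon\<close>

context graphon_game
begin

text \<open>The graph is the step graphon that reads \<open>W\<close> at the positions
  \<open>v\<close>. It differs from \<open>W\<close> by order \<open>D + 1 / N\<close> away from the
  partition boundaries, and by at most 1 on strips of measure of the same order. The constant
  collects \<open>2 * \<bar>LW\<bar>\<close> from the two arguments and the strips of both
  variables.\<close>

lemma close_to_graphon_weighted:
  obtains c where "0 \<le> c" "\<And>N v D. 1 \<le> N \<Longrightarrow> 0 \<le> D \<Longrightarrow> (\<And>i. i \<in> {1..N} \<Longrightarrow> v i \<in> {0..1}) \<Longrightarrow>
    (\<And>i. i \<in> {1..N} \<Longrightarrow> \<bar>v i - real i / real N\<bar> \<le> D) \<Longrightarrow>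
    close_to_graphon N (\<lambda>i j. W (v i) (v j)) (c * (D + 1 / real N))"
proof -
  from W_Lipschitz obtain LW \<I> where part: "finite_interval_partition \<I>" and
    lip': "\<forall>I\<in>\<I>. \<forall>J\<in>\<I>. \<forall>x\<in>I. \<forall>x'\<in>I. \<forall>y\<in>J. \<forall>y'\<in>J.
      \<bar>W x y - W x' y'\<bar> \<le> LW * (\<bar>x - x'\<bar> + \<bar>y - y'\<bar>)"
    unfolding piecewise_lipschitz_graphon_def by (elim exE conjE)
  note lip = lip'[rule_format]
  define c where "c = M * (2 * \<bar>LW\<bar> + 4 * real (card \<I>))"
  have "close_to_graphon N (\<lambda>i j. W (v i) (v j)) (c * (D + 1 / real N))"
    if N: "1 \<le> N" and D0: "0 \<le> D" and v: "\<And>i. i \<in> {1..N} \<Longrightarrow> v i \<in> {0..1}"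
      and vD: "\<And>i. i \<in> {1..N} \<Longrightarrow> \<bar>v i - real i / real N\<bar> \<le> D" for N v D
    unfolding close_to_graphon_def
  proof (intro allI impI)
    fix b :: "nat \<Rightarrow> 'w process" assume "\<forall>j\<in>{1..N}. b j \<in> A0"
    then have bA: "\<And>j. j \<in> {1..N} \<Longrightarrow> b j \<in> A0" by auto
    let ?G = "\<lambda>i j. W (v i) (v j)" and ?b = "step_profile N b"
    \<comment> \<open>A point is at most \<open>1 / N\<close> away from the right end of its cell,
      and that end is within \<open>D\<close> of the position.\<close>
    define D' where "D' = D + 1 / real N"
    have D': "0 \<le> D'" using D0 by (simp add: D'_def)
    obtain E where E: "E \<in> sets borel" "E \<subseteq> {0..1}" "measure \<nu> E \<le> 2 * real (card \<I>) * D'"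
      "\<And>x v. x \<in> {0..1} - E \<Longrightarrow> v \<in> {0..1} \<Longrightarrow> \<bar>x - v\<bar> \<le> D' \<Longrightarrow> \<exists>I\<in>\<I>. x \<in> I \<and> v \<in> I"
      using interval_partition_near_boundary[OF index part D'] by blast
    have E\<nu>: "E \<in> sets \<nu>" by (rule unit_lebesgue_borel(1)[OF index E(1,2)])
    have iE: "integrable \<nu> (indicator E :: real \<Rightarrow> real)"
      using E\<nu> by (intro integrable_real_indicator) (auto simp: I.emeasure_eq_measure)
    have bf: "?b \<in> families" by (rule step_profile_families[OF N bA])
    have zL: "L2_profile \<nu> \<mu> (step_profile N (network_agg N ?G b))"
      using step_profile_space(1)[OF N network_agg_K[OF bA]] by (simp add: profile_space_iff)
    have vc: "v (cell N x) \<in> {0..1}" "\<bar>x - v (cell N x)\<bar> \<le> D'" if x: "x \<in> {0..1}" for x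
      using v[OF cell_unit_cell(1)[OF N x]] vD[OF cell_unit_cell(1)[OF N x]] cell_right_endpoint[OF N x]
      unfolding D'_def by linarith+
    have diff: "\<bar>W x y - ?G (cell N x) (cell N y)\<bar> \<le> 2 * \<bar>LW\<bar> * D' + indicator E x + indicator E y"
      if x: "x \<in> {0..1}" and y: "y \<in> {0..1}" for x y
    proof (cases "x \<in> E \<or> y \<in> E")
      case True
      have "W x y \<in> {0..1}" "?G (cell N x) (cell N y) \<in> {0..1}"
        using W_bounds x y vc(1) by auto
      then have "\<bar>W x y - ?G (cell N x) (cell N y)\<bar> \<le> 1" by (auto simp: abs_le_iff)
      also have "1 \<le> 2 * \<bar>LW\<bar> * D' + indicator E x + indicator E y"
        using True D' by (auto simp: indicator_def)
      finally show ?thesis .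
    next
      case False
      obtain I where I: "I \<in> \<I>" "x \<in> I" "v (cell N x) \<in> I" using E(4)[of x "v (cell N x)"] False x vc by blast
      obtain J where J: "J \<in> \<I>" "y \<in> J" "v (cell N y) \<in> J" using E(4)[of y "v (cell N y)"] False y vc by blast
      have "\<bar>W x y - ?G (cell N x) (cell N y)\<bar> \<le> LW * (\<bar>x - v (cell N x)\<bar> + \<bar>y - v (cell N y)\<bar>)"
        by (rule lip[OF I(1) J(1) I(2,3) J(2,3)])
      also have "\<dots> \<le> \<bar>LW\<bar> * (D' + D')" using vc(2)[OF x] vc(2)[OF y] by (intro mult_mono add_mono) auto
      finally show ?thesis using False by simp
    qed
    have pt: "nrm (Z ?b x - network_agg N ?G b (cell N x)) \<le> M * (2 * \<bar>LW\<bar> * D' + indicator E x + measure \<nu> E)"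
      if x: "x \<in> {0..1}" for x
    proof -
      let ?v = "\<lambda>y. ?G (cell N x) (cell N y)"
      \<comment> \<open>The network aggregate is itself an average over the index space, so the two
        averages differ only in their weights.\<close>
      have agg: "network_agg N ?G b (cell N x) = (\<lambda>p. LINT y|\<nu>. ?v y * ?b y p)"
        unfolding step_profile_cell network_agg_def
        by (intro ext integral_cell(2)[OF index N, symmetric])
      have "nrm (Z ?b x - network_agg N ?G b (cell N x)) \<le> (LINT y|\<nu>. \<bar>W x y - ?v y\<bar> * nrm (?b y))"
        unfolding agg graphon_op_def
      proof (rule weighted_average_diff_weight[OF families_L2[OF bf] W_section[OF x]])
        show "?v \<in> borel_measurable \<nu>"
          by (rule measurable_compose[OF cell_measurable[OF index N]]) simp
      qed (use W_bounds x vc(1) in \<open>auto simp: space_\<nu>\<close>)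
      also have "\<dots> \<le> (LINT y|\<nu>. (2 * \<bar>LW\<bar> * D' + indicator E x + indicator E y) * M)"
      proof (rule integral_mono)
        have "W x y \<in> {0..1}" "?v y \<in> {0..1}" if "y \<in> {0..1}" for y
          using W_bounds x that vc(1) by auto
        then have "\<bar>W x y - ?v y\<bar> \<le> 1" if "y \<in> space \<nu>" for y
          using that unfolding space_\<nu> by (fastforce simp: abs_le_iff)
        moreover have "(\<lambda>y. W x y - ?v y) \<in> borel_measurable \<nu>"
          by (intro borel_measurable_diff W_section[OF x] measurable_compose[OF cell_measurable[OF index N]]) simp
        ultimately show "integrable \<nu> (\<lambda>y. \<bar>W x y - ?v y\<bar> * nrm (?b y))"
          using L2_profile_mean_norm(1)[OF families_L2[OF bf]] by (intro integral_weight_le(2)) auto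
        show "integrable \<nu> (\<lambda>y. (2 * \<bar>LW\<bar> * D' + indicator E x + indicator E y) * M)"
          using iE by (intro integrable_mult_left Bochner_Integration.integrable_add) auto
        fix y assume "y \<in> space \<nu>"
        then have y: "y \<in> {0..1}" by (simp add: space_\<nu>)
        show "\<bar>W x y - ?v y\<bar> * nrm (?b y) \<le> (2 * \<bar>LW\<bar> * D' + indicator E x + indicator E y) * M"
          using diff[OF x y] nrm_A0[OF families_A0[OF bf y]] D' by (intro mult_mono) (auto simp: indicator_def)
      qed
      also have "\<dots> = M * (2 * \<bar>LW\<bar> * D' + indicator E x + measure \<nu> E)"
        using iE E\<nu> by (simp add: I.prob_space I.emeasure_eq_measure mult.commute)
      finally show ?thesis .
    qed
    have "(LINT x|\<nu>. nrm (Z ?b x - network_agg N ?G b (cell N x)))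
        \<le> (LINT x|\<nu>. M * (2 * \<bar>LW\<bar> * D' + indicator E x + measure \<nu> E))"
    proof (rule integral_mono)
      show "integrable \<nu> (\<lambda>x. nrm (Z ?b x - network_agg N ?G b (cell N x)))"
        using L2_profile_mean_norm(1)[OF L2_profile_diff[OF Z_L2[OF bf] zL]] by (simp add: step_profile_cell)
      show "integrable \<nu> (\<lambda>x. M * (2 * \<bar>LW\<bar> * D' + indicator E x + measure \<nu> E))"
        using iE by (intro integrable_mult_right Bochner_Integration.integrable_add) auto
    qed (use pt in \<open>simp add: space_\<nu>\<close>)
    also have "\<dots> = M * (2 * \<bar>LW\<bar> * D' + 2 * measure \<nu> E)"
      using iE E\<nu> by (simp add: I.prob_space I.emeasure_eq_measure)
    also have "\<dots> \<le> M * (2 * \<bar>LW\<bar> * D' + 2 * (2 * real (card \<I>) * D'))"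
      using E(3) M_nonneg by (intro mult_left_mono add_left_mono) auto
    also have "\<dots> = c * (D + 1 / real N)" by (simp add: c_def D'_def algebra_simps)
    finally show "(LINT x|\<nu>. nrm (Z ?b x - network_agg N ?G b (cell N x))) \<le> c * (D + 1 / real N)" .
  qed
  moreover have "0 \<le> c" using M_nonneg by (simp add: c_def)
  ultimately show ?thesis using that by blast
qed

text \<open>The operator norm of \<open>B = G' - G\<close> is replaced by the entries of \<open>B\<^sup>T B\<close>: the actions are
  bounded uniformly over the players.\<close>

lemma close_to_graphon_perturbed:
  assumes N: "1 \<le> N" and G: "unit_weights N G" and G': "unit_weights N G'"
    and close: "close_to_graphon N G e" and t: "0 \<le> t"
    and cod: "\<And>j k. j \<in> {1..N} \<Longrightarrow> k \<in> {1..N} \<Longrightarrow> j \<noteq> k \<Longrightarrow> \<bar>codegree N (\<lambda>i j. G' i j - G i j) j k\<bar> \<le> t"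
  shows "close_to_graphon N G' (e + M * sqrt ((3 + t) / real N))"
  unfolding close_to_graphon_def
proof (intro allI impI)
  fix b :: "nat \<Rightarrow> 'w process" assume b: "\<forall>j\<in>{1..N}. b j \<in> A0"
  then have bA: "\<And>j. j \<in> {1..N} \<Longrightarrow> b j \<in> A0" by auto
  define B where "B i j = G' i j - G i j" for i j
  have B1: "\<bar>B i j\<bar> \<le> 1" if "i \<in> {1..N}" "j \<in> {1..N}" for i j
  proof -
    have "G' i j \<in> {0..1}" "G i j \<in> {0..1}" using G G' that by (auto simp: unit_weights_def)
    then show ?thesis by (auto simp: B_def abs_le_iff)
  qed
  have col: "\<bar>\<Sum>i=1..N. B i j * B i k\<bar> \<le> (if j = k then real N else t + 2)" if jk: "j \<in> {1..N}" "k \<in> {1..N}" for j k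
  proof (cases "j = k")
    case True
    have "\<bar>\<Sum>i=1..N. B i j * B i k\<bar> \<le> (\<Sum>i=1..N. 1)"
    proof (intro order_trans[OF sum_abs] sum_mono)
      fix i assume "i \<in> {1..N}"
      then show "\<bar>B i j * B i k\<bar> \<le> 1"
        using mult_mono[OF B1[of i j] B1[of i k]] jk by (simp add: abs_mult)
    qed
    then show ?thesis using True by simp
  next
    case False
    have "\<bar>codegree N B j k\<bar> \<le> t" using cod[OF jk False] by (simp add: B_def[abs_def])
    moreover have "\<bar>\<Sum>i=1..N. B i j * B i k\<bar> \<le> \<bar>codegree N B j k\<bar> + 2"
      by (intro codegree_full_sum_bound B1 jk)
    ultimately show ?thesis using False by simp
  qed
  define a where "a i = nrm (network_agg N G b i - network_agg N G' b i)" for i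
  define ip where "ip j k = (LINT p|\<mu>. b j p * b k p)" for j k
  have ip: "\<bar>ip j k\<bar> \<le> M\<^sup>2" if "j \<in> {1..N}" "k \<in> {1..N}" for j k
  proof -
    have "\<bar>ip j k\<bar> \<le> nrm (b j) * nrm (b k)"
      unfolding ip_def using that by (intro l2_Cauchy_Schwarz A0_sq bA)
    also have "\<dots> \<le> M * M" using that by (intro mult_mono nrm_A0 bA M_nonneg l2_norm_nonneg)
    finally show ?thesis by (simp add: power2_eq_square)
  qed
  have a_sq: "(a i)\<^sup>2 = (\<Sum>j=1..N. \<Sum>k=1..N. (1 / real N)\<^sup>2 * (B i j * B i k * ip j k))" for i
  proof -
    have "network_agg N G b i - network_agg N G' b i = (\<lambda>p. \<Sum>j=1..N. (- (1 / real N) * B i j) * b j p)"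
      by (simp add: network_agg_eq fun_eq_iff B_def left_diff_distrib right_diff_distrib sum_subtractf)
    then have "(a i)\<^sup>2 = (\<Sum>j=1..N. \<Sum>k=1..N. (- (1 / real N) * B i j) * (- (1 / real N) * B i k) * ip j k)"
      unfolding a_def ip_def by (simp only:) (rule l2_norm_sum_sq, rule A0_sq, rule bA)
    also have "\<dots> = (\<Sum>j=1..N. \<Sum>k=1..N. (1 / real N)\<^sup>2 * (B i j * B i k * ip j k))"
      by (intro sum.cong refl) (simp add: power2_eq_square)
    finally show ?thesis .
  qed
  \<comment> \<open>Summing over \<open>i\<close> first turns the squared errors into column
    products of \<open>B\<close>, weighted with inner products of actions, which are at most
    \<open>M\<^sup>2\<close>.\<close>
  have "(\<Sum>i=1..N. (a i)\<^sup>2) = (\<Sum>j=1..N. \<Sum>k=1..N. \<Sum>i=1..N. (1 / real N)\<^sup>2 * (B i j * B i k * ip j k))"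
    unfolding a_sq by (subst sum.swap) (intro sum.cong refl sum.swap)
  also have "\<dots> = (1 / real N)\<^sup>2 * (\<Sum>j=1..N. \<Sum>k=1..N. (\<Sum>i=1..N. B i j * B i k) * ip j k)"
    by (simp only: sum_distrib_left sum_distrib_right)
  also have "\<dots> \<le> (1 / real N)\<^sup>2 * (\<Sum>j=1..N. \<Sum>k=1..N. (if j = k then real N else t + 2) * M\<^sup>2)"
  proof (intro mult_left_mono sum_mono)
    fix j k assume jk: "j \<in> {1..N}" "k \<in> {1..N}"
    have "(\<Sum>i=1..N. B i j * B i k) * ip j k \<le> \<bar>\<Sum>i=1..N. B i j * B i k\<bar> * \<bar>ip j k\<bar>"
      unfolding abs_mult[symmetric] by (rule abs_ge_self)
    also have "\<dots> \<le> (if j = k then real N else t + 2) * M\<^sup>2"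
      using t by (intro mult_mono col jk ip) auto
    finally show "(\<Sum>i=1..N. B i j * B i k) * ip j k \<le> (if j = k then real N else t + 2) * M\<^sup>2" .
  qed simp
  also have "\<dots> \<le> (1 / real N)\<^sup>2 * (\<Sum>j=1..N. \<Sum>k=1..N. ((if j = k then real N else 0) + (t + 2)) * M\<^sup>2)"
    using t by (intro mult_left_mono sum_mono mult_right_mono) auto
  \<comment> \<open>The \<open>N\<close> diagonal entries of size \<open>N\<close> contribute
    \<open>N\<^sup>2\<close>, and the summand \<open>t + 2\<close> contributes
    \<open>(t + 2) * N\<^sup>2\<close>, whence \<open>3 + t\<close>.\<close>
  also have "\<dots> = (1 / real N)\<^sup>2 * ((real N)\<^sup>2 * (3 + t) * M\<^sup>2)"
  proof -
    have "(\<Sum>k=1..N. (if j = k then real N else 0) + (t + 2)) = real N * (3 + t)" if "j \<in> {1..N}" for j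
      using that by (simp add: sum.distrib algebra_simps)
    then have "(\<Sum>j=1..N. \<Sum>k=1..N. (if j = k then real N else 0) + (t + 2)) = real N * (real N * (3 + t))"
      by simp
    then show ?thesis unfolding sum_distrib_right[symmetric] by (simp add: power2_eq_square)
  qed
  also have "\<dots> = M\<^sup>2 * (3 + t)" using N by (simp add: power2_eq_square)
  finally have sum_sq: "(\<Sum>i=1..N. (a i)\<^sup>2) \<le> M\<^sup>2 * (3 + t)" .
  have mean: "1 / real N * (\<Sum>i=1..N. a i) \<le> M * sqrt ((3 + t) / real N)"
  proof (rule power2_le_imp_le)
    have "(1 / real N * (\<Sum>i=1..N. a i))\<^sup>2 = (1 / real N)\<^sup>2 * (\<Sum>i=1..N. a i)\<^sup>2" by (rule power_mult_distrib)
    also have "\<dots> \<le> (1 / real N)\<^sup>2 * ((\<Sum>i=1..N. (a i)\<^sup>2) * real (card {1..N}))"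
      by (intro mult_left_mono sum_squared_le_sum_of_squares) simp
    also have "\<dots> \<le> (1 / real N)\<^sup>2 * (M\<^sup>2 * (3 + t) * real N)"
      using sum_sq by (intro mult_left_mono) (auto intro: mult_right_mono)
    also have "\<dots> = M\<^sup>2 * ((3 + t) / real N)" using N by (simp add: power2_eq_square)
    also have "\<dots> = (M * sqrt ((3 + t) / real N))\<^sup>2" using t by (simp add: power_mult_distrib)
    finally show "(1 / real N * (\<Sum>i=1..N. a i))\<^sup>2 \<le> (M * sqrt ((3 + t) / real N))\<^sup>2" .
    show "0 \<le> M * sqrt ((3 + t) / real N)" using t M_nonneg by simp
  qed
  let ?b = "step_profile N b"
  have bf: "?b \<in> families" by (rule step_profile_families[OF N bA])
  have zK: "network_agg N H b i \<in> K" for H i using bA by (rule network_agg_K)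
  have zL: "L2_profile \<nu> \<mu> (step_profile N (network_agg N H b))" for H
    using step_profile_space(1)[OF N zK] by (simp add: profile_space_iff)
  have int: "integrable \<nu> (\<lambda>x. nrm (Z ?b x - network_agg N H b (cell N x)))" for H
    using L2_profile_mean_norm(1)[OF L2_profile_diff[OF Z_L2[OF bf] zL]] by (simp add: step_profile_cell)
  have "(LINT x|\<nu>. nrm (Z ?b x - network_agg N G' b (cell N x)))
      \<le> (LINT x|\<nu>. nrm (Z ?b x - network_agg N G b (cell N x)) + a (cell N x))"
  proof (rule integral_mono[OF int])
    show "integrable \<nu> (\<lambda>x. nrm (Z ?b x - network_agg N G b (cell N x)) + a (cell N x))"
      by (intro Bochner_Integration.integrable_add int integral_cell(1)[OF index N])
    fix x assume "x \<in> space \<nu>"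
    then show "nrm (Z ?b x - network_agg N G' b (cell N x)) \<le> nrm (Z ?b x - network_agg N G b (cell N x)) + a (cell N x)"
      unfolding a_def using Z_bounded(1)[OF bf, of x] K_sq[OF zK] by (intro l2_norm_diff_triangle) (auto simp: space_\<nu>)
  qed
  also have "\<dots> = (LINT x|\<nu>. nrm (Z ?b x - network_agg N G b (cell N x))) + 1 / real N * (\<Sum>i=1..N. a i)"
    using int integral_cell[OF index N, of a] by simp
  also have "\<dots> \<le> e + M * sqrt ((3 + t) / real N)"
    using close b mean unfolding close_to_graphon_def by (intro add_mono) auto
  finally show "(LINT x|\<nu>. nrm (Z ?b x - network_agg N G' b (cell N x))) \<le> e + M * sqrt ((3 + t) / real N)" .
qed

end

text \<open>The gap involves a supremum over uncountably many interventions, so measurability cannot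
  be read off its definition. It is continuous in the finitely many edge weights that matter;
  clipping extends it from weights in [0,1] to a continuous function of all real arrays.\<close>

lemma (in intervention_game) gap_measurable:
  assumes N: "1 \<le> N" and H: "\<And>i j. i \<in> {1..N} \<Longrightarrow> j \<in> {1..N} \<Longrightarrow> (\<lambda>\<omega>. H \<omega> i j) \<in> borel_measurable Q"
    and unit: "\<And>\<omega>. \<omega> \<in> space Q \<Longrightarrow> unit_weights N (H \<omega>)"
  shows "(\<lambda>\<omega>. gap N (H \<omega>)) \<in> borel_measurable Q"
proof -
  define clip :: "real \<Rightarrow> real" where "clip y = max 0 (min 1 y)" for y
  define h :: "(nat \<times> nat \<Rightarrow> real) \<Rightarrow> real" where "h g = gap N (\<lambda>i j. clip (g (i, j)))" for g
  let ?e = "\<lambda>G G'. 2 * (L * (\<kappa> * (1 / real N * (\<Sum>i=1..N. 1 / real N * (\<Sum>j=1..N. \<bar>G i j - G' i j\<bar> * M)))))"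
  have cu: "unit_weights N (\<lambda>i j. clip (g (i, j)))" for g :: "nat \<times> nat \<Rightarrow> real"
    by (auto simp: unit_weights_def clip_def)
  have "continuous_on UNIV h"
    unfolding continuous_on_def
  proof
    fix g :: "nat \<times> nat \<Rightarrow> real"
    have coord: "((\<lambda>g'. g' q) \<longlongrightarrow> g q) (at g)" for q :: "nat \<times> nat"
      using continuous_on_product_coordinates[of q] unfolding continuous_on_def by blast
    have "((\<lambda>g'. ?e (\<lambda>i j. clip (g' (i, j))) (\<lambda>i j. clip (g (i, j)))) \<longlongrightarrow>
        ?e (\<lambda>i j. clip (g (i, j))) (\<lambda>i j. clip (g (i, j)))) (at g)"
      unfolding clip_def by (intro tendsto_intros tendsto_max tendsto_min coord)
    then have lim: "((\<lambda>g'. ?e (\<lambda>i j. clip (g' (i, j))) (\<lambda>i j. clip (g (i, j)))) \<longlongrightarrow> 0) (at g)" by simp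
    have "((\<lambda>g'. h g' - h g) \<longlongrightarrow> 0) (at g)"
      by (rule Lim_null_comparison[OF _ lim])
        (unfold h_def real_norm_def, intro always_eventually allI gap_Lipschitz[OF N cu cu])
    then show "(h \<longlongrightarrow> h g) (at g within UNIV)" by (simp add: LIM_zero_iff)
  qed
  then have hm: "h \<in> borel_measurable borel" by (rule borel_measurable_continuous_onI)
  \<comment> \<open>Entries outside the network are set to 0, since \<open>H\<close> is known to be
    measurable only inside.\<close>
  define f where "f \<omega> q = (if q \<in> {1..N} \<times> {1..N} then H \<omega> (fst q) (snd q) else 0)" for \<omega> q
  have "f \<in> borel_measurable Q"
  proof (rule measurable_coordinatewise_then_product)
    show "(\<lambda>\<omega>. f \<omega> q) \<in> borel_measurable Q" for q
      using H by (cases "q \<in> {1..N} \<times> {1..N}") (auto simp: f_def)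
  qed
  then have "(\<lambda>\<omega>. h (f \<omega>)) \<in> borel_measurable Q" by (rule measurable_compose[OF _ hm])
  moreover have "h (f \<omega>) = gap N (H \<omega>)" if \<omega>: "\<omega> \<in> space Q" for \<omega>
  proof -
    have "clip (f \<omega> (i, j)) = H \<omega> i j" if "i \<in> {1..N}" "j \<in> {1..N}" for i j
    proof -
      have "H \<omega> i j \<in> {0..1}" using unit[OF \<omega>] that by (auto simp: unit_weights_def)
      then show ?thesis using that by (simp add: f_def clip_def)
    qed
    then have "?e (\<lambda>i j. clip (f \<omega> (i, j))) (H \<omega>) = 0" by simp
    have "\<bar>h (f \<omega>) - gap N (H \<omega>)\<bar> \<le> ?e (\<lambda>i j. clip (f \<omega> (i, j))) (H \<omega>)"
      unfolding h_def by (rule gap_Lipschitz[OF N cu unit[OF \<omega>]])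
    also have "\<dots> = 0" by (rule \<open>?e (\<lambda>i j. clip (f \<omega> (i, j))) (H \<omega>) = 0\<close>)
    finally show ?thesis by simp
  qed
  ultimately show ?thesis by (simp cong: measurable_cong)
qed

text \<open>The event is split over the finitely many edge sets. The conditional law turns each
  piece into an integral over the positions, and for fixed positions the integrands add up to the
  probability of certain bad graphs under \<open>random_graph\<close>, which is bounded
  independently of the positions.\<close>

lemma simple_graph_concentration:
  fixes x :: "nat \<Rightarrow> 'q \<Rightarrow> real" and S :: "'q \<Rightarrow> (nat \<times> nat) set"
  assumes Q: "prob_space Q" and W: "graphon W" "piecewise_lipschitz_graphon W"
    and S: "sampled_edges Q N W x S"
    and xm: "\<And>i. i \<in> {1..N} \<Longrightarrow> x i \<in> borel_measurable Q"
    and x01: "\<And>i \<omega>. i \<in> {1..N} \<Longrightarrow> \<omega> \<in> space Q \<Longrightarrow> x i \<omega> \<in> {0..1}" and t: "0 < t"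
  obtains E where "E \<in> sets Q" "measure Q E \<le> 2 * (real N)\<^sup>2 * exp (- t\<^sup>2 / (2 * real N))"
    "\<And>\<omega> j k. \<omega> \<in> space Q - E \<Longrightarrow> j \<in> {1..N} \<Longrightarrow> k \<in> {1..N} \<Longrightarrow> j \<noteq> k \<Longrightarrow>
      \<bar>codegree N (\<lambda>i j. adjacency (S \<omega>) i j - W (x i \<omega>) (x j \<omega>)) j k\<bar> < t"
proof -
  interpret Q: prob_space Q by (rule Q)
  let ?PM = "PiM {1..N} (\<lambda>_. borel) :: (nat \<Rightarrow> real) measure"
  \<comment> \<open>Borel measurable on the whole plane, and equal to \<open>W\<close> at the
    sampled positions.\<close>
  define W' where "W' y z = indicator ({0..1} \<times> {0..1}) (y, z) * W y z" for y z :: real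
  have W'm: "(\<lambda>q. W' (fst q) (snd q)) \<in> borel_measurable (borel \<Otimes>\<^sub>M borel)"
    using graphon_borel[OF W] by (simp add: W'_def borel_prod)
  have W'_eq: "W' y z = W y z" if "y \<in> {0..1}" "z \<in> {0..1}" for y z
    using that by (simp add: W'_def)
  have W01: "W y z \<in> {0..1} \<and> W y z = W z y" if "y \<in> {0..1}" "z \<in> {0..1}" for y z
    using W(1) that unfolding graphon_def by blast
  define cod where "cod v e j k = codegree N (\<lambda>i j. adjacency e i j - W' (v i) (v j)) j k" for v e j k
  define bad where "bad v e \<longleftrightarrow> (\<exists>j\<in>{1..N}. \<exists>k\<in>{1..N}. j \<noteq> k \<and> t \<le> \<bar>cod v e j k\<bar>)" for v e
  have entry: "(\<lambda>v. W' (v i) (v j)) \<in> borel_measurable ?PM" if "i \<in> {1..N}" "j \<in> {1..N}" for i j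
  proof -
    have "(\<lambda>v. (v i, v j)) \<in> ?PM \<rightarrow>\<^sub>M borel \<Otimes>\<^sub>M borel"
      using that by (intro measurable_Pair measurable_component_singleton)
    from measurable_compose[OF this W'm] show ?thesis by simp
  qed
  have codm: "(\<lambda>v. cod v e j k) \<in> borel_measurable ?PM" if "j \<in> {1..N}" "k \<in> {1..N}" for e j k
    unfolding cod_def codegree_def using that
    by (intro borel_measurable_sum borel_measurable_times borel_measurable_diff borel_measurable_const entry) auto
  have bad_sets: "{v \<in> space ?PM. bad v e} \<in> sets ?PM" for e
    unfolding bad_def
  proof (intro sets.sets_Collect_finite_Ex finite_atLeastAtMost sets.sets_Collect_conj sets.sets_Collect_const)
    fix j k assume jk: "j \<in> {1..N}" "k \<in> {1..N}"
    show "{v \<in> space ?PM. t \<le> \<bar>cod v e j k\<bar>} \<in> sets ?PM" using codm[OF jk, of e] by measurable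
  qed
  define xr where "xr \<omega> = (\<lambda>i\<in>{1..N}. x i \<omega>)" for \<omega>
  have xrm: "xr \<in> Q \<rightarrow>\<^sub>M ?PM" unfolding xr_def[abs_def] using xm by (intro measurable_restrict)
  have cod_xr: "cod (xr \<omega>) e j k = codegree N (\<lambda>i j. adjacency e i j - W (x i \<omega>) (x j \<omega>)) j k"
    if "\<omega> \<in> space Q" "j \<in> {1..N}" "k \<in> {1..N}" for \<omega> e j k
    unfolding cod_def codegree_def using that x01
    by (intro sum.cong refl) (auto simp: xr_def W'_eq simp del: atLeastAtMost_iff)
  define p where "p e \<omega> = (\<Prod>(i, j)\<in>node_pairs N. if (i, j) \<in> e then W (x i \<omega>) (x j \<omega>) else 1 - W (x i \<omega>) (x j \<omega>))"
    for e \<omega>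
  define A where "A e = {\<omega> \<in> space Q. xr \<omega> \<in> {v \<in> space ?PM. bad v e} \<and> S \<omega> = e}" for e
  have Sm: "S \<in> Q \<rightarrow>\<^sub>M count_space (Pow (node_pairs N))" using S by (simp add: sampled_edges_def)
  have SPow: "S \<omega> \<in> Pow (node_pairs N)" if "\<omega> \<in> space Q" for \<omega>
    using measurable_space[OF Sm that] by simp
  have Am: "A e \<in> sets Q" if "e \<in> Pow (node_pairs N)" for e
  proof -
    have "A e = (xr -` {v \<in> space ?PM. bad v e} \<inter> space Q) \<inter> (S -` {e} \<inter> space Q)" by (auto simp: A_def)
    then show ?thesis
      using measurable_sets[OF xrm bad_sets[of e]] measurable_sets[OF Sm, of "{e}"] that by auto
  qed
  have Ap: "measure Q (A e) = (LINT \<omega>|Q. indicator {v \<in> space ?PM. bad v e} (xr \<omega>) * p e \<omega>)"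
    if "e \<in> Pow (node_pairs N)" for e
    using S bad_sets[of e] that unfolding sampled_edges_def A_def xr_def p_def by blast
  have pairs: "i \<in> {1..N}" "j \<in> {1..N}" if "(i, j) \<in> node_pairs N" for i j
    using that by (auto simp: node_pairs_def)
  have p01: "p e \<omega> \<in> {0..1}" if \<omega>: "\<omega> \<in> space Q" for e \<omega>
  proof -
    have "W (x i \<omega>) (x j \<omega>) \<in> {0..1}" if "(i, j) \<in> node_pairs N" for i j
      using W01[OF x01[OF pairs(1)[OF that] \<omega>] x01[OF pairs(2)[OF that] \<omega>]] by simp
    then have "0 \<le> (if (i, j) \<in> e then W (x i \<omega>) (x j \<omega>) else 1 - W (x i \<omega>) (x j \<omega>)) \<and>
        (if (i, j) \<in> e then W (x i \<omega>) (x j \<omega>) else 1 - W (x i \<omega>) (x j \<omega>)) \<le> 1"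
      if "(i, j) \<in> node_pairs N" for i j
      using that by fastforce
    then show ?thesis unfolding p_def by (auto intro!: prod_nonneg prod_le_1)
  qed
  have pm: "p e \<in> borel_measurable Q" for e
  proof -
    have "(\<lambda>\<omega>. \<Prod>q\<in>node_pairs N. if q \<in> e then W' (xr \<omega> (fst q)) (xr \<omega> (snd q)) else 1 - W' (xr \<omega> (fst q)) (xr \<omega> (snd q)))
        \<in> borel_measurable Q"
    proof (rule borel_measurable_prod)
      fix q assume "q \<in> node_pairs N"
      then have "(\<lambda>\<omega>. W' (xr \<omega> (fst q)) (xr \<omega> (snd q))) \<in> borel_measurable Q"
        using pairs[of "fst q" "snd q"] by (intro measurable_compose[OF xrm entry]) auto
      then show "(\<lambda>\<omega>. if q \<in> e then W' (xr \<omega> (fst q)) (xr \<omega> (snd q)) else 1 - W' (xr \<omega> (fst q)) (xr \<omega> (snd q)))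
          \<in> borel_measurable Q" by (cases "q \<in> e") auto
    qed
    moreover have "(\<Prod>q\<in>node_pairs N. if q \<in> e then W' (xr \<omega> (fst q)) (xr \<omega> (snd q)) else 1 - W' (xr \<omega> (fst q)) (xr \<omega> (snd q)))
        = p e \<omega>" if \<omega>: "\<omega> \<in> space Q" for \<omega>
      unfolding p_def
    proof (rule prod.cong[OF refl])
      fix q assume q: "q \<in> node_pairs N"
      have "W' (xr \<omega> (fst q)) (xr \<omega> (snd q)) = W (x (fst q) \<omega>) (x (snd q) \<omega>)"
        using pairs[of "fst q" "snd q"] q x01[OF _ \<omega>] by (simp add: xr_def W'_eq del: atLeastAtMost_iff)
      then show "(if q \<in> e then W' (xr \<omega> (fst q)) (xr \<omega> (snd q)) else 1 - W' (xr \<omega> (fst q)) (xr \<omega> (snd q)))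
          = (case q of (i, j) \<Rightarrow> if (i, j) \<in> e then W (x i \<omega>) (x j \<omega>) else 1 - W (x i \<omega>) (x j \<omega>))"
        by (simp add: case_prod_beta')
    qed
    ultimately show ?thesis by (rule measurable_cong[THEN iffD1, rotated])
  qed
  let ?b = "2 * (real N)\<^sup>2 * exp (- t\<^sup>2 / (2 * real N))"
  have int: "integrable Q (\<lambda>\<omega>. indicator {v \<in> space ?PM. bad v e} (xr \<omega>) * p e \<omega>)" for e
  proof (rule Q.integrable_const_bound[where B=1])
    show "AE \<omega> in Q. norm (indicator {v \<in> space ?PM. bad v e} (xr \<omega>) * p e \<omega>) \<le> 1"
      using p01 by (intro AE_I2) (auto simp: indicator_def)
    show "(\<lambda>\<omega>. indicator {v \<in> space ?PM. bad v e} (xr \<omega>) * p e \<omega>) \<in> borel_measurable Q"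
      using bad_sets pm by (intro borel_measurable_times measurable_compose[OF xrm] borel_measurable_indicator)
  qed
  have pointwise: "(\<Sum>e\<in>Pow (node_pairs N). indicator {v \<in> space ?PM. bad v e} (xr \<omega>) * p e \<omega>) \<le> ?b"
    if \<omega>: "\<omega> \<in> space Q" for \<omega>
  proof -
    define G where "G i j = W (x i \<omega>) (x j \<omega>)" for i j
    have G: "G i j \<in> {0..1} \<and> G i j = G j i" if "i \<in> {1..N}" "j \<in> {1..N}" for i j
      unfolding G_def using that x01[OF _ \<omega>] by (intro W01)
    let ?R = "random_graph N G"
    let ?C = "{e \<in> Pow (node_pairs N). bad (xr \<omega>) e}"
    let ?f = "\<lambda>(e :: (nat \<times> nat) set) q. q \<in> e"
    have fin: "finite (Pow (node_pairs N))" using finite_node_pairs by simp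
    have pmf: "pmf ?R (?f e) = p e \<omega>" if e: "e \<in> Pow (node_pairs N)" for e
    proof -
      have "pmf ?R (?f e) = (\<Prod>q\<in>node_pairs N. pmf (bernoulli_pmf (G (fst q) (snd q))) (q \<in> e))"
        unfolding random_graph_def using e by (subst pmf_Pi[OF finite_node_pairs]) auto
      also have "\<dots> = p e \<omega>" unfolding p_def
      proof (rule prod.cong[OF refl])
        fix q assume "q \<in> node_pairs N"
        then have "G (fst q) (snd q) \<in> {0..1}" using G[of "fst q" "snd q"] pairs[of "fst q" "snd q"] by simp
        then show "pmf (bernoulli_pmf (G (fst q) (snd q))) (q \<in> e)
            = (case q of (i, j) \<Rightarrow> if (i, j) \<in> e then W (x i \<omega>) (x j \<omega>) else 1 - W (x i \<omega>) (x j \<omega>))"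
          by (cases "q \<in> e") (auto simp: G_def case_prod_beta')
      qed
      finally show ?thesis .
    qed
    have "(\<Sum>e\<in>Pow (node_pairs N). indicator {v \<in> space ?PM. bad v e} (xr \<omega>) * p e \<omega>)
        = (\<Sum>e\<in>Pow (node_pairs N). if bad (xr \<omega>) e then p e \<omega> else 0)"
      using measurable_space[OF xrm \<omega>] by (intro sum.cong refl) (auto simp: indicator_def)
    also have "\<dots> = (\<Sum>e\<in>?C. p e \<omega>)" by (rule sum.inter_filter[OF fin, symmetric])
    also have "\<dots> = (\<Sum>e\<in>?C. pmf ?R (?f e))" using pmf by (intro sum.cong refl) simp
    \<comment> \<open>Edge sets are identified with their characteristic functions, the points of
      the product law.\<close>
    also have "\<dots> = (\<Sum>f\<in>?f ` ?C. pmf ?R f)"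
      by (subst sum.reindex) (auto simp: inj_on_def fun_eq_iff)
    also have "\<dots> = measure_pmf.prob ?R (?f ` ?C)"
      using fin by (intro measure_measure_pmf_finite[symmetric]) simp
    also have "\<dots> \<le> measure_pmf.prob ?R {f. \<exists>j\<in>{1..N}. \<exists>k\<in>{1..N}. j \<noteq> k \<and> \<bar>codegree N (centered_edge G f) j k\<bar> \<ge> t}"
    proof (rule measure_pmf.finite_measure_mono)
      show "?f ` ?C \<subseteq> {f. \<exists>j\<in>{1..N}. \<exists>k\<in>{1..N}. j \<noteq> k \<and> \<bar>codegree N (centered_edge G f) j k\<bar> \<ge> t}"
      proof (rule image_subsetI)
        fix e assume "e \<in> ?C"
        then have e: "e \<subseteq> node_pairs N" and be: "bad (xr \<omega>) e" by auto
        from be obtain j k where jk: "j \<in> {1..N}" "k \<in> {1..N}" "j \<noteq> k" "t \<le> \<bar>cod (xr \<omega>) e j k\<bar>"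
          unfolding bad_def by (elim bexE conjE) (rule that)
        \<comment> \<open>Only entries off the diagonal occur in a codegree, and \<open>e\<close>
          stores each pair in one order.\<close>
        have adj: "adjacency e i m - W (x i \<omega>) (x m \<omega>) = centered_edge G (?f e) i m" if "i \<noteq> m" for i m
        proof -
          have "(i, m) \<in> e \<or> (m, i) \<in> e \<longleftrightarrow> edge i m \<in> e"
            using e that by (cases "i < m") (auto simp: edge_def min_def max_def node_pairs_def dest: subsetD)
          then show ?thesis by (simp add: adjacency_def centered_edge_def G_def)
        qed
        have "cod (xr \<omega>) e j k = codegree N (centered_edge G (?f e)) j k"
          unfolding cod_xr[OF \<omega> jk(1,2)] codegree_def using adj by (intro sum.cong refl) auto
        then have "\<exists>k\<in>{1..N}. j \<noteq> k \<and> \<bar>codegree N (centered_edge G (?f e)) j k\<bar> \<ge> t"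
          using jk by (intro bexI[of _ k]) auto
        from bexI[of "\<lambda>j. \<exists>k\<in>{1..N}. j \<noteq> k \<and> \<bar>codegree N (centered_edge G (?f e)) j k\<bar> \<ge> t", OF this jk(1)]
        show "?f e \<in> {f. \<exists>j\<in>{1..N}. \<exists>k\<in>{1..N}. j \<noteq> k \<and> \<bar>codegree N (centered_edge G f) j k\<bar> \<ge> t}"
          unfolding mem_Collect_eq .
      qed
    qed simp
    also have "\<dots> \<le> ?b" by (rule codegrees_concentration[OF G t])
    finally show ?thesis .
  qed
  define E where "E = (\<Union>e\<in>Pow (node_pairs N). A e)"
  have fin: "finite (Pow (node_pairs N))" using finite_node_pairs by simp
  show ?thesis
  proof (rule that[of E])
    show "E \<in> sets Q" unfolding E_def using fin Am by (rule sets.finite_UN)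
    have "measure Q E \<le> (\<Sum>e\<in>Pow (node_pairs N). measure Q (A e))"
      unfolding E_def using fin Am by (intro Q.finite_measure_subadditive_finite) auto
    also have "\<dots> = (\<Sum>e\<in>Pow (node_pairs N). LINT \<omega>|Q. indicator {v \<in> space ?PM. bad v e} (xr \<omega>) * p e \<omega>)"
      using Ap by (rule sum.cong[OF refl])
    also have "\<dots> = (LINT \<omega>|Q. (\<Sum>e\<in>Pow (node_pairs N). indicator {v \<in> space ?PM. bad v e} (xr \<omega>) * p e \<omega>))"
      using int by (rule Bochner_Integration.integral_sum[symmetric])
    also have "\<dots> \<le> (LINT \<omega>|Q. ?b)"
      using int pointwise by (intro integral_mono Bochner_Integration.integrable_sum) auto
    finally show "measure Q E \<le> ?b" by (simp add: Q.prob_space)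
    fix \<omega> j k assume \<omega>: "\<omega> \<in> space Q - E" and jk: "j \<in> {1..N}" "k \<in> {1..N}" "j \<noteq> k"
    have \<omega>': "\<omega> \<in> space Q" using \<omega> by simp
    have "\<not> bad (xr \<omega>) (S \<omega>)"
      using \<omega> SPow[OF \<omega>'] measurable_space[OF xrm \<omega>'] by (auto simp: E_def A_def)
    then have "\<bar>cod (xr \<omega>) (S \<omega>) j k\<bar> < t" using jk unfolding bad_def not_le[symmetric] by blast
    then show "\<bar>codegree N (\<lambda>i j. adjacency (S \<omega>) i j - W (x i \<omega>) (x j \<omega>)) j k\<bar> < t"
      unfolding cod_xr[OF \<omega>' jk(1,2)] .
  qed
qed

section \<open>Rates of convergence\<close>

text \<open>\<open>\<epsilon>\<close> and \<open>t\<close> are the values for which the two union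
  bounds equal \<open>\<delta>\<close> exactly. The condition \<open>\<delta> < exp (-1)\<close>
  makes the logarithm at least 1, so that \<open>1 / N\<close> and the constants are absorbed. For a
  quotient at most 1, the fourth root dominates the square root and the quotient itself.\<close>

lemma sampling_rates:
  fixes N :: nat and \<delta> :: real
  assumes N: "1 \<le> N" and \<delta>: "0 < \<delta>" "\<delta> < exp (-1)" and y1: "ln (real N / \<delta>) / real N \<le> 1"
  defines "\<rho> \<equiv> (ln (real N / \<delta>) / real N) powr (1/4)"
    and "\<epsilon> \<equiv> sqrt (ln (2 * real N / \<delta>) / (2 * real N))"
    and "t \<equiv> sqrt (2 * real N * ln (2 * (real N)\<^sup>2 / \<delta>))"
  shows "0 < \<epsilon>" "0 < t" "2 * real N * exp (- 2 * real N * \<epsilon>\<^sup>2) = \<delta>"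
    "2 * (real N)\<^sup>2 * exp (- t\<^sup>2 / (2 * real N)) = \<delta>"
    "\<epsilon> \<le> \<rho>" "1 / real N \<le> \<rho>" "1 / sqrt (real N) \<le> \<rho>" "sqrt ((3 + t) / real N) \<le> 3 * \<rho>"
proof -
  define n where "n = real N"
  define g where "g = ln (n / \<delta>)"
  define y where "y = g / n"
  have n: "1 \<le> n" using N by (simp add: n_def)
  have "exp 1 * \<delta> < exp 1 * exp (-1)" using \<delta> by (intro mult_strict_left_mono) auto
  then have "exp 1 * \<delta> < 1" by (simp flip: exp_add)
  then have "exp 1 \<le> n / \<delta>" using n \<delta> by (simp add: pos_le_divide_eq)
  then have g1: "1 \<le> g" unfolding g_def using n \<delta> by (subst ln_ge_iff) auto
  have y: "1 / n \<le> y" "y \<le> 1" "0 < y" using g1 n y1 by (auto simp: y_def g_def n_def divide_right_mono)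
  have \<rho>: "\<rho> = y powr (1/4)" by (simp add: \<rho>_def y_def g_def n_def)
  have sqrt_y: "sqrt y \<le> \<rho>"
    unfolding \<rho> powr_half_sqrt[symmetric, OF less_imp_le[OF y(3)]] using y by (intro powr_mono') auto
  have \<rho>_sq: "\<rho>\<^sup>2 = sqrt y"
    using y by (simp add: \<rho> power2_eq_square powr_half_sqrt[symmetric] flip: powr_add)
  have y_sqrt: "y \<le> sqrt y" using y by (intro real_le_rsqrt) (simp add: power2_eq_square mult_left_le)
  show "1 / real N \<le> \<rho>" using y(1) y_sqrt sqrt_y by (simp add: n_def)
  have "sqrt (1 / n) \<le> sqrt y" using y(1) by simp
  then show "1 / sqrt (real N) \<le> \<rho>" using sqrt_y by (simp add: n_def real_sqrt_divide)
  have ln2: "ln (2 * n / \<delta>) = ln 2 + g"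
    unfolding g_def times_divide_eq_right[symmetric] using n \<delta> by (subst ln_mult) auto
  have ln2n: "ln (2 * n\<^sup>2 / \<delta>) = ln 2 + (ln n + g)"
  proof -
    have "2 * n\<^sup>2 / \<delta> = 2 * (n * (n / \<delta>))" by (simp add: power2_eq_square)
    then have "ln (2 * n\<^sup>2 / \<delta>) = ln (2 * (n * (n / \<delta>)))" by (rule arg_cong)
    also have "ln (2 * (n * (n / \<delta>))) = ln 2 + ln (n * (n / \<delta>))" using n \<delta> by (subst ln_mult) auto
    also have "ln (n * (n / \<delta>)) = ln n + g" unfolding g_def using n \<delta> by (subst ln_mult) auto
    finally show ?thesis .
  qed
  have l2: "0 < ln (2::real)" "ln (2::real) \<le> 1" using ln_2_less_1 by auto
  have lnn: "0 \<le> ln n" "ln n \<le> g"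
  proof -
    have "\<delta> < 1" using \<delta>(2) by (rule less_trans) simp
    then have "n \<le> n / \<delta>" using n \<delta> by (simp add: pos_le_divide_eq mult_left_le)
    then show "ln n \<le> g" unfolding g_def using n by simp
  qed (use n in simp)
  have pos: "0 < ln 2 + g" "0 < ln 2 + (ln n + g)" using l2 lnn g1 by linarith+
  have \<epsilon>_sq: "\<epsilon>\<^sup>2 = (ln 2 + g) / (2 * n)"
    unfolding \<epsilon>_def n_def[symmetric] ln2 using n pos by (intro real_sqrt_pow2) simp
  have t_sq: "t\<^sup>2 = 2 * n * (ln 2 + (ln n + g))"
    unfolding t_def n_def[symmetric] ln2n using n pos by (intro real_sqrt_pow2) simp
  show "0 < \<epsilon>" unfolding \<epsilon>_def n_def[symmetric] ln2 using n pos by simp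
  show t0: "0 < t" unfolding t_def n_def[symmetric] ln2n using n pos by simp
  show "2 * real N * exp (- 2 * real N * \<epsilon>\<^sup>2) = \<delta>"
  proof -
    have "- 2 * n * \<epsilon>\<^sup>2 = - ln (2 * n / \<delta>)" unfolding \<epsilon>_sq ln2 using n by simp
    then show ?thesis using n \<delta> unfolding n_def[symmetric] by (simp add: exp_minus)
  qed
  show "2 * (real N)\<^sup>2 * exp (- t\<^sup>2 / (2 * real N)) = \<delta>"
  proof -
    have "- t\<^sup>2 / (2 * n) = - ln (2 * n\<^sup>2 / \<delta>)" unfolding t_sq ln2n using n by simp
    then show ?thesis using n \<delta> unfolding n_def[symmetric] by (simp add: exp_minus)
  qed
  have "\<epsilon>\<^sup>2 \<le> y" unfolding \<epsilon>_sq y_def using n l2 g1 by (simp add: divide_simps)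
  then have "\<epsilon> \<le> sqrt y" by (rule real_le_rsqrt)
  then show "\<epsilon> \<le> \<rho>" using sqrt_y by simp
  \<comment> \<open>Each of \<open>ln 2\<close>, \<open>ln n\<close> and \<open>g\<close> is at most
    \<open>g\<close>; the resulting factor 6 is enlarged to 9 to obtain a perfect square.\<close>
  have "t\<^sup>2 \<le> 2 * n * (3 * g)" unfolding t_sq using n l2 g1 lnn by (intro mult_left_mono) auto
  also have "\<dots> = 6 * n\<^sup>2 * y" using n by (simp add: y_def power2_eq_square)
  also have "\<dots> \<le> 9 * n\<^sup>2 * y" using y(3) by (intro mult_right_mono) auto
  also have "\<dots> = (3 * n * sqrt y)\<^sup>2" using y(3) by (simp add: power_mult_distrib)
  finally have "t\<^sup>2 \<le> (3 * n * sqrt y)\<^sup>2" .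
  moreover have "0 \<le> 3 * n * sqrt y" using n y(3) by simp
  ultimately have "t \<le> 3 * n * sqrt y" by (rule power2_le_imp_le)
  then have "t / n \<le> 3 * sqrt y" using n by (subst pos_divide_le_eq) (auto simp: mult_ac)
  moreover have "(3 + t) / n = 3 * (1 / n) + t / n" by (simp add: add_divide_distrib)
  ultimately have "(3 + t) / n \<le> 9 * sqrt y" using y(1) y_sqrt y(3) real_sqrt_ge_zero[of y] by linarith
  also have "9 * sqrt y = (3 * \<rho>)\<^sup>2" unfolding power_mult_distrib \<rho>_sq by simp
  finally have "(3 + t) / n \<le> (3 * \<rho>)\<^sup>2" .
  then show "sqrt ((3 + t) / real N) \<le> 3 * \<rho>"
    unfolding n_def by (intro real_le_lsqrt) (simp_all add: \<rho>_def)
qed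

text \<open>For fixed \<open>\<delta>\<close> the side condition on the logarithm holds for all
  large \<open>N\<close>, which is why the rate is asymptotic. Nonnegativity of \<open>X\<close>
  supplies the lower side of the almost sure limit.\<close>

lemma whp_bigo_and_AE_tendsto:
  fixes X :: "nat \<Rightarrow> 'q \<Rightarrow> real" and r :: "nat \<Rightarrow> real"
  assumes Q: "prob_space Q" and Xm: "\<And>N. 1 \<le> N \<Longrightarrow> X N \<in> borel_measurable Q"
    and X0: "\<And>N \<omega>. 1 \<le> N \<Longrightarrow> \<omega> \<in> space Q \<Longrightarrow> 0 \<le> X N \<omega>" and C: "0 \<le> C"
    and r: "r \<longlonglongrightarrow> 0"
    and tail: "\<And>N \<delta>. 1 \<le> N \<Longrightarrow> 0 < \<delta> \<Longrightarrow> \<delta> < exp (-1) \<Longrightarrow> ln (real N / \<delta>) / real N \<le> 1 \<Longrightarrow>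
      \<exists>E\<in>sets Q. measure Q E \<le> m * \<delta> \<and> (\<forall>\<omega>\<in>space Q - E. X N \<omega> \<le> C * ((ln (real N / \<delta>) / real N) powr (1/4) + r N))"
  shows "\<And>\<delta>. 0 < \<delta> \<Longrightarrow> \<delta> < exp (-1) \<Longrightarrow>
      whp_bigo Q (1 - m * \<delta>) X (\<lambda>N. max ((ln (real N / \<delta>) / real N) powr (1/4)) (r N))"
    and "AE \<omega> in Q. (\<lambda>N. X N \<omega>) \<longlonglongrightarrow> 0"
proof -
  interpret Q: prob_space Q by (rule Q)
  show "whp_bigo Q (1 - m * \<delta>) X (\<lambda>N. max ((ln (real N / \<delta>) / real N) powr (1/4)) (r N))"
    if \<delta>: "0 < \<delta>" "\<delta> < exp (-1)" for \<delta>
    unfolding whp_bigo_def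
  proof (rule exI[of _ "2 * C"])
    have "(\<lambda>N. (ln (real N) - ln \<delta>) / real N) \<longlonglongrightarrow> 0" by real_asymp
    then have "\<forall>\<^sub>F N in sequentially. (ln (real N) - ln \<delta>) / real N < 1" by (rule order_tendstoD) simp
    with eventually_ge_at_top[of 1]
    show "\<forall>\<^sub>F N in sequentially. 1 - m * \<delta> \<le> measure Q {\<omega> \<in> space Q.
        X N \<omega> \<le> 2 * C * max ((ln (real N / \<delta>) / real N) powr (1/4)) (r N)}"
    proof eventually_elim
      case (elim N)
      let ?\<rho> = "(ln (real N / \<delta>) / real N) powr (1/4)"
      have "ln (real N / \<delta>) / real N \<le> 1" using elim \<delta> by (simp add: ln_div)
      from tail[OF elim(1) \<delta> this] obtain E where E: "E \<in> sets Q" "measure Q E \<le> m * \<delta>"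
        "\<And>\<omega>. \<omega> \<in> space Q - E \<Longrightarrow> X N \<omega> \<le> C * (?\<rho> + r N)" by blast
      have le: "C * (?\<rho> + r N) \<le> 2 * C * max ?\<rho> (r N)"
      proof -
        have "?\<rho> + r N \<le> 2 * max ?\<rho> (r N)" by (simp add: max_def)
        from mult_left_mono[OF this C] show ?thesis by (simp add: mult_ac)
      qed
      have "1 - m * \<delta> \<le> 1 - measure Q E" using E by simp
      also have "\<dots> = measure Q (space Q - E)" using E(1) by (rule Q.prob_compl[symmetric])
      also have "\<dots> \<le> measure Q {\<omega> \<in> space Q. X N \<omega> \<le> 2 * C * max ?\<rho> (r N)}"
      proof (rule Q.finite_measure_mono)
        show "space Q - E \<subseteq> {\<omega> \<in> space Q. X N \<omega> \<le> 2 * C * max ?\<rho> (r N)}"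
          using order_trans[OF E(3) le] by blast
        show "{\<omega> \<in> space Q. X N \<omega> \<le> 2 * C * max ?\<rho> (r N)} \<in> sets Q"
          using Xm[OF elim(1)] by measurable
      qed
      finally show ?case .
    qed
  qed
  \<comment> \<open>Summable, yet decaying so slowly that the logarithm in the rate grows only by a
    constant factor.\<close>
  define \<delta> where "\<delta> N = 1 / (real N)\<^sup>2" for N :: nat
  define \<rho> where "\<rho> N = (ln (real N / \<delta> N) / real N) powr (1/4)" for N :: nat
  define good where "good N \<longleftrightarrow> 1 \<le> N \<and> 0 < \<delta> N \<and> \<delta> N < exp (-1) \<and> ln (real N / \<delta> N) / real N \<le> 1" for N
  have "\<forall>\<^sub>F N in sequentially. 0 < \<delta> N \<and> \<delta> N < exp (-1)"
  proof (rule eventually_conj)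
    show "\<forall>\<^sub>F N in sequentially. 0 < \<delta> N" unfolding \<delta>_def by real_asymp
    have "\<delta> \<longlonglongrightarrow> 0" unfolding \<delta>_def by real_asymp
    then show "\<forall>\<^sub>F N in sequentially. \<delta> N < exp (-1)" by (rule order_tendstoD) simp
  qed
  moreover have "(\<lambda>N. ln (real N / \<delta> N) / real N) \<longlonglongrightarrow> 0" unfolding \<delta>_def by real_asymp
  then have "\<forall>\<^sub>F N in sequentially. ln (real N / \<delta> N) / real N < 1" by (rule order_tendstoD) simp
  ultimately have ev_good: "\<forall>\<^sub>F N in sequentially. good N"
    using eventually_ge_at_top[of 1] unfolding good_def by eventually_elim simp
  have "\<forall>N. \<exists>E. E \<in> sets Q \<and> measure Q E \<le> \<bar>m\<bar> * \<delta> N \<and> (good N \<longrightarrow> (\<forall>\<omega>\<in>space Q - E. X N \<omega> \<le> C * (\<rho> N + r N)))"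
  proof
    fix N
    show "\<exists>E. E \<in> sets Q \<and> measure Q E \<le> \<bar>m\<bar> * \<delta> N \<and> (good N \<longrightarrow> (\<forall>\<omega>\<in>space Q - E. X N \<omega> \<le> C * (\<rho> N + r N)))"
    proof (cases "good N")
      case True
      then obtain E where E: "E \<in> sets Q" "measure Q E \<le> m * \<delta> N"
        "\<forall>\<omega>\<in>space Q - E. X N \<omega> \<le> C * (\<rho> N + r N)"
        using tail[of N "\<delta> N"] unfolding good_def \<rho>_def by blast
      have "m * \<delta> N \<le> \<bar>m\<bar> * \<delta> N" by (intro mult_right_mono) (auto simp: \<delta>_def)
      then show ?thesis using E by (intro exI[of _ E]) auto
    next
      \<comment> \<open>For the finitely many \<open>N\<close> that violate the side conditions the
        exceptional set is empty and nothing is claimed.\<close>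
      case False
      then show ?thesis by (intro exI[of _ "{}"]) (simp add: \<delta>_def)
    qed
  qed
  then obtain E where Em: "\<And>N. E N \<in> sets Q" and Ep: "\<And>N. measure Q (E N) \<le> \<bar>m\<bar> * \<delta> N"
    and EX: "\<And>N \<omega>. good N \<Longrightarrow> \<omega> \<in> space Q - E N \<Longrightarrow> X N \<omega> \<le> C * (\<rho> N + r N)" by metis
  have "summable (\<lambda>N. \<bar>m\<bar> * \<delta> N)"
    unfolding \<delta>_def using inverse_power_summable[of 2] by (intro summable_mult) (simp add: divide_inverse)
  then have "summable (\<lambda>N. measure Q (E N))"
    by (rule summable_comparison_test'[where N=0]) (simp add: Ep)
  then have "AE \<omega> in Q. \<forall>\<^sub>F N in sequentially. \<omega> \<in> space Q - E N"
    using Em by (intro borel_cantelli_AE1) (auto simp: Q.emeasure_eq_measure)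
  then show "AE \<omega> in Q. (\<lambda>N. X N \<omega>) \<longlonglongrightarrow> 0"
    using AE_space
  proof eventually_elim
    case (elim \<omega>)
    have "\<rho> \<longlonglongrightarrow> 0" unfolding \<rho>_def \<delta>_def by real_asymp
    then have "(\<lambda>N. C * (\<rho> N + r N)) \<longlonglongrightarrow> C * (0 + 0)" by (intro tendsto_intros r)
    then have lim: "(\<lambda>N. C * (\<rho> N + r N)) \<longlonglongrightarrow> 0" by simp
    show ?case
    proof (rule tendsto_sandwich[OF _ _ tendsto_const lim])
      show "\<forall>\<^sub>F N in sequentially. 0 \<le> X N \<omega>"
        using eventually_ge_at_top[of 1] by eventually_elim (rule X0[OF _ elim(2)])
      show "\<forall>\<^sub>F N in sequentially. X N \<omega> \<le> C * (\<rho> N + r N)"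
        using elim(1) ev_good by eventually_elim (rule EX)
    qed
  qed
qed

text \<open>The deterministic part: only the distance of the positions to the grid and the codegrees
  enter, so that randomness is confined to two exceptional sets. All errors but \<open>r N\<close>
  are measured by the single quantity \<open>\<rho>\<close>.\<close>

lemma (in intervention_game) sampled_gap_bound:
  assumes B: "\<And>y. y \<in> {0..1} \<Longrightarrow> proc_norm P T (\<theta>b y) \<le> B" and lip: "piecewise_lipschitz_profile P T \<theta>b"
  obtains C where "0 \<le> C"
    "\<And>N v \<rho> D. 1 \<le> N \<Longrightarrow> 0 \<le> D \<Longrightarrow> (\<And>i. i \<in> {1..N} \<Longrightarrow> v i \<in> {0..1}) \<Longrightarrow>
      (\<And>i. i \<in> {1..N} \<Longrightarrow> \<bar>v i - real i / real N\<bar> \<le> D + 1 / real N) \<Longrightarrow>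
      D \<le> \<rho> \<Longrightarrow> 1 / real N \<le> \<rho> \<Longrightarrow> 1 / sqrt (real N) \<le> \<rho> \<Longrightarrow>
      gap N (\<lambda>i j. W (v i) (v j)) \<le> C * (\<rho> + r N)"
    "\<And>N v \<rho> D H t. 1 \<le> N \<Longrightarrow> 0 \<le> D \<Longrightarrow> (\<And>i. i \<in> {1..N} \<Longrightarrow> v i \<in> {0..1}) \<Longrightarrow>
      (\<And>i. i \<in> {1..N} \<Longrightarrow> \<bar>v i - real i / real N\<bar> \<le> D + 1 / real N) \<Longrightarrow>
      D \<le> \<rho> \<Longrightarrow> 1 / real N \<le> \<rho> \<Longrightarrow> 1 / sqrt (real N) \<le> \<rho> \<Longrightarrow>
      unit_weights N H \<Longrightarrow> 0 \<le> t \<Longrightarrow> sqrt ((3 + t) / real N) \<le> 3 * \<rho> \<Longrightarrow>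
      (\<And>j k. j \<in> {1..N} \<Longrightarrow> k \<in> {1..N} \<Longrightarrow> j \<noteq> k \<Longrightarrow>
        \<bar>codegree N (\<lambda>i j. H i j - W (v i) (v j)) j k\<bar> \<le> t) \<Longrightarrow>
      gap N H \<le> C * (\<rho> + r N)"
proof -
  obtain c where c: "0 \<le> c" "\<And>N v D. 1 \<le> N \<Longrightarrow> 0 \<le> D \<Longrightarrow> (\<And>i. i \<in> {1..N} \<Longrightarrow> v i \<in> {0..1}) \<Longrightarrow>
      (\<And>i. i \<in> {1..N} \<Longrightarrow> \<bar>v i - real i / real N\<bar> \<le> D) \<Longrightarrow>
      close_to_graphon N (\<lambda>i j. W (v i) (v j)) (c * (D + 1 / real N))"
    using close_to_graphon_weighted by metis
  obtain c' where c': "0 \<le> c'" "\<And>N. 1 \<le> N \<Longrightarrow> s N \<le> c' / sqrt (real N)"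
    using sampling_error[OF B lip] by metis
  \<comment> \<open>\<open>3 * c\<close> comes from \<open>D + 2 / N\<close>, \<open>3 * M\<close>
    from the codegrees, \<open>c'\<close> from sampling the solution, and 1 from the term
    \<open>r N\<close>.\<close>
  define a where "a = 3 * c + 3 * M + 1 + c'"
  have a: "0 \<le> a" using c(1) c'(1) M_nonneg by (simp add: a_def)
  have L\<kappa>: "0 \<le> 2 * L * \<kappa>" using L_nonneg \<kappa>_nonneg by simp
  have r0: "0 \<le> r N" for N by (simp add: r_def profile_norm_eq)
  have final: "gap N G \<le> (2 * L * \<kappa> * a) * (\<rho> + r N)"
    if N: "1 \<le> N" and G: "unit_weights N G" and close: "close_to_graphon N G e"
      and e: "e \<le> 3 * c * \<rho> + 3 * M * \<rho>" and \<rho>: "1 / sqrt (real N) \<le> \<rho>" for N G e \<rho>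
  proof -
    have \<rho>0: "0 \<le> \<rho>" using \<rho> by (rule order_trans[rotated]) simp
    have "s N \<le> c' * \<rho>"
      using c'(2)[OF N] mult_left_mono[OF \<rho> c'(1)] by simp
    moreover have "0 \<le> (3 * c + 3 * M + c') * r N" using c(1) c'(1) M_nonneg r0 by simp
    ultimately have "e + r N + s N \<le> a * (\<rho> + r N)"
      using e \<rho>0 by (simp add: a_def algebra_simps)
    then have "2 * L * \<kappa> * (e + r N + s N) \<le> 2 * L * \<kappa> * (a * (\<rho> + r N))"
      using L\<kappa> by (rule mult_left_mono)
    then show ?thesis using gap_upper[OF N G close] by (simp add: mult.assoc)
  qed
  have close_bound: "close_to_graphon N (\<lambda>i j. W (v i) (v j)) (c * (D + 1 / real N + 1 / real N))"
      "c * (D + 1 / real N + 1 / real N) \<le> 3 * c * \<rho>" "unit_weights N (\<lambda>i j. W (v i) (v j))"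
    if "1 \<le> N" "0 \<le> D" "\<And>i. i \<in> {1..N} \<Longrightarrow> v i \<in> {0..1}"
      "\<And>i. i \<in> {1..N} \<Longrightarrow> \<bar>v i - real i / real N\<bar> \<le> D + 1 / real N"
      "D \<le> \<rho>" "1 / real N \<le> \<rho>" for N v D \<rho>
  proof -
    show "close_to_graphon N (\<lambda>i j. W (v i) (v j)) (c * (D + 1 / real N + 1 / real N))"
      using that by (intro c(2)) auto
    have "D + 1 / real N + 1 / real N \<le> 3 * \<rho>" using that(5,6) by linarith
    from mult_left_mono[OF this c(1)] show "c * (D + 1 / real N + 1 / real N) \<le> 3 * c * \<rho>" by simp
    show "unit_weights N (\<lambda>i j. W (v i) (v j))"
      unfolding unit_weights_def by (intro ballI W_bounds that(3))
  qed
  show ?thesis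
  proof (rule that[of "2 * L * \<kappa> * a"])
    show "0 \<le> 2 * L * \<kappa> * a" using L\<kappa> a by simp
    fix N :: nat and v and \<rho> D :: real
    assume A: "1 \<le> N" "0 \<le> D" "\<And>i. i \<in> {1..N} \<Longrightarrow> v i \<in> {0..1}"
      "\<And>i. i \<in> {1..N} \<Longrightarrow> \<bar>v i - real i / real N\<bar> \<le> D + 1 / real N"
      "D \<le> \<rho>" "1 / real N \<le> \<rho>" "1 / sqrt (real N) \<le> \<rho>"
    have cb: "close_to_graphon N (\<lambda>i j. W (v i) (v j)) (c * (D + 1 / real N + 1 / real N))"
      "c * (D + 1 / real N + 1 / real N) \<le> 3 * c * \<rho>" "unit_weights N (\<lambda>i j. W (v i) (v j))"
      by (rule close_bound[OF A(1,2) _ _ A(5,6)]; erule A(3) A(4))+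
    have \<rho>0: "0 \<le> \<rho>" using A(7) by (rule order_trans[rotated]) simp
    have M\<rho>: "0 \<le> 3 * M * \<rho>" using M_nonneg \<rho>0 by simp
    show "gap N (\<lambda>i j. W (v i) (v j)) \<le> 2 * L * \<kappa> * a * (\<rho> + r N)"
      using cb(2) M\<rho> by (intro final[OF A(1) cb(3,1) _ A(7)]) linarith
    fix G t
    assume G: "unit_weights N G" and t: "0 \<le> t" "sqrt ((3 + t) / real N) \<le> 3 * \<rho>"
      and cod: "\<And>j k. j \<in> {1..N} \<Longrightarrow> k \<in> {1..N} \<Longrightarrow> j \<noteq> k \<Longrightarrow>
        \<bar>codegree N (\<lambda>i j. G i j - W (v i) (v j)) j k\<bar> \<le> t"
    have "M * sqrt ((3 + t) / real N) \<le> 3 * M * \<rho>"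
      using mult_left_mono[OF t(2) M_nonneg] by (simp add: mult_ac)
    then show "gap N G \<le> 2 * L * \<kappa> * a * (\<rho> + r N)"
      using cb(2) by (intro final[OF A(1) G close_to_graphon_perturbed[OF A(1) cb(3) G cb(1) t(1) cod] _ A(7)]) auto
  qed
qed

theorem corollary3p5:
  fixes T :: real
    and P :: "'w measure" and \<nu> :: "real measure" and E :: "(real \<times> 'w) measure"
    and Q :: "'q measure"
    and F :: "real \<Rightarrow> 'w measure"
    and U :: "'w utility" and \<theta> :: "real \<Rightarrow> 'w process" and W :: "real \<Rightarrow> real \<Rightarrow> real"
    and A :: "real \<Rightarrow> 'w process set" and A\<^sub>0 :: "'w process set"
    and \<alpha>\<^sub>U l\<^sub>U l\<^sub>\<theta> C\<^sub>B :: real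
    and \<theta>b :: "real \<Rightarrow> 'w process"
    and \<theta>N :: "nat \<Rightarrow> nat \<Rightarrow> 'w process"
    and u :: "nat \<Rightarrow> nat \<Rightarrow> 'q \<Rightarrow> real" and x :: "nat \<Rightarrow> nat \<Rightarrow> 'q \<Rightarrow> real"
    and S :: "nat \<Rightarrow> 'q \<Rightarrow> (nat \<times> nat) set"
  assumes horizon: "T > 0"
    and prob_P: "prob_space P"
    and index_space: "extends_unit_lebesgue \<nu>"
    and fubini: "rich_fubini_extension \<nu> P E"
    and filtration: "F = augmented_filtration P {0..1} \<theta>"
    and net_filtration: "\<And>N t. N \<ge> 1 \<Longrightarrow> t \<in> {0..T} \<Longrightarrow>
          sets (augmented_filtration P {1..N} (\<theta>N N) t) \<subseteq> sets (F t)"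
    and U_wd: "utility_respects_eq P T F U"
    and \<theta>_profile: "\<theta> \<in> profile_space \<nu> P T F"
    and W_graphon: "graphon W"
    and homogeneous: "\<And>y. y \<in> {0..1} \<Longrightarrow> A y = A\<^sub>0"
    and A1: "regular_utility P T F U \<alpha>\<^sub>U l\<^sub>U l\<^sub>\<theta>"
    and A2_set: "A\<^sub>0 \<noteq> {}" "closed_convex_in P T F A\<^sub>0"
    and A2_argmax: "\<exists>z\<^sub>0\<in>proc_space P T F. \<exists>h\<^sub>0\<in>proc_space P T F. \<exists>b\<in>profile_space \<nu> P T F.
          \<forall>y\<in>{0..1}. is_arg_max (\<lambda>a. U a z\<^sub>0 h\<^sub>0) (\<lambda>a. a \<in> A y) (b y)"
    and A3: "\<exists>M. \<forall>a\<in>A\<^sub>0. proc_norm P T a \<le> M"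
    and A4: "piecewise_lipschitz_graphon W"
    and A5: "l\<^sub>U < \<alpha>\<^sub>U"
    and A6: "jointly_lipschitz_utility P T F A\<^sub>0 U"
    and budget: "C\<^sub>B > 0"
    and A7_solution: "graphon_intervention_solution \<nu> P T F A U \<theta> W C\<^sub>B \<theta>b"
    and A7_bounded: "\<exists>\<theta>max. \<forall>y\<in>{0..1}. proc_norm P T (\<theta>b y) \<le> \<theta>max"
    and A7_lipschitz: "piecewise_lipschitz_profile P T \<theta>b"
    and \<theta>N_space: "\<And>N. N \<ge> 1 \<Longrightarrow> \<theta>N N \<in> net_space P T F N"
    and \<theta>N_conv: "(\<lambda>N. profile_norm \<nu> P T (\<theta> - step_profile N (\<theta>N N))) \<longlonglongrightarrow> 0"
    and prob_Q: "prob_space Q"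
    and sample: "\<And>N. N \<ge> 1 \<Longrightarrow> iid_uniform Q N (u N)"
    and ordered: "\<And>N. x N = order_statistic N (u N)"
    and edges: "\<And>N. N \<ge> 1 \<Longrightarrow> sampled_edges Q N W (x N) (S N)"
  shows
    "(\<forall>N\<ge>1. \<forall>\<omega>\<in>space Q. \<forall>\<theta>h\<in>net_space P T F N.
       unique_network_nash P T N A\<^sub>0 U (\<theta>N N + \<theta>h) (weighted_graph W (x N) \<omega>)) \<and>
     (\<forall>\<delta>. 0 < \<delta> \<and> \<delta> < exp (-1) \<longrightarrow>
       whp_bigo Q (1 - \<delta>)
         (\<lambda>N \<omega>. intervention_gap \<nu> P T F N A\<^sub>0 U (\<theta>N N) (weighted_graph W (x N) \<omega>) C\<^sub>B \<theta>b)
         (\<lambda>N. max ((ln (real N / \<delta>) / real N) powr (1/4))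
                  (profile_norm \<nu> P T (\<theta> - step_profile N (\<theta>N N))))) \<and>
     (AE \<omega> in Q.
       (\<lambda>N. intervention_gap \<nu> P T F N A\<^sub>0 U (\<theta>N N) (weighted_graph W (x N) \<omega>) C\<^sub>B \<theta>b)
         \<longlonglongrightarrow> 0) \<and>
     (\<forall>\<delta>. 0 < \<delta> \<and> \<delta> < exp (-1) \<longrightarrow>
       (\<exists>N\<^sub>\<delta>\<ge>1. \<forall>N\<ge>N\<^sub>\<delta>. measure Q {\<omega>\<in>space Q. \<forall>\<theta>h\<in>net_space P T F N.
          unique_network_nash P T N A\<^sub>0 U (\<theta>N N + \<theta>h) (adjacency (S N \<omega>))} \<ge> 1 - 2 * \<delta>)) \<and>
     (\<forall>\<delta>. 0 < \<delta> \<and> \<delta> < exp (-1) \<longrightarrow>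
       whp_bigo Q (1 - 2 * \<delta>)
         (\<lambda>N \<omega>. intervention_gap \<nu> P T F N A\<^sub>0 U (\<theta>N N) (adjacency (S N \<omega>)) C\<^sub>B \<theta>b)
         (\<lambda>N. max ((ln (real N / \<delta>) / real N) powr (1/4))
                  (profile_norm \<nu> P T (\<theta> - step_profile N (\<theta>N N))))) \<and>
     (AE \<omega> in Q.
       (\<lambda>N. intervention_gap \<nu> P T F N A\<^sub>0 U (\<theta>N N) (adjacency (S N \<omega>)) C\<^sub>B \<theta>b) \<longlonglongrightarrow> 0)"
proof -
  from A3 obtain M where M: "\<And>a. a \<in> A\<^sub>0 \<Longrightarrow> proc_norm P T a \<le> M" by auto
  from A6 obtain L' where L': "\<forall>a\<in>A\<^sub>0. \<forall>a'\<in>A\<^sub>0. \<forall>z\<in>proc_space P T F. \<forall>z'\<in>proc_space P T F.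
      \<forall>h\<in>proc_space P T F. \<forall>h'\<in>proc_space P T F. \<bar>U a z h - U a' z' h'\<bar>
        \<le> L' * (proc_norm P T (a - a') + proc_norm P T (z - z') + proc_norm P T (h - h'))"
    unfolding jointly_lipschitz_utility_def by (elim exE)
  \<comment> \<open>The Lipschitz constant is only asserted to exist; the locale wants it
    nonnegative.\<close>
  define L where "L = max 0 L'"
  have L: "\<bar>U a z h - U a' z' h'\<bar> \<le> L * (proc_norm P T (a - a') + proc_norm P T (z - z') + proc_norm P T (h - h'))"
    if "a \<in> A\<^sub>0" "a' \<in> A\<^sub>0" "z \<in> proc_space P T F" "z' \<in> proc_space P T F" "h \<in> proc_space P T F" "h' \<in> proc_space P T F"
    for a a' z z' h h'
  proof -
    have "\<bar>U a z h - U a' z' h'\<bar> \<le> L' * (proc_norm P T (a - a') + proc_norm P T (z - z') + proc_norm P T (h - h'))"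
      by (rule L'[rule_format, OF that])
    also have "\<dots> \<le> L * (proc_norm P T (a - a') + proc_norm P T (z - z') + proc_norm P T (h - h'))"
      by (intro mult_right_mono) (auto simp: L_def proc_norm_eq)
    finally show ?thesis .
  qed
  have \<alpha>: "0 < \<alpha>\<^sub>U" using A1 by (simp add: regular_utility_def)
  \<comment> \<open>Truncated at 0, the gradient constant of the aggregate is still below
    \<open>\<alpha>\<^sub>U\<close>, which is positive.\<close>
  interpret G: intervention_game P T F U A\<^sub>0 \<alpha>\<^sub>U "max 0 l\<^sub>U" "max 0 l\<^sub>\<theta>" L M \<nu> W A \<theta> \<theta>b \<theta>N C\<^sub>B
  proof (unfold intervention_game_def intervention_game_axioms_def graphon_game_def graphon_game_axioms_def
      concave_game_def concave_game_axioms_def, intro conjI)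
    show "regular_utility P T F U \<alpha>\<^sub>U (max 0 l\<^sub>U) (max 0 l\<^sub>\<theta>)" by (rule regular_utility_mono[OF A1]) auto
    show "max 0 l\<^sub>U < \<alpha>\<^sub>U" using A5 \<alpha> by simp
    show "\<forall>a. a \<in> A\<^sub>0 \<longrightarrow> proc_norm P T a \<le> M" using M by blast
    show "\<forall>a a' z z' h h'. a \<in> A\<^sub>0 \<longrightarrow> a' \<in> A\<^sub>0 \<longrightarrow> z \<in> proc_space P T F \<longrightarrow> z' \<in> proc_space P T F \<longrightarrow>
        h \<in> proc_space P T F \<longrightarrow> h' \<in> proc_space P T F \<longrightarrow> \<bar>U a z h - U a' z' h'\<bar>
          \<le> L * (proc_norm P T (a - a') + proc_norm P T (z - z') + proc_norm P T (h - h'))"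
      by (intro allI impI L)
    show "0 \<le> L" by (simp add: L_def)
    show "\<forall>y. y \<in> {0..1} \<longrightarrow> A y = A\<^sub>0" using homogeneous by (intro allI impI)
    show "\<forall>N\<ge>1. \<theta>N N \<in> net_space P T F N" using \<theta>N_space by (intro allI impI)
  qed (simp_all add: prob_P U_wd A2_set index_space W_graphon A4 \<theta>_profile budget A7_solution)
  from A7_bounded obtain B where B': "\<forall>y\<in>{0..1}. proc_norm P T (\<theta>b y) \<le> B" by (elim exE)
  note B = B'[rule_format]
  obtain C where C: "0 \<le> C"
    and weighted: "\<And>N v \<rho> D. 1 \<le> N \<Longrightarrow> 0 \<le> D \<Longrightarrow> (\<And>i. i \<in> {1..N} \<Longrightarrow> v i \<in> {0..1}) \<Longrightarrow>
      (\<And>i. i \<in> {1..N} \<Longrightarrow> \<bar>v i - real i / real N\<bar> \<le> D + 1 / real N) \<Longrightarrow>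
      D \<le> \<rho> \<Longrightarrow> 1 / real N \<le> \<rho> \<Longrightarrow> 1 / sqrt (real N) \<le> \<rho> \<Longrightarrow>
      G.gap N (\<lambda>i j. W (v i) (v j)) \<le> C * (\<rho> + G.r N)"
    and simple: "\<And>N v \<rho> D H t. 1 \<le> N \<Longrightarrow> 0 \<le> D \<Longrightarrow> (\<And>i. i \<in> {1..N} \<Longrightarrow> v i \<in> {0..1}) \<Longrightarrow>
      (\<And>i. i \<in> {1..N} \<Longrightarrow> \<bar>v i - real i / real N\<bar> \<le> D + 1 / real N) \<Longrightarrow>
      D \<le> \<rho> \<Longrightarrow> 1 / real N \<le> \<rho> \<Longrightarrow> 1 / sqrt (real N) \<le> \<rho> \<Longrightarrow>
      G.unit_weights N H \<Longrightarrow> 0 \<le> t \<Longrightarrow> sqrt ((3 + t) / real N) \<le> 3 * \<rho> \<Longrightarrow>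
      (\<And>j k. j \<in> {1..N} \<Longrightarrow> k \<in> {1..N} \<Longrightarrow> j \<noteq> k \<Longrightarrow>
        \<bar>codegree N (\<lambda>i j. H i j - W (v i) (v j)) j k\<bar> \<le> t) \<Longrightarrow>
      G.gap N H \<le> C * (\<rho> + G.r N)"
  proof (rule G.sampled_gap_bound[OF B A7_lipschitz], goal_cases)
    case (1 y)
    show ?case by (rule 1(2))
  next
    case (2 C)
    show ?case by (rule that[OF 2(2) 2(3) 2(4)]) assumption+
  qed
  interpret Q: prob_space Q by (rule prob_Q)
  have um: "u N k \<in> borel_measurable Q" if "1 \<le> N" "k \<in> {1..N}" for N k
    by (rule iid_uniform_measurable[OF prob_Q sample[OF that(1)] that(2)])
  have xm: "x N i \<in> borel_measurable Q" if "1 \<le> N" "i \<in> {1..N}" for N i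
    unfolding ordered using um[OF that(1)] that(2) by (rule order_statistic_measurable)
  have x01: "x N i \<omega> \<in> {0..1}" if "1 \<le> N" "i \<in> {1..N}" "\<omega> \<in> space Q" for N i \<omega>
    unfolding ordered using that(2)
  proof (rule order_statistic_range)
    fix k assume "k \<in> {1..N}"
    then have "u N k \<in> space Q \<rightarrow> {0..1}" using sample[OF that(1)] by (simp add: iid_uniform_def)
    then show "u N k \<omega> \<in> {0..1}" using that(3) by blast
  qed
  have unit_w: "G.unit_weights N (weighted_graph W (x N) \<omega>)" if "1 \<le> N" "\<omega> \<in> space Q" for N \<omega>
    unfolding G.unit_weights_def weighted_graph_def using that by (intro ballI G.W_bounds x01)
  have unit_s: "G.unit_weights N (adjacency e)" for N e
    by (simp add: G.unit_weights_def adjacency_def)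
  have r: "G.r \<longlonglongrightarrow> 0" using \<theta>N_conv by (simp add: G.r_def[abs_def])
  have nash: "unique_network_nash P T N A\<^sub>0 U (\<theta>N N + \<theta>h) H"
    if "1 \<le> N" "G.unit_weights N H" "\<theta>h \<in> net_space P T F N" for N H \<theta>h
    by (rule G.unique_network_nash_unit_weights[OF that(1,2) G.net_space_add[OF \<theta>N_space[OF that(1)] that(3)]])
  let ?\<rho> = "\<lambda>N \<delta>. (ln (real N / \<delta>) / real N) powr (1/4)"
  have wW: "weighted_graph W (x N) \<omega> = (\<lambda>i j. W (x N i \<omega>) (x N j \<omega>))" for N \<omega>
    by (simp add: weighted_graph_def fun_eq_iff)
  have Wm: "(\<lambda>\<omega>. weighted_graph W (x N) \<omega> i j) \<in> borel_measurable Q"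
    if N: "1 \<le> N" and ij: "i \<in> {1..N}" "j \<in> {1..N}" for N i j
  proof -
    have "(\<lambda>\<omega>. (x N i \<omega>, x N j \<omega>)) \<in> Q \<rightarrow>\<^sub>M borel"
      unfolding borel_prod[symmetric] using xm[OF N] ij by (intro measurable_Pair)
    from measurable_compose[OF this graphon_borel[OF W_graphon A4]]
    show ?thesis
      by (rule measurable_cong[THEN iffD1, rotated])
        (use x01[OF N ij(1)] x01[OF N ij(2)] in \<open>simp add: weighted_graph_def\<close>)
  qed
  let ?X = "\<lambda>N \<omega>. G.gap N (weighted_graph W (x N) \<omega>)" and ?Y = "\<lambda>N \<omega>. G.gap N (adjacency (S N \<omega>))"
  have Xm: "?X N \<in> borel_measurable Q" if "1 \<le> N" for N
    by (intro G.gap_measurable Wm unit_w that)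
  \<comment> \<open>The edge set takes values in a discrete space, so every function of it is
    measurable.\<close>
  have Ym: "?Y N \<in> borel_measurable Q" if "1 \<le> N" for N
  proof -
    have "S N \<in> Q \<rightarrow>\<^sub>M count_space (Pow (node_pairs N))" using edges[OF that] by (simp add: sampled_edges_def)
    then show ?thesis by (rule measurable_compose) simp
  qed
  have tailX: "\<exists>E\<in>sets Q. measure Q E \<le> 1 * \<delta> \<and> (\<forall>\<omega>\<in>space Q - E. ?X N \<omega> \<le> C * (?\<rho> N \<delta> + G.r N))"
    and tailY: "\<exists>E\<in>sets Q. measure Q E \<le> 2 * \<delta> \<and> (\<forall>\<omega>\<in>space Q - E. ?Y N \<omega> \<le> C * (?\<rho> N \<delta> + G.r N))"
    if N: "1 \<le> N" and \<delta>: "0 < \<delta>" "\<delta> < exp (-1)" and y: "ln (real N / \<delta>) / real N \<le> 1" for N \<delta>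
  proof -
    let ?\<epsilon> = "sqrt (ln (2 * real N / \<delta>) / (2 * real N))" and ?t = "sqrt (2 * real N * ln (2 * (real N)\<^sup>2 / \<delta>))"
    note R = sampling_rates[OF N \<delta> y]
    \<comment> \<open>Each of the two exceptional sets has probability at most
      \<open>\<delta>\<close>. Weighted graphs need only the first, simple graphs both, whence
      \<open>1 - \<delta>\<close> and \<open>1 - 2 * \<delta>\<close>.\<close>
    obtain E1 where E1: "E1 \<in> sets Q" "measure Q E1 \<le> \<delta>"
      "\<And>\<omega> i. \<omega> \<in> space Q - E1 \<Longrightarrow> i \<in> {1..N} \<Longrightarrow> \<bar>x N i \<omega> - real i / real N\<bar> \<le> ?\<epsilon> + 1 / real N"
      using order_statistics_concentration[OF prob_Q sample[OF N] N R(1)] unfolding R(3) ordered by blast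
    obtain E2 where E2: "E2 \<in> sets Q" "measure Q E2 \<le> \<delta>"
      "\<And>\<omega> j k. \<omega> \<in> space Q - E2 \<Longrightarrow> j \<in> {1..N} \<Longrightarrow> k \<in> {1..N} \<Longrightarrow> j \<noteq> k \<Longrightarrow>
        \<bar>codegree N (\<lambda>i j. adjacency (S N \<omega>) i j - W (x N i \<omega>) (x N j \<omega>)) j k\<bar> < ?t"
      using simple_graph_concentration[OF prob_Q W_graphon A4 edges[OF N] xm[OF N] x01[OF N] R(2)]
      unfolding R(4) by blast
    have "?X N \<omega> \<le> C * (?\<rho> N \<delta> + G.r N)" if \<omega>: "\<omega> \<in> space Q - E1" for \<omega>
      unfolding wW using \<omega> R(1)
      by (intro weighted[OF N _ _ E1(3)[OF \<omega>] R(5,6,7)] x01[OF N]) auto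
    then show "\<exists>E\<in>sets Q. measure Q E \<le> 1 * \<delta> \<and> (\<forall>\<omega>\<in>space Q - E. ?X N \<omega> \<le> C * (?\<rho> N \<delta> + G.r N))"
      using E1(1,2) by (intro bexI[of _ E1]) auto
    have "?Y N \<omega> \<le> C * (?\<rho> N \<delta> + G.r N)" if \<omega>: "\<omega> \<in> space Q - (E1 \<union> E2)" for \<omega>
    proof -
      have \<omega>1: "\<omega> \<in> space Q - E1" and \<omega>2: "\<omega> \<in> space Q - E2" and \<omega>0: "\<omega> \<in> space Q" using \<omega> by auto
      show ?thesis
        by (rule simple[OF N less_imp_le[OF R(1)] x01[OF N _ \<omega>0] E1(3)[OF \<omega>1] R(5,6,7) unit_s
              less_imp_le[OF R(2)] R(8) less_imp_le[OF E2(3)[OF \<omega>2]]])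
    qed
    moreover have "measure Q (E1 \<union> E2) \<le> 2 * \<delta>"
      using measure_Un_le[OF E1(1) E2(1)] E1(2) E2(2) by simp
    ultimately show "\<exists>E\<in>sets Q. measure Q E \<le> 2 * \<delta> \<and> (\<forall>\<omega>\<in>space Q - E. ?Y N \<omega> \<le> C * (?\<rho> N \<delta> + G.r N))"
      using E1(1) E2(1) by (intro bexI[of _ "E1 \<union> E2"]) auto
  qed
  note X = whp_bigo_and_AE_tendsto[where X="?X" and m=1, OF prob_Q Xm G.gap_nonneg[OF _ unit_w] C r tailX]
  note Y = whp_bigo_and_AE_tendsto[where X="?Y" and m=2, OF prob_Q Ym G.gap_nonneg[OF _ unit_s] C r tailY]
  show ?thesis
  proof (intro conjI allI impI ballI)
    fix N :: nat and \<omega> \<theta>h assume "1 \<le> N" "\<omega> \<in> space Q" "\<theta>h \<in> net_space P T F N"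
    then show "unique_network_nash P T N A\<^sub>0 U (\<theta>N N + \<theta>h) (weighted_graph W (x N) \<omega>)"
      by (intro nash unit_w)
  next
    fix \<delta> :: real assume "0 < \<delta> \<and> \<delta> < exp (-1)"
    then show "whp_bigo Q (1 - \<delta>) ?X (\<lambda>N. max (?\<rho> N \<delta>) (profile_norm \<nu> P T (\<theta> - step_profile N (\<theta>N N))))"
      using X(1)[of \<delta>] by (simp add: G.r_def)
  next
    show "AE \<omega> in Q. (\<lambda>N. ?X N \<omega>) \<longlonglongrightarrow> 0" by (rule X(2))
  next
    fix \<delta> :: real assume \<delta>: "0 < \<delta> \<and> \<delta> < exp (-1)"
    show "\<exists>N\<^sub>\<delta>\<ge>1. \<forall>N\<ge>N\<^sub>\<delta>. measure Q {\<omega>\<in>space Q. \<forall>\<theta>h\<in>net_space P T F N.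
          unique_network_nash P T N A\<^sub>0 U (\<theta>N N + \<theta>h) (adjacency (S N \<omega>))} \<ge> 1 - 2 * \<delta>"
    \<comment> \<open>Uniqueness holds for every realised simple graph, so 1 serves as
      \<open>N\<^sub>\<delta>\<close> and the event is the whole space.\<close>
    proof (intro exI[of _ 1] conjI allI impI order_refl)
      fix N :: nat assume "1 \<le> N"
      then have "{\<omega>\<in>space Q. \<forall>\<theta>h\<in>net_space P T F N.
          unique_network_nash P T N A\<^sub>0 U (\<theta>N N + \<theta>h) (adjacency (S N \<omega>))} = space Q"
        using nash unit_s by blast
      then show "measure Q {\<omega>\<in>space Q. \<forall>\<theta>h\<in>net_space P T F N.
          unique_network_nash P T N A\<^sub>0 U (\<theta>N N + \<theta>h) (adjacency (S N \<omega>))} \<ge> 1 - 2 * \<delta>"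
        using \<delta> by (simp add: Q.prob_space)
    qed
  next
    fix \<delta> :: real assume "0 < \<delta> \<and> \<delta> < exp (-1)"
    then show "whp_bigo Q (1 - 2 * \<delta>) ?Y (\<lambda>N. max (?\<rho> N \<delta>) (profile_norm \<nu> P T (\<theta> - step_profile N (\<theta>N N))))"
      using Y(1)[of \<delta>] by (simp add: G.r_def)
  next
    show "AE \<omega> in Q. (\<lambda>N. ?Y N \<omega>) \<longlonglongrightarrow> 0" by (rule Y(2))
  qed
qed

end
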